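(* Let $q\geq 3$ be fixed, let $k\geq 2$, and let $\mathbf{a}=(a_1,\dots,a_k)$ with $(a_j,q)=1$ for all $j$. Suppose the coordinates of $\mathbf{a}$ take exactly $l$ distinct values $b_1,\dots,b_l$ modulo $q$, and let $k_j\geq 1$ be the number of coordinates equal to $b_j$, so $k_1+\cdots+k_l=k$. Then, for fixed $k\geq 2$, $$\frac{M_k(x;\mathbf{a})}{\frac{1}{\phi^k(q)}\frac{k!}{k_1!k_2!\cdots k_l!}S_k(x)}=1+\frac{k-1}{\log\log x}\cdot\frac1k\sum_{j=1}^kC(q,a_j)+O_{q,k,l}\left(\frac{1}{(\log\log x)^2}\right).$$ Moreover, for fixed $l$ and fixed $A>0$, suppose $k=\sum_{j=1}^lk_j\sim A\log\log x$ and that $e_j:=\lim_{x\to\infty}\frac{k_j}{\log\log x}$ exists for every $1\leq j\leq l$ (so $\sum_{j=1}^le_j=A$). Then as $x\to\infty$, $$\frac{M_k(x;\mathbf{a})}{\frac{1}{\phi^k(q)}\frac{k!}{k_1!k_2!\cdots k_l!}S_k(x)}\sim\prod_p\frac{\prod_{j=1}^l\left(1+\frac{\phi(q)e_j\mathbb{1}_{p\equiv b_j\bmod q}(p)}{p}\right)}{1+\frac{A\chi_0(p)}{p}}.$$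
   Context: $M_k(x;\mathbf{a})$ denotes the number of integers $n\leq x$ that can be written as $n=p_1p_2\cdots p_k$ with $p_1,\dots,p_k$ distinct primes and $p_j\equiv a_j\bmod q$ for $1\leq j\leq k$ (any ordering of the prime factors is allowed; each such $n$ is counted once). $S_k(x)$ denotes the number of integers $n\leq x$ of the form $p_1\cdots p_k$ with $p_1,\dots,p_k$ distinct primes and $(p_1\cdots p_k,q)=1$. $\phi$ is Euler's function, $\chi_0$ the principal character modulo $q$, $\mathbb{1}_{p\equiv b\bmod q}(p)$ is $1$ if $p\equiv b\bmod q$ and $0$ otherwise, and $$C(q,a)=\lim_{x\to\infty}\Big(\phi(q)\sum_{\substack{p\leq x\\ p\equiv a\bmod q}}\frac1p-\sum_{\substack{p\leq x\\(p,q)=1}}\frac1p\Big)=\sum_{\chi\neq\chi_0}\bar\chi(a)\sum_p\frac{\chi(p)}{p},$$ the sum over $\chi$ being over non-principal Dirichlet characters modulo $q$. *)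

theory Defs
  imports
    "HOL-Analysis.Analysis"
    "HOL-Number_Theory.Number_Theory"
    "HOL-Library.Landau_Symbols"
begin

text \<open>
  A $k$-tuple is a function on \<open>nat\<close> of which only the values on \<open>{1..k}\<close> matter.
\<close>

definition M_count :: "nat \<Rightarrow> nat \<Rightarrow> (nat \<Rightarrow> int) \<Rightarrow> real \<Rightarrow> nat" where
  "M_count q k a x =
     card {n::nat. real n \<le> x \<and>
       (\<exists>p. inj_on p {1..k} \<and>
            (\<forall>j\<in>{1..k}. prime (p j) \<and> [int (p j) = a j] (mod int q)) \<and>
            n = (\<Prod>j=1..k. p j))}"

definition S_count :: "nat \<Rightarrow> nat \<Rightarrow> real \<Rightarrow> nat" where
  "S_count q k x =
     card {n::nat. real n \<le> x \<and> coprime n q \<and>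
       (\<exists>p. inj_on p {1..k} \<and> (\<forall>j\<in>{1..k}. prime (p j)) \<and> n = (\<Prod>j=1..k. p j))}"

definition bias_const :: "nat \<Rightarrow> int \<Rightarrow> real" where
  "bias_const q a =
     Lim at_top (\<lambda>x::real.
       real (totient q) *
         (\<Sum>p | prime p \<and> real p \<le> x \<and> [int p = a] (mod int q). 1 / real p)
       - (\<Sum>p | prime p \<and> real p \<le> x \<and> coprime p q. 1 / real p))"

definition principal_char :: "nat \<Rightarrow> nat \<Rightarrow> real" where
  "principal_char q n = (if coprime n q then 1 else 0)"

text \<open>
  The entries of \<open>a\<close> are coprime to \<open>q\<close> and take exactly the \<open>l\<close> distinct values
  \<open>b 1, \<dots>, b l\<close> modulo \<open>q\<close>, the value \<open>b j\<close> being taken \<open>m j\<close> times.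
\<close>

definition residue_profile ::
  "nat \<Rightarrow> nat \<Rightarrow> (nat \<Rightarrow> int) \<Rightarrow> nat \<Rightarrow> (nat \<Rightarrow> int) \<Rightarrow> (nat \<Rightarrow> nat) \<Rightarrow> bool" where
  "residue_profile q k a l b m \<longleftrightarrow>
     (\<forall>i\<in>{1..k}. coprime (a i) (int q)) \<and>
     (\<forall>i\<in>{1..l}. \<forall>j\<in>{1..l}. [b i = b j] (mod int q) \<longrightarrow> i = j) \<and>
     (\<forall>i\<in>{1..k}. \<exists>j\<in>{1..l}. [a i = b j] (mod int q)) \<and>
     (\<forall>j\<in>{1..l}. m j = card {i\<in>{1..k}. [a i = b j] (mod int q)} \<and> m j \<ge> 1)"

definition M_ratio ::
  "nat \<Rightarrow> nat \<Rightarrow> (nat \<Rightarrow> int) \<Rightarrow> nat \<Rightarrow> (nat \<Rightarrow> nat) \<Rightarrow> real \<Rightarrow> real" where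
  "M_ratio q k a l m x =
     real (M_count q k a x) /
       (1 / real (totient q) ^ k * (fact k / (\<Prod>j=1..l. fact (m j))) * real (S_count q k x))"

text \<open>
  Factors of the product over primes, set to 1 off the primes.  That product converges
  only conditionally, with the primes in increasing order, which is the order used by
  \<^const>\<open>convergent_prod\<close> and \<^const>\<open>prodinf\<close>.
\<close>

definition prime_factor_term ::
  "nat \<Rightarrow> nat \<Rightarrow> (nat \<Rightarrow> int) \<Rightarrow> (nat \<Rightarrow> real) \<Rightarrow> real \<Rightarrow> nat \<Rightarrow> real" where
  "prime_factor_term q l b e A p =
     (if prime p then
        (\<Prod>j=1..l. 1 + real (totient q) * e j * of_bool ([int p = b j] (mod int q)) / real p)
          / (1 + A * principal_char q p / real p)
      else 1)"

end

theory Submission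
  imports Defs "HOL-Complex_Analysis.Complex_Analysis" "HOL-Probability.Probability" "HOL-Real_Asymp.Real_Asymp"
begin

text \<open>An integer in \<open>M_count\<close> comes from \<open>\<Prod>\<^sub>j m\<^sub>j!\<close> ordered prime tuples, so \<open>M_ratio\<close> is the quotient \<open>N(c)/N(1)\<close>
  of two weighted counts \<open>N(u)\<close> of tuples of distinct primes with product at most \<open>x\<close>, the weight of a prime being
  \<open>\<phi>(q) 1[p \<equiv> a\<^sub>i]\<close> or \<open>1[(p,q) = 1]\<close>. Every such weight satisfies the prime number theorem with a relative
  saving \<open>(ln x)\<^sup>-\<^sup>b\<close>. Writing \<open>ln x\<close> as the sum of the logarithms of the prime factors turns \<open>N(u)\<close> into
  \<open>x / ln x \<Sum>\<^sub>i T\<^sub>i(u)\<close>, where \<open>T\<^sub>i\<close> is the sum of \<open>\<Prod> u(p)/p\<close> over the tuples without coordinate \<open>i\<close>.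
  Uniformly for \<open>k = O(ln ln x)\<close>, removing a coordinate divides \<open>T\<close> by \<open>ln ln x + O(1)\<close>. For fixed \<open>k\<close>, changing
  the weight of one coordinate changes \<open>T\<close> by the difference of the Mertens constants times the \<open>T\<close> without it, and that
  difference is \<open>C(q,a)\<close>. For \<open>k \<sim> A ln ln x\<close>, the primes up to \<open>n\<close> are split off one at a time, each multiplying
  the quotient by its factor in the limit product; for primes above \<open>n\<close> the quotient of the remaining sums tends to 1 as
  \<open>n\<close> grows, because the weights are equidistributed there.\<close>

text \<open>No zero-free region to the left of Re s = 1 is used: a polynomial bound in Im s for the
  logarithmic derivatives, uniform as Re s decreases to 1, suffices, and one integration by parts
  turns it into the saving. Some saving is indispensable, since the bias is visible only at relative
  size 1 / L with L = ln ln x, so Mertens sums must be known up to o(1 / L). The main obstacle is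
  uniformity in k. With k of order L, a relative error c / L per coordinate accumulates to a
  constant factor, so crude estimates can control sizes but never yield the quotient. Replacing one
  weight by another costs e / L, hence A e in total, and e must be made small. It is not small at
  first, because Mertens constants of different classes differ; for weights restricted to p > n the
  constants cancel up to O((ln n)^-b), which is why the small primes have to be stripped off. Two
  nuisances recur. Distinctness of the primes produces collisions, which cost sums of 1 / p^2. The
  condition that the product be at most x leaves little room for a further prime when the product is
  within a factor V of x; such tuples carry a share of about ln V / ln x.\<close>

abbreviation nfloor :: "real => nat" where "nfloor x \<equiv> nat \<lfloor>x\<rfloor>"

abbreviation lnln :: "real => real" where "lnln x \<equiv> ln (ln x)"

abbreviation Ipos :: "real => 'a :: zero_neq_one" where "Ipos t \<equiv> indicator {0..} t"

abbreviation vprod :: "'i set => ('i => nat => real) => ('i => nat) => real" where "vprod I v f \<equiv> \<Prod>i\<in>I. v i (f i)"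

abbreviation npow :: "nat => complex => complex" where "npow n s \<equiv> of_nat n powr (-s)"

abbreviation rphi :: "nat => real" where "rphi q \<equiv> real (totient q)"

abbreviation evt :: "(real => bool) => bool" (binder "EV " 10) where "evt P \<equiv> eventually P at_top"

abbreviation "gauss x \<equiv> std_normal_density x"

section \<open>Dirichlet characters\<close>

definition dchars :: "nat => (nat => complex) set" where
 "dchars q = {ch. (\<forall>m n. ch (m * n) = ch m * ch n) \<and> (\<forall>m n. [m = n] (mod q) --> ch m = ch n)
         \<and> (\<forall>n. ch n \<noteq> 0 \<longleftrightarrow> coprime n q)}"

text \<open>A character of a subgroup of the units modulo q, the subgroup being given as the set of
  all naturals in its residue classes. This avoids quotient groups; inverses come from Euler's
  theorem.\<close>

definition partial_char :: "nat => nat set => (nat => complex) => bool" where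
 "partial_char q H ch \<longleftrightarrow> H \<subseteq> {n. coprime n q} \<and> 1 \<in> H \<and> ch 1 = 1 \<and>
   (\<forall>m\<in>H. \<forall>n\<in>H. m * n \<in> H \<and> ch (m * n) = ch m * ch n) \<and>
   (\<forall>m\<in>H. \<forall>n. [m = n] (mod q) --> n \<in> H \<and> ch n = ch m)"

lemma partial_charD:
 assumes "partial_char q H ch"
 shows "m \<in> H ==> coprime m q" "1 \<in> H" "ch 1 = 1"
  "m \<in> H ==> n \<in> H ==> m * n \<in> H"
  "m \<in> H ==> n \<in> H ==> ch (m * n) = ch m * ch n"
  "m \<in> H ==> [m = n] (mod q) ==> n \<in> H"
  "m \<in> H ==> [m = n] (mod q) ==> ch n = ch m"
 using assms unfolding partial_char_def by blast+

lemma partial_char_power: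
 assumes "partial_char q H ch" "h \<in> H"
 shows "h ^ n \<in> H \<and> ch (h ^ n) = ch h ^ n"
proof (induction n)
 case 0
 thus ?case using partial_charD(2,3)[OF assms(1)] by simp
next
 case (Suc n)
 thus ?case using assms(2) partial_charD(4,5)[OF assms(1) assms(2)] by simp
qed

lemma partial_char_inverse:
 assumes "partial_char q H ch" "h \<in> H" "q > 0"
 shows "\<exists>y\<in>H. [y * h = 1] (mod q)"
proof
 show "h ^ (totient q - 1) \<in> H" using partial_char_power[OF assms(1,2)] by blast
 have "coprime h q" using assms by (auto simp: partial_char_def)
 hence "[h ^ totient q = 1] (mod q)" by (rule euler_theorem)
 moreover have "totient q > 0" using \<open>q > 0\<close> by simp
 ultimately show "[h ^ (totient q - 1) * h = 1] (mod q)"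
  by (metis Suc_diff_1 power_Suc2)
qed

lemma partial_char_cancel:
 assumes pc: "partial_char q H ch" and "a \<in> H" "a * b \<in> H" "q > 0"
 shows "b \<in> H"
proof -
 obtain y where y: "y \<in> H" "[y * a = 1] (mod q)"
  using partial_char_inverse[OF pc \<open>a \<in> H\<close> \<open>q > 0\<close>] by blast
 have "[y * a * b = 1 * b] (mod q)" using y(2) by (rule cong_scalar_right)
 moreover have "y * (a * b) \<in> H" using pc y(1) assms(3) by (auto simp: partial_char_def)
 ultimately show ?thesis using pc unfolding partial_char_def
  by (metis mult.assoc mult_1)
qed

lemma partial_char_nonzero:
 assumes "partial_char q H ch" "h \<in> H" "q > 0"
 shows "ch h \<noteq> 0"
proof
 assume "ch h = 0"
 obtain y where y: "y \<in> H" "[y * h = 1] (mod q)"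
  using partial_char_inverse[OF assms] by blast
 have "y * h \<in> H" "ch (y * h) = ch y * ch h" using partial_charD(4,5)[OF assms(1) y(1) assms(2)] by auto
 hence "ch 1 = ch y * ch h" using partial_charD(7)[OF assms(1) _ y(2)] by simp
 thus False using \<open>ch h = 0\<close> partial_charD(3)[OF assms(1)] by simp
qed

text \<open>Elements of the subgroup generated by H and g have the form h * g^i, and all relations
  come from the least positive k with g^k in H. So the value at g may be any k-th root w of ch
  (g^k). The freedom in w is what later separates residue classes.\<close>

lemma partial_char_extend_step:
 assumes pc: "partial_char q H ch" and "q > 0" and g: "coprime g q"
  and k: "k > 0" "g ^ k \<in> H" and kmin: "\<And>j. 0 < j ==> j < k ==> g ^ j \<notin> H"
  and w: "w ^ k = ch (g ^ k)"
 shows "\<exists>H' ch'. partial_char q H' ch' \<and> H \<subseteq> H' \<and> g \<in> H' \<and> (\<forall>h\<in>H. ch' h = ch h) \<and> ch' g = w"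
proof -
 \<comment> \<open>Division with remainder: by minimality of k, only multiples of k are exponents d
   with g^d in H.\<close>
 have kd: "ch (g ^ d) = w ^ d" if "g ^ d \<in> H" for d
 proof -
  have 1: "(g ^ k) ^ (d div k) \<in> H" "ch ((g ^ k) ^ (d div k)) = ch (g ^ k) ^ (d div k)"
   using partial_char_power[OF pc k(2)] by auto
  have 2: "g ^ d = (g ^ k) ^ (d div k) * g ^ (d mod k)"
   by (metis mult_div_mod_eq power_add power_mult)
  have "g ^ (d mod k) \<in> H"
   by (rule partial_char_cancel[OF pc 1(1) _ \<open>q > 0\<close>]) (use that 2 in simp)
  with kmin[of "d mod k"] k(1) have "d mod k = 0" by fastforce
  hence d: "d = k * (d div k)" by auto
  have "ch (g ^ d) = ch (g ^ k) ^ (d div k)" using 1 2 \<open>d mod k = 0\<close> by simp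
  also have "\<dots> = w ^ (k * (d div k))" by (simp add: w power_mult)
  finally show ?thesis using d by simp
 qed
 \<comment> \<open>Independence of the representation h * g^i: cancelling g^i reduces it to
   \<open>kd\<close>.\<close>
 have uniq0: "ch h * w ^ i = ch h' * w ^ j"
  if "h \<in> H" "h' \<in> H" "[h * g ^ i = h' * g ^ j] (mod q)" "i \<le> j" for h h' i j
 proof -
  have cg: "coprime (g ^ i) q" using g by simp
  have "h' * g ^ j = (h' * g ^ (j - i)) * g ^ i"
   using \<open>i \<le> j\<close> by (simp add: mult.assoc power_add[symmetric])
  with that(3) cg have c: "[h = h' * g ^ (j - i)] (mod q)"
   by (metis cong_mult_rcancel_nat)
  hence "h' * g ^ (j - i) \<in> H" and e: "ch (h' * g ^ (j - i)) = ch h" using pc that(1)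
   unfolding partial_char_def by metis+
  hence "g ^ (j - i) \<in> H" using partial_char_cancel[OF pc that(2) _ \<open>q > 0\<close>] by blast
  hence "ch h = ch h' * w ^ (j - i)" using e kd pc that(2) unfolding partial_char_def by metis
  thus ?thesis using \<open>i \<le> j\<close> by (simp add: mult.assoc power_add[symmetric])
 qed
 have uniq: "ch h * w ^ i = ch h' * w ^ j"
  if "h \<in> H" "h' \<in> H" "[h * g ^ i = h' * g ^ j] (mod q)" for h h' i j
  using uniq0[OF that] uniq0[OF that(2,1) cong_sym[OF that(3)]] by (cases "i \<le> j") auto
 define H' where "H' = {n. \<exists>h\<in>H. \<exists>i. [n = h * g ^ i] (mod q)}"
 define ch' where "ch' n = (SOME c. \<exists>h\<in>H. \<exists>i. [n = h * g ^ i] (mod q) \<and> c = ch h * w ^ i)" for n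
 have ch': "ch' n = ch h * w ^ i" if "h \<in> H" "[n = h * g ^ i] (mod q)" for n h i
 proof -
  have "\<exists>c. \<exists>h\<in>H. \<exists>i. [n = h * g ^ i] (mod q) \<and> c = ch h * w ^ i" using that by blast
  from someI_ex[OF this] obtain h' j where
   "h' \<in> H" "[n = h' * g ^ j] (mod q)" "ch' n = ch h' * w ^ j" unfolding ch'_def by blast
  with uniq[OF that(1), of h' i j] that show ?thesis by (metis cong_sym cong_trans)
 qed
 have "1 \<in> H" "ch 1 = 1" using pc by (auto simp: partial_char_def)
 have ext: "h \<in> H' \<and> ch' h = ch h" if "h \<in> H" for h
  using ch'[of h h 0] that unfolding H'_def by (auto intro!: bexI[of _ h] exI[of _ 0])
 have "g \<in> H' \<and> ch' g = w"
  using ch'[of 1 g 1] \<open>1 \<in> H\<close> \<open>ch 1 = 1\<close> unfolding H'_def by (auto intro!: bexI[of _ 1] exI[of _ 1])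
 moreover have "partial_char q H' ch'"
  unfolding partial_char_def
 proof (intro conjI ballI allI impI subsetI)
  fix n assume "n \<in> H'"
  then obtain h i where h: "h \<in> H" "[n = h * g ^ i] (mod q)" by (auto simp: H'_def)
  have "coprime (h * g ^ i) q" using h(1) pc g by (auto simp: partial_char_def)
  thus "n \<in> {n. coprime n q}" using h(2) by (metis cong_imp_coprime cong_sym mem_Collect_eq)
 next
  show "1 \<in> H'" "ch' 1 = 1" using ext[OF \<open>1 \<in> H\<close>] \<open>ch 1 = 1\<close> by auto
 next
  fix m n assume "m \<in> H'" "n \<in> H'"
  then obtain h i h' j where h: "h \<in> H" "[m = h * g ^ i] (mod q)" "h' \<in> H" "[n = h' * g ^ j] (mod q)"
   by (auto simp: H'_def)
  have "[m * n = (h * g ^ i) * (h' * g ^ j)] (mod q)" using h by (intro cong_mult)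
  hence c: "[m * n = (h * h') * g ^ (i + j)] (mod q)" by (simp add: power_add ac_simps)
  have hh: "h * h' \<in> H" "ch (h * h') = ch h * ch h'" using partial_charD(4,5)[OF pc h(1,3)] by auto
  show "m * n \<in> H'" using c hh by (auto simp: H'_def)
  show "ch' (m * n) = ch' m * ch' n"
   using ch'[OF hh(1) c] ch'[OF h(1,2)] ch'[OF h(3,4)] hh(2) by (simp add: power_add ac_simps)
 next
  fix m n assume "m \<in> H'" "[m = n] (mod q)"
  then obtain h i where h: "h \<in> H" "[m = h * g ^ i] (mod q)" "[n = h * g ^ i] (mod q)"
   unfolding H'_def using cong_sym cong_trans by blast
  thus "n \<in> H'" "ch' n = ch' m" using ch' by (auto simp: H'_def)
 qed
 ultimately show ?thesis using ext by blast
qed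

lemma exists_complex_root:
 fixes z :: complex assumes "z \<noteq> 0" "k > 0" shows "\<exists>w. w ^ k = z"
proof
 show "exp (Ln z / of_nat k) ^ k = z"
  using assms by (simp flip: exp_of_nat_mult)
qed

text \<open>The induction measure is the number of reduced units outside H. The new element g is
  taken modulo q so that adjoining it really lowers this number.\<close>

lemma partial_char_extend:
 assumes "partial_char q H ch" "q > 0"
 shows "\<exists>ch'. partial_char q {n. coprime n q} ch' \<and> (\<forall>h\<in>H. ch' h = ch h)"
 using assms(1)
proof (induction "card ({n. coprime n q \<and> n < q} - H)" arbitrary: H ch rule: less_induct)
 case less
 show ?case
 proof (cases "{n. coprime n q} \<subseteq> H")
  case True
  hence "H = {n. coprime n q}" using less.prems by (auto simp: partial_char_def)
  thus ?thesis using less.prems by auto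
 next
  case False
  then obtain g0 where g0: "coprime g0 q" "g0 \<notin> H" by auto
  define g where "g = g0 mod q"
  have gg: "[g = g0] (mod q)" by (simp add: g_def)
  hence g: "coprime g q" using g0 by (metis cong_imp_coprime cong_sym)
  have gH: "g \<notin> H" using partial_charD(6)[OF less.prems _ gg] g0 by blast
  have "g < q" using \<open>q > 0\<close> by (simp add: g_def)
  define k where "k = (LEAST k. k > 0 \<and> g ^ k \<in> H)"
  have "g ^ totient q \<in> H"
   using less.prems euler_theorem[OF g] unfolding partial_char_def by (metis cong_sym)
  hence ex: "\<exists>k. k > 0 \<and> g ^ k \<in> H" using \<open>q > 0\<close> by (intro exI[of _ "totient q"]) auto
  have k: "k > 0" "g ^ k \<in> H" using LeastI_ex[OF ex] by (auto simp: k_def)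
  have kmin: "g ^ j \<notin> H" if "0 < j" "j < k" for j using not_less_Least[of j] that by (auto simp: k_def)
  obtain w where w: "w ^ k = ch (g ^ k)"
   using exists_complex_root partial_char_nonzero[OF less.prems k(2) \<open>q > 0\<close>] k(1) by blast
  obtain H' ch' where H': "partial_char q H' ch'" "H \<subseteq> H'" "g \<in> H'" "\<forall>h\<in>H. ch' h = ch h"
   using partial_char_extend_step[OF less.prems \<open>q > 0\<close> g k kmin w] by blast
  have "card ({n. coprime n q \<and> n < q} - H') < card ({n. coprime n q \<and> n < q} - H)"
   using H' gH g \<open>g < q\<close> by (intro psubset_card_mono) auto
  from less.hyps[OF this H'(1)] show ?thesis using H' by (metis subsetD)
 qed
qed

lemma dchar_of_partial:
 assumes "partial_char q {n. coprime n q} ch" "q > 0"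
 shows "(\<lambda>n. if coprime n q then ch n else 0) \<in> dchars q"
proof -
 have "coprime m q \<longleftrightarrow> coprime n q" if "[m = n] (mod q)" for m n
  using that by (metis cong_imp_coprime cong_sym)
 moreover have "ch n \<noteq> 0" if "coprime n q" for n
  using partial_char_nonzero[OF assms(1) _ assms(2)] that by auto
 moreover have "ch m = ch n" if "[m = n] (mod q)" "coprime m q" for m n
  using partial_charD(7)[OF assms(1) _ that(1)] that(2) by simp
 moreover have "ch (m * n) = ch m * ch n" if "coprime m q" "coprime n q" for m n
  using partial_charD(5)[OF assms(1)] that by simp
 ultimately show ?thesis unfolding dchars_def by auto
qed

lemma root_of_unity_neq_1:
 assumes "k > (1::nat)" shows "\<exists>w::complex. w ^ k = 1 \<and> w \<noteq> 1"
proof (intro exI conjI)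
 have "cis (2 * pi / real k) ^ k = cis (2 * pi)" using assms Complex.DeMoivre[of "2 * pi / real k" k] by (simp only: nonzero_mult_div_cancel_left times_divide_eq_right)
 thus "cis (2 * pi / real k) ^ k = 1" by simp
 have x: "0 < 2 * pi / real k" "2 * pi / real k < 2 * pi" using assms by (auto simp: field_simps)
 show "cis (2 * pi / real k) \<noteq> 1"
 proof
  assume "cis (2 * pi / real k) = 1"
  hence "cos (2 * pi / real k) = 1" by (metis cis.sel(1) one_complex.sel(1))
  then obtain n :: int where n: "2 * pi / real k = of_int n * 2 * pi"
   by (auto simp: cos_one_2pi_int)
  have "0 < of_int n * (2 * pi)" "of_int n * (2 * pi) < 1 * (2 * pi)" using x n by (auto simp: mult.assoc)
  hence "0 < (of_int n :: real)" "of_int n < (1::real)"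
   using pi_gt_zero by (auto simp: zero_less_mult_iff mult_less_cancel_right)
  thus False by simp
 qed
qed

text \<open>The trivial character on the class of 1 is extended to a by a root of unity other than
  1, which exists because the order of a modulo q exceeds 1; the result is then extended to all
  units.\<close>

lemma dchar_separates:
 assumes "q > 0" "coprime a q" "\<not> [a = 1] (mod q)"
 shows "\<exists>ch\<in>dchars q. ch a \<noteq> 1"
proof -
 have pc: "partial_char q {n. [n = 1] (mod q)} (\<lambda>_. 1)"
  unfolding partial_char_def
 proof (intro conjI ballI allI impI subsetI)
  show "n \<in> {n. coprime n q}" if "n \<in> {n. [n = 1] (mod q)}" for n
   using cong_imp_coprime[of 1 n q] that by (auto intro: cong_sym)
  show "m * n \<in> {n. [n = 1] (mod q)}" if "m \<in> {n. [n = 1] (mod q)}" "n \<in> {n. [n = 1] (mod q)}" for m n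
   using that cong_mult[of m 1 q n 1] by auto
  show "n \<in> {n. [n = 1] (mod q)}" if "m \<in> {n. [n = 1] (mod q)}" "[m = n] (mod q)" for m n
   using that by (auto intro: cong_sym cong_trans)
 qed auto
 define k where "k = (LEAST k. k > 0 \<and> a ^ k \<in> {n. [n = 1] (mod q)})"
 have ex: "\<exists>k. k > 0 \<and> a ^ k \<in> {n. [n = 1] (mod q)}"
  using euler_theorem[OF assms(2)] assms(1) by (intro exI[of _ "totient q"]) auto
 have k: "k > 0" "a ^ k \<in> {n. [n = 1] (mod q)}" using LeastI_ex[OF ex] by (auto simp: k_def)
 have kmin: "a ^ j \<notin> {n. [n = 1] (mod q)}" if "0 < j" "j < k" for j
  using not_less_Least[of j] that unfolding k_def by blast
 have "k \<noteq> 1" using k(2) assms(3) by auto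
 then obtain w :: complex where w: "w ^ k = 1" "w \<noteq> 1" using root_of_unity_neq_1[of k] k(1) by auto
 obtain H' ch' where H': "partial_char q H' ch'" "a \<in> H'" "ch' a = w"
  using partial_char_extend_step[OF pc assms(1,2) k kmin w(1)] by blast
 obtain ch where ch: "partial_char q {n. coprime n q} ch" "\<forall>h\<in>H'. ch h = ch' h"
  using partial_char_extend[OF H'(1) assms(1)] by blast
 show ?thesis
  using dchar_of_partial[OF ch(1) assms(1)] ch(2) H' w assms(2) by (intro bexI) auto
qed

lemma dcharD:
 assumes "ch \<in> dchars q"
 shows "ch (m * n) = ch m * ch n" "[m = n] (mod q) ==> ch m = ch n" "ch n \<noteq> 0 \<longleftrightarrow> coprime n q"
  "ch 1 = 1" "ch (Suc 0) = 1"
proof -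
 show "ch (m * n) = ch m * ch n" "[m = n] (mod q) ==> ch m = ch n" "ch n \<noteq> 0 \<longleftrightarrow> coprime n q"
  using assms by (auto simp: dchars_def)
 have mult: "ch (m * n) = ch m * ch n" and nz: "ch n \<noteq> 0 \<longleftrightarrow> coprime n q" for m n
  using assms by (auto simp: dchars_def)
 show "ch 1 = 1" using mult[of 1 1] nz[of 1] by simp
 thus "ch (Suc 0) = 1" by simp
qed

lemma dchar_power: "ch \<in> dchars q ==> ch (n ^ k) = ch n ^ k"
 by (induction k) (auto simp: dcharD)

lemma dchar_root_of_unity:
 assumes "ch \<in> dchars q" "coprime n q" shows "ch n ^ totient q = 1"
 using dcharD(2)[OF assms(1) euler_theorem[OF assms(2)]] dcharD(4)[OF assms(1)] assms
 by (simp add: dchar_power)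

lemma norm_dchar:
 assumes "ch \<in> dchars q" "q > 0" shows "norm (ch n) = (if coprime n q then 1 else 0)"
proof (cases "coprime n q")
 case True
 have "norm (ch n) ^ totient q = 1"
  using dchar_root_of_unity[OF assms(1) True] by (metis norm_one norm_power)
 hence "norm (ch n) = 1" using assms(2)
  by (metis norm_ge_zero one_power2 power_eq_imp_eq_base power_one totient_gt_0_iff zero_le_one)
 thus ?thesis using True by simp
qed (use dcharD(3)[OF assms(1), of n] in simp)

lemma norm_dchar_le: "ch \<in> dchars q ==> q > 0 ==> norm (ch n) \<le> 1"
 by (simp add: norm_dchar)

definition dchar0 :: "nat => nat => complex" where
 "dchar0 q n = (if coprime n q then 1 else 0)"

lemma dchar0_in: "q > 0 ==> dchar0 q \<in> dchars q"
proof -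
 have "coprime m q \<longleftrightarrow> coprime n q" if "[m = n] (mod q)" for m n
  using that by (metis cong_imp_coprime cong_sym)
 thus ?thesis by (auto simp: dchars_def dchar0_def)
qed

lemma dchar_mult_in: "c1 \<in> dchars q ==> c2 \<in> dchars q ==> (\<lambda>n. c1 n * c2 n) \<in> dchars q"
proof -
 assume c: "c1 \<in> dchars q" "c2 \<in> dchars q"
 show ?thesis
  unfolding dchars_def mem_Collect_eq
 proof (intro conjI allI impI)
  show "c1 (m * n) * c2 (m * n) = c1 m * c2 m * (c1 n * c2 n)" for m n
   using c by (simp add: dcharD(1))
  show "c1 m * c2 m = c1 n * c2 n" if "[m = n] (mod q)" for m n
   using dcharD(2)[OF c(1) that] dcharD(2)[OF c(2) that] by simp
  show "c1 n * c2 n \<noteq> 0 \<longleftrightarrow> coprime n q" for n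
   using dcharD(3)[OF c(1), of n] dcharD(3)[OF c(2), of n] by simp
 qed
qed

lemma dchar_cnj_in: "c1 \<in> dchars q ==> (\<lambda>n. cnj (c1 n)) \<in> dchars q"
proof -
 assume c: "c1 \<in> dchars q"
 show ?thesis
  unfolding dchars_def mem_Collect_eq
 proof (intro conjI allI impI)
  show "cnj (c1 (m * n)) = cnj (c1 m) * cnj (c1 n)" for m n
   using c by (simp add: dcharD(1))
  show "cnj (c1 m) = cnj (c1 n)" if "[m = n] (mod q)" for m n
   using dcharD(2)[OF c(1) that] by simp
  show "cnj (c1 n) \<noteq> 0 \<longleftrightarrow> coprime n q" for n
   using dcharD(3)[OF c(1), of n] by simp
 qed
qed

lemma dchar_mod: "ch \<in> dchars q ==> ch (n mod q) = ch n"
 by (rule dcharD(2)) (auto simp: cong_def)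

lemma finite_dchars:
 assumes "q > 0" shows "finite (dchars q)"
proof -
 define R where "R = insert 0 {z::complex. z ^ totient q = 1}"
 have "finite R" using assms finite_roots_unity[of "totient q"] unfolding R_def
  by (simp add: Suc_leI)
 hence fin: "finite (PiE {..<q} (\<lambda>_. R))" by (intro finite_PiE) auto
 have "inj_on (\<lambda>ch. restrict ch {..<q}) (dchars q)"
 proof (rule inj_onI)
  fix c1 c2 assume c: "c1 \<in> dchars q" "c2 \<in> dchars q" and e: "restrict c1 {..<q} = restrict c2 {..<q}"
  show "c1 = c2"
  proof
   fix n
   have "c1 (n mod q) = c2 (n mod q)"
    using fun_cong[OF e, of "n mod q"] assms by (simp add: restrict_def)
   thus "c1 n = c2 n" using c dchar_mod by metis
  qed
 qed
 moreover have "(\<lambda>ch. restrict ch {..<q}) ` dchars q \<subseteq> PiE {..<q} (\<lambda>_. R)"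
 proof (intro subsetI, elim imageE)
  fix f c assume c: "f = restrict c {..<q}" "c \<in> dchars q"
  have "c n \<in> R" for n using dchar_root_of_unity[OF c(2)] dcharD(3)[OF c(2)] unfolding R_def by blast
  thus "f \<in> PiE {..<q} (\<lambda>_. R)" using c by auto
 qed
 ultimately show ?thesis using fin by (meson finite_imageD finite_subset)
qed

lemma sum_dchar_shift:
 assumes "c \<in> dchars q" "q > 0" "coprime a q"
 shows "c a * (\<Sum>n<q. c n) = (\<Sum>n<q. c n)"
proof -
 have "inj_on (\<lambda>n. (a * n) mod q) {..<q}"
 proof (rule inj_onI)
  fix m n assume "m \<in> {..<q}" "n \<in> {..<q}" "a * m mod q = a * n mod q"
  thus "m = n" using assms(3)
   by (metis cong_def cong_mult_lcancel_nat cong_less_modulus_unique_nat lessThan_iff)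
 qed
 moreover have "(\<lambda>n. (a * n) mod q) ` {..<q} \<subseteq> {..<q}" using assms(2) by auto
 ultimately have bij: "bij_betw (\<lambda>n. (a * n) mod q) {..<q} {..<q}"
  by (simp add: bij_betw_def endo_inj_surj)
 have "(\<Sum>n<q. c n) = (\<Sum>n<q. c ((a * n) mod q))"
  using sum.reindex_bij_betw[OF bij, of c] by simp
 also have "\<dots> = (\<Sum>n<q. c a * c n)"
  by (intro sum.cong refl) (simp add: dchar_mod[OF assms(1)] dcharD(1)[OF assms(1)])
 also have "\<dots> = c a * (\<Sum>n<q. c n)" by (rule sum_distrib_left[symmetric])
 finally show ?thesis by (rule sym)
qed

lemma sum_dchar0:
 assumes "q > 0" shows "(\<Sum>n<q. dchar0 q n) = of_nat (totient q)"
proof (cases "q = 1")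
 case True thus ?thesis by (simp add: dchar0_def)
next
 case False
 have "(\<Sum>n<q. dchar0 q n) = (\<Sum>n\<in>totatives q. 1)"
 proof (rule sum.mono_neutral_cong_right)
  show "totatives q \<subseteq> {..<q}" using False assms by (auto intro: totatives_less)
  show "\<forall>i\<in>{..<q} - totatives q. dchar0 q i = 0"
   using False by (auto simp: dchar0_def totatives_def intro!: Nat.gr0I)
 qed (auto simp: dchar0_def totatives_def)
 thus ?thesis by (simp add: totient_def)
qed

lemma sum_dchar_nonprincipal:
 assumes "c \<in> dchars q" "q > 0" "c \<noteq> dchar0 q"
 shows "(\<Sum>n<q. c n) = 0"
proof -
 have "\<exists>a. coprime a q \<and> c a \<noteq> 1"
 proof (rule ccontr)
  assume "\<nexists>a. coprime a q \<and> c a \<noteq> 1"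
  hence "c = dchar0 q" using dcharD(3)[OF assms(1)] by (intro ext) (auto simp: dchar0_def)
  with assms(3) show False by simp
 qed
 then obtain a where "coprime a q" "c a \<noteq> 1" by blast
 with sum_dchar_shift[OF assms(1,2)] show ?thesis
  by (metis mult_cancel_right1)
qed

text \<open>If some character d has d a different from 1, multiplication by d permutes the
  characters and multiplies the sum by d a, so the sum vanishes.\<close>

lemma sum_over_dchars:
 assumes "q > 0" "coprime a q"
 shows "(\<Sum>c\<in>dchars q. c a) = (if [a = 1] (mod q) then of_nat (card (dchars q)) else 0)"
proof (cases "[a = 1] (mod q)")
 case True
 hence "(\<Sum>c\<in>dchars q. c a) = (\<Sum>c\<in>dchars q. 1)"
  by (intro sum.cong refl) (metis dcharD(2,4))
 with True show ?thesis by simp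
next
 case False
 obtain d where d: "d \<in> dchars q" "d a \<noteq> 1" using dchar_separates[OF assms False] by blast
 have dd: "d n * cnj (d n) = (if coprime n q then 1 else 0)" for n
  using norm_dchar[OF d(1) assms(1), of n] by (simp add: complex_norm_square[symmetric])
 have nz: "c n = 0" if "c \<in> dchars q" "\<not> coprime n q" for c n using dcharD(3)[OF that(1)] that(2) by auto
 have "bij_betw (\<lambda>c n. d n * c n) (dchars q) (dchars q)"
 proof (rule bij_betw_byWitness[where f' = "\<lambda>c n. cnj (d n) * c n"])
  show "\<forall>c\<in>dchars q. (\<lambda>n. cnj (d n) * (d n * c n)) = c"
  proof (intro ballI ext)
   fix c n assume "c \<in> dchars q"
   have "cnj (d n) * (d n * c n) = (d n * cnj (d n)) * c n" by (simp only: ac_simps)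
   thus "cnj (d n) * (d n * c n) = c n" using nz[OF \<open>c \<in> dchars q\<close>, of n] by (simp only: dd) auto
  qed
  show "\<forall>c\<in>dchars q. (\<lambda>n. d n * (cnj (d n) * c n)) = c"
  proof (intro ballI ext)
   fix c n assume "c \<in> dchars q"
   have "d n * (cnj (d n) * c n) = (d n * cnj (d n)) * c n" by (simp only: ac_simps)
   thus "d n * (cnj (d n) * c n) = c n" using nz[OF \<open>c \<in> dchars q\<close>, of n] by (simp only: dd) auto
  qed
 qed (use d dchar_mult_in dchar_cnj_in in blast)+
 from sum.reindex_bij_betw[OF this, of "\<lambda>c. c a"]
 have "d a * (\<Sum>c\<in>dchars q. c a) = (\<Sum>c\<in>dchars q. c a)" by (simp add: sum_distrib_left)
 thus ?thesis using d False by (metis mult_cancel_right1)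
qed

text \<open>Double counting of c n over all c and all n < q: summed over c first, only the class of
  1 survives; summed over n first, only \<open>dchar0\<close>.\<close>

lemma card_dchars:
 assumes "q > 0" shows "card (dchars q) = totient q"
proof -
 have "(\<Sum>n<q. \<Sum>c\<in>dchars q. c n) = (\<Sum>n<q. if [n = 1] (mod q) then of_nat (card (dchars q)) else (0::complex))"
 proof (rule sum.cong[OF refl])
  fix n
  show "(\<Sum>c\<in>dchars q. c n) = (if [n = 1] (mod q) then of_nat (card (dchars q)) else 0)"
  proof (cases "coprime n q")
   case False
   hence "\<not> [n = 1] (mod q)" by (metis cong_imp_coprime cong_sym coprime_1_left)
   moreover have "(\<Sum>c\<in>dchars q. c n) = 0" using False dcharD(3) by (intro sum.neutral) blast
   ultimately show ?thesis by simp
  qed (rule sum_over_dchars[OF assms])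
 qed
 also have "\<dots> = (\<Sum>n<q. if n = 1 mod q then of_nat (card (dchars q)) else 0)"
  by (intro sum.cong refl) (auto simp: cong_def)
 also have "\<dots> = of_nat (card (dchars q))" using assms by (simp add: sum.delta)
 finally have 1: "(\<Sum>n<q. \<Sum>c\<in>dchars q. c n) = of_nat (card (dchars q))" .
 have "(\<Sum>n<q. \<Sum>c\<in>dchars q. c n) = (\<Sum>c\<in>dchars q. \<Sum>n<q. c n)" by (rule sum.swap)
 also have "\<dots> = (\<Sum>c\<in>dchars q. if c = dchar0 q then of_nat (totient q) else 0)"
  using sum_dchar0 sum_dchar_nonprincipal assms by (intro sum.cong) auto
 also have "\<dots> = of_nat (totient q)" using dchar0_in finite_dchars assms by (simp add: sum.delta)
 finally show ?thesis using 1 by (metis of_nat_eq_iff)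
qed

lemma dchar_orthogonality:
 assumes "q > 0" "coprime a q"
 shows "(\<Sum>c\<in>dchars q. cnj (c a) * c n) = (if [n = a] (mod q) then of_nat (totient q) else 0)"
proof (cases "coprime n q")
 case False
 hence "\<not> [n = a] (mod q)" using assms(2) by (metis cong_imp_coprime cong_sym)
 moreover have "(\<Sum>c\<in>dchars q. cnj (c a) * c n) = 0"
 proof (rule sum.neutral, rule ballI)
  fix c assume "c \<in> dchars q"
  hence "c n = 0" using dcharD(3) False by blast
  thus "cnj (c a) * c n = 0" by simp
 qed
 ultimately show ?thesis by simp
next
 case True
 obtain b where b: "[a * b = 1] (mod q)" using cong_solve_coprime_nat[OF assms(2)] by auto
 have "coprime b q" using b by (metis cong_imp_coprime cong_sym coprime_1_left coprime_mult_left_iff)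
 \<comment> \<open>Values at units have modulus 1, so conjugation is inversion, and the conjugate at
   a is the value at an inverse of a.\<close>
 have inv: "cnj (c a) = c b" if "c \<in> dchars q" for c
 proof -
  have "c a * c b = 1" using dcharD(1,2,4)[OF that] b by metis
  moreover have "c a * cnj (c a) = 1"
   using norm_dchar[OF that assms(1), of a] assms(2) by (simp add: complex_norm_square[symmetric])
  ultimately show ?thesis by (metis mult_cancel_left mult_zero_left zero_neq_one)
 qed
 have "(\<Sum>c\<in>dchars q. cnj (c a) * c n) = (\<Sum>c\<in>dchars q. c (b * n))"
  using inv dcharD(1) by (intro sum.cong) auto
 also have "\<dots> = (if [b * n = 1] (mod q) then of_nat (totient q) else 0)"
  using sum_over_dchars[OF assms(1), of "b * n"] \<open>coprime b q\<close> True card_dchars[OF assms(1)] by simp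
 also have "[b * n = 1] (mod q) \<longleftrightarrow> [n = a] (mod q)"
 proof
  assume "[b * n = 1] (mod q)"
  hence "[a * (b * n) = a * 1] (mod q)" by (rule cong_scalar_left)
  moreover have "[a * b * n = 1 * n] (mod q)" using b by (rule cong_scalar_right)
  ultimately show "[n = a] (mod q)" by (metis cong_sym cong_trans mult.assoc mult_1 mult.right_neutral)
 next
  assume "[n = a] (mod q)"
  hence "[b * n = b * a] (mod q)" by (rule cong_scalar_left)
  thus "[b * n = 1] (mod q)" using b by (metis cong_trans mult.commute)
 qed
 finally show ?thesis .
qed

section \<open>Continuation of the L-functions to Re s > 1/2, with polynomial growth\<close>

lemma norm_nat_powr: "n > 0 ==> norm (of_nat n powr s :: complex) = real n powr Re s"
 by (subst norm_powr_real_powr) auto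

lemma norm_powr_diff_le:
 assumes "n > 0" "real n \<le> u" "u \<le> real n + 1" "Re s > 0"
 shows "norm (npow n s - of_real u powr (-s)) \<le> norm s * real n powr (- Re s - 1)"
proof -
 define S where "S = (of_real ` {real n..real n + 1} :: complex set)"
 have conv: "convex S" unfolding S_def by (intro convex_linear_image bounded_linear.linear bounded_linear_of_real convex_real_interval)
 have der: "((\<lambda>z. z powr (-s)) has_field_derivative (-s * z powr (-s - 1))) (at z within S)" if zS: "z \<in> S" for z
 proof -
  obtain v where v: "z = of_real v" "real n \<le> v" using zS unfolding S_def by (elim imageE) auto
  hence "z \<notin> \<real>\<^sub>\<le>\<^sub>0" using assms(1) by (auto simp: complex_nonpos_Reals_iff)
  thus ?thesis by (intro has_field_derivative_at_within[OF has_field_derivative_powr])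
 qed
 have bd: "norm (-s * z powr (-s - 1)) \<le> norm s * real n powr (- Re s - 1)" if zS: "z \<in> S" for z
 proof -
  obtain v where v: "z = of_real v" "real n \<le> v" using zS unfolding S_def by (elim imageE) auto
  have "norm (z powr (-s - 1)) = v powr (- Re s - 1)"
   using v assms(1) by (subst norm_powr_real_powr) auto
  also have "\<dots> \<le> real n powr (- Re s - 1)" using v assms by (intro powr_mono2') auto
  finally show ?thesis by (simp add: norm_mult mult_left_mono)
 qed
 have "norm ((of_nat n :: complex) powr (-s) - of_real u powr (-s)) \<le>
   norm s * real n powr (- Re s - 1) * norm (of_nat n - of_real u :: complex)"
  by (rule field_differentiable_bound[OF conv der bd])
    (use assms(2,3) in \<open>auto simp: S_def intro!: image_eqI[of _ _ "real n"]\<close>)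
 also have "norm (of_nat n - of_real u :: complex) = \<bar>real n - u\<bar>"
  by (metis norm_of_real of_real_diff of_real_of_nat_eq)
 also have "norm s * real n powr (- Re s - 1) * \<bar>real n - u\<bar> \<le> norm s * real n powr (- Re s - 1) * 1"
  using assms(2,3) by (intro mult_left_mono) auto
 finally show ?thesis by simp
qed

text \<open>The subtracted difference is the integral of (s - 1) u^-s over [n, n + 1]. The function
  \<open>g\<close> has derivative (s - 1) (n^-s - z^-s), which is small on that segment, and the
  mean value inequality applies.\<close>

lemma norm_zeta_term_le:
 assumes "n > 0" "Re s > 0"
 shows "norm ((s - 1) * npow n s - (of_nat n powr (1-s) - of_nat (Suc n) powr (1-s)))
  \<le> norm (s - 1) * norm s * real n powr (- Re s - 1)"
proof -
 define S where "S = (of_real ` {real n..real n + 1} :: complex set)"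
 define g where "g z = (s - 1) * npow n s * z + z powr (1 - s)" for z
 have conv: "convex S" unfolding S_def by (intro convex_linear_image bounded_linear.linear bounded_linear_of_real convex_real_interval)
 have der: "(g has_field_derivative ((s - 1) * (npow n s - z powr (-s)))) (at z within S)" if zS: "z \<in> S" for z
 proof -
  obtain v where v: "z = of_real v" "real n \<le> v" using zS unfolding S_def by (elim imageE) auto
  hence z: "z \<notin> \<real>\<^sub>\<le>\<^sub>0" using assms(1) by (auto simp: complex_nonpos_Reals_iff)
  have "((\<lambda>z. z powr (1 - s)) has_field_derivative ((1 - s) * z powr (1 - s - 1))) (at z within S)"
   by (intro has_field_derivative_at_within[OF has_field_derivative_powr] z)
  thus ?thesis unfolding g_def using z by (auto intro!: derivative_eq_intros simp: algebra_simps)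
 qed
 have bd: "norm ((s - 1) * (npow n s - z powr (-s))) \<le> norm (s - 1) * norm s * real n powr (- Re s - 1)" if zS: "z \<in> S" for z
 proof -
  obtain v where v: "z = of_real v" "real n \<le> v" "v \<le> real n + 1" using zS unfolding S_def by (elim imageE) auto
  show ?thesis unfolding norm_mult mult.assoc v(1)
   by (intro mult_left_mono norm_powr_diff_le v assms) auto
 qed
 have "norm (g (of_nat (Suc n)) - g (of_nat n)) \<le>
   norm (s - 1) * norm s * real n powr (- Re s - 1) * norm (of_nat (Suc n) - of_nat n :: complex)"
 proof (rule field_differentiable_bound[OF conv der bd])
  show "of_nat (Suc n) \<in> S" unfolding S_def by (rule image_eqI[of _ _ "real n + 1"]) auto
  show "of_nat n \<in> S" unfolding S_def by (rule image_eqI[of _ _ "real n"]) auto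
 qed
 also have "g (of_nat (Suc n)) - g (of_nat n) = (s - 1) * npow n s - (of_nat n powr (1-s) - of_nat (Suc n) powr (1-s))"
  by (simp add: g_def algebra_simps)
 finally show ?thesis by simp
qed

text \<open>A majorant test, locally uniform in s. The growth factor is carried along because
  polynomial bounds in Im s are needed up to the line Re s = 1.\<close>

lemma holomorphic_series_bound:
 fixes f :: "nat => complex => complex"
 assumes hol: "\<And>n. f n holomorphic_on {s. Re s > 1/2}"
  and bd0: "\<forall>n s. Re s > 1/2 --> norm (f n s) \<le> (1 + norm s) ^ 2 * h n"
  and h: "summable h" "\<And>n. h n \<ge> 0"
 shows "(\<lambda>s. \<Sum>n. f n s) holomorphic_on {s. Re s > 1/2}"
  and "Re s > 1/2 ==> summable (\<lambda>n. f n s)"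
  and "Re s > 1/2 ==> norm (\<Sum>n. f n s) \<le> (1 + norm s) ^ 2 * suminf h"
proof -
 let ?S = "{s. Re s > 1/2}"
 have bd: "norm (f n s) \<le> (1 + norm s) ^ 2 * h n" if "Re s > 1/2" for n s using bd0 that by blast
 have op: "open ?S" by (rule open_halfspace_Re_gt)
 have sm: "summable (\<lambda>n. norm (f n s))" if "Re s > 1/2" for s
  using bd[OF that] h by (intro summable_comparison_test'[OF summable_mult[OF h(1)]]) auto
 show "summable (\<lambda>n. f n s)" if "Re s > 1/2" by (rule summable_norm_cancel[OF sm[OF that]])
 show "norm (\<Sum>n. f n s) \<le> (1 + norm s) ^ 2 * suminf h" if "Re s > 1/2"
 proof -
  have "norm (\<Sum>n. f n s) \<le> (\<Sum>n. norm (f n s))" using summable_norm[OF sm[OF that]] .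
  also have "\<dots> \<le> (\<Sum>n. (1 + norm s) ^ 2 * h n)"
   by (intro suminf_le bd that sm summable_mult h)
  also have "\<dots> = (1 + norm s) ^ 2 * suminf h" by (rule suminf_mult[OF h(1)])
  finally show ?thesis .
 qed
 have "\<exists>g g'. \<forall>x\<in>?S. (\<lambda>n. f n x) sums g x \<and> (\<lambda>n. deriv (f n) x) sums g' x \<and> (g has_field_derivative g' x) (at x)"
 proof (rule series_and_derivative_comparison_local[OF op])
  show "(f n has_field_derivative deriv (f n) x) (at x)" if "x \<in> ?S" for n x
   using holomorphic_derivI[OF hol op that] .
  show "\<exists>d h. 0 < d \<and> summable h \<and> (\<forall>\<^sub>F n in sequentially. \<forall>y\<in>ball x d \<inter> ?S. norm (f n y) \<le> h n)" if "x \<in> ?S" for x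
  proof (intro exI conjI)
   show "summable (\<lambda>n. (2 + norm x) ^ 2 * h n)" by (intro summable_mult h)
   show "\<forall>\<^sub>F n in sequentially. \<forall>y\<in>ball x 1 \<inter> ?S. norm (f n y) \<le> (2 + norm x) ^ 2 * h n"
   proof (intro always_eventually allI ballI)
    fix n y assume y: "y \<in> ball x 1 \<inter> ?S"
    hence "norm y \<le> norm x + 1"
     using norm_triangle_sub[of y x] by (simp add: dist_norm norm_minus_commute)
    hence "(1 + norm y) ^ 2 * h n \<le> (2 + norm x) ^ 2 * h n"
     by (intro mult_right_mono power_mono h) auto
    with bd[of y n] y show "norm (f n y) \<le> (2 + norm x) ^ 2 * h n" by auto
   qed
  qed simp
 qed
 then obtain g g' where g: "\<And>x. x \<in> ?S ==> (\<lambda>n. f n x) sums g x \<and> (g has_field_derivative g' x) (at x)" by blast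
 have "g holomorphic_on ?S" using g holomorphic_on_open[OF op] by blast
 moreover have "(\<Sum>n. f n x) = g x" if "x \<in> ?S" for x using g[OF that] by (simp add: sums_iff)
 ultimately show "(\<lambda>s. \<Sum>n. f n s) holomorphic_on ?S" by (metis (no_types, lifting) holomorphic_transform)
qed

lemma powr_holomorphic: "(\<lambda>s. of_nat n powr (a - s)) holomorphic_on A"
proof (cases "n = 0")
 case False
 hence "(\<lambda>s. of_nat n powr (a - s)) = (\<lambda>s. exp ((a - s) * Ln (of_nat n)) :: complex)"
  by (auto simp: powr_def)
 thus ?thesis by (auto intro!: holomorphic_intros)
qed simp

lemma powr_holomorphic': "(\<lambda>s. of_nat n powr (- s)) holomorphic_on A"
 using powr_holomorphic[of n 0 A] by simp

lemma summable_powr_32: "summable (\<lambda>n. C * real n powr (-3/2))"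
 by (intro summable_mult) (simp add: summable_real_powr_iff)

lemma powr_le_32:
 assumes "Re s > 1/2" shows "real n powr (- Re s - 1) \<le> real n powr (-3/2)"
 using assms by (cases "n = 0") (auto intro!: powr_mono)

lemma tendsto_nat_powr_0:
 assumes "a < 0" shows "(\<lambda>n. real (Suc n) powr a) \<longlonglongrightarrow> 0"
 using tendsto_neg_powr[OF assms filterlim_compose[OF filterlim_real_sequentially filterlim_Suc]] .

text \<open>Summation by parts: n^-s - (n + 1)^-s is O(n^(-Re s - 1)), which converges absolutely
  for Re s > 0. Stopping at Re s > 1/2 provides the common majorant n^(-3/2).\<close>

lemma bounded_partial_sums_series:
 fixes c :: "nat => complex"
 assumes X: "\<And>n. norm (\<Sum>m=1..n. c m) \<le> B"
 shows "\<exists>Z C. Z holomorphic_on {s. Re s > 1/2} \<and> (\<forall>s. Re s > 1/2 --> norm (Z s) \<le> C * (1 + norm s) ^ 2) \<and>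
   (\<forall>s. Re s > 1/2 --> (\<lambda>n. c n * npow n s) sums Z s)"
proof -
 define X where "X n = (\<Sum>m=1..n. c m)" for n
 define f where "f n s = X n * (npow n s - of_nat (Suc n) powr (-s))" for n s
 define h where "h n = B * real n powr (-3/2)" for n
 have B: "B \<ge> 0" using X[of 0] by simp
 have fb: "norm (f n s) \<le> (1 + norm s) ^ 2 * h n" if "Re s > 1/2" for n s
 proof (cases "n = 0")
  case False
  have "norm (npow n s - of_nat (Suc n) powr (-s)) \<le> norm s * real n powr (- Re s - 1)"
   using norm_powr_diff_le[of n "real n + 1" s] False that by (simp add: add.commute)
  also have "\<dots> \<le> (1 + norm s) ^ 2 * real n powr (-3/2)"
   using powr_le_32[OF that] by (intro mult_mono) (auto simp: power2_eq_square algebra_simps)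
  finally have "norm (f n s) \<le> B * ((1 + norm s) ^ 2 * real n powr (-3/2))"
   using X[of n] B unfolding f_def norm_mult X_def by (intro mult_mono) auto
  thus ?thesis by (simp add: h_def mult_ac)
 qed (simp add: f_def X_def h_def)
 have hol: "f n holomorphic_on {s. Re s > 1/2}" for n
  unfolding f_def by (intro holomorphic_intros powr_holomorphic')
 have h: "summable h" unfolding h_def by (rule summable_powr_32)
 have h0: "\<And>n. h n \<ge> 0" using B by (auto simp: h_def)
 have fb': "\<forall>n s. Re s > 1/2 --> norm (f n s) \<le> (1 + norm s) ^ 2 * h n" using fb by blast
 note R = holomorphic_series_bound[OF hol fb' h h0]
 have part: "(\<Sum>n<Suc N. c n * npow n s) = X N * of_nat (Suc N) powr (-s) + (\<Sum>n<Suc N. f n s)" for N s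
 proof (induction N)
  case (Suc N)
  have "X (Suc N) = X N + c (Suc N)" by (simp add: X_def)
  with Suc show ?case unfolding sum.lessThan_Suc[of _ "Suc N"] by (simp add: f_def algebra_simps)
 qed (simp add: X_def f_def)
 have "(\<lambda>n. c n * npow n s) sums (\<Sum>n. f n s)" if s: "Re s > 1/2" for s
 proof -
  have "(\<lambda>N. X N * of_nat (Suc N) powr (-s)) \<longlonglongrightarrow> 0"
  proof (rule Lim_null_comparison)
   show "\<forall>\<^sub>F N in sequentially. norm (X N * of_nat (Suc N) powr (-s)) \<le> B * real (Suc N) powr (- Re s)"
    using X B unfolding X_def norm_mult
    by (intro always_eventually allI mult_mono) (auto simp: norm_nat_powr simp del: of_nat_Suc)
   show "(\<lambda>N. B * real (Suc N) powr (- Re s)) \<longlonglongrightarrow> 0"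
    using tendsto_mult_left[OF tendsto_nat_powr_0[of "- Re s"], of B] s by simp
  qed
  moreover have "(\<lambda>N. \<Sum>n<Suc N. f n s) \<longlonglongrightarrow> (\<Sum>n. f n s)"
   using summable_LIMSEQ[OF R(2)[OF s]] by (rule LIMSEQ_Suc)
  ultimately have "(\<lambda>N. \<Sum>n<Suc N. c n * npow n s) \<longlonglongrightarrow> 0 + (\<Sum>n. f n s)"
   unfolding part by (rule tendsto_add)
  thus ?thesis unfolding sums_def add_0_left by (rule LIMSEQ_imp_Suc)
 qed
 moreover have "norm (\<Sum>n. f n s) \<le> suminf h * (1 + norm s) ^ 2" if "Re s > 1/2" for s
  using R(3)[OF that] by (simp add: mult.commute)
 ultimately show ?thesis using R(1) by blast
qed

text \<open>Z is (s - 1) times the Riemann zeta function. After multiplication by s - 1 the series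
  telescopes up to terms O(n^(-Re s - 1)); all of them vanish at s = 1, whence the value
  there.\<close>

lemma zeta_continuation:
 "\<exists>Z C. Z holomorphic_on {s. Re s > 1/2} \<and> (\<forall>s. Re s > 1/2 --> norm (Z s) \<le> C * (1 + norm s) ^ 2) \<and> Z 1 = 1 \<and>
   (\<forall>s. Re s > 1 --> (\<lambda>n. npow n s) sums (Z s / (s - 1)))"
proof -
 define f where "f n s = (if n = 0 then 0 else (s - 1) * npow n s - (of_nat n powr (1-s) - of_nat (Suc n) powr (1-s)))"
  for n and s :: complex
 define h where "h n = 1 * real n powr (-3/2)" for n
 have fb: "norm (f n s) \<le> (1 + norm s) ^ 2 * h n" if "Re s > 1/2" for n s
 proof (cases "n = 0")
  case False
  have "norm (f n s) \<le> norm (s - 1) * norm s * real n powr (- Re s - 1)"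
   unfolding f_def using norm_zeta_term_le[of n s] False that by simp
  also have "\<dots> \<le> (1 + norm s) * (1 + norm s) * real n powr (-3/2)"
   using powr_le_32[OF that] norm_triangle_ineq4[of s 1] by (intro mult_mono) auto
  finally show ?thesis by (simp add: h_def power2_eq_square)
 qed (simp add: f_def h_def)
 have hol: "f n holomorphic_on {s. Re s > 1/2}" for n
  unfolding f_def by (cases "n = 0") (auto intro!: holomorphic_intros powr_holomorphic' powr_holomorphic)
 have h: "summable h" unfolding h_def by (rule summable_powr_32)
 have h0: "\<And>n. h n \<ge> 0" by (auto simp: h_def)
 have fb': "\<forall>n s. Re s > 1/2 --> norm (f n s) \<le> (1 + norm s) ^ 2 * h n" using fb by blast
 note R = holomorphic_series_bound[OF hol fb' h h0]
 have part: "(s - 1) * (\<Sum>n<Suc N. npow n s) = 1 - of_nat (Suc N) powr (1 - s) + (\<Sum>n<Suc N. f n s)" for N s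
 proof (induction N)
  case (Suc N)
  show ?case unfolding sum.lessThan_Suc[of _ "Suc N"] ring_distribs(1) Suc by (simp add: f_def)
 qed (simp add: f_def)
 have sm: "(\<lambda>n. npow n s) sums ((1 + (\<Sum>n. f n s)) / (s - 1))" if s: "Re s > 1" for s
 proof -
  have "(\<lambda>N. of_nat (Suc N) powr (1 - s) :: complex) \<longlonglongrightarrow> 0"
  proof (rule Lim_null_comparison)
   show "\<forall>\<^sub>F N in sequentially. norm (of_nat (Suc N) powr (1-s) :: complex) \<le> real (Suc N) powr (1 - Re s)"
    by (intro always_eventually allI) (auto simp: norm_nat_powr simp del: of_nat_Suc)
   show "(\<lambda>N. real (Suc N) powr (1 - Re s)) \<longlonglongrightarrow> 0"
    using tendsto_nat_powr_0[of "1 - Re s"] s by simp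
  qed
  moreover have "(\<lambda>N. \<Sum>n<Suc N. f n s) \<longlonglongrightarrow> (\<Sum>n. f n s)"
   using summable_LIMSEQ[OF R(2)[of s]] s by (intro LIMSEQ_Suc) auto
  ultimately have "(\<lambda>N. (s - 1) * (\<Sum>n<Suc N. npow n s)) \<longlonglongrightarrow> 1 - 0 + (\<Sum>n. f n s)"
   unfolding part by (intro tendsto_intros)
  hence "(\<lambda>N. (s - 1) * (\<Sum>n<Suc N. npow n s) / (s - 1)) \<longlonglongrightarrow> (1 - 0 + (\<Sum>n. f n s)) / (s - 1)"
   by (rule tendsto_divide) (use s in auto)
  moreover have "s - 1 \<noteq> 0" using s by auto
  ultimately have "(\<lambda>N. (\<Sum>n<Suc N. npow n s)) \<longlonglongrightarrow> (1 + (\<Sum>n. f n s)) / (s - 1)"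
   by simp
  thus ?thesis unfolding sums_def by (rule LIMSEQ_imp_Suc)
 qed
 have b: "norm (1 + (\<Sum>n. f n s)) \<le> (1 + suminf h) * (1 + norm s) ^ 2" if "Re s > 1/2" for s
 proof -
  have "norm (1 + (\<Sum>n. f n s)) \<le> 1 + norm (\<Sum>n. f n s)" using norm_triangle_ineq[of "1::complex" "\<Sum>n. f n s"] by simp
  moreover have "1 \<le> (1 + norm s) ^ 2" by (intro one_le_power) auto
  moreover have "norm (\<Sum>n. f n s) \<le> suminf h * (1 + norm s) ^ 2"
   using R(3)[OF that] by (simp add: mult.commute)
  ultimately show ?thesis unfolding distrib_right mult_1_left by linarith
 qed
 have z1: "f n 1 = 0" for n by (simp add: f_def del: of_nat_Suc)
 have "(\<lambda>s. 1 + (\<Sum>n. f n s)) holomorphic_on {s. Re s > 1/2}" by (intro holomorphic_intros R(1))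
 with sm b show ?thesis
  by (intro exI[of _ "\<lambda>s. 1 + (\<Sum>n. f n s)"] exI[of _ "1 + suminf h"]) (auto simp: z1)
qed

text \<open>Whole periods cancel and an incomplete one has fewer than q terms. The additional 2 pays
  for the term at 0, which the sum from 1 omits. Terms up to 2 are allowed because a character minus
  its mean value is also treated.\<close>

lemma periodic_sum_bounded:
 fixes c :: "nat => complex"
 assumes "q > 0" and per: "\<And>n. c (n + q) = c n" and "(\<Sum>n<q. c n) = 0" and b: "\<And>n. norm (c n) \<le> 2"
 shows "norm (\<Sum>m=1..n. c m) \<le> 2 * real q + 2"
proof -
 define P where "P n = (\<Sum>m<n. c m)" for n
 have "P (n + q) = P n" for n
  by (induction n) (use assms in "auto simp: P_def")
 note step = this
 have "P (n + k * q) = P n" for n k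
 proof (induction k)
  case (Suc k)
  have "n + Suc k * q = (n + k * q) + q" by simp
  with Suc step show ?case by metis
 qed simp
 from this[of "Suc n mod q" "Suc n div q"] have "P (Suc n) = P (Suc n mod q)" by simp
 also have "norm \<dots> \<le> (\<Sum>m<Suc n mod q. 2)" unfolding P_def by (intro order_trans[OF norm_sum] sum_mono b)
 also have "\<dots> \<le> 2 * real q" using mod_less_divisor[OF assms(1), of "Suc n"] by simp
 finally have 1: "norm (P (Suc n)) \<le> 2 * real q" .
 have "(\<Sum>m=1..n. c m) = P (Suc n) - c 0"
  by (induction n) (auto simp: P_def)
 thus ?thesis using 1 b[of 0] norm_triangle_ineq4[of "P (Suc n)" "c 0"] by simp
qed

text \<open>For the principal character Z is (s - 1) L(s), which absorbs the pole. Subtracting the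
  mean value \<open>\<kappa>\<close> leaves a periodic function of mean zero, so L is
  \<open>\<kappa>\<close> times zeta plus a regular part. The exponent 3 instead of 2 is due to the
  factor s - 1 on that part.\<close>

lemma L_continuation:
 assumes "q > 0" "c \<in> dchars q"
 shows "\<exists>Z C. Z holomorphic_on {s. Re s > 1/2} \<and> (\<forall>s. Re s > 1/2 --> norm (Z s) \<le> C * (1 + norm s) ^ 3) \<and>
   (\<forall>s. Re s > 1 --> (\<lambda>n. c n * npow n s) sums (if c = dchar0 q then Z s / (s - 1) else Z s)) \<and>
   (c = dchar0 q --> Z 1 \<noteq> 0) \<and> (c \<noteq> dchar0 q --> (\<lambda>n. c n / of_nat n) sums Z 1)"
proof (cases "c = dchar0 q")
 case False
 have per: "c (n + q) = c n" for n by (rule dcharD(2)[OF assms(2)]) (simp add: cong_def)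
 have "norm (c n) \<le> 2" for n using norm_dchar_le[OF assms(2,1), of n] by simp
 from bounded_partial_sums_series[OF periodic_sum_bounded[OF assms(1) per sum_dchar_nonprincipal[OF assms(2,1) False] this]]
 obtain Z C where Z: "Z holomorphic_on {s. Re s > 1/2}" "\<forall>s. Re s > 1/2 --> norm (Z s) \<le> C * (1 + norm s) ^ 2"
  "\<forall>s. Re s > 1/2 --> (\<lambda>n. c n * npow n s) sums Z s" by blast
 have "norm (Z s) \<le> \<bar>C\<bar> * (1 + norm s) ^ 3" if "Re s > 1/2" for s
 proof -
  have "norm (Z s) \<le> C * (1 + norm s) ^ 2" using Z(2) that by blast
  also have "\<dots> \<le> \<bar>C\<bar> * (1 + norm s) ^ 3" by (intro mult_mono power_increasing) auto
  finally show ?thesis .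
 qed
 moreover have "(\<lambda>n. c n / of_nat n) sums Z 1"
 proof -
  have "of_nat n powr (- 1) = inverse (of_nat n :: complex)" for n by (simp add: powr_minus)
  thus ?thesis using Z(3)[rule_format, of 1] unfolding divide_inverse by simp
 qed
 ultimately show ?thesis using False Z by (intro exI[of _ Z] exI[of _ "\<bar>C\<bar>"]) auto
next
 case True
 define \<kappa> :: complex where "\<kappa> = of_nat (totient q) / of_nat q"
 define d where "d n = dchar0 q n - \<kappa>" for n
 have "totient q \<le> q" by (rule totient_le)
 hence k: "norm \<kappa> \<le> 1" using assms(1) by (simp add: \<kappa>_def norm_divide)
 have "dchar0 q \<in> dchars q" by (rule dchar0_in[OF assms(1)])
 note D = this
 have per: "d (n + q) = d n" for n using dcharD(2)[OF D, of "n + q" n] by (auto simp: cong_def d_def)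
 have b: "norm (d n) \<le> 2" for n
  using norm_dchar_le[OF D assms(1), of n] k norm_triangle_ineq4[of "dchar0 q n" \<kappa>] by (simp add: d_def)
 have z: "(\<Sum>n<q. d n) = 0" using sum_dchar0[OF assms(1)] assms(1) by (simp add: d_def sum_subtractf \<kappa>_def)
 from bounded_partial_sums_series[OF periodic_sum_bounded[OF assms(1) per z b]]
 obtain E C where E: "E holomorphic_on {s. Re s > 1/2}" "\<forall>s. Re s > 1/2 --> norm (E s) \<le> C * (1 + norm s) ^ 2"
  "\<forall>s. Re s > 1/2 --> (\<lambda>n. d n * npow n s) sums E s" by blast
 obtain Y C' where Y: "Y holomorphic_on {s. Re s > 1/2}" "\<forall>s. Re s > 1/2 --> norm (Y s) \<le> C' * (1 + norm s) ^ 2"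
  "Y 1 = 1" "\<forall>s. Re s > 1 --> (\<lambda>n. npow n s) sums (Y s / (s - 1))" using zeta_continuation by blast
 define Z where "Z s = \<kappa> * Y s + (s - 1) * E s" for s
 have "norm (Z s) \<le> (\<bar>C'\<bar> + \<bar>C\<bar>) * (1 + norm s) ^ 3" if s: "Re s > 1/2" for s
 proof -
  have "norm (Y s) \<le> C' * (1 + norm s) ^ 2" using Y(2) s by blast
  also have "\<dots> \<le> \<bar>C'\<bar> * (1 + norm s) ^ 3" by (intro mult_mono power_increasing) auto
  finally have 1: "norm \<kappa> * norm (Y s) \<le> 1 * (\<bar>C'\<bar> * (1 + norm s) ^ 3)" using k by (intro mult_mono) auto
  have "norm (E s) \<le> C * (1 + norm s) ^ 2" using E(2) s by blast
  also have "\<dots> \<le> \<bar>C\<bar> * (1 + norm s) ^ 2" by (intro mult_right_mono) auto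
  finally have "norm (s - 1) * norm (E s) \<le> (1 + norm s) * (\<bar>C\<bar> * (1 + norm s) ^ 2)"
   using norm_triangle_ineq4[of s 1] by (intro mult_mono) auto
  hence 2: "norm (s - 1) * norm (E s) \<le> \<bar>C\<bar> * (1 + norm s) ^ 3" by (simp add: power3_eq_cube power2_eq_square mult_ac)
  have "norm (Z s) \<le> norm \<kappa> * norm (Y s) + norm (s - 1) * norm (E s)"
   unfolding Z_def by (metis norm_mult norm_triangle_ineq)
  with 1 2 show ?thesis by (simp add: algebra_simps)
 qed
 moreover have "(\<lambda>n. c n * npow n s) sums (Z s / (s - 1))" if s: "Re s > 1" for s
 proof -
  have "(\<lambda>n. \<kappa> * npow n s + d n * npow n s) sums (\<kappa> * (Y s / (s - 1)) + E s)"
   using Y(4) E(3) s by (intro sums_add sums_mult) auto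
  moreover have "\<kappa> * (Y s / (s - 1)) + E s = Z s / (s - 1)" proof -
   have "s - 1 \<noteq> 0" using s by auto
   thus ?thesis by (simp add: Z_def add_divide_distrib)
  qed
  moreover have "\<kappa> * npow n s + d n * npow n s = c n * npow n s" for n
   unfolding True d_def by (simp add: algebra_simps)
  ultimately show ?thesis by simp
 qed
 moreover have "Z 1 \<noteq> 0" using Y(3) assms(1) by (simp add: Z_def \<kappa>_def)
 moreover have "Z holomorphic_on {s. Re s > 1/2}" unfolding Z_def by (intro holomorphic_intros E Y)
 ultimately show ?thesis using True by (intro exI[of _ Z] exI[of _ "\<bar>C'\<bar> + \<bar>C\<bar>"]) auto
qed

section \<open>Dirichlet products, logarithmic derivatives and the 3-4-1 inequality\<close>

lemma has_sum_nat_from_1: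
 fixes h :: "nat => 'a::{comm_monoid_add,t2_space}"
 assumes "h 0 = 0" shows "(h has_sum S) {1..} \<longleftrightarrow> (h has_sum S) UNIV"
proof (rule has_sum_cong_neutral)
 fix x :: nat assume "x \<in> UNIV - {1..}"
 hence "x = 0" by (cases x) auto
 thus "h x = 0" using assms by simp
qed auto

lemma has_sum_divisors:
 fixes F :: "nat \<times> nat => complex"
 assumes "(F has_sum S) ({1..} \<times> {1..})"
 shows "(\<lambda>n. \<Sum>d | d dvd n. F (d, n div d)) sums S"
proof -
 have "((\<lambda>p. F (snd p, fst p div snd p)) has_sum S) (Sigma {1..} (\<lambda>n. {d. d dvd n}))
   \<longleftrightarrow> (F has_sum S) ({1..} \<times> {1..})"
  by (rule has_sum_reindex_bij_witness[of _ "\<lambda>(d, m). (d * m, d)" "\<lambda>(n, d). (d, n div d)"])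
    (auto elim!: dvdE simp: Suc_le_eq)
 hence "((\<lambda>p. F (snd p, fst p div snd p)) has_sum S) (Sigma {1..} (\<lambda>n. {d. d dvd n}))"
  using assms by blast
 hence "((\<lambda>n. \<Sum>d | d dvd n. F (d, n div d)) has_sum S) {1..}"
  by (rule has_sum_SigmaD) (auto intro!: has_sum_finiteI)
 \<comment> \<open>A \<open>sum\<close> over an infinite set is 0, so the index n = 0 contributes
   nothing.\<close>
 moreover have "infinite {d::nat. d dvd 0}" by simp
 ultimately have "((\<lambda>n. \<Sum>d | d dvd n. F (d, n div d)) has_sum S) UNIV"
  using has_sum_nat_from_1[of "\<lambda>n. \<Sum>d | d dvd n. F (d, n div d)"] by simp
 thus ?thesis by (rule has_sum_imp_sums)
qed

lemma dirichlet_product_sums: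
 fixes f g :: "nat => complex"
 assumes z: "f 0 = 0" "g 0 = 0" and sf: "summable (\<lambda>n. norm (f n))" and sg: "summable (\<lambda>n. norm (g n))"
 shows "(\<lambda>n. \<Sum>d | d dvd n. f d * g (n div d)) sums (suminf f * suminf g)"
proof -
 let ?P = "{1::nat..}"
 have hf: "(f has_sum suminf f) ?P" unfolding has_sum_nat_from_1[of f, OF z(1)]
  by (rule norm_summable_imp_has_sum[OF sf summable_sums[OF summable_norm_cancel[OF sf]]])
 have hg: "(g has_sum suminf g) ?P" unfolding has_sum_nat_from_1[of g, OF z(2)]
  by (rule norm_summable_imp_has_sum[OF sg summable_sums[OF summable_norm_cancel[OF sg]]])
 have hnf: "((\<lambda>n. norm (f n)) has_sum suminf (\<lambda>n. norm (f n))) ?P" using has_sum_nat_from_1[of "\<lambda>n. norm (f n)"] z(1)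
  norm_summable_imp_has_sum[of "\<lambda>n. norm (f n)"] sf summable_sums[OF sf] by simp
 have hng: "((\<lambda>n. norm (g n)) has_sum suminf (\<lambda>n. norm (g n))) ?P" using has_sum_nat_from_1[of "\<lambda>n. norm (g n)"] z(2)
  norm_summable_imp_has_sum[of "\<lambda>n. norm (g n)"] sg summable_sums[OF sg] by simp
 have "(\<lambda>p. norm (f (fst p)) * norm (g (snd p))) summable_on (?P \<times> ?P)"
 proof (rule summable_on_SigmaI)
  show "((\<lambda>y. norm (f (fst (x, y))) * norm (g (snd (x, y)))) has_sum norm (f x) * suminf (\<lambda>n. norm (g n))) ?P" for x
   using has_sum_cmult_right[OF hng, of "norm (f x)"] by simp
  show "(\<lambda>x. norm (f x) * suminf (\<lambda>n. norm (g n))) summable_on ?P"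
   by (rule has_sum_imp_summable[OF has_sum_cmult_left[OF hnf]])
 qed auto
 hence "(\<lambda>p. norm (f (fst p) * g (snd p))) summable_on (?P \<times> ?P)" by (simp add: norm_mult)
 hence abs: "(\<lambda>p. f (fst p) * g (snd p)) summable_on (?P \<times> ?P)" by (rule abs_summable_summable)
 have prod: "((\<lambda>p. f (fst p) * g (snd p)) has_sum (suminf f * suminf g)) (?P \<times> ?P)"
 proof (rule has_sum_SigmaI[OF _ _ abs])
  show "((\<lambda>y. f (fst (x, y)) * g (snd (x, y))) has_sum f x * suminf g) ?P" for x
   using has_sum_cmult_right[OF hg, of "f x"] by simp
  show "((\<lambda>x. f x * suminf g) has_sum suminf f * suminf g) ?P" by (rule has_sum_cmult_left[OF hf])
 qed
 show ?thesis using has_sum_divisors[OF prod] by simp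
qed

lemma mangoldt_le_ln: "n > 0 ==> (mangoldt n :: real) \<le> ln (real n)"
proof -
 assume n: "n > 0"
 have "(mangoldt n :: real) \<le> (\<Sum>d | d dvd n. mangoldt d)"
  by (rule member_le_sum) (use n in "auto simp: mangoldt_nonneg")
 also have "\<dots> = ln (real n)" using mangoldt_sum[of n, where 'a = real] n by simp
 finally show ?thesis .
qed

definition Lfun :: "(nat => complex) => complex => complex" where
 "Lfun c s = (\<Sum>n. c n * npow n s)"

definition Lam :: "(nat => complex) => complex => complex" where
 "Lam c s = (\<Sum>n. mangoldt n * c n * npow n s)"

lemma norm_nat_powr': "norm (npow n s :: complex) = real n powr (- Re s)"
 by (cases "n = 0") (auto simp: norm_nat_powr)

lemma summable_nat_powr: "a > 1 ==> summable (\<lambda>n. real n powr (- a))"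
 by (simp add: summable_real_powr_iff)

lemma ln_powr_le:
 assumes "a > 1" shows "ln (real n) * real n powr (- a) \<le> 2 / (a - 1) * real n powr (- ((a + 1) / 2))"
proof (cases "n = 0")
 case False
 have "ln (real n) \<le> real n powr ((a - 1)/2) / ((a - 1)/2)" using False assms by (intro ln_powr_bound) auto
 hence "ln (real n) * real n powr (- a) \<le> real n powr ((a - 1)/2) / ((a - 1)/2) * real n powr (- a)"
  by (intro mult_right_mono) auto
 also have "\<dots> = 2 / (a - 1) * (real n powr ((a - 1)/2) * real n powr (- a))" by simp
 also have "real n powr ((a - 1)/2) * real n powr (- a) = real n powr (- ((a + 1) / 2))"
 proof -
  have "(a - 1)/2 + (- a) = - ((a + 1) / 2)" by (simp add: field_simps)
  thus ?thesis by (simp only: powr_add[symmetric])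
 qed
 finally show ?thesis .
qed simp

lemma summable_ln_powr: "a > 1 ==> summable (\<lambda>n. ln (real n) * real n powr (- a))"
proof (rule summable_comparison_test'[where N = 1])
 assume a: "a > 1"
 show "summable (\<lambda>n. 2 / (a - 1) * real n powr (- ((a + 1) / 2)))"
  by (intro summable_mult summable_nat_powr) (use a in auto)
 show "norm (ln (real n) * real n powr (- a)) \<le> 2 / (a - 1) * real n powr (- ((a + 1) / 2))" if "1 \<le> n" for n
  using ln_powr_le[OF a, of n] that by (simp add: abs_mult)
qed

lemma summable_norm_Lfun:
 assumes "q > 0" "c \<in> dchars q" "Re s > 1"
 shows "summable (\<lambda>n. norm (c n * npow n s))"
proof (rule summable_comparison_test'[OF summable_nat_powr[OF assms(3)]])
 show "norm (norm (c n * npow n s)) \<le> real n powr (- Re s)" for n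
  using mult_right_mono[OF norm_dchar_le[OF assms(2,1), of n], of "real n powr (- Re s)"]
  by (simp add: norm_mult norm_nat_powr')
qed

lemma summable_norm_Lam:
 assumes "q > 0" "c \<in> dchars q" "Re s > 1"
 shows "summable (\<lambda>n. norm (mangoldt n * c n * npow n s))"
proof (rule summable_comparison_test'[OF summable_ln_powr[OF assms(3)], where N = 1])
 show "norm (norm (mangoldt n * c n * npow n s)) \<le> ln (real n) * real n powr (- Re s)" if "1 \<le> n" for n
 proof -
  have "mangoldt n * norm (c n) \<le> ln (real n) * 1"
   using that by (intro mult_mono mangoldt_le_ln norm_dchar_le[OF assms(2,1)]) auto
  from mult_right_mono[OF this, of "real n powr (- Re s)"] show ?thesis
   by (simp add: norm_mult norm_nat_powr' abs_mult)
 qed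
qed

lemma Lfun_deriv_series:
 fixes s :: complex and c :: "nat => complex"
 assumes "q > 0" "c \<in> dchars q" "Re s > 1"
 shows "(Lfun c has_field_derivative (\<Sum>n. - (of_real (ln (real n)) * c n * npow n s))) (at s)"
proof -
 let ?S = "{s. Re s > 1}"
 let ?f = "\<lambda>n (s::complex). c n * npow n s" and ?f' = "\<lambda>n (s::complex). - (of_real (ln (real n)) * c n * npow n s)"
 have "\<exists>g g'. \<forall>x\<in>?S. (\<lambda>n. ?f n x) sums g x \<and> (\<lambda>n. ?f' n x) sums g' x \<and> (g has_field_derivative g' x) (at x)"
 proof (rule series_and_derivative_comparison_local[OF open_halfspace_Re_gt])
  show "(?f n has_field_derivative ?f' n x) (at x)" for n x
  proof (cases "n = 0")
   case False
   have e: "?f n = (\<lambda>s::complex. c n * exp (- s * of_real (ln (real n))))"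
    using False by (auto simp: powr_def Ln_of_nat)
   have pw: "(of_nat n :: complex) powr (-x) = exp (- x * of_real (ln (real n)))"
    using False by (auto simp: powr_def Ln_of_nat)
   show ?thesis unfolding e pw by (auto intro!: derivative_eq_intros)
  qed simp
  show "\<exists>d h. 0 < d \<and> summable h \<and> (\<forall>\<^sub>F n in sequentially. \<forall>y\<in>ball x d \<inter> ?S. norm (?f n y) \<le> h n)" if "x \<in> ?S" for x
  proof (intro exI conjI)
   show "(Re x - 1) / 2 > 0" using that by simp
   show "summable (\<lambda>n. real n powr (- ((Re x + 1) / 2)))" using that by (intro summable_nat_powr) auto
   show "\<forall>\<^sub>F n in sequentially. \<forall>y\<in>ball x ((Re x - 1) / 2) \<inter> ?S. norm (?f n y) \<le> real n powr (- ((Re x + 1) / 2))"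
   proof (intro eventually_sequentiallyI[of 1] ballI)
    fix n :: nat and y assume n: "1 \<le> n" and y: "y \<in> ball x ((Re x - 1) / 2) \<inter> ?S"
    hence "\<bar>Re x - Re y\<bar> < (Re x - 1) / 2" using abs_Re_le_cmod[of "x - y"] by (simp add: dist_norm)
    hence "Re x - Re y < (Re x - 1) / 2" by linarith
    hence "(Re x + 1) / 2 \<le> Re y" by (simp add: field_simps)
    hence "real n powr (- Re y) \<le> real n powr (- ((Re x + 1) / 2))" using n by (intro powr_mono) auto
    moreover have "norm (c n) * real n powr (- Re y) \<le> 1 * real n powr (- Re y)"
     by (intro mult_right_mono norm_dchar_le[OF assms(2,1)]) auto
    ultimately show "norm (?f n y) \<le> real n powr (- ((Re x + 1) / 2))" by (simp add: norm_mult norm_nat_powr')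
   qed
  qed
 qed
 then obtain g g' where g: "\<And>x. x \<in> ?S ==> (\<lambda>n. ?f n x) sums g x \<and> (\<lambda>n. ?f' n x) sums g' x \<and> (g has_field_derivative g' x) (at x)"
  by blast
 have s: "s \<in> ?S" using assms by simp
 have "(Lfun c has_field_derivative g' s) (at s)"
 proof (rule has_field_derivative_transform_within_open[OF _ open_halfspace_Re_gt s])
  show "(g has_field_derivative g' s) (at s)" using g[OF s] by blast
  show "g x = Lfun c x" if "x \<in> ?S" for x using g[OF that] by (simp add: Lfun_def sums_iff)
 qed
 moreover have "g' s = (\<Sum>n. ?f' n s)" using g[OF s] by (simp add: sums_iff)
 ultimately show ?thesis by simp
qed

text \<open>ln is the Dirichlet convolution of the von Mangoldt function with 1, and c is completely
  multiplicative. No division by \<open>Lfun\<close> occurs, because its nonvanishing is itself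
  deduced from this equation.\<close>

lemma Lfun_deriv:
 assumes "q > 0" "c \<in> dchars q" "Re s > 1"
 shows "(Lfun c has_field_derivative (- Lam c s * Lfun c s)) (at s)"
proof -
 let ?f = "\<lambda>n. mangoldt n * c n * npow n s" and ?g = "\<lambda>n. c n * npow n s"
 have "(\<lambda>n. \<Sum>d | d dvd n. ?f d * ?g (n div d)) sums (suminf ?f * suminf ?g)"
  by (rule dirichlet_product_sums) (use summable_norm_Lfun[OF assms] summable_norm_Lam[OF assms] in auto)
 moreover have "(\<Sum>d | d dvd n. ?f d * ?g (n div d)) = of_real (ln (real n)) * c n * npow n s" for n
 proof (cases "n = 0")
  case False
  have "(\<Sum>d | d dvd n. ?f d * ?g (n div d)) = (\<Sum>d | d dvd n. mangoldt d * (c n * npow n s))"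
  proof (rule sum.cong[OF refl])
   fix d assume "d \<in> {d. d dvd n}"
   then obtain m where m: "n = d * m" by auto
   hence d: "d > 0" "n div d = m" using False by auto
   have "(of_nat n :: complex) powr (-s) = of_nat d powr (-s) * of_nat m powr (-s)"
    unfolding m of_nat_mult by (rule powr_times_real) auto
   moreover have "c n = c d * c m" unfolding m by (rule dcharD(1)[OF assms(2)])
   ultimately show "?f d * ?g (n div d) = mangoldt d * (c n * npow n s)" by (simp add: d)
  qed
  also have "\<dots> = (\<Sum>d | d dvd n. mangoldt d) * (c n * npow n s)" by (rule sum_distrib_right[symmetric])
  also have "(\<Sum>d | d dvd n. mangoldt d :: complex) = ln (real n)" by (rule mangoldt_sum[OF False])
  finally show ?thesis by (simp add: mult.assoc)
 qed simp
 ultimately have "(\<lambda>n. of_real (ln (real n)) * c n * npow n s) sums (Lam c s * Lfun c s)"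
  by (simp only: Lam_def Lfun_def)
 hence "(\<lambda>n. - (of_real (ln (real n)) * c n * npow n s)) sums (- (Lam c s * Lfun c s))" by (rule sums_minus)
 hence "(\<Sum>n. - (of_real (ln (real n)) * c n * npow n s)) = - (Lam c s * Lfun c s)" by (simp add: sums_iff)
 with Lfun_deriv_series[OF assms] show ?thesis by simp
qed

text \<open>Supplies the value at infinity from which the monotonicity argument for the 3-4-1
  product starts.\<close>

lemma Lfun_tendsto_1:
 assumes "q > 0" "c \<in> dchars q" "Re b = 0"
 shows "((\<lambda>x. Lfun c (of_real x + b)) \<longlongrightarrow> 1) at_top"
proof -
 define B where "B = (\<Sum>n. real n powr (- 2))"
 have "EV x. norm (Lfun c (of_real x + b) - 1) \<le> B * 2 powr (2 - x)"
 proof (rule eventually_at_top_linorderI[of 3])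
  fix x :: real assume x: "x \<ge> 3"
  let ?s = "of_real x + b" and ?f = "\<lambda>n. c n * of_nat n powr (- (of_real x + b))"
  have Re: "Re ?s > 1" using x assms by simp
  have sm: "summable ?f" by (rule summable_norm_cancel[OF summable_norm_Lfun[OF assms(1,2) Re]])
  have "Lfun c ?s = (\<Sum>n. ?f (n + 2)) + (\<Sum>i<2. ?f i)" unfolding Lfun_def by (rule suminf_split_initial_segment[OF sm])
  also have "(\<Sum>i<2. ?f i) = 1" using dcharD(5)[OF assms(2)] by (simp add: numeral_2_eq_2)
  finally have e: "Lfun c ?s - 1 = (\<Sum>n. ?f (n + 2))" by simp
  have le: "norm (?f (n + 2)) \<le> 2 powr (2 - x) * real (n + 2) powr (- 2)" for n
  proof -
   have "norm (?f (n + 2)) \<le> 1 * real (n + 2) powr (- x)"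
    unfolding norm_mult norm_nat_powr' using assms(3)
    by (intro mult_mono norm_dchar_le[OF assms(2,1)]) auto
   also have "\<dots> = real (n + 2) powr (2 - x) * real (n + 2) powr (- 2)"
    by (simp flip: powr_add)
   also have "\<dots> \<le> 2 powr (2 - x) * real (n + 2) powr (- 2)"
    using x by (intro mult_right_mono powr_mono2') auto
   finally show ?thesis .
  qed
  have s2: "summable (\<lambda>n. real n powr (- 2))" by (rule summable_nat_powr) simp
  have s3: "summable (\<lambda>n. 2 powr (2 - x) * real (n + 2) powr (- 2))"
   by (intro summable_mult summable_ignore_initial_segment[OF s2])
  have "norm (\<Sum>n. ?f (n + 2)) \<le> (\<Sum>n. 2 powr (2 - x) * real (n + 2) powr (- 2))"
   by (rule norm_suminf_le[OF le s3])
  also have "\<dots> = 2 powr (2 - x) * (\<Sum>n. real (n + 2) powr (- 2))"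
   by (rule suminf_mult[OF summable_ignore_initial_segment[OF s2]])
  also have "(\<Sum>n. real (n + 2) powr (- 2)) \<le> B"
   unfolding B_def suminf_split_initial_segment[OF s2, of 2] by (simp add: sum_nonneg)
  finally show "norm (Lfun c ?s - 1) \<le> B * 2 powr (2 - x)" unfolding e by (simp add: mult.commute)
 qed
 moreover have "((\<lambda>x. B * 2 powr (2 - x)) \<longlongrightarrow> 0) at_top" by real_asymp
 ultimately have "((\<lambda>x. Lfun c (of_real x + b) - 1) \<longlongrightarrow> 0) at_top" by (rule Lim_null_comparison)
 thus ?thesis by (simp add: LIM_zero_iff)
qed

lemma three_four_one_term:
 fixes w :: complex assumes "norm w = 1" shows "3 + 4 * Re w + Re (w ^ 2) \<ge> 0"
proof -
 have "(Re w)\<^sup>2 + (Im w)\<^sup>2 = 1" using assms by (simp add: cmod_def)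
 hence "3 + 4 * Re w + Re (w ^ 2) = 2 * (1 + Re w)\<^sup>2" by (simp add: power2_eq_square algebra_simps)
 thus ?thesis by simp
qed

lemma three_four_one_Lam:
 assumes "q > 0" "c \<in> dchars q" "x > 1"
 shows "Re (3 * Lam (dchar0 q) (of_real x) + 4 * Lam c (of_real x + \<i> * of_real t) +
   Lam (\<lambda>n. c n * c n) (of_real x + 2 * \<i> * of_real t)) \<ge> 0"
proof -
 let ?s0 = "of_real x :: complex" and ?s1 = "of_real x + \<i> * of_real t" and ?s2 = "of_real x + 2 * \<i> * of_real t"
 have sm: "(\<lambda>n. mangoldt n * d n * npow n s) sums Lam d s" if "d \<in> dchars q" "Re s = x" for d s
 proof -
  have "summable (\<lambda>n. norm (mangoldt n * d n * npow n s))"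
   by (rule summable_norm_Lam[OF assms(1) that(1)]) (use assms(3) that(2) in simp)
  from summable_sums[OF summable_norm_cancel[OF this]] show ?thesis unfolding Lam_def .
 qed
 have "(\<lambda>n. 3 * (mangoldt n * dchar0 q n * of_nat n powr (-?s0)) + 4 * (mangoldt n * c n * of_nat n powr (-?s1)) +
    mangoldt n * (c n * c n) * of_nat n powr (-?s2)) sums
   (3 * Lam (dchar0 q) ?s0 + 4 * Lam c ?s1 + Lam (\<lambda>n. c n * c n) ?s2)" (is "?F sums _")
  by (intro sums_add sums_mult sm dchar0_in assms dchar_mult_in) auto
 hence SR: "(\<lambda>n. Re (?F n)) sums Re (3 * Lam (dchar0 q) ?s0 + 4 * Lam c ?s1 + Lam (\<lambda>n. c n * c n) ?s2)"
  by (rule sums_Re)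
 have nn: "0 \<le> Re (?F n)" for n
 proof (cases "n > 0 \<and> coprime n q")
  case True
  define w where "w = c n * of_nat n powr (- (\<i> * of_real t))"
  have nw: "norm w = 1" using True norm_dchar[OF assms(2,1), of n] unfolding w_def norm_mult norm_nat_powr'
   by simp
  have p0: "(of_nat n :: complex) powr (- ?s0) = of_real (real n powr (- x))"
   using powr_of_real[of "real n" "- x"] by simp
  have p1: "(of_nat n :: complex) powr (- ?s1) = of_real (real n powr (- x)) * of_nat n powr (- (\<i> * of_real t))"
   unfolding p0[symmetric] powr_add[symmetric] by (simp add: True)
  have p2: "(of_nat n :: complex) powr (- ?s2) = of_real (real n powr (- x)) * (of_nat n powr (- (\<i> * of_real t)))\<^sup>2"
   unfolding p0[symmetric] power2_eq_square powr_add[symmetric] by (simp add: True algebra_simps)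
  have "?F n = of_real (mangoldt n * real n powr (- x)) * (3 + 4 * w + w ^ 2)"
   unfolding p0 p1 p2 using True by (simp add: dchar0_def w_def power2_eq_square algebra_simps)
  hence "Re (?F n) = mangoldt n * real n powr (- x) * (3 + 4 * Re w + Re (w ^ 2))"
   by (simp del: of_real_mult)
  also have "\<dots> \<ge> 0" using three_four_one_term[OF nw] by (intro mult_nonneg_nonneg mangoldt_nonneg) auto
  finally show ?thesis .
 next
  case False
  hence "?F n = 0" using dcharD(3)[OF assms(2), of n] by (auto simp: dchar0_def)
  thus ?thesis by simp
 qed
 show ?thesis by (rule sums_le[OF nn sums_zero SR])
qed

text \<open>Logarithms of L-functions are avoided. The product \<open>K\<close> satisfies K' = - S K
  with Re S >= 0 on the real axis, so its modulus decreases along the ray to the right, where it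
  tends to 1.\<close>

lemma three_four_one:
 assumes "q > 0" "c \<in> dchars q" "x > 1"
 shows "norm (Lfun (dchar0 q) (of_real x)) ^ 3 * norm (Lfun c (of_real x + \<i> * of_real t)) ^ 4 *
   norm (Lfun (\<lambda>n. c n * c n) (of_real x + 2 * \<i> * of_real t)) \<ge> 1"
proof -
 define K where "K z = Lfun (dchar0 q) z ^ 3 * Lfun c (z + \<i> * of_real t) ^ 4 * Lfun (\<lambda>n. c n * c n) (z + 2 * \<i> * of_real t)" for z
 define S where "S z = 3 * Lam (dchar0 q) z + 4 * Lam c (z + \<i> * of_real t) + Lam (\<lambda>n. c n * c n) (z + 2 * \<i> * of_real t)" for z
 have Kd: "(K has_field_derivative (- S z * K z)) (at z)" if z: "Re z > 1" for z
 proof -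
  have sh: "((\<lambda>z. Lfun d (z + b)) has_field_derivative (- Lam d (z + b) * Lfun d (z + b))) (at z)"
   if "d \<in> dchars q" "Re b = 0" for d b
   using DERIV_shift[of "Lfun d" _ z b] Lfun_deriv[OF assms(1) that(1), of "z + b"] z that(2) by simp
  note d = Lfun_deriv[OF assms(1) dchar0_in[OF assms(1)] z] sh[OF assms(2), of "\<i> * of_real t"]
   sh[OF dchar_mult_in[OF assms(2,2)], of "2 * \<i> * of_real t"]
  show ?thesis unfolding K_def
   by (rule derivative_eq_intros d refl | simp)+ (simp add: S_def algebra_simps power2_eq_square power3_eq_cube power4_eq_xxxx)
 qed
 define N where "N x = (Re (K (of_real x)))\<^sup>2 + (Im (K (of_real x)))\<^sup>2" for x
 have Nd: "\<exists>y. (N has_real_derivative y) (at x) \<and> y \<le> 0" if x: "x > 1" for x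
 proof -
  let ?k = "K (of_real x)" and ?k' = "- S (of_real x) * K (of_real x)"
  have "((\<lambda>x. K (of_real x)) has_vector_derivative ?k') (at x)"
   using Kd[of "of_real x"] x by (intro has_vector_derivative_real_field) auto
  hence r: "((\<lambda>x. Re (K (of_real x))) has_field_derivative Re ?k') (at x)"
   "((\<lambda>x. Im (K (of_real x))) has_field_derivative Im ?k') (at x)"
   unfolding has_vector_derivative_complex_iff by auto
  have "(N has_real_derivative 2 * Re ?k * Re ?k' + 2 * Im ?k * Im ?k') (at x)"
   unfolding N_def by (rule derivative_eq_intros r refl)+ simp
  moreover have "2 * Re ?k * Re ?k' + 2 * Im ?k * Im ?k' = - (2 * Re (S (of_real x)) * ((Re ?k)\<^sup>2 + (Im ?k)\<^sup>2))"
   by (simp add: power2_eq_square algebra_simps)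
  moreover have "Re (S (of_real x)) \<ge> 0" unfolding S_def by (rule three_four_one_Lam[OF assms(1,2) x])
  ultimately show ?thesis by (metis (no_types, lifting) mult_nonneg_nonneg neg_le_0_iff_le sum_power2_ge_zero zero_le_numeral)
 qed
 have dec: "N y \<le> N x" if "x \<le> y" for y
  using that by (rule DERIV_nonpos_imp_nonincreasing) (use Nd assms(3) in force)
 have "((\<lambda>x. K (of_real x)) \<longlongrightarrow> 1 ^ 3 * 1 ^ 4 * 1) at_top"
  unfolding K_def using Lfun_tendsto_1[OF assms(1) dchar0_in[OF assms(1)], of 0]
   Lfun_tendsto_1[OF assms(1,2), of "\<i> * of_real t"]
   Lfun_tendsto_1[OF assms(1) dchar_mult_in[OF assms(2,2)], of "2 * \<i> * of_real t"]
  by (intro tendsto_mult tendsto_power) auto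
 hence "((\<lambda>x. (Re (K (of_real x)))\<^sup>2 + (Im (K (of_real x)))\<^sup>2) \<longlongrightarrow> (Re (1 ^ 3 * 1 ^ 4 * 1 :: complex))\<^sup>2 + (Im (1 ^ 3 * 1 ^ 4 * 1 :: complex))\<^sup>2) at_top"
  by (intro tendsto_intros)
 hence "(N \<longlongrightarrow> 1) at_top" unfolding N_def by simp
 hence "1 \<le> N x"
  by (rule tendsto_upperbound) (use dec in "auto intro: eventually_at_top_linorderI[of x]")
 hence "1 \<le> (norm (K (of_real x)))\<^sup>2" by (simp add: N_def cmod_power2)
 hence "1 \<le> norm (K (of_real x))" using power2_le_imp_le[of 1 "norm (K (of_real x))"] by simp
 thus ?thesis by (simp add: K_def norm_mult norm_power)
qed

section \<open>Nonvanishing of L(1, c) for real characters c\<close>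

lemma sum_divisors_coprime_mult:
 fixes f :: "nat => real"
 assumes "coprime a b" "a > 0" "b > 0" and mult: "\<And>m n. f (m * n) = f m * f n"
 shows "(\<Sum>d | d dvd a * b. f d) = (\<Sum>d | d dvd a. f d) * (\<Sum>d | d dvd b. f d)"
proof -
 have inj: "inj_on (\<lambda>(x, y). x * y) ({d. d dvd a} \<times> {d. d dvd b})"
 proof (rule inj_onI, clarify)
  fix x y x' y' assume d: "x dvd a" "y dvd b" "x' dvd a" "y' dvd b" and e: "x * y = x' * y'"
  have "coprime x y'" "coprime x' y" using assms(1) d by (meson coprime_divisors)+
  with e show "x = x' \<and> y = y'" using coprime_crossproduct_nat[of x y' x' y] by (simp add: mult.commute)
 qed
 have img: "(\<lambda>(x, y). x * y) ` ({d. d dvd a} \<times> {d. d dvd b}) = {d. d dvd a * b}"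
 proof (intro equalityI subsetI)
  fix d assume "d \<in> {d. d dvd a * b}"
  then obtain x y where "d = x * y" "x dvd a" "y dvd b" using division_decomp by blast
  thus "d \<in> (\<lambda>(x, y). x * y) ` ({d. d dvd a} \<times> {d. d dvd b})" by auto
 qed (auto intro: mult_dvd_mono)
 have "(\<Sum>d | d dvd a * b. f d) = (\<Sum>p\<in>{d. d dvd a} \<times> {d. d dvd b}. f (fst p * snd p))"
  unfolding img[symmetric] by (subst sum.reindex[OF inj]) (auto simp: case_prod_unfold)
 also have "\<dots> = (\<Sum>x | x dvd a. \<Sum>y | y dvd b. f x * f y)"
  unfolding mult by (simp add: sum.cartesian_product case_prod_unfold)
 finally show ?thesis by (simp add: sum_product)
qed

text \<open>The divisor sum is multiplicative; on p^k it is the sum of f(p)^i for i <= k, which is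
  nonnegative for f p in {-1, 0, 1} and at least 1 for even k. Perfect squares are what makes the
  Lambert series unbounded later.\<close>

lemma sum_divisors_quadratic_nonneg:
 fixes f :: "nat => real"
 assumes mult: "\<And>m n. f (m * n) = f m * f n" and vals: "\<And>n. f n \<in> {-1, 0, 1}" and f1: "f 1 = 1" and "n > 0"
 shows "(\<Sum>d | d dvd n. f d) \<ge> 0 \<and> ((\<forall>p. prime p --> even (multiplicity p n)) --> (\<Sum>d | d dvd n. f d) \<ge> 1)"
 using \<open>n > 0\<close>
proof (induction n rule: less_induct)
 case (less n)
 show ?case
 proof (cases "n = 1")
  case True
  thus ?thesis using f1 by simp
 next
  case False
  then obtain p where p: "prime p" "p dvd n" using prime_factor_nat by blast
  define k where "k = multiplicity p n"
  obtain m where m: "n = p ^ k * m" "\<not> p dvd m"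
   using multiplicity_decompose'[of n p] less.prems p unfolding k_def by (metis not_prime_unit not_gr_zero)
  have "k > 0" using p less.prems unfolding k_def by (simp add: prime_multiplicity_gt_zero_iff)
  have "m > 0" using m less.prems by (cases m) auto
  have "m < n"
  proof -
   have "1 < p ^ k" by (rule one_less_power[OF prime_gt_1_nat[OF p(1)] \<open>k > 0\<close>])
   thus ?thesis using m(1) \<open>m > 0\<close> by simp
  qed
  have cop: "coprime (p ^ k) m" using m(2) p(1) by (simp add: prime_imp_coprime)
  have R: "(\<Sum>d | d dvd n. f d) = (\<Sum>d | d dvd p ^ k. f d) * (\<Sum>d | d dvd m. f d)"
   unfolding m(1) using sum_divisors_coprime_mult[OF cop _ \<open>m > 0\<close> mult] prime_gt_0_nat[OF p(1)] by simp
  have fp: "f (p ^ i) = f p ^ i" for i by (induction i) (auto simp: mult f1[simplified])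
  have "{d. d dvd p ^ k} = (\<lambda>i. p ^ i) ` {..k}" using divides_primepow_nat[OF p(1)] by auto
  moreover have "inj_on (\<lambda>i. p ^ i) {..k}" using prime_gt_1_nat[OF p(1)] by (auto simp: inj_on_def)
  ultimately have Rp: "(\<Sum>d | d dvd p ^ k. f d) = (\<Sum>i\<le>k. f p ^ i)" by (simp add: sum.reindex fp)
  have alt: "(\<Sum>i\<le>j. (-1::real) ^ i) = (if even j then 1 else 0)" for j by (induction j) auto
  have zer: "(\<Sum>i\<le>j. (0::real) ^ i) = 1" for j by (induction j) auto
  have pos: "(\<Sum>i\<le>k. f p ^ i) \<ge> 0 \<and> (even k --> (\<Sum>i\<le>k. f p ^ i) \<ge> 1)"
   using vals[of p] alt[of k] zer[of k] by auto
  have IH: "(\<Sum>d | d dvd m. f d) \<ge> 0" "(\<forall>p. prime p --> even (multiplicity p m)) ==> (\<Sum>d | d dvd m. f d) \<ge> 1"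
   using less.IH[OF \<open>m < n\<close> \<open>m > 0\<close>] by auto
  show ?thesis
  proof (intro conjI impI)
   show "(\<Sum>d | d dvd n. f d) \<ge> 0" unfolding R Rp using pos IH(1) by simp
   assume ev: "\<forall>p. prime p --> even (multiplicity p n)"
   have "even (multiplicity r m)" if r: "prime r" for r
   proof (cases "r = p")
    case True thus ?thesis using m(2) by (simp add: not_dvd_imp_multiplicity_0)
   next
    case False
    have "multiplicity r n = multiplicity r (p ^ k) + multiplicity r m"
     unfolding m(1) using r p(1) \<open>m > 0\<close> by (intro prime_elem_multiplicity_mult_distrib) auto
    moreover have "multiplicity r (p ^ k) = 0"
     using False r p(1) by (metis multiplicity_distinct_prime_power)
    moreover have "even (multiplicity r n)" using ev r by blast
    ultimately show ?thesis by simp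
   qed
   hence "(\<Sum>d | d dvd m. f d) \<ge> 1" using IH(2) by blast
   moreover have "(\<Sum>i\<le>k. f p ^ i) \<ge> 1" using pos ev p(1) by (simp add: k_def)
   ultimately show "(\<Sum>d | d dvd n. f d) \<ge> 1" unfolding R Rp
    using mult_mono[of 1 "\<Sum>i\<le>k. f p ^ i" 1 "\<Sum>d | d dvd m. f d"] by simp
  qed
 qed
qed

text \<open>The exponents i and n - 1 - i are paired, and each pair is bounded below by the
  inequality between arithmetic and geometric mean.\<close>

lemma geometric_sum_am_gm:
 fixes z :: real assumes "0 \<le> z"
 shows "real n * z ^ (n - 1) \<le> (\<Sum>i<n. (z ^ 2) ^ i)"
proof -
 have "2 * z ^ (n - 1) \<le> (z ^ 2) ^ i + (z ^ 2) ^ (n - Suc i)" if "i < n" for i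
 proof -
  have e: "z ^ (n - 1) = z ^ i * z ^ (n - Suc i)" using that by (simp flip: power_add)
  have "0 \<le> (z ^ i - z ^ (n - Suc i))\<^sup>2" by simp
  thus ?thesis unfolding e by (simp add: power2_eq_square algebra_simps power_mult_distrib)
 qed
 hence "(\<Sum>i<n. 2 * z ^ (n - 1)) \<le> (\<Sum>i<n. (z ^ 2) ^ i + (z ^ 2) ^ (n - Suc i))"
  by (intro sum_mono) auto
 also have "\<dots> = 2 * (\<Sum>i<n. (z ^ 2) ^ i)"
  using sum.nat_diff_reindex[of "\<lambda>i. (z ^ 2) ^ i" n] by (simp add: sum.distrib)
 finally show ?thesis by simp
qed

text \<open>The Lambert series argument for \<open>L(1, \<chi>) \<noteq> 0\<close> for real \<open>\<chi>\<close>: the weights below decrease in \<open>n\<close>,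
 so a bounded character sum against them stays bounded as \<open>y \<rightarrow> 1\<close>.\<close>

definition lambert_weight :: "real => nat => real" where
 "lambert_weight y n = 1 / (real n * (1 - y)) - y ^ n / (1 - y ^ n)"

text \<open>Writing 1 - y^m as (1 - y) S m takes out the factor 1 / (1 - y). Both claims become
  lower bounds for S n and for S n * S (Suc n), obtained from \<open>geometric_sum_am_gm\<close>
  with z = sqrt y.\<close>

lemma lambert_weight:
 assumes "0 < y" "y < 1" "n > 0"
 shows "lambert_weight y n \<ge> 0" "lambert_weight y (Suc n) \<le> lambert_weight y n"
proof -
 define z where "z = sqrt y"
 have z: "0 < z" "z < 1" "y = z ^ 2" using assms by (auto simp: z_def)
 define S where "S m = (\<Sum>i<m. y ^ i)" for m
 have S: "1 - y ^ m = (1 - y) * S m" for m unfolding S_def by (rule one_diff_power_eq)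
 have Sge: "real m * z ^ (m - 1) \<le> S m" for m unfolding S_def z(3) by (rule geometric_sum_am_gm) (use z in auto)
 have Spos: "S m > 0" if "m > 0" for m
  using Sge[of m] z that by (smt (verit) mult_pos_pos of_nat_0_less_iff zero_less_power)
 have yz: "y ^ m \<le> z ^ (m - 1)" for m
  unfolding z(3) power_mult[symmetric] using z by (intro power_decreasing) auto
 have "real n * y ^ n \<le> S n" using Sge[of n] yz[of n] by (smt (verit) mult_left_mono of_nat_0_le_iff)
 hence "y ^ n / S n \<le> 1 / real n" using Spos[of n] assms(3) by (simp add: field_simps)
 hence "(1 / (1 - y)) * (y ^ n / S n) \<le> (1 / (1 - y)) * (1 / real n)" using assms by (intro mult_left_mono) auto
 thus "lambert_weight y n \<ge> 0" unfolding lambert_weight_def S by (simp add: mult.commute)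
 have "real n * real (Suc n) * y ^ n \<le> S n * S (Suc n)"
 proof -
  have "real n * real (Suc n) * y ^ n \<le> real n * real (Suc n) * (z ^ (n - 1) * z ^ n)"
   unfolding z(3) power_mult[symmetric] power_add[symmetric] using z
   by (intro mult_left_mono power_decreasing) auto
  also have "\<dots> = (real n * z ^ (n - 1)) * (real (Suc n) * z ^ (Suc n - 1))" by simp
  also have "\<dots> \<le> S n * S (Suc n)" using z Spos assms(3) by (intro mult_mono Sge) (auto intro: less_imp_le)
  finally show ?thesis .
 qed
 hence k: "y ^ n / (S n * S (Suc n)) \<le> 1 / (real n * real (Suc n))"
 proof -
  have *: "p / P \<le> 1 / Q" if "Q * p \<le> P" "P > 0" "Q > 0" for p P Q :: real
   using that by (simp add: field_simps)
  show ?thesis by (rule *[OF \<open>real n * real (Suc n) * y ^ n \<le> S n * S (Suc n)\<close>])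
   (use Spos[of n] Spos[of "Suc n"] assms(3) in auto)
 qed
 have "lambert_weight y n - lambert_weight y (Suc n) =
   (1 / (1 - y)) * (1 / real n - 1 / real (Suc n) - (y ^ n / S n - y ^ Suc n / S (Suc n)))"
 proof -
  have "1 / (a * u) - p / (u * s) - (1 / (b * u) - p' / (u * s')) = (1 / u) * (1 / a - 1 / b - (p / s - p' / s'))"
   for a b u s s' p p' :: real by (simp add: divide_inverse algebra_simps)
  thus ?thesis unfolding lambert_weight_def S .
 qed
 also have "1 / real n - 1 / real (Suc n) = 1 / (real n * real (Suc n))" using assms(3) by (simp add: field_simps)
 also have "y ^ n / S n - y ^ Suc n / S (Suc n) = y ^ n / (S n * S (Suc n))"
 proof -
  have "S (Suc n) - y * S n = 1"
  proof -
   have "(1 - y) * (S (Suc n) - y * S n) = (1 - y) * S (Suc n) - y * ((1 - y) * S n)" by (simp add: algebra_simps)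
   also have "\<dots> = 1 - y" unfolding S[symmetric] by (simp add: algebra_simps)
   finally show ?thesis using assms by simp
  qed
  have "y ^ n / S n - y ^ Suc n / S (Suc n) = y ^ n * (S (Suc n) - y * S n) / (S n * S (Suc n))"
   using Spos[of n] Spos[of "Suc n"] assms(3) by (simp add: field_simps)
  thus ?thesis by (simp only: \<open>S (Suc n) - y * S n = 1\<close> mult_1_right)
 qed
 finally show "lambert_weight y (Suc n) \<le> lambert_weight y n"
  using k assms by (smt (verit) divide_nonneg_nonneg mult_nonneg_nonneg)
qed

lemma abel_sum_bound:
 fixes c :: "nat => complex" and b :: "nat => real"
 assumes X: "\<And>n. norm (\<Sum>m=1..n. c m) \<le> B" and b: "\<And>n. n > 0 ==> b n \<ge> 0" "\<And>n. n > 0 ==> b (Suc n) \<le> b n"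
 shows "norm (\<Sum>n=1..N. c n * of_real (b n)) \<le> B * b 1"
proof -
 define X where "X n = (\<Sum>m=1..n. c m)" for n
 have e: "(\<Sum>n=1..N. c n * of_real (b n)) = X N * of_real (b (Suc N)) + (\<Sum>n=1..N. X n * of_real (b n - b (Suc n)))" for N
 proof (induction N)
  case (Suc N)
  have "X (Suc N) = X N + c (Suc N)" by (simp add: X_def)
  with Suc show ?case by (simp add: algebra_simps)
 qed (simp add: X_def)
 have t: "(\<Sum>n=1..N. b n - b (Suc n)) = b 1 - b (Suc N)" for N by (induction N) auto
 have "norm (\<Sum>n=1..N. c n * of_real (b n)) \<le> B * b (Suc N) + (\<Sum>n=1..N. B * (b n - b (Suc n)))"
 proof -
  have 1: "norm (X N * of_real (b (Suc N))) \<le> B * b (Suc N)"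
   using b(1)[of "Suc N"] X[of N] by (simp add: norm_mult X_def mult_right_mono)
  have "norm (\<Sum>n=1..N. X n * of_real (b n - b (Suc n))) \<le> (\<Sum>n=1..N. norm (X n * of_real (b n - b (Suc n))))"
   by (rule norm_sum)
  also have "\<dots> \<le> (\<Sum>n=1..N. B * (b n - b (Suc n)))"
  proof (rule sum_mono)
   show "norm (X n * of_real (b n - b (Suc n))) \<le> B * (b n - b (Suc n))" if "n \<in> {1..N}" for n
    using b(2)[of n] X[of n] that by (simp add: norm_mult X_def mult_right_mono del: of_real_diff)
  qed
  finally show ?thesis unfolding e using 1 by (intro order_trans[OF norm_triangle_ineq] add_mono)
 qed
 also have "\<dots> = B * b 1" unfolding sum_distrib_left[symmetric] t by (simp add: algebra_simps)
 finally show ?thesis .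
qed

text \<open>If L(1, c) were 0, the series of c(n) y^n / (1 - y^n) would be, up to sign, the sum of c
  against \<open>lambert_weight\<close>, hence bounded for 0 < y < 1. As a power series it is the
  sum of R(n) y^n with R >= 0 and R >= 1 at squares, so it exceeds the sum of y^(m^2), which is
  unbounded as y tends to 1.\<close>

lemma L1_real_nonzero:
 assumes "q > 0" "c \<in> dchars q" "c \<noteq> dchar0 q" "(\<lambda>n. c n * c n) = dchar0 q"
 shows "\<not> (\<lambda>n. c n / of_nat n) sums 0"
proof
 assume L: "(\<lambda>n. c n / of_nat n) sums 0"
 define B where "B = 2 * real q + 2"
 have per: "c (n + q) = c n" for n by (rule dcharD(2)[OF assms(2)]) (simp add: cong_def)
 have c2: "norm (c n) \<le> 2" for n using norm_dchar_le[OF assms(2,1), of n] by simp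
 have X: "norm (\<Sum>m=1..n. c m) \<le> B" for n unfolding B_def
  by (rule periodic_sum_bounded[OF assms(1) per sum_dchar_nonprincipal[OF assms(2,1,3)] c2])
 have cval: "c n = 0 \<or> c n = 1 \<or> c n = -1" for n
 proof -
  have "c n * c n = dchar0 q n" using fun_cong[OF assms(4), of n] by simp
  hence "c n * c n = 0 \<or> c n * c n = 1" by (auto simp: dchar0_def)
  thus ?thesis by (metis mult_eq_0_iff square_eq_1_iff)
 qed
 define f where "f n = Re (c n)" for n
 have cf: "c n = of_real (f n)" for n using cval[of n] by (auto simp: f_def)
 have "f (m * n) = f m * f n" for m n
 proof -
  have "of_real (f (m * n)) = (of_real (f m * f n) :: complex)" using dcharD(1)[OF assms(2), of m n] unfolding cf by simp
  thus ?thesis by (simp only: of_real_eq_iff)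
 qed
 note fR = sum_divisors_quadratic_nonneg[of f, OF this]
 have fv: "f n \<in> {-1, 0, 1}" for n using cval[of n] by (auto simp: f_def)
 have f1: "f 1 = 1" using dcharD(4)[OF assms(2)] by (simp add: f_def)
 define R where "R n = (\<Sum>d | d dvd n. f d)" for n
 have R0: "R n \<ge> 0" if "n > 0" for n unfolding R_def using fR[OF fv f1 that] by blast
 have R1: "R (n ^ 2) \<ge> 1" if "n > 0" for n
 proof -
  have "even (multiplicity p (n ^ 2))" if "prime p" for p
   using prime_elem_multiplicity_power_distrib[of p n 2] that \<open>n > 0\<close> by simp
  thus ?thesis unfolding R_def using fR[OF fv f1, of "n ^ 2"] \<open>n > 0\<close> by simp
 qed
 have main: "(\<Sum>m=1..M. y ^ (m ^ 2)) \<le> B" if y: "0 < y" "y < 1" for y M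
 proof -
  define F where "F p = c (fst p) * of_real (y ^ (fst p * snd p))" for p :: "nat \<times> nat"
  have geo: "((\<lambda>k. y ^ (d * k)) has_sum y ^ d / (1 - y ^ d)) {1..}" if "d > 0" for d
  proof -
   have yd: "norm (y ^ d) < 1" using y that by (simp add: power_less_one_iff)
   have "(\<lambda>k. (y ^ d) ^ k) sums (1 / (1 - y ^ d))" by (rule geometric_sums[OF yd])
   hence "((\<lambda>k. (y ^ d) ^ k) has_sum (1 / (1 - y ^ d))) UNIV"
    using y by (intro norm_summable_imp_has_sum) (auto simp: sums_iff)
   hence "((\<lambda>k. y ^ d * (y ^ d) ^ k) has_sum (y ^ d * (1 / (1 - y ^ d)))) UNIV" by (rule has_sum_cmult_right)
   hence "((\<lambda>k. y ^ (d * Suc k)) has_sum (y ^ d / (1 - y ^ d))) UNIV" by (simp add: power_add power_mult)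
   moreover have "((\<lambda>k. y ^ (d * Suc k)) has_sum (y ^ d / (1 - y ^ d))) UNIV \<longleftrightarrow> ((\<lambda>k. y ^ (d * k)) has_sum (y ^ d / (1 - y ^ d))) {1..}"
    by (rule has_sum_reindex_bij_witness[of _ "\<lambda>k. k - 1" Suc]) auto
   ultimately show ?thesis by blast
  qed
  have bnd: "y ^ d / (1 - y ^ d) \<le> 1 / (1 - y) * y ^ d" if "d > 0" for d
  proof -
   have "1 - y \<le> 1 - y ^ d" using power_decreasing[of 1 d y] y that by simp
   thus ?thesis using y by (simp add: frac_le)
  qed
  have sgeo: "(\<lambda>d. 1 / (1 - y) * y ^ d) summable_on {1..}"
  proof -
   have "summable (\<lambda>n. norm (1 / (1 - y) * y ^ n))" using y by (simp add: abs_mult summable_geometric)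
   hence "(\<lambda>d. 1 / (1 - y) * y ^ d) summable_on UNIV" by (rule norm_summable_imp_summable_on)
   thus ?thesis by (rule summable_on_subset_banach) simp
  qed
  have s1: "(\<lambda>d. y ^ d / (1 - y ^ d)) summable_on {1..}"
   by (rule summable_on_comparison_test[OF sgeo]) (use bnd y in "auto simp: power_le_one")
  have "(\<lambda>p. y ^ (fst p * snd p)) summable_on ({1..} \<times> {1..})"
   by (rule summable_on_SigmaI[where g = "\<lambda>d. y ^ d / (1 - y ^ d)"]) (use geo s1 y in auto)
  moreover have "norm (of_real (y ^ k) :: complex) = y ^ k" for k using y by (simp del: of_real_power)
  ultimately have "(\<lambda>p. norm (of_real (y ^ (fst p * snd p)) :: complex)) summable_on ({1..} \<times> {1..})"
   by (simp only:)
  hence absF: "(\<lambda>p. norm (F p)) summable_on ({1..} \<times> {1..})"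
  proof (rule Infinite_Sum.abs_summable_on_comparison_test[where g = "\<lambda>p. of_real (y ^ (fst p * snd p)) :: complex"])
   fix p show "norm (F p) \<le> norm (of_real (y ^ (fst p * snd p)) :: complex)"
    using norm_dchar_le[OF assms(2,1), of "fst p"] unfolding F_def norm_mult by (simp add: mult_left_le_one_le)
  qed
  hence sF: "F summable_on ({1..} \<times> {1..})" by (rule abs_summable_summable)
  then obtain S where S: "(F has_sum S) ({1..} \<times> {1..})" by (auto simp: summable_on_def)
  have "((\<lambda>d. c d * of_real (y ^ d / (1 - y ^ d))) has_sum S) {1..}"
  proof (rule has_sum_SigmaD[OF S])
   fix d :: nat assume "d \<in> {1..}"
   hence "((\<lambda>k. of_real (y ^ (d * k)) :: complex) has_sum of_real (y ^ d / (1 - y ^ d))) {1..}"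
    by (intro has_sum_of_real geo) auto
   thus "((\<lambda>k. F (d, k)) has_sum c d * of_real (y ^ d / (1 - y ^ d))) {1..}"
    unfolding F_def fst_conv snd_conv by (rule has_sum_cmult_right)
  qed
  moreover have "c 0 * of_real (y ^ 0 / (1 - y ^ 0)) = 0" by simp
  ultimately have S1: "(\<lambda>d. c d * of_real (y ^ d / (1 - y ^ d))) sums S"
   using has_sum_nat_from_1[of "\<lambda>d. c d * of_real (y ^ d / (1 - y ^ d))"] has_sum_imp_sums by blast
  have S2: "(\<lambda>n. \<Sum>d | d dvd n. F (d, n div d)) sums S" by (rule has_sum_divisors[OF S])
  have "(\<Sum>d | d dvd n. F (d, n div d)) = of_real (R n * y ^ n)" for n
  proof (cases "n = 0")
   case False
   have "(\<Sum>d | d dvd n. F (d, n div d)) = (\<Sum>d | d dvd n. of_real (f d * y ^ n))"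
    by (intro sum.cong refl) (auto simp: F_def cf)
   thus ?thesis by (simp add: R_def sum_distrib_right)
  qed (simp add: R_def)
  with S2 have "(\<lambda>n. of_real (R n * y ^ n)) sums S" by simp
  hence S3: "(\<lambda>n. R n * y ^ n) sums Re S" by (auto dest: sums_Re simp del: of_real_mult)
  have "norm (\<Sum>n=1..N. c n * of_real (lambert_weight y n)) \<le> B" for N
  proof -
   have "norm (\<Sum>n=1..N. c n * of_real (lambert_weight y n)) \<le> B * lambert_weight y 1"
    by (rule abel_sum_bound[OF X]) (use lambert_weight[OF y] in auto)
   also have "lambert_weight y 1 = 1" using y by (simp add: lambert_weight_def diff_divide_distrib[symmetric])
   finally show ?thesis by simp
  qed
  moreover have "(\<Sum>n=1..N. c n * of_real (lambert_weight y n)) =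
    (\<Sum>n<Suc N. c n / of_nat n) * of_real (1 / (1 - y)) - (\<Sum>n<Suc N. c n * of_real (y ^ n / (1 - y ^ n)))" for N
  proof (induction N)
   case (Suc N)
   thus ?case unfolding sum.lessThan_Suc[of _ "Suc N"] lambert_weight_def
    by (simp add: algebra_simps del: of_nat_Suc power_Suc)
  qed simp
  ultimately have b: "norm ((\<Sum>n<Suc N. c n / of_nat n) * of_real (1 / (1 - y)) - (\<Sum>n<Suc N. c n * of_real (y ^ n / (1 - y ^ n)))) \<le> B" for N
   by metis
  have "(\<lambda>N. norm ((\<Sum>n<Suc N. c n / of_nat n) * of_real (1 / (1 - y)) - (\<Sum>n<Suc N. c n * of_real (y ^ n / (1 - y ^ n)))))
   \<longlonglongrightarrow> norm (0 * of_real (1 / (1 - y)) - S)"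
   using L S1 unfolding sums_def by (intro tendsto_norm tendsto_diff tendsto_mult tendsto_const LIMSEQ_Suc)
  hence "norm (0 * of_real (1 / (1 - y)) - S) \<le> B" by (rule LIMSEQ_le_const2) (use b in auto)
  hence "Re S \<le> B" using complex_Re_le_cmod[of S] by simp
  have "(\<Sum>m=1..M. y ^ (m ^ 2)) \<le> (\<Sum>m=1..M. R (m ^ 2) * y ^ (m ^ 2))"
   using R1 y by (intro sum_mono) (auto simp: mult_le_cancel_right1)
  also have "\<dots> = (\<Sum>n\<in>(\<lambda>m. m ^ 2) ` {1..M}. R n * y ^ n)"
   by (subst sum.reindex) (auto simp: inj_on_def)
  also have "\<dots> \<le> suminf (\<lambda>n. R n * y ^ n)"
  proof (rule sum_le_suminf)
   show "summable (\<lambda>n. R n * y ^ n)" using S3 by (rule sums_summable)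
   show "0 \<le> R n * y ^ n" if "n \<in> - (\<lambda>m. m ^ 2) ` {1..M}" for n
    using R0[of n] y by (cases "n = 0") (auto simp: R_def)
  qed simp
  also have "\<dots> = Re S" using S3 by (simp add: sums_iff)
  finally show ?thesis using \<open>Re S \<le> B\<close> by linarith
 qed
 define M where "M = nat \<lceil>B\<rceil> + 1"
 have "((\<lambda>y::real. \<Sum>m=1..M. y ^ (m ^ 2)) \<longlongrightarrow> (\<Sum>m=1..M. 1 ^ (m ^ 2))) (at_left 1)"
  by (intro tendsto_intros)
 hence "(\<Sum>m=1..M. (1::real) ^ (m ^ 2)) \<le> B"
 proof (rule tendsto_upperbound)
  have "\<forall>\<^sub>F y in at_left (1::real). y \<in> {0<..<1}" by (rule eventually_at_left_real) simp
  thus "\<forall>\<^sub>F y in at_left (1::real). (\<Sum>m=1..M. y ^ (m ^ 2)) \<le> B"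
   by (rule eventually_mono) (use main in auto)
 qed simp
 hence "real M \<le> B" by simp
 thus False unfolding M_def by linarith
qed

section \<open>Nonvanishing and lower bounds for L-functions up to the line Re s = 1\<close>

text \<open>Z is L itself, or (s - 1) L for the principal character, so that one holomorphic
  function serves both cases and a zero of Z at 1 is excluded in both.\<close>

definition continuation_of :: "nat => (nat => complex) => (complex => complex) => real => bool" where
 "continuation_of q c Z C \<longleftrightarrow> C \<ge> 1 \<and> Z holomorphic_on {s. Re s > 1/2} \<and> (\<forall>s. Re s > 1/2 --> norm (Z s) \<le> C * (1 + norm s) ^ 3) \<and>
   (\<forall>s. Re s > 1 --> Lfun c s = (if c = dchar0 q then Z s / (s - 1) else Z s)) \<and>
   (c = dchar0 q --> Z 1 \<noteq> 0) \<and> (c \<noteq> dchar0 q --> (\<lambda>n. c n / of_nat n) sums Z 1)"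

lemma continuation_exists:
 assumes "q > 0" "c \<in> dchars q"
 shows "\<exists>Z C. continuation_of q c Z C"
proof -
 obtain Z C where Z: "Z holomorphic_on {s. Re s > 1/2}" "\<forall>s. Re s > 1/2 --> norm (Z s) \<le> C * (1 + norm s) ^ 3"
   "\<forall>s. Re s > 1 --> (\<lambda>n. c n * npow n s) sums (if c = dchar0 q then Z s / (s - 1) else Z s)"
   "(c = dchar0 q --> Z 1 \<noteq> 0)" "(c \<noteq> dchar0 q --> (\<lambda>n. c n / of_nat n) sums Z 1)"
  using L_continuation[OF assms] by blast
 have "norm (Z s) \<le> max C 1 * (1 + norm s) ^ 3" if "Re s > 1/2" for s
 proof -
  have "norm (Z s) \<le> C * (1 + norm s) ^ 3" using Z(2) that by blast
  also have "\<dots> \<le> max C 1 * (1 + norm s) ^ 3" by (intro mult_right_mono) auto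
  finally show ?thesis .
 qed
 moreover have "Lfun c s = (if c = dchar0 q then Z s / (s - 1) else Z s)" if "Re s > 1" for s
  using Z(3)[rule_format, OF that] unfolding Lfun_def by (simp add: sums_iff)
 ultimately show ?thesis using Z by (intro exI[of _ Z] exI[of _ "max C 1"]) (auto simp: continuation_of_def)
qed

text \<open>Cauchy's inequality on circles of radius 1/4, which stay inside Re s > 1/2. On such a
  circle 1 + norm s at most doubles, which costs 2^3 = 8; the constant is that of the second
  derivative, 2! * 8 * 4^2 = 256.\<close>

lemma continuation_deriv_bounds:
 assumes "continuation_of q c Z C" "Re s \<ge> 1"
 shows "norm (Z s) \<le> 256 * C * (1 + norm s) ^ 3" "norm (deriv Z s) \<le> 256 * C * (1 + norm s) ^ 3"
  "norm (deriv (deriv Z) s) \<le> 256 * C * (1 + norm s) ^ 3"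
proof -
 have C: "C \<ge> 1" and hol: "Z holomorphic_on {s. Re s > 1/2}"
  and bd: "\<And>s. Re s > 1/2 ==> norm (Z s) \<le> C * (1 + norm s) ^ 3" using assms(1) by (auto simp: continuation_of_def)
 have sub: "cball s (1/4) \<subseteq> {s. Re s > 1/2}"
 proof
  fix z assume "z \<in> cball s (1/4)"
  hence "\<bar>Re s - Re z\<bar> \<le> 1/4" using abs_Re_le_cmod[of "s - z"] by (simp add: dist_norm)
  hence "Re z > 1/2" using assms(2) by linarith
  thus "z \<in> {s. Re s > 1/2}" by simp
 qed
 have B: "norm (Z x) \<le> 8 * C * (1 + norm s) ^ 3" if "norm (s - x) = 1/4" for x
 proof -
  have "norm (Z x) \<le> C * (1 + norm x) ^ 3" proof (rule bd)
   have "x \<in> cball s (1/4)" using that by (simp add: dist_norm)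
   thus "Re x > 1/2" using sub by blast
  qed
  also have "\<dots> \<le> C * (2 * (1 + norm s)) ^ 3"
  proof (intro mult_left_mono power_mono)
   have "norm x \<le> norm s + norm (s - x)" using norm_triangle_sub[of x s] by (simp add: norm_minus_commute)
   hence "norm x \<le> norm s + 1/4" unfolding that .
   moreover have "norm s \<ge> 0" by simp
   ultimately show "1 + norm x \<le> 2 * (1 + norm s)" unfolding distrib_left by linarith
  qed (use C in auto)
  also have "\<dots> = 8 * C * (1 + norm s) ^ 3" by (simp only: power_mult_distrib) simp
  finally show ?thesis .
 qed
 have K: "norm ((deriv ^^ n) Z s) \<le> fact n * (8 * C * (1 + norm s) ^ 3) / (1/4) ^ n" for n
  by (rule Cauchy_inequality[OF _ _ _ B])
    (use holomorphic_on_subset[OF hol sub] holomorphic_on_subset[OF hol order_trans[OF ball_subset_cball sub]]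
     in "auto intro: holomorphic_on_imp_continuous_on")
 have pos: "0 \<le> C * (1 + norm s) ^ 3" using C by simp
 show "norm (Z s) \<le> 256 * C * (1 + norm s) ^ 3" using bd[of s] assms(2) pos by simp
 show "norm (deriv Z s) \<le> 256 * C * (1 + norm s) ^ 3" using K[of 1] pos by simp
 show "norm (deriv (deriv Z) s) \<le> 256 * C * (1 + norm s) ^ 3" using K[of 2] pos by (simp add: numeral_2_eq_2)
qed

lemma continuation_lipschitz:
 assumes "continuation_of q c Z C" "1 \<le> x" "x \<le> y" "y \<le> 2"
 shows "norm (Z (Complex y t) - Z (Complex x t)) \<le> 256 * C * (4 + \<bar>t\<bar>) ^ 3 * (y - x)"
proof -
 define S where "S = {s. 1 \<le> Re s \<and> Re s \<le> 2 \<and> Im s = t}"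
 have hol: "Z holomorphic_on {s. Re s > 1/2}" and C: "C \<ge> 1" using assms(1) by (auto simp: continuation_of_def)
 have "S = {s. Re s \<ge> 1} \<inter> {s. Re s \<le> 2} \<inter> ({s. Im s \<ge> t} \<inter> {s. Im s \<le> t})" by (auto simp: S_def)
 hence "convex S"
  by (simp only:) (intro convex_Int convex_halfspace_Re_ge convex_halfspace_Re_le convex_halfspace_Im_ge convex_halfspace_Im_le)
 hence "norm (Z (Complex y t) - Z (Complex x t)) \<le> 256 * C * (4 + \<bar>t\<bar>) ^ 3 * norm (Complex y t - Complex x t)"
 proof (rule field_differentiable_bound)
  show "(Z has_field_derivative deriv Z s) (at s within S)" if "s \<in> S" for s
   by (rule has_field_derivative_at_within[OF holomorphic_derivI[OF hol open_halfspace_Re_gt]])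
     (use that in "auto simp: S_def")
  show "norm (deriv Z s) \<le> 256 * C * (4 + \<bar>t\<bar>) ^ 3" if "s \<in> S" for s
  proof -
   have "norm (deriv Z s) \<le> 256 * C * (1 + norm s) ^ 3"
    by (rule continuation_deriv_bounds[OF assms(1)]) (use that in "auto simp: S_def")
   also have "\<dots> \<le> 256 * C * (4 + \<bar>t\<bar>) ^ 3"
    using cmod_le[of s] that C by (intro mult_left_mono power_mono) (auto simp: S_def)
   finally show ?thesis .
  qed
 qed (use assms in "auto simp: S_def")
 also have "norm (Complex y t - Complex x t) = y - x"
  using assms by (simp add: complex_diff cmod_def)
 finally show ?thesis .
qed

lemma Lfun_nonzero:
 assumes "q > 0" "c \<in> dchars q" "Re s > 1"
 shows "Lfun c s \<noteq> 0"
proof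
 assume "Lfun c s = 0"
 moreover have "of_real (Re s) + \<i> * of_real (Im s) = s" by (simp add: complex_eq_iff)
 ultimately show False using three_four_one[OF assms, of "Im s"] by simp
qed

lemma continuation_nonzero_right:
 assumes "q > 0" "c \<in> dchars q" "continuation_of q c Z C" "Re s > 1"
 shows "Z s \<noteq> 0"
 using Lfun_nonzero[OF assms(1,2,4)] assms(3,4) unfolding continuation_of_def by (auto split: if_splits)

lemma norm_Lfun_le:
 assumes "q > 0" "continuation_of q c Z C" "1 < x" "x \<le> 2" "c = dchar0 q ==> \<bar>t\<bar> \<ge> \<delta>" "0 < \<delta>" "\<delta> \<le> 1"
 shows "norm (Lfun c (Complex x t)) \<le> norm (Z (Complex x t)) / \<delta>"
proof -
 have L: "Lfun c (Complex x t) = (if c = dchar0 q then Z (Complex x t) / (Complex x t - 1) else Z (Complex x t))"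
  using assms(2,3) unfolding continuation_of_def by auto
 show ?thesis
 proof (cases "c = dchar0 q")
  case True
  have "\<delta> \<le> norm (Complex x t - 1)" using abs_Im_le_cmod[of "Complex x t - 1"] assms(5)[OF True] by simp
  thus ?thesis using L True assms by (auto simp: norm_divide intro!: divide_left_mono mult_pos_pos)
 next
  case False
  have "norm (Z (Complex x t)) * \<delta> \<le> norm (Z (Complex x t)) * 1" using assms by (intro mult_left_mono) auto
  thus ?thesis using L False assms(6) by (simp add: field_simps)
 qed
qed

text \<open>Off the real axis a small value of \<open>L(1 + it, \<chi>)\<close> would contradict the 3-4-1 inequality,
 since then \<open>\<chi>\<^sup>2\<close> contributes no pole; \<open>\<delta>\<close> measures the distance from that pole.\<close>

lemma three_four_one_Z:
 assumes "q > 0" "c \<in> dchars q" "continuation_of q c Z C" "continuation_of q (dchar0 q) Z0 C0"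
  "continuation_of q (\<lambda>n. c n * c n) Z2 C2"
  "1 < x" "x \<le> 2" "0 < \<delta>" "\<delta> \<le> 1" "c = dchar0 q \<or> (\<lambda>n. c n * c n) = dchar0 q ==> \<bar>t\<bar> \<ge> \<delta>"
 shows "1 \<le> (256 * C0 * 64) ^ 3 * (norm (Z (Complex x t)) / \<delta>) ^ 4 * (256 * C2 * (4 + 2 * \<bar>t\<bar>) ^ 3 / \<delta>) / (x - 1) ^ 3"
proof -
 have C: "C \<ge> 1" "C0 \<ge> 1" "C2 \<ge> 1" using assms by (auto simp: continuation_of_def)
 have "Lfun (dchar0 q) (of_real x) = Z0 (of_real x) / (of_real x - 1)"
  using assms(4,6) unfolding continuation_of_def by auto
 hence "norm (Lfun (dchar0 q) (of_real x)) = norm (Z0 (of_real x)) / (x - 1)"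
 proof -
  have "norm (of_real x - 1 :: complex) = \<bar>x - 1\<bar>" by (metis norm_of_real of_real_1 of_real_diff)
  moreover assume "Lfun (dchar0 q) (of_real x) = Z0 (of_real x) / (of_real x - 1)"
  ultimately show ?thesis using assms(6) by (simp add: norm_divide)
 qed
 also have "norm (Z0 (of_real x)) \<le> 256 * C0 * (1 + norm (of_real x :: complex)) ^ 3"
  by (rule continuation_deriv_bounds[OF assms(4)]) (use assms in auto)
 also have "\<dots> \<le> 256 * C0 * 4 ^ 3" using assms C by (intro mult_left_mono power_mono) auto
 finally have 0: "norm (Lfun (dchar0 q) (of_real x)) \<le> 256 * C0 * 64 / (x - 1)" using assms(6) by (simp add: divide_right_mono)
 have e1: "of_real x + \<i> * of_real t = Complex x t" and e2: "of_real x + 2 * \<i> * of_real t = Complex x (2 * t)"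
  by (simp_all add: complex_eq_iff)
 have 1: "norm (Lfun c (Complex x t)) \<le> norm (Z (Complex x t)) / \<delta>"
  by (rule norm_Lfun_le[OF assms(1,3,6,7)]) (use assms in auto)
 have "norm (Lfun (\<lambda>n. c n * c n) (Complex x (2 * t))) \<le> norm (Z2 (Complex x (2 * t))) / \<delta>"
  by (rule norm_Lfun_le[OF assms(1,5,6,7)]) (use assms in auto)
 also have "norm (Z2 (Complex x (2 * t))) \<le> 256 * C2 * (1 + norm (Complex x (2 * t))) ^ 3"
  by (rule continuation_deriv_bounds[OF assms(5)]) (use assms in auto)
 also have "\<dots> \<le> 256 * C2 * (4 + 2 * \<bar>t\<bar>) ^ 3"
  using cmod_le[of "Complex x (2 * t)"] assms C by (intro mult_left_mono power_mono) auto
 finally have 2: "norm (Lfun (\<lambda>n. c n * c n) (Complex x (2 * t))) \<le> 256 * C2 * (4 + 2 * \<bar>t\<bar>) ^ 3 / \<delta>"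
  using assms(8) by (simp add: divide_right_mono)
 have "1 \<le> norm (Lfun (dchar0 q) (of_real x)) ^ 3 * norm (Lfun c (Complex x t)) ^ 4 * norm (Lfun (\<lambda>n. c n * c n) (Complex x (2 * t)))"
  using three_four_one[OF assms(1,2,6), of t] unfolding e1 e2 .
 also have "\<dots> \<le> (256 * C0 * 64 / (x - 1)) ^ 3 * (norm (Z (Complex x t)) / \<delta>) ^ 4 * (256 * C2 * (4 + 2 * \<bar>t\<bar>) ^ 3 / \<delta>)"
  using assms C by (intro mult_mono power_mono 0 1 2) auto
 finally show ?thesis by (simp only: power_divide times_divide_eq_left)
qed

text \<open>A zero at 1 + it makes Z (x + it) of size x - 1; its fourth power beats the triple pole
  in the 3-4-1 inequality, so that 1 <= A (x - 1) for all x near 1. At t = 0 with c^2 principal the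
  argument breaks down, because c^2 contributes a further pole.\<close>

lemma continuation_nonzero_line:
 assumes "q > 0" "c \<in> dchars q" "continuation_of q c Z C" and t: "t \<noteq> 0 \<or> (c \<noteq> dchar0 q \<and> (\<lambda>n. c n * c n) \<noteq> dchar0 q)"
 shows "Z (Complex 1 t) \<noteq> 0"
proof
 assume Z1: "Z (Complex 1 t) = 0"
 obtain Z0 C0 where Z0: "continuation_of q (dchar0 q) Z0 C0" using continuation_exists[OF assms(1) dchar0_in[OF assms(1)]] by blast
 obtain Z2 C2 where Z2: "continuation_of q (\<lambda>n. c n * c n) Z2 C2"
  using continuation_exists[OF assms(1) dchar_mult_in[OF assms(2,2)]] by blast
 \<comment> \<open>For t = 0 the hypothesis on c excludes both poles, so the distance condition is
   vacuous and 1 will do.\<close>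
 define \<delta> where "\<delta> = (if t = 0 then 1 else min 1 \<bar>t\<bar>)"
 have d: "0 < \<delta>" "\<delta> \<le> 1" "c = dchar0 q \<or> (\<lambda>n. c n * c n) = dchar0 q ==> \<bar>t\<bar> \<ge> \<delta>"
  using t by (auto simp: \<delta>_def)
 define K where "K = 256 * C * (4 + \<bar>t\<bar>) ^ 3"
 define A where "A = (256 * C0 * 64) ^ 3 * (K / \<delta>) ^ 4 * (256 * C2 * (4 + 2 * \<bar>t\<bar>) ^ 3 / \<delta>)"
 have C: "C \<ge> 1" "C0 \<ge> 1" "C2 \<ge> 1" using assms(3) Z0 Z2 by (auto simp: continuation_of_def)
 have "1 \<le> A * (x - 1)" if x: "1 < x" "x \<le> 2" for x
 proof -
  have "norm (Z (Complex x t)) \<le> K * (x - 1)"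
   using continuation_lipschitz[OF assms(3), of 1 x t] x Z1 by (simp add: K_def)
  hence z: "norm (Z (Complex x t)) / \<delta> \<le> K / \<delta> * (x - 1)" using d(1) by (simp add: divide_right_mono)
  have "1 \<le> (256 * C0 * 64) ^ 3 * (norm (Z (Complex x t)) / \<delta>) ^ 4 * (256 * C2 * (4 + 2 * \<bar>t\<bar>) ^ 3 / \<delta>) / (x - 1) ^ 3"
   by (rule three_four_one_Z[OF assms(1-3) Z0 Z2 x d])
  also have "\<dots> \<le> (256 * C0 * 64) ^ 3 * (K / \<delta> * (x - 1)) ^ 4 * (256 * C2 * (4 + 2 * \<bar>t\<bar>) ^ 3 / \<delta>) / (x - 1) ^ 3"
   using x C d z by (intro divide_right_mono mult_right_mono mult_left_mono power_mono) auto
  also have "\<dots> = A * ((x - 1) ^ 4 / (x - 1) ^ 3)"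
  proof -
   have "a * (k * u) ^ 4 * b / u ^ 3 = (a * k ^ 4 * b) * (u ^ 4 / u ^ 3)" for a k u b :: real
    by (simp add: power_mult_distrib)
   thus ?thesis unfolding A_def .
  qed
  also have "(x - 1) ^ 4 / (x - 1) ^ 3 = x - 1" using x by (simp add: eval_nat_numeral)
  finally show ?thesis .
 qed
 note key = this
 have "A > 0" using key[of 2] by simp
 define x where "x = 1 + min 1 (1 / (2 * A))"
 have "1 < x" "x \<le> 2" using \<open>A > 0\<close> by (auto simp: x_def)
 hence "1 \<le> A * (x - 1)" by (rule key)
 also have "\<dots> \<le> A * (1 / (2 * A))" using \<open>A > 0\<close> by (intro mult_left_mono) (auto simp: x_def)
 also have "\<dots> = 1/2" using \<open>A > 0\<close> by simp
 finally show False by simp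
qed

text \<open>Only s = 1 with c^2 principal escapes the 3-4-1 argument. For principal c the value
  there is a nonzero residue, for real c it is L(1, c).\<close>

lemma continuation_nonzero:
 assumes "q > 0" "c \<in> dchars q" "continuation_of q c Z C" "Re s \<ge> 1"
 shows "Z s \<noteq> 0"
proof (cases "Re s > 1")
 case True thus ?thesis by (rule continuation_nonzero_right[OF assms(1-3)])
next
 case False
 hence s: "s = Complex 1 (Im s)" using assms(4) by (simp add: complex_eq_iff)
 show ?thesis
 proof (cases "Im s \<noteq> 0 \<or> (c \<noteq> dchar0 q \<and> (\<lambda>n. c n * c n) \<noteq> dchar0 q)")
  case True thus ?thesis using continuation_nonzero_line[OF assms(1-3)] s by metis
 next
  case False
  hence "s = 1" using s by (simp add: complex_eq_iff)
  show ?thesis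
  proof (cases "c = dchar0 q")
   case True thus ?thesis using assms(3) \<open>s = 1\<close> by (auto simp: continuation_of_def)
  next
   case c: False
   hence "(\<lambda>n. c n / of_nat n) sums Z 1" using assms(3) by (auto simp: continuation_of_def)
   moreover have "(\<lambda>n. c n * c n) = dchar0 q" using False c by blast
   ultimately show ?thesis using L1_real_nonzero[OF assms(1,2) c] \<open>s = 1\<close> by metis
  qed
 qed
qed

text \<open>The 3-4-1 inequality degenerates as Re s tends to 1. Very near the line the bound at a
  slightly larger abscissa is carried over by the Lipschitz estimate.\<close>

lemma continuation_lower_bound_far:
 assumes "q > 0" "c \<in> dchars q" "continuation_of q c Z C"
 shows "\<exists>b>0. \<forall>x t. 1 < x --> x \<le> 2 --> \<bar>t\<bar> \<ge> 1 --> norm (Z (Complex x t)) \<ge> b / (1 + \<bar>t\<bar>) ^ 13"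
proof -
 obtain Z0 C0 where Z0: "continuation_of q (dchar0 q) Z0 C0" using continuation_exists[OF assms(1) dchar0_in[OF assms(1)]] by blast
 obtain Z2 C2 where Z2: "continuation_of q (\<lambda>n. c n * c n) Z2 C2"
  using continuation_exists[OF assms(1) dchar_mult_in[OF assms(2,2)]] by blast
 have C: "C \<ge> 1" "C0 \<ge> 1" "C2 \<ge> 1" using assms(3) Z0 Z2 by (auto simp: continuation_of_def)
 \<comment> \<open>One constant, large enough both for the factors of the 3-4-1 inequality and for
   the Lipschitz constant.\<close>
 define A where "A = (256 * C0 * 64) ^ 3 * (256 * C2 * 64) + 1000000 * C"
 have "0 \<le> (256 * C0 * 64) ^ 3 * (256 * C2 * 64)" using C by simp
 hence A: "A \<ge> 1000000 * C" "A \<ge> 1" "A \<ge> (256 * C0 * 64) ^ 3 * (256 * C2 * 64)"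
  using C unfolding A_def by linarith+
 show ?thesis
 proof (intro exI[of _ "1 / (16 * A ^ 7)"] conjI allI impI)
  show "0 < 1 / (16 * A ^ 7)" using A by simp
  fix x t :: real assume x: "1 < x" "x \<le> 2" and t: "1 \<le> \<bar>t\<bar>"
  define w where "w = 1 + \<bar>t\<bar>"
  have w: "w \<ge> 2" using t by (simp add: w_def)
  \<comment> \<open>Chosen so that the Lipschitz loss A w^3 \<eta>^4 is exactly half of \<eta>^3 /
    (A w), the lower bound valid from 1 + \<eta>^4 on.\<close>
  define \<eta> where "\<eta> = 1 / (2 * A\<^sup>2 * w ^ 4)"
  have "1 \<le> 2 * A\<^sup>2 * w ^ 4"
  proof -
   have "1 \<le> A\<^sup>2" "1 \<le> w ^ 4" using A w by (auto intro!: one_le_power)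
   hence "1 * 1 \<le> A\<^sup>2 * w ^ 4" by (intro mult_mono) auto
   thus ?thesis by simp
  qed
  hence eta: "0 < \<eta>" "\<eta> \<le> 1" by (auto simp: \<eta>_def divide_le_eq)
  have big: "norm (Z (Complex y t)) \<ge> \<eta> ^ 3 / (A * w)" if y: "1 + \<eta> ^ 4 \<le> y" "y \<le> 2" for y
  proof -
   have "\<eta> ^ 4 > 0" using eta by simp
   hence y1: "1 < y" using y by linarith
   have "1 \<le> (256 * C0 * 64) ^ 3 * (norm (Z (Complex y t)) / 1) ^ 4 * (256 * C2 * (4 + 2 * \<bar>t\<bar>) ^ 3 / 1) / (y - 1) ^ 3"
    by (rule three_four_one_Z[OF assms(1-3) Z0 Z2 y1 y(2)]) (use t in auto)
   hence "(y - 1) ^ 3 \<le> (256 * C0 * 64) ^ 3 * norm (Z (Complex y t)) ^ 4 * (256 * C2 * (4 + 2 * \<bar>t\<bar>) ^ 3)"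
    using y1 by (simp add: pos_le_divide_eq)
   also have "\<dots> \<le> (256 * C0 * 64) ^ 3 * norm (Z (Complex y t)) ^ 4 * (256 * C2 * (4 * w) ^ 3)"
    using t C by (intro mult_left_mono power_mono) (auto simp: w_def)
   also have "\<dots> = ((256 * C0 * 64) ^ 3 * (256 * C2 * 64)) * (norm (Z (Complex y t)) ^ 4 * w ^ 3)"
    by (simp add: power_mult_distrib)
   also have "\<dots> \<le> A * (norm (Z (Complex y t)) ^ 4 * w ^ 3)"
    using A w by (intro mult_right_mono) auto
   also have "\<dots> \<le> A ^ 4 * (norm (Z (Complex y t)) ^ 4 * w ^ 4)"
    using A w power_increasing[of 1 4 A] power_increasing[of 3 4 w] by (intro mult_mono mult_left_mono) auto
   also have "\<dots> = (A * w * norm (Z (Complex y t))) ^ 4" by (simp add: power_mult_distrib)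
   finally have "(y - 1) ^ 3 \<le> (A * w * norm (Z (Complex y t))) ^ 4" .
   moreover have "(\<eta> ^ 4) ^ 3 \<le> (y - 1) ^ 3" using y eta by (intro power_mono) auto
   ultimately have "(\<eta> ^ 3) ^ 4 \<le> (A * w * norm (Z (Complex y t))) ^ 4" by (simp flip: power_mult)
   hence "\<eta> ^ 3 \<le> A * w * norm (Z (Complex y t))" using A w power_mono_iff[of "\<eta> ^ 3" "A * w * norm (Z (Complex y t))" 4] eta by simp
   thus ?thesis using A w by (simp add: divide_le_eq mult_ac)
  qed
  have target: "\<eta> ^ 3 / (2 * (A * w)) = 1 / (16 * A ^ 7) / (1 + \<bar>t\<bar>) ^ 13"
  proof -
   have "\<eta> ^ 3 = 1 / (8 * A ^ 6 * w ^ 12)"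
    unfolding \<eta>_def by (simp add: power_divide power_mult_distrib flip: power_mult)
   thus ?thesis unfolding w_def[symmetric] by (simp add: eval_nat_numeral)
  qed
  have pos: "0 \<le> \<eta> ^ 3 / (2 * (A * w))" using eta A w by simp
  have half: "\<eta> ^ 3 / (A * w) = 2 * (\<eta> ^ 3 / (2 * (A * w)))" by simp
  have "norm (Z (Complex x t)) \<ge> \<eta> ^ 3 / (2 * (A * w))"
  proof (cases "1 + \<eta> ^ 4 \<le> x")
   case True thus ?thesis using big[OF True x(2)] pos half by linarith
  next
   case False
   have e2: "1 + \<eta> ^ 4 \<le> 2" using eta by (simp add: power_le_one)
   have "norm (Z (Complex (1 + \<eta> ^ 4) t) - Z (Complex x t)) \<le> 256 * C * (4 + \<bar>t\<bar>) ^ 3 * ((1 + \<eta> ^ 4) - x)"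
    by (rule continuation_lipschitz[OF assms(3)]) (use False x e2 in auto)
   also have "\<dots> \<le> A * w ^ 3 * \<eta> ^ 4"
   proof -
    have "256 * C * (4 + \<bar>t\<bar>) ^ 3 \<le> 256 * C * (4 * w) ^ 3" using C t by (intro mult_left_mono power_mono) (auto simp: w_def)
    also have "\<dots> = 16384 * C * w ^ 3" by (simp add: power_mult_distrib)
    also have "\<dots> \<le> A * w ^ 3" using A C w by (intro mult_right_mono) auto
    finally show ?thesis by (rule mult_mono) (use x C A w False in auto)
   qed
   also have "\<dots> = \<eta> ^ 3 * (A * w ^ 3 * \<eta>)" by (simp add: eval_nat_numeral)
   also have "A * w ^ 3 * \<eta> = 1 / (2 * (A * w))" using A w unfolding \<eta>_def by (simp add: eval_nat_numeral)
   finally have "norm (Z (Complex (1 + \<eta> ^ 4) t) - Z (Complex x t)) \<le> \<eta> ^ 3 / (2 * (A * w))" by simp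
   moreover have "norm (Z (Complex (1 + \<eta> ^ 4) t)) \<ge> 2 * (\<eta> ^ 3 / (2 * (A * w)))" using big[OF order.refl e2] half by linarith
   ultimately show ?thesis using norm_triangle_ineq2[of "Z (Complex (1 + \<eta> ^ 4) t)" "Z (Complex x t)"] by linarith
  qed
  thus "1 / (16 * A ^ 7) / (1 + \<bar>t\<bar>) ^ 13 \<le> norm (Z (Complex x t))" unfolding target .
 qed
qed

text \<open>For |Im s| <= 1, where the pole spoils the 3-4-1 argument, compactness together with
  nonvanishing on Re s >= 1 gives a positive minimum.\<close>

lemma continuation_lower_bound:
 assumes "q > 0" "c \<in> dchars q" "continuation_of q c Z C"
 shows "\<exists>b>0. \<forall>s. 1 < Re s --> Re s \<le> 2 --> norm (Z s) \<ge> b / (1 + \<bar>Im s\<bar>) ^ 13"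
proof -
 obtain b1 where b1: "b1 > 0" "\<And>x t. 1 < x ==> x \<le> 2 ==> \<bar>t\<bar> \<ge> 1 ==> norm (Z (Complex x t)) \<ge> b1 / (1 + \<bar>t\<bar>) ^ 13"
  using continuation_lower_bound_far[OF assms] by blast
 define K where "K = cbox (Complex 1 (-1)) (Complex 2 1)"
 have hol: "Z holomorphic_on {s. Re s > 1/2}" using assms(3) by (auto simp: continuation_of_def)
 have KR: "s \<in> K \<longleftrightarrow> 1 \<le> Re s \<and> Re s \<le> 2 \<and> -1 \<le> Im s \<and> Im s \<le> 1" for s by (auto simp: K_def in_cbox_complex_iff)
 have "continuous_on K (\<lambda>s. norm (Z s))"
  by (intro continuous_on_norm holomorphic_on_imp_continuous_on holomorphic_on_subset[OF hol]) (auto simp: KR)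
 moreover have "compact K" "K \<noteq> {}" using KR[of "Complex 1 0"] by (auto simp: K_def)
 ultimately obtain s0 where s0: "s0 \<in> K" "\<And>s. s \<in> K ==> norm (Z s0) \<le> norm (Z s)"
  using continuous_attains_inf by (metis (no_types, lifting))
 have "norm (Z s0) > 0" using continuation_nonzero[OF assms, of s0] s0(1) KR by simp
 show ?thesis
 proof (intro exI[of _ "min b1 (norm (Z s0))"] conjI allI impI)
  show "min b1 (norm (Z s0)) > 0" using b1 \<open>norm (Z s0) > 0\<close> by simp
  fix s assume s: "1 < Re s" "Re s \<le> 2"
  show "min b1 (norm (Z s0)) / (1 + \<bar>Im s\<bar>) ^ 13 \<le> norm (Z s)"
  proof (cases "\<bar>Im s\<bar> \<ge> 1")
   case True
   have "min b1 (norm (Z s0)) / (1 + \<bar>Im s\<bar>) ^ 13 \<le> b1 / (1 + \<bar>Im s\<bar>) ^ 13" by (intro divide_right_mono) auto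
   also have "\<dots> \<le> norm (Z (Complex (Re s) (Im s)))" by (rule b1(2)[OF s True])
   finally show ?thesis by simp
  next
   case False
   hence "s \<in> K" using s by (auto simp: KR)
   have "1 \<le> (1 + \<bar>Im s\<bar>) ^ 13" by (intro one_le_power) auto
   hence "min b1 (norm (Z s0)) / (1 + \<bar>Im s\<bar>) ^ 13 \<le> min b1 (norm (Z s0)) / 1"
    using b1 \<open>norm (Z s0) > 0\<close> by (intro divide_left_mono) auto
   also have "\<dots> \<le> norm (Z s)" using s0(2)[OF \<open>s \<in> K\<close>] by simp
   finally show ?thesis .
  qed
 qed
qed

text \<open>The exponent is 3 from the growth of Z and its derivatives plus 13 from the lower bound,
  doubled to 32 by the square. The second quantity is the derivative of the first.\<close>

lemma logderiv_bounds:
 assumes "q > 0" "c \<in> dchars q" "continuation_of q c Z C"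
 shows "\<exists>B. B \<ge> 0 \<and> (\<forall>s. 1 < Re s --> Re s \<le> 2 --> norm (deriv Z s / Z s) \<le> B * (1 + \<bar>Im s\<bar>) ^ 32 \<and>
   norm (deriv (deriv Z) s / Z s - (deriv Z s / Z s)\<^sup>2) \<le> B * (1 + \<bar>Im s\<bar>) ^ 32)"
proof -
 obtain b where b: "b > 0" "\<And>s. 1 < Re s ==> Re s \<le> 2 ==> norm (Z s) \<ge> b / (1 + \<bar>Im s\<bar>) ^ 13"
  using continuation_lower_bound[OF assms] by blast
 have C: "C \<ge> 1" using assms(3) by (auto simp: continuation_of_def)
 define D where "D = 256 * C * 27 / b"
 have D: "D \<ge> 0" using b C by (simp add: D_def)
 show ?thesis
 proof (intro exI[of _ "D + D\<^sup>2"] conjI allI impI)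
  show "D + D\<^sup>2 \<ge> 0" using D by simp
  fix s assume s: "1 < Re s" "Re s \<le> 2"
  define w where "w = 1 + \<bar>Im s\<bar>"
  have w: "w \<ge> 1" by (simp add: w_def)
  have lb: "norm (Z s) \<ge> b / w ^ 13" "b / w ^ 13 > 0" using b(2)[OF s] b(1) w by (auto simp: w_def)
  have quot: "norm (F / Z s) \<le> D * w ^ 16" if "norm F \<le> 256 * C * (1 + norm s) ^ 3" for F
  proof -
   have "norm F \<le> 256 * C * (3 * w) ^ 3"
    using that cmod_le[of s] s C by (elim order_trans) (intro mult_left_mono power_mono; auto simp: w_def)
   hence "norm F / norm (Z s) \<le> 256 * C * (3 * w) ^ 3 / (b / w ^ 13)" using lb C w by (intro frac_le) auto
   also have "\<dots> = D * w ^ 16" using b(1) w by (simp add: D_def power_mult_distrib flip: power_add)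
   finally show ?thesis by (simp add: norm_divide)
  qed
  have q1: "norm (deriv Z s / Z s) \<le> D * w ^ 16"
   by (rule quot[OF continuation_deriv_bounds(2)[OF assms(3)]]) (use s in simp)
  have q2: "norm (deriv (deriv Z) s / Z s) \<le> D * w ^ 16"
   by (rule quot[OF continuation_deriv_bounds(3)[OF assms(3)]]) (use s in simp)
  have w16: "D * w ^ 16 \<le> D * w ^ 32" using D w by (intro mult_left_mono power_increasing) auto
  have sq: "norm ((deriv Z s / Z s)\<^sup>2) \<le> D\<^sup>2 * w ^ 32"
   using power_mono[OF q1, of 2] by (simp add: norm_power norm_divide power_mult_distrib flip: power_mult)
  have nn: "0 \<le> D\<^sup>2 * w ^ 32" using w by simp
  show "norm (deriv Z s / Z s) \<le> (D + D\<^sup>2) * (1 + \<bar>Im s\<bar>) ^ 32"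
   using q1 w16 nn unfolding w_def[symmetric] distrib_right by linarith
  show "norm (deriv (deriv Z) s / Z s - (deriv Z s / Z s)\<^sup>2) \<le> (D + D\<^sup>2) * (1 + \<bar>Im s\<bar>) ^ 32"
   using norm_triangle_ineq4[of "deriv (deriv Z) s / Z s" "(deriv Z s / Z s)\<^sup>2"] q2 w16 sq
   unfolding w_def[symmetric] distrib_right by linarith
 qed
qed

text \<open>The residue class \<open>a\<close> is isolated by orthogonality: away from the pole of the principal character,
 its von Mangoldt series is the combination of the logarithmic derivatives of all \<open>L\<close>-functions.\<close>

lemma mangoldt_class_series:
 assumes "q > 0" "coprime a q"
 shows "\<exists>H H' B. (\<forall>s. Re s > 1 --> (H has_field_derivative H' s) (at s)) \<and> B \<ge> 0 \<and>
   (\<forall>s. 1 < Re s --> Re s \<le> 2 --> norm (H s) \<le> B * (1 + \<bar>Im s\<bar>) ^ 32 \<and> norm (H' s) \<le> B * (1 + \<bar>Im s\<bar>) ^ 32) \<and>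
   (\<forall>s. Re s > 1 --> (\<lambda>n. (if [n = a] (mod q) then mangoldt n else 0) * npow n s) sums
    (1 / of_nat (totient q) / (s - 1) + H s))"
proof -
 define D where "D = dchars q"
 have "\<forall>c\<in>D. \<exists>Z. \<exists>C. continuation_of q c Z C" using continuation_exists[OF assms(1)] by (auto simp: D_def)
 then obtain Z where Z0: "\<forall>c\<in>D. \<exists>C. continuation_of q c (Z c) C" by metis
 then obtain C where Z: "\<And>c. c \<in> D ==> continuation_of q c (Z c) (C c)" by metis
 have finD: "finite D" unfolding D_def by (rule finite_dchars[OF assms(1)])
 define l where "l c s = deriv (Z c) s / Z c s" for c s
 define l' where "l' c s = deriv (deriv (Z c)) s / Z c s - (deriv (Z c) s / Z c s)\<^sup>2" for c s
 have "\<forall>c\<in>D. \<exists>B. B \<ge> 0 \<and> (\<forall>s. 1 < Re s --> Re s \<le> 2 --> norm (l c s) \<le> B * (1 + \<bar>Im s\<bar>) ^ 32 \<and>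
   norm (l' c s) \<le> B * (1 + \<bar>Im s\<bar>) ^ 32)"
  using logderiv_bounds[OF assms(1)] Z unfolding D_def l_def l'_def by blast
 then obtain B where B: "\<And>c. c \<in> D ==> B c \<ge> 0"
   "\<And>c s. c \<in> D ==> 1 < Re s ==> Re s \<le> 2 ==> norm (l c s) \<le> B c * (1 + \<bar>Im s\<bar>) ^ 32"
   "\<And>c s. c \<in> D ==> 1 < Re s ==> Re s \<le> 2 ==> norm (l' c s) \<le> B c * (1 + \<bar>Im s\<bar>) ^ 32" by metis
 have nz: "Z c s \<noteq> 0" if "c \<in> D" "Re s > 1" for c s
  using continuation_nonzero[OF assms(1) _ Z[OF that(1)], of s] that by (simp add: D_def)
 have hol: "Z c holomorphic_on {s. Re s > 1/2}" if "c \<in> D" for c using Z[OF that] by (simp add: continuation_of_def)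
 have ld: "(l c has_field_derivative l' c s) (at s)" if c: "c \<in> D" and s: "Re s > 1" for c s
 proof -
  have "(Z c has_field_derivative deriv (Z c) s) (at s)"
   by (rule holomorphic_derivI[OF hol[OF c] open_halfspace_Re_gt]) (use s in simp)
  moreover have "(deriv (Z c) has_field_derivative deriv (deriv (Z c)) s) (at s)"
   by (rule holomorphic_derivI[OF holomorphic_deriv[OF hol[OF c] open_halfspace_Re_gt] open_halfspace_Re_gt]) (use s in simp)
  ultimately show ?thesis using nz[OF c s] unfolding l_def l'_def
   by (auto intro!: derivative_eq_intros simp: power2_eq_square diff_divide_distrib)
 qed
 \<comment> \<open>For the principal character L = Z / (s - 1), whose logarithmic derivative splits
   off the pole; all other contributions are regular.\<close>
 have Lam: "Lam c s = (if c = dchar0 q then 1 / (s - 1) else 0) - l c s" if c: "c \<in> D" and s: "Re s > 1" for c s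
 proof -
  have LZ: "Lfun c z = (if c = dchar0 q then Z c z / (z - 1) else Z c z)" if "Re z > 1" for z
   using Z[OF c] that by (simp add: continuation_of_def)
  have dZ: "(Z c has_field_derivative deriv (Z c) s) (at s)"
   by (rule holomorphic_derivI[OF hol[OF c] open_halfspace_Re_gt]) (use s in simp)
  have s1: "s - 1 \<noteq> 0" using s by auto
  have "(Lfun c has_field_derivative (if c = dchar0 q then (deriv (Z c) s * (s - 1) - Z c s) / (s - 1)\<^sup>2 else deriv (Z c) s)) (at s)"
  proof (rule has_field_derivative_transform_within_open[OF _ open_halfspace_Re_gt, of _ _ _ 1])
   show "((\<lambda>z. if c = dchar0 q then Z c z / (z - 1) else Z c z) has_field_derivative
     (if c = dchar0 q then (deriv (Z c) s * (s - 1) - Z c s) / (s - 1)\<^sup>2 else deriv (Z c) s)) (at s)"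
    using dZ s1 by (cases "c = dchar0 q") (auto intro!: derivative_eq_intros simp: power2_eq_square)
  qed (use s LZ in auto)
  hence "- Lam c s * Lfun c s = (if c = dchar0 q then (deriv (Z c) s * (s - 1) - Z c s) / (s - 1)\<^sup>2 else deriv (Z c) s)"
   by (rule DERIV_unique[OF Lfun_deriv[OF assms(1) c[unfolded D_def] s]])
  note eq = this
  have a: "L = 1 / u - z' / z" if "- L * (z / u) = (z' * u - z) / u\<^sup>2" "u \<noteq> 0" "z \<noteq> 0" for L u z z' :: complex
   using that by (simp add: field_simps power2_eq_square) algebra
  have b: "L = - (z' / z)" if "- L * z = z'" "z \<noteq> 0" for L z z' :: complex
   using that by auto
  show ?thesis
  proof (cases "c = dchar0 q")
   case True
   thus ?thesis using a[of "Lam c s" "Z c s" "s - 1" "deriv (Z c) s"] eq LZ[OF s] nz[OF c s] s1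
    unfolding l_def by simp
  next
   case False
   thus ?thesis using b[of "Lam c s" "Z c s" "deriv (Z c) s"] eq LZ[OF s] nz[OF c s] unfolding l_def by simp
  qed
 qed
 define \<phi> where "\<phi> = (of_nat (totient q) :: complex)"
 have phi: "\<phi> \<noteq> 0" using assms(1) by (simp add: \<phi>_def)
 define H where "H s = - (\<Sum>c\<in>D. cnj (c a) * l c s) / \<phi>" for s
 define H' where "H' s = - (\<Sum>c\<in>D. cnj (c a) * l' c s) / \<phi>" for s
 have Hd: "(H has_field_derivative H' s) (at s)" if "Re s > 1" for s
  unfolding H_def H'_def by (auto intro!: derivative_eq_intros ld that simp: phi mult.commute)
 have norm_phi: "norm \<phi> \<ge> 1" using assms(1) by (simp add: \<phi>_def Suc_le_eq)
 have sumb: "norm (- (\<Sum>c\<in>D. cnj (c a) * f c) / \<phi>) \<le> (\<Sum>c\<in>D. B c) * W" if "\<And>c. c \<in> D ==> norm (f c) \<le> B c * W" "W \<ge> 0" for f W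
 proof -
  have "norm (- (\<Sum>c\<in>D. cnj (c a) * f c) / \<phi>) \<le> norm (\<Sum>c\<in>D. cnj (c a) * f c)"
   using norm_phi mult_left_mono[OF norm_phi, of "norm (\<Sum>c\<in>D. cnj (c a) * f c)"] by (simp add: norm_divide divide_le_eq)
  also have "\<dots> \<le> (\<Sum>c\<in>D. norm (cnj (c a) * f c))" by (rule norm_sum)
  also have "\<dots> \<le> (\<Sum>c\<in>D. 1 * (B c * W))"
   unfolding norm_mult complex_mod_cnj
   by (intro sum_mono mult_mono that norm_dchar_le[OF _ assms(1)]) (auto simp: D_def)
  finally show ?thesis by (simp add: sum_distrib_right)
 qed
 have ser: "(\<lambda>n. (if [n = a] (mod q) then mangoldt n else 0) * npow n s) sums (1 / \<phi> / (s - 1) + H s)"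
  if s: "Re s > 1" for s
 proof -
  have "(\<lambda>n. \<Sum>c\<in>D. cnj (c a) * (mangoldt n * c n * npow n s)) sums (\<Sum>c\<in>D. cnj (c a) * Lam c s)"
  proof (intro sums_sum sums_mult)
   fix c assume "c \<in> D"
   thus "(\<lambda>n. mangoldt n * c n * npow n s) sums Lam c s"
    using summable_sums[OF summable_norm_cancel[OF summable_norm_Lam[OF assms(1) _ s]]] unfolding D_def Lam_def by blast
  qed
  hence "(\<lambda>n. (\<Sum>c\<in>D. cnj (c a) * (mangoldt n * c n * npow n s)) / \<phi>) sums ((\<Sum>c\<in>D. cnj (c a) * Lam c s) / \<phi>)"
   by (rule sums_divide)
  moreover have "(\<Sum>c\<in>D. cnj (c a) * (mangoldt n * c n * npow n s)) / \<phi> =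
    (if [n = a] (mod q) then mangoldt n else 0) * npow n s" for n
  proof -
   have "(\<Sum>c\<in>D. cnj (c a) * (mangoldt n * c n * npow n s)) = (\<Sum>c\<in>D. cnj (c a) * c n) * (mangoldt n * npow n s)"
    unfolding sum_distrib_right by (intro sum.cong refl) (simp add: mult_ac)
   thus ?thesis using dchar_orthogonality[OF assms, of n] phi by (simp add: D_def \<phi>_def)
  qed
  moreover have "(\<Sum>c\<in>D. cnj (c a) * Lam c s) / \<phi> = 1 / \<phi> / (s - 1) + H s"
  proof -
   have "(\<Sum>c\<in>D. cnj (c a) * Lam c s) = (\<Sum>c\<in>D. (if c = dchar0 q then cnj (c a) * (1 / (s - 1)) else 0) - cnj (c a) * l c s)"
    by (intro sum.cong refl) (simp add: Lam[OF _ s] algebra_simps)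
   also have "\<dots> = cnj (dchar0 q a) * (1 / (s - 1)) - (\<Sum>c\<in>D. cnj (c a) * l c s)"
    using finD dchar0_in[OF assms(1)] by (simp add: sum_subtractf sum.delta D_def)
   also have "cnj (dchar0 q a) = 1" using assms(2) by (simp add: dchar0_def)
   finally show ?thesis by (simp add: H_def diff_divide_distrib)
  qed
  ultimately show ?thesis by simp
 qed
 show ?thesis
 proof (rule exI[of _ H], rule exI[of _ H'], rule exI[of _ "\<Sum>c\<in>D. B c"], intro conjI allI impI)
  show "0 \<le> (\<Sum>c\<in>D. B c)" by (intro sum_nonneg B)
  fix s assume s: "1 < Re s" "Re s \<le> 2"
  show "norm (H s) \<le> (\<Sum>c\<in>D. B c) * (1 + \<bar>Im s\<bar>) ^ 32" unfolding H_def by (rule sumb) (use B s in auto)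
  show "norm (H' s) \<le> (\<Sum>c\<in>D. B c) * (1 + \<bar>Im s\<bar>) ^ 32" unfolding H'_def by (rule sumb) (use B s in auto)
 qed (use Hd ser in "auto simp: \<phi>_def")
qed

section \<open>The prime number theorem in residue classes\<close>

lemma lborel_integral_FTC_halfline:
 fixes F f :: "real => complex"
 assumes F: "\<And>x. (F has_vector_derivative f x) (at x)" and f: "continuous_on UNIV f"
  and int: "integrable lborel (\<lambda>x. indicator {c..} x *\<^sub>R f x)" and lim: "(F \<longlongrightarrow> 0) at_top"
 shows "(\<integral>x. indicator {c..} x *\<^sub>R f x \<partial>lborel) = - F c"
proof -
 have ae: "AE x in lborel. indicator {c..} x *\<^sub>R f x = indicator {c<..} x *\<^sub>R f x"
  using AE_lborel_singleton[of c] by eventually_elim (auto split: split_indicator)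
 have int': "integrable lborel (\<lambda>x. indicator {c<..} x *\<^sub>R f x)"
 proof -
  have "integrable lborel (\<lambda>x. indicator {c<..} x *\<^sub>R (indicator {c..} x *\<^sub>R f x))"
   by (rule integrable_mult_indicator[OF _ int]) simp
  moreover have "(\<lambda>x. indicator {c<..} x *\<^sub>R (indicator {c..} x *\<^sub>R f x)) = (\<lambda>x. indicator {c<..} x *\<^sub>R f x)"
   by (auto split: split_indicator)
  ultimately show ?thesis by simp
 qed
 have contF: "continuous (at x) F" for x
  using F has_vector_derivative_continuous by blast
 have "(LBINT x=ereal c..\<infinity>. f x) = 0 - F c"
 proof (rule interval_integral_FTC_integrable[where F = F])
  show "isCont f x" for x using f by (simp add: continuous_on_eq_continuous_at)
  show "set_integrable lborel (einterval (ereal c) \<infinity>) f" using int' by (simp add: set_integrable_def)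
  show "((F \<circ> real_of_ereal) \<longlongrightarrow> F c) (at_right (ereal c))"
   using contF[of c] by (simp add: ereal_tendsto_simps continuous_within filterlim_at_split)
  show "((F \<circ> real_of_ereal) \<longlongrightarrow> 0) (at_left \<infinity>)" using lim by (simp add: ereal_tendsto_simps)
 qed (use F in auto)
 moreover have "(LBINT x=ereal c..\<infinity>. f x) = (\<integral>x. indicator {c<..} x *\<^sub>R f x \<partial>lborel)"
  by (simp add: interval_lebesgue_integral_def set_lebesgue_integral_def)
 moreover have "(\<integral>x. indicator {c..} x *\<^sub>R f x \<partial>lborel) = (\<integral>x. indicator {c<..} x *\<^sub>R f x \<partial>lborel)"
  by (rule integral_cong_AE[OF borel_measurable_integrable[OF int] borel_measurable_integrable[OF int'] ae])
 ultimately show ?thesis by simp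
qed

lemma lborel_integral_FTC_line:
 fixes F f :: "real => complex"
 assumes F: "\<And>x. (F has_vector_derivative f x) (at x)" and f: "continuous_on UNIV f"
  and int: "integrable lborel f" and lim: "(F \<longlongrightarrow> 0) at_top" "(F \<longlongrightarrow> 0) at_bot"
 shows "(\<integral>x. f x \<partial>lborel) = 0"
proof -
 have "(LBINT x=-\<infinity>..\<infinity>. f x) = 0 - 0"
 proof (rule interval_integral_FTC_integrable[where F = F])
  show "isCont f x" for x using f by (simp add: continuous_on_eq_continuous_at)
  show "set_integrable lborel (einterval (-\<infinity>) \<infinity>) f" using int by (simp add: set_integrable_def)
  show "((F \<circ> real_of_ereal) \<longlongrightarrow> 0) (at_right (-\<infinity>))" using lim by (simp add: ereal_tendsto_simps)
  show "((F \<circ> real_of_ereal) \<longlongrightarrow> 0) (at_left \<infinity>)" using lim by (simp add: ereal_tendsto_simps)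
 qed (use F in auto)
 thus ?thesis by (simp add: interval_lebesgue_integral_def set_lebesgue_integral_def)
qed

lemma exp_halfline:
 fixes s :: complex assumes s: "Re s > 0"
 shows "integrable lborel (\<lambda>t. indicator {c..} t *\<^sub>R exp (- s * of_real t))"
  "(\<integral>t. indicator {c..} t *\<^sub>R exp (- s * of_real t) \<partial>lborel) = exp (- s * of_real c) / s"
  "(\<integral>t. norm (indicator {c..} t *\<^sub>R exp (- s * of_real t)) \<partial>lborel) = exp (- Re s * c) / Re s"
proof -
 have nn: "(\<integral>\<^sup>+t. ennreal (exp (- Re s * t)) * indicator {c..} t \<partial>lborel) = ennreal (0 - (- exp (- Re s * c) / Re s))"
 proof (rule nn_integral_FTC_atLeast)
  show "((\<lambda>t. - exp (- Re s * t) / Re s) has_real_derivative exp (- Re s * x)) (at x)" for x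
   using s by (auto intro!: derivative_eq_intros)
  show "((\<lambda>t. - exp (- Re s * t) / Re s) \<longlongrightarrow> 0) at_top" using s by real_asymp
 qed auto
 have hb: "has_bochner_integral lborel (\<lambda>t. indicator {c..} t * exp (- Re s * t)) (exp (- Re s * c) / Re s)"
  by (rule has_bochner_integral_nn_integral) (use nn s in "auto simp: ennreal_mult' ennreal_indicator mult.commute")
 have nm: "norm (indicator {c..} t *\<^sub>R exp (- s * of_real t)) = indicator {c..} t * exp (- Re s * t)" for t :: real
  by (auto split: split_indicator)
 show int: "integrable lborel (\<lambda>t. indicator {c..} t *\<^sub>R exp (- s * of_real t))"
  by (rule Bochner_Integration.integrable_bound[OF integrable.intros[OF hb]])
    (auto intro!: AE_I2 split: split_indicator)
 show "(\<integral>t. norm (indicator {c..} t *\<^sub>R exp (- s * of_real t)) \<partial>lborel) = exp (- Re s * c) / Re s"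
  unfolding nm by (rule has_bochner_integral_integral_eq[OF hb])
 have s0: "s \<noteq> 0" using s by auto
 have "(\<integral>t. indicator {c..} t *\<^sub>R exp (- s * of_real t) \<partial>lborel) = - (- exp (- s * of_real c) / s)"
 proof (rule lborel_integral_FTC_halfline[OF _ _ int])
  show "((\<lambda>t. - exp (- s * of_real t) / s) has_vector_derivative exp (- s * of_real x)) (at x)" for x :: real
  proof -
   have "((\<lambda>z. - exp (- s * z) / s) has_field_derivative exp (- s * of_real x)) (at (of_real x))"
    using s0 by (auto intro!: derivative_eq_intros)
   thus ?thesis by (rule has_vector_derivative_real_field)
  qed
  show "continuous_on UNIV (\<lambda>t::real. exp (- s * of_real t))" by (intro continuous_intros)
  have "((\<lambda>t. exp (- Re s * t) / norm s) \<longlongrightarrow> 0) at_top" using s s0 by real_asymp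
  thus "((\<lambda>t::real. - exp (- s * of_real t) / s) \<longlongrightarrow> 0) at_top"
   by (rule Lim_null_comparison[rotated]) (auto simp: norm_divide)
 qed
 thus "(\<integral>t. indicator {c..} t *\<^sub>R exp (- s * of_real t) \<partial>lborel) = exp (- s * of_real c) / s" by simp
qed

text \<open>The kernel is Gaussian, so that its Fourier transform damps the polynomial growth of the boundary values.\<close>

lemma gaussian_fourier:
 "(\<integral>x. gauss x *\<^sub>R iexp (u * x) \<partial>lborel) = of_real (exp (- u\<^sup>2 / 2))"
proof -
 have "char std_normal_distribution u = of_real (exp (- u\<^sup>2 / 2))" by (simp add: char_std_normal_distribution)
 moreover have "char std_normal_distribution u = (\<integral>x. gauss x *\<^sub>R iexp (u * x) \<partial>lborel)"
  unfolding char_def by (subst integral_density) (auto simp: normal_density_nonneg)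
 ultimately show ?thesis by simp
qed

section \<open>A Tauberian theorem with a power saving\<close>

text \<open>The setting of Wiener and Ikehara with quantitative hypotheses: H is controlled only in
  the open half-plane, but with bounds for H and H' that are uniform up to the line. No boundary
  values are ever formed.\<close>

locale tauberian =
 fixes a :: "nat => real" and \<kappa> :: real and H H' :: "complex => complex" and B :: real and N :: nat
 assumes a0: "a 0 = 0" and a_nonneg: "\<And>n. a n \<ge> 0" and a_le: "\<And>n. n > 0 ==> a n \<le> ln (real n)"
  and B: "B \<ge> 0" and kappa: "\<kappa> \<ge> 0"
  and Hd: "\<And>s. Re s > 1 ==> (H has_field_derivative H' s) (at s)"
  and HB: "\<And>s. 1 < Re s ==> Re s \<le> 2 ==> norm (H s) \<le> B * (1 + \<bar>Im s\<bar>) ^ N"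
  and HB': "\<And>s. 1 < Re s ==> Re s \<le> 2 ==> norm (H' s) \<le> B * (1 + \<bar>Im s\<bar>) ^ N"
  and ser: "\<And>s. Re s > 1 ==> (\<lambda>n. of_real (a n) * npow n s) sums (of_real \<kappa> / (s - 1) + H s)"
begin

definition A :: "real => real" where "A t = (\<Sum>n\<in>{n. n > 0 \<and> ln (real n) \<le> t}. a n)"
text \<open>In the variable t = ln x this normalised summatory function should tend to
  \<open>\<kappa>\<close>. It is almost increasing: from s to t it loses at most the factor exp (s -
  t), which is the Tauberian condition.\<close>

definition f :: "real => real" where "f t = exp (- t) * A t"

lemma index_eq: "{n. n > 0 \<and> ln (real n) \<le> t} = {1..nfloor (exp t)}"
proof -
 have "n > 0 \<and> ln (real n) \<le> t \<longleftrightarrow> n \<ge> 1 \<and> n \<le> nfloor (exp t)" for n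
 proof (cases "n > 0")
  case True
  hence "ln (real n) \<le> t \<longleftrightarrow> real n \<le> exp t" by (metis exp_le_cancel_iff exp_ln of_nat_0_less_iff)
  also have "\<dots> \<longleftrightarrow> n \<le> nfloor (exp t)" by (metis exp_ge_zero le_nat_floor of_nat_floor of_nat_le_iff order_trans)
  finally show ?thesis using True by simp
 qed simp
 thus ?thesis unfolding set_eq_iff mem_Collect_eq atLeastAtMost_iff by blast
qed

lemma index_finite: "finite {n. n > 0 \<and> ln (real n) \<le> t}" unfolding index_eq by simp

lemma A_mono: "mono A"
 unfolding A_def by (intro monoI sum_mono2 index_finite a_nonneg) auto

lemma A_nonneg: "A t \<ge> 0" unfolding A_def by (intro sum_nonneg a_nonneg)

lemma A_le: "t \<ge> 0 ==> A t \<le> exp t * t"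
proof -
 assume t: "t \<ge> 0"
 have "A t \<le> (\<Sum>n\<in>{n. n > 0 \<and> ln (real n) \<le> t}. t)" unfolding A_def by (intro sum_mono order_trans[OF a_le]) auto
 also have "\<dots> = real (nfloor (exp t)) * t" unfolding index_eq by simp
 also have "\<dots> \<le> exp t * t" using t by (intro mult_right_mono) auto
 finally show ?thesis .
qed

lemma f_nonneg: "f t \<ge> 0" using A_nonneg by (simp add: f_def)

lemma f_le: "t \<ge> 0 ==> f t \<le> t"
 using mult_left_mono[OF A_le, of t "exp (-t)"] by (simp add: f_def exp_minus field_simps)

lemma f_mono: "s \<le> t ==> f s * exp (s - t) \<le> f t"
proof -
 assume "s \<le> t"
 hence "exp (- t) * A s \<le> exp (- t) * A t" using A_mono by (simp add: monoD)
 moreover have "f s * exp (s - t) = exp (- t) * A s"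
 proof -
  have "exp (- s) * exp (s - t) = exp (- t)" by (simp flip: exp_add)
  moreover have "f s * exp (s - t) = exp (- s) * exp (s - t) * A s" by (simp only: f_def mult_ac)
  ultimately show ?thesis by (simp only:)
 qed
 ultimately show ?thesis by (simp only: f_def[of t])
qed

lemma f_measurable [measurable]: "f \<in> borel_measurable borel"
proof -
 have [measurable]: "A \<in> borel_measurable borel" by (rule borel_measurable_mono[OF A_mono])
 show ?thesis unfolding f_def by measurable
qed

text \<open>Termwise integration: a n contributes an exponential on the half-line from ln n on, with
  transform a n * n^-s / s. The bound a n <= ln n makes the integrals of the norms summable.\<close>

lemma laplace_A:
 assumes s: "Re s > 1"
 shows "integrable lborel (\<lambda>t. Ipos t *\<^sub>R (of_real (A t) * exp (- s * of_real t)))"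
  "(\<integral>t. Ipos t *\<^sub>R (of_real (A t) * exp (- s * of_real t)) \<partial>lborel) = (of_real \<kappa> / (s - 1) + H s) / s"
proof -
 define g where "g n t = of_real (a n) * (indicator {ln (real n)..} t *\<^sub>R exp (- s * of_real t))" for n t
 have s0: "Re s > 0" using s by simp
 have int: "integrable lborel (g n)" for n
  unfolding g_def by (intro integrable_mult_right exp_halfline(1) s0)
 have zero: "g 0 t = 0" for t by (simp add: g_def a0)
 have pt: "g n t = 0" if "\<not> (n > 0 \<and> ln (real n) \<le> t)" for n t
  using that zero by (cases "n = 0") (auto simp: g_def split: split_indicator)
 have sm: "(\<lambda>n. g n t) sums (\<Sum>n\<in>{n. n > 0 \<and> ln (real n) \<le> t}. g n t)" for t
  by (rule sums_finite[OF index_finite]) (use pt in auto)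
 have smn: "summable (\<lambda>n. norm (g n t))" for t
  by (rule summable_finite[OF index_finite[of t]]) (use pt in auto)
 have val: "(\<Sum>n. g n t) = Ipos t *\<^sub>R (of_real (A t) * exp (- s * of_real t))" for t
 proof -
  have "(\<Sum>n. g n t) = (\<Sum>n\<in>{n. n > 0 \<and> ln (real n) \<le> t}. g n t)" using sm[of t] by (simp add: sums_iff)
  also have "\<dots> = (\<Sum>n\<in>{n. n > 0 \<and> ln (real n) \<le> t}. of_real (a n) * exp (- s * of_real t))"
   by (intro sum.cong refl) (auto simp: g_def)
  also have "\<dots> = of_real (A t) * exp (- s * of_real t)" by (simp add: A_def sum_distrib_right)
  also have "\<dots> = Ipos t *\<^sub>R (of_real (A t) * exp (- s * of_real t))"
  proof (cases "t \<ge> 0")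
   case False
   have "ln (real n) \<ge> 0" if "n > 0" for n using that by simp
   with False have "{n. n > 0 \<and> ln (real n) \<le> t} = {}" by (smt (verit) Collect_empty_eq)
   hence "A t = 0" unfolding A_def by (simp only: sum.empty)
   thus ?thesis by simp
  qed simp
  finally show ?thesis .
 qed
 have expn: "exp (- (r * ln (real n))) = real n powr (- r)" if "n > 0" for n r using that by (simp add: powr_def)
 have nrm: "(\<integral>t. norm (g n t) \<partial>lborel) = a n * real n powr (- Re s) / Re s" for n
 proof (cases "n = 0")
  case False
  have "(\<integral>t. norm (g n t) \<partial>lborel) = (\<integral>t. a n * norm (indicator {ln (real n)..} t *\<^sub>R exp (- s * of_real t)) \<partial>lborel)"
   by (simp only: g_def norm_mult norm_of_real abs_of_nonneg[OF a_nonneg])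
  also have "\<dots> = a n * (exp (- Re s * ln (real n)) / Re s)" using exp_halfline(3)[OF s0] by simp
  finally show ?thesis using False by (simp add: expn)
 qed (simp add: zero a0)
 have sumn: "summable (\<lambda>n. \<integral>t. norm (g n t) \<partial>lborel)"
  unfolding nrm
 proof (rule summable_comparison_test'[OF summable_divide[OF summable_ln_powr[OF s]], where N = 1])
  show "norm (a n * real n powr (- Re s) / Re s) \<le> ln (real n) * real n powr (- Re s) / Re s" if "1 \<le> n" for n
   using a_le[of n] a_nonneg[of n] s that by (auto intro!: divide_right_mono mult_right_mono simp: abs_mult)
 qed
 have val_int: "(\<integral>t. g n t \<partial>lborel) = of_real (a n) * npow n s / s" for n
 proof (cases "n = 0")
  case False
  have "(\<integral>t. g n t \<partial>lborel) = of_real (a n) * (exp (- s * of_real (ln (real n))) / s)"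
   by (simp only: g_def integral_mult_right_zero exp_halfline(2)[OF s0])
  moreover have "exp (- s * of_real (ln (real n))) = npow n s" using False by (simp add: powr_def Ln_of_nat)
  ultimately show ?thesis by simp
 qed (simp add: zero a0)
 show "integrable lborel (\<lambda>t. Ipos t *\<^sub>R (of_real (A t) * exp (- s * of_real t)))"
  using integrable_suminf[OF int _ sumn] smn unfolding val by auto
 have "(\<lambda>n. \<integral>t. g n t \<partial>lborel) sums (\<integral>t. (\<Sum>n. g n t) \<partial>lborel)"
  by (rule sums_integral[OF int _ sumn]) (use smn in auto)
 moreover have "(\<lambda>n. of_real (a n) * npow n s / s) sums ((of_real \<kappa> / (s - 1) + H s) / s)"
  by (rule sums_divide[OF ser[OF s]])
 ultimately show "(\<integral>t. Ipos t *\<^sub>R (of_real (A t) * exp (- s * of_real t)) \<partial>lborel) = (of_real \<kappa> / (s - 1) + H s) / s"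
  unfolding val_int val by (rule sums_unique2)
qed

text \<open>The Laplace transform of f - \<kappa>: in (\<kappa> / z + H (1 + z)) / (1 + z) -
  \<kappa> / z the poles at 0 cancel and this remains.\<close>

definition G :: "complex => complex" where "G z = (H (1 + z) - of_real \<kappa>) / (1 + z)"
definition G' :: "complex => complex" where "G' z = H' (1 + z) / (1 + z) - (H (1 + z) - of_real \<kappa>) / (1 + z)\<^sup>2"

lemma laplace_f:
 assumes z: "Re z > 0"
 shows "integrable lborel (\<lambda>t. Ipos t *\<^sub>R (of_real (f t - \<kappa>) * exp (- z * of_real t)))"
  "(\<integral>t. Ipos t *\<^sub>R (of_real (f t - \<kappa>) * exp (- z * of_real t)) \<partial>lborel) = G z"
proof -
 have s: "Re (1 + z) > 1" using z by simp
 have e: "Ipos t *\<^sub>R (of_real (f t - \<kappa>) * exp (- z * of_real t)) =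
   Ipos t *\<^sub>R (of_real (A t) * exp (- (1 + z) * of_real t)) - of_real \<kappa> * (Ipos t *\<^sub>R exp (- z * of_real t))" for t
 proof -
  have "exp (- (1 + z) * of_real t) = of_real (exp (-t)) * exp (- z * of_real t)"
   by (simp add: algebra_simps exp_of_real[symmetric] flip: exp_add)
  thus ?thesis by (auto split: split_indicator simp: f_def algebra_simps)
 qed
 note i1 = laplace_A(1)[OF s]
 have i2: "integrable lborel (\<lambda>t. of_real \<kappa> * (Ipos t *\<^sub>R exp (- z * of_real t)))"
  by (intro integrable_mult_right exp_halfline(1) z)
 show "integrable lborel (\<lambda>t. Ipos t *\<^sub>R (of_real (f t - \<kappa>) * exp (- z * of_real t)))"
  unfolding e by (rule Bochner_Integration.integrable_diff[OF i1 i2])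
 have nz: "z \<noteq> 0" "1 + z \<noteq> 0" using z by (auto simp: complex_eq_iff)
 have "(\<integral>t. Ipos t *\<^sub>R (of_real (f t - \<kappa>) * exp (- z * of_real t)) \<partial>lborel) =
   (of_real \<kappa> / (1 + z - 1) + H (1 + z)) / (1 + z) - of_real \<kappa> * (exp (- z * of_real 0) / z)"
  unfolding e Bochner_Integration.integral_diff[OF i1 i2] laplace_A(2)[OF s] integral_mult_right_zero exp_halfline(2)[OF z] ..
 also have "\<dots> = G z" unfolding G_def using nz by (simp add: divide_simps) (simp add: algebra_simps)
 finally show "(\<integral>t. Ipos t *\<^sub>R (of_real (f t - \<kappa>) * exp (- z * of_real t)) \<partial>lborel) = G z" .
qed

lemma G_deriv: "Re z > 0 ==> (G has_field_derivative G' z) (at z)"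
proof -
 assume z: "Re z > 0"
 hence nz: "1 + z \<noteq> 0" by (auto simp: complex_eq_iff)
 have "((\<lambda>z. H (1 + z)) has_field_derivative H' (1 + z)) (at z)"
  using DERIV_shift[of H "H' (1 + z)" z 1] Hd[of "1 + z"] z by (simp add: add.commute)
 hence "((\<lambda>z. (H (1 + z) - of_real \<kappa>) / (1 + z)) has_field_derivative
   (H' (1 + z) * (1 + z) - (H (1 + z) - of_real \<kappa>) * 1) / ((1 + z) * (1 + z))) (at z)"
  using nz by (intro DERIV_divide) (auto intro!: derivative_eq_intros)
 thus ?thesis unfolding G_def[abs_def] G'_def using nz by (simp add: diff_divide_distrib power2_eq_square)
qed

lemma G_bounds:
 assumes "0 < Re z" "Re z \<le> 1"
 shows "norm (G z) \<le> (2 * B + 2 * \<kappa>) * (1 + \<bar>Im z\<bar>) ^ N" "norm (G' z) \<le> (2 * B + 2 * \<kappa>) * (1 + \<bar>Im z\<bar>) ^ N"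
proof -
 define W where "W = (1 + \<bar>Im z\<bar>) ^ N"
 have W: "W \<ge> 1" unfolding W_def by (intro one_le_power) auto
 have n1: "norm (1 + z) \<ge> 1" using complex_Re_le_cmod[of "1 + z"] assms by simp
 have h: "norm (H (1 + z)) \<le> B * W" "norm (H' (1 + z)) \<le> B * W"
  using HB[of "1 + z"] HB'[of "1 + z"] assms by (auto simp: W_def)
 have kW: "\<kappa> \<le> \<kappa> * W" using kappa W by (simp add: mult_le_cancel_left1)
 have nn: "0 \<le> B * W" "0 \<le> \<kappa> * W" using B kappa W by auto
 have dv: "norm (x / (1 + z)) \<le> norm x" for x
  using n1 mult_left_mono[OF n1, of "norm x"] by (simp add: norm_divide divide_le_eq)
 have hk: "norm (H (1 + z) - of_real \<kappa>) \<le> B * W + \<kappa> * W"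
  using norm_triangle_ineq4[of "H (1 + z)" "of_real \<kappa>"] h kappa kW by simp
 have g1: "norm (G z) \<le> B * W + \<kappa> * W" unfolding G_def using dv[of "H (1 + z) - of_real \<kappa>"] hk by linarith
 thus "norm (G z) \<le> (2 * B + 2 * \<kappa>) * (1 + \<bar>Im z\<bar>) ^ N"
  unfolding W_def[symmetric] distrib_right using nn by linarith
 have "G' z = H' (1 + z) / (1 + z) - G z / (1 + z)" unfolding G'_def G_def by (simp add: power2_eq_square)
 hence "norm (G' z) \<le> norm (H' (1 + z)) + norm (G z)"
  using norm_triangle_ineq4[of "H' (1 + z) / (1 + z)" "G z / (1 + z)"] dv[of "H' (1 + z)"] dv[of "G z"] by simp
 thus "norm (G' z) \<le> (2 * B + 2 * \<kappa>) * (1 + \<bar>Im z\<bar>) ^ N"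
  unfolding W_def[symmetric] distrib_right using nn g1 h by linarith
qed

end

lemma integrable_normal_poly:
 "integrable lborel (\<lambda>x. gauss x * (1 + \<bar>x\<bar>) ^ k)"
proof (rule Bochner_Integration.integrable_bound)
 show "integrable lborel (\<lambda>x. 2 ^ k * (gauss x + gauss x * \<bar>x - 0\<bar> ^ k))"
  by (intro integrable_mult_right Bochner_Integration.integrable_add integrable_normal_density integrable_normal_moment_abs) auto
 have "(1 + \<bar>x\<bar>) ^ k \<le> 2 ^ k * (1 + \<bar>x\<bar> ^ k)" for x :: real
 proof -
  have "(1 + \<bar>x\<bar>) ^ k \<le> (2 * max 1 \<bar>x\<bar>) ^ k" by (intro power_mono) auto
  also have "\<dots> = 2 ^ k * (max 1 \<bar>x\<bar>) ^ k" by (rule power_mult_distrib)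
  also have "(max 1 \<bar>x\<bar>) ^ k \<le> 1 + \<bar>x\<bar> ^ k" by (auto simp: max_def)
  finally show ?thesis by simp
 qed
 hence "gauss x * (1 + \<bar>x\<bar>) ^ k \<le> gauss x * (2 ^ k * (1 + \<bar>x\<bar> ^ k))" for x
  by (intro mult_left_mono) auto
 thus "AE x in lborel. norm (gauss x * (1 + \<bar>x\<bar>) ^ k) \<le>
   norm (2 ^ k * (gauss x + gauss x * \<bar>x - 0\<bar> ^ k))"
  by (intro AE_I2) (auto simp: abs_mult algebra_simps intro: order_trans[OF _ abs_ge_self])
qed simp

lemma normal_poly_tendsto_0:
 "((\<lambda>x. gauss x * (1 + \<bar>x\<bar>) ^ k) \<longlongrightarrow> 0) at_top"
 "((\<lambda>x. gauss x * (1 + \<bar>x\<bar>) ^ k) \<longlongrightarrow> 0) at_bot"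
proof -
 have bd: "norm (gauss x * (1 + \<bar>x\<bar>) ^ k) \<le> exp (3/2) * ((1 + \<bar>x\<bar>) ^ k / exp (1 + \<bar>x\<bar>))" for x
 proof -
  have "gauss x \<le> exp (3/2) * exp (- (1 + \<bar>x\<bar>))"
  proof -
   have "1 \<le> sqrt (2 * pi)" using pi_gt3 by simp
   hence "1 / sqrt (2 * pi) \<le> 1" by simp
   hence "1 / sqrt (2 * pi) * exp (- x\<^sup>2 / 2) \<le> 1 * exp (- x\<^sup>2 / 2)" by (intro mult_right_mono) auto
   hence "gauss x \<le> exp (- x\<^sup>2 / 2)" by (simp add: std_normal_density_def)
   also have "\<dots> \<le> exp (3/2 - (1 + \<bar>x\<bar>))"
   proof -
    have "0 \<le> (\<bar>x\<bar> - 1)\<^sup>2" by simp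
    thus ?thesis by (simp add: power2_eq_square algebra_simps)
   qed
   also have "exp (3/2 - (1 + \<bar>x\<bar>)) = exp (3/2) * exp (- (1 + \<bar>x\<bar>))"
    unfolding exp_add[symmetric] by (rule arg_cong[of _ _ exp]) simp
   finally show ?thesis .
  qed
  hence "gauss x * (1 + \<bar>x\<bar>) ^ k \<le> exp (3/2) * exp (- (1 + \<bar>x\<bar>)) * (1 + \<bar>x\<bar>) ^ k"
   by (intro mult_right_mono) auto
  also have "exp (3/2) * exp (- (1 + \<bar>x\<bar>)) * (1 + \<bar>x\<bar>) ^ k = exp (3/2) * ((1 + \<bar>x\<bar>) ^ k / exp (1 + \<bar>x\<bar>))"
   by (simp only: exp_minus divide_inverse mult_ac)
  finally have "gauss x * (1 + \<bar>x\<bar>) ^ k \<le> exp (3/2) * ((1 + \<bar>x\<bar>) ^ k / exp (1 + \<bar>x\<bar>))" .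
  moreover have "0 \<le> gauss x * (1 + \<bar>x\<bar>) ^ k" by simp
  ultimately show ?thesis by (simp only: real_norm_def abs_of_nonneg)
 qed
 have lim: "((\<lambda>v::real. exp (3/2) * (v ^ k / exp v)) \<longlongrightarrow> 0) at_top"
  using tendsto_mult_left[OF tendsto_power_div_exp_0[of k], of "exp (3/2)"] by simp
 have "filterlim (\<lambda>x::real. 1 + \<bar>x\<bar>) at_top at_top" by real_asymp
 from filterlim_compose[OF lim this]
 show "((\<lambda>x. gauss x * (1 + \<bar>x\<bar>) ^ k) \<longlongrightarrow> 0) at_top"
  by (rule Lim_null_comparison[rotated]) (use bd in auto)
 have "filterlim (\<lambda>x::real. 1 + \<bar>x\<bar>) at_top at_bot" by real_asymp
 from filterlim_compose[OF lim this]
 show "((\<lambda>x. gauss x * (1 + \<bar>x\<bar>) ^ k) \<longlongrightarrow> 0) at_bot"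
  by (rule Lim_null_comparison[rotated]) (use bd in auto)
qed

context tauberian
begin

definition D where "D = 2 * B + 2 * \<kappa>"
definition E where "E = (\<integral>x. gauss x * (1 + \<bar>x\<bar>) ^ (N + 1) \<partial>lborel)"

lemma D_nonneg: "D \<ge> 0" using B kappa by (simp add: D_def)
lemma E_nonneg: "E \<ge> 0" unfolding E_def by (intro integral_nonneg_AE AE_I2) auto

lemma G_line_bounds:
 assumes "0 < \<sigma>" "\<sigma> \<le> 1" "c \<ge> 1"
 shows "norm (G (Complex \<sigma> (c * x))) \<le> D * c ^ N * (1 + \<bar>x\<bar>) ^ N"
  "norm (G' (Complex \<sigma> (c * x))) \<le> D * c ^ N * (1 + \<bar>x\<bar>) ^ N"
proof -
 have "(1 + \<bar>c * x\<bar>) ^ N \<le> (c * (1 + \<bar>x\<bar>)) ^ N"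
  using assms(3) by (intro power_mono) (auto simp: abs_mult algebra_simps)
 hence "D * (1 + \<bar>c * x\<bar>) ^ N \<le> D * c ^ N * (1 + \<bar>x\<bar>) ^ N"
  using D_nonneg by (simp add: power_mult_distrib mult_left_mono mult.assoc)
 thus "norm (G (Complex \<sigma> (c * x))) \<le> D * c ^ N * (1 + \<bar>x\<bar>) ^ N"
  "norm (G' (Complex \<sigma> (c * x))) \<le> D * c ^ N * (1 + \<bar>x\<bar>) ^ N"
  using G_bounds[of "Complex \<sigma> (c * x)"] assms unfolding D_def[symmetric] by auto
qed

text \<open>One integration by parts against the oscillation gains 1 / \<omega>; the Gaussian
  absorbs the polynomial growth of G and G'. The bound does not involve \<sigma>, so it survives
  \<sigma> tending to 0.\<close>

lemma fourier_parts:
 assumes "0 < \<sigma>" "\<sigma> \<le> 1" "c \<ge> 1" "\<omega> > 0"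
 shows "norm (\<integral>x. gauss x *\<^sub>R (iexp (\<omega> * x) * G (Complex \<sigma> (c * x))) \<partial>lborel) \<le> D * E * c ^ (N + 1) / \<omega>"
proof -
 let ?A = "\<i> * of_real \<omega>"
 define h where "h x = of_real (gauss x) * G (Complex \<sigma> (c * x))" for x
 define h' where "h' x = of_real (- x * gauss x) * G (Complex \<sigma> (c * x))
   + of_real (gauss x) * (\<i> * of_real c * G' (Complex \<sigma> (c * x)))" for x
 define e where "e x = iexp (\<omega> * x)" for x
 have Cz: "Complex \<sigma> (c * x) = of_real \<sigma> + \<i> * of_real c * of_real x" for x by (simp add: complex_eq_iff)
 have dn: "(std_normal_density has_real_derivative - x * gauss x) (at x)" for x
 proof -
  have "((\<lambda>x. k * exp (- x\<^sup>2 / 2)) has_real_derivative (- x * (k * exp (- x\<^sup>2 / 2)))) (at x)" for k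
   by (auto intro!: derivative_eq_intros)
  thus ?thesis unfolding std_normal_density_def by blast
 qed
 have dG: "((\<lambda>x. G (Complex \<sigma> (c * x))) has_vector_derivative (\<i> * of_real c * G' (Complex \<sigma> (c * x)))) (at x)" for x
 proof -
  have "((\<lambda>z. G (of_real \<sigma> + \<i> * of_real c * z)) has_field_derivative G' (of_real \<sigma> + \<i> * of_real c * of_real x) * (\<i> * of_real c)) (at (of_real x))"
   by (rule DERIV_chain2[OF G_deriv]) (use assms in "auto intro!: derivative_eq_intros")
  from has_vector_derivative_real_field[OF this] show ?thesis unfolding Cz by (simp add: mult_ac)
 qed
 have dh: "(h has_vector_derivative h' x) (at x)" for x
  unfolding h_def h'_def
  using has_vector_derivative_mult[OF has_vector_derivative_of_real[OF dn[of x]] dG[of x]]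
  by (simp add: algebra_simps)
 have de: "(e has_vector_derivative ?A * e x) (at x)" for x
 proof -
  have "((\<lambda>z. exp (\<i> * of_real \<omega> * z)) has_field_derivative ?A * exp (\<i> * of_real \<omega> * of_real x)) (at (of_real x))"
   by (auto intro!: derivative_eq_intros)
  from has_vector_derivative_real_field[OF this] show ?thesis unfolding e_def by (simp add: mult_ac)
 qed
 have contG: "continuous_on UNIV (\<lambda>x. G (Complex \<sigma> (c * x)))"
  using dG by (intro continuous_at_imp_continuous_on ballI has_vector_derivative_continuous) auto
 have contH': "continuous_on UNIV (\<lambda>x. G' (Complex \<sigma> (c * x)))"
 proof -
  have "G holomorphic_on {z. Re z > 0}"
   unfolding holomorphic_on_open[OF open_halfspace_Re_gt] using G_deriv by blast
  hence "deriv G holomorphic_on {z. Re z > 0}" by (rule holomorphic_deriv[OF _ open_halfspace_Re_gt])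
  hence "continuous_on {z. Re z > 0} (deriv G)" by (rule holomorphic_on_imp_continuous_on)
  moreover have "G' z = deriv G z" if "Re z > 0" for z using DERIV_imp_deriv[OF G_deriv[OF that]] by simp
  ultimately have c: "continuous_on {z. Re z > 0} G'" by (metis (no_types, lifting) continuous_on_cong mem_Collect_eq)
  show ?thesis unfolding Cz
   by (rule continuous_on_compose2[OF c]) (use assms in "auto intro!: continuous_intros")
 qed
 have contn: "continuous_on UNIV std_normal_density"
  using dn by (intro continuous_at_imp_continuous_on ballI DERIV_isCont) auto
 have conth: "continuous_on UNIV h" "continuous_on UNIV h'" "continuous_on UNIV e"
  unfolding h_def h'_def e_def by (intro continuous_intros contG contH' contn)+
 have ne: "norm (e x) = 1" for x by (simp add: e_def)
 have cN: "c ^ N \<le> c ^ (N + 1)" using assms by (intro power_increasing) auto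
 have bh: "norm (h x) \<le> D * c ^ N * (gauss x * (1 + \<bar>x\<bar>) ^ N)" for x
  using mult_left_mono[OF G_line_bounds(1)[OF assms(1-3), of x], of "gauss x"]
  by (simp add: h_def norm_mult mult_ac)
 have bh': "norm (h' x) \<le> D * c ^ (N + 1) * (gauss x * (1 + \<bar>x\<bar>) ^ (N + 1))" for x
 proof -
  have "norm (h' x) \<le> \<bar>x\<bar> * gauss x * (D * c ^ N * (1 + \<bar>x\<bar>) ^ N) +
    gauss x * (c * (D * c ^ N * (1 + \<bar>x\<bar>) ^ N))"
   unfolding h'_def
  proof (rule order_trans[OF norm_triangle_ineq add_mono])
   show "norm (of_real (- x * gauss x) * G (Complex \<sigma> (c * x))) \<le> \<bar>x\<bar> * gauss x * (D * c ^ N * (1 + \<bar>x\<bar>) ^ N)"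
    unfolding norm_mult norm_of_real by (intro mult_mono G_line_bounds[OF assms(1-3)]) (auto simp: abs_mult)
   show "norm (of_real (gauss x) * (\<i> * of_real c * G' (Complex \<sigma> (c * x)))) \<le> gauss x * (c * (D * c ^ N * (1 + \<bar>x\<bar>) ^ N))"
    unfolding norm_mult norm_of_real using assms(3) by (intro mult_mono G_line_bounds[OF assms(1-3)]) auto
  qed
  also have "\<dots> = D * c ^ N * gauss x * (1 + \<bar>x\<bar>) ^ N * (\<bar>x\<bar> + c)" by (simp add: algebra_simps)
  also have "\<dots> \<le> D * c ^ N * gauss x * (1 + \<bar>x\<bar>) ^ N * (c * (1 + \<bar>x\<bar>))"
   using assms(3) D_nonneg mult_right_mono[OF assms(3), of "\<bar>x\<bar>"] by (intro mult_left_mono) (auto simp: algebra_simps)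
  finally show ?thesis by (simp add: mult_ac)
 qed
 have inth: "integrable lborel h"
  by (rule Bochner_Integration.integrable_bound[OF integrable_mult_right[OF integrable_normal_poly, of "D * c ^ N" N]])
   (use bh borel_measurable_continuous_onI[OF conth(1)] in \<open>auto intro!: AE_I2 intro: order_trans[OF _ abs_ge_self]\<close>)
 have inth': "integrable lborel h'"
  by (rule Bochner_Integration.integrable_bound[OF integrable_mult_right[OF integrable_normal_poly, of "D * c ^ (N + 1)" "N + 1"]])
   (use bh' borel_measurable_continuous_onI[OF conth(2)] in \<open>auto intro!: AE_I2 intro: order_trans[OF _ abs_ge_self]\<close>)
 have me: "e \<in> borel_measurable lborel" using borel_measurable_continuous_onI[OF conth(3)] by simp
 have ihe: "integrable lborel (\<lambda>x. h x * e x)"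
  by (rule Bochner_Integration.integrable_bound[OF inth]) (use me inth in "auto simp: norm_mult ne")
 have ih'e: "integrable lborel (\<lambda>x. h' x * e x)"
  by (rule Bochner_Integration.integrable_bound[OF inth']) (use me inth' in "auto simp: norm_mult ne")
 have "(\<integral>x. ?A * (h x * e x) + h' x * e x \<partial>lborel) = 0"
 proof (rule lborel_integral_FTC_line[where F = "\<lambda>x. h x * e x"])
  show "((\<lambda>x. h x * e x) has_vector_derivative ?A * (h x * e x) + h' x * e x) (at x)" for x
   using has_vector_derivative_mult[OF dh[of x] de[of x]] by (simp add: mult_ac)
  show "continuous_on UNIV (\<lambda>x. ?A * (h x * e x) + h' x * e x)"
   by (intro continuous_intros conth)
  show "integrable lborel (\<lambda>x. ?A * (h x * e x) + h' x * e x)"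
   by (intro Bochner_Integration.integrable_add integrable_mult_right ihe ih'e)
  have b: "norm (h x * e x) \<le> D * c ^ N * (gauss x * (1 + \<bar>x\<bar>) ^ N)" for x
   using bh[of x] by (simp add: norm_mult ne)
  show "((\<lambda>x. h x * e x) \<longlongrightarrow> 0) at_top"
   by (rule Lim_null_comparison[OF always_eventually[OF allI[OF b]] tendsto_mult_right_zero[OF normal_poly_tendsto_0(1)]])
  show "((\<lambda>x. h x * e x) \<longlongrightarrow> 0) at_bot"
   by (rule Lim_null_comparison[OF always_eventually[OF allI[OF b]] tendsto_mult_right_zero[OF normal_poly_tendsto_0(2)]])
 qed
 hence "?A * (\<integral>x. h x * e x \<partial>lborel) + (\<integral>x. h' x * e x \<partial>lborel) = 0"
  by (subst (asm) Bochner_Integration.integral_add) (auto intro: ihe ih'e)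
 hence "norm (?A * (\<integral>x. h x * e x \<partial>lborel)) = norm (\<integral>x. h' x * e x \<partial>lborel)"
  by (metis add_eq_0_iff norm_minus_cancel)
 hence eq: "\<omega> * norm (\<integral>x. h x * e x \<partial>lborel) = norm (\<integral>x. h' x * e x \<partial>lborel)"
  using assms(4) by (simp add: norm_mult)
 have "norm (\<integral>x. h' x * e x \<partial>lborel) \<le> (\<integral>x. norm (h' x * e x) \<partial>lborel)" by (rule integral_norm_bound)
 also have "\<dots> \<le> (\<integral>x. D * c ^ (N + 1) * (gauss x * (1 + \<bar>x\<bar>) ^ (N + 1)) \<partial>lborel)"
  by (intro integral_mono integrable_norm ih'e integrable_mult_right integrable_normal_poly) (use bh' in "simp add: norm_mult ne")
 also have "\<dots> = D * c ^ (N + 1) * E" unfolding E_def by (rule integral_mult_right_zero)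
 finally have "\<omega> * norm (\<integral>x. h x * e x \<partial>lborel) \<le> D * c ^ (N + 1) * E" unfolding eq .
 moreover have "(\<integral>x. h x * e x \<partial>lborel) = (\<integral>x. gauss x *\<^sub>R (iexp (\<omega> * x) * G (Complex \<sigma> (c * x))) \<partial>lborel)"
  by (intro Bochner_Integration.integral_cong refl) (simp add: h_def e_def scaleR_conv_of_real)
 ultimately show ?thesis using assms(4) by (simp add: pos_le_divide_eq mult_ac)
qed

text \<open>Fubini: a Gaussian window of width 1 / c around t0 is the Fourier transform of a
  Gaussian in x, and the remaining integral over t is the Laplace transform on the line Re z =
  \<sigma>.\<close>

lemma smoothing_identity:
 assumes "0 < \<sigma>" "c > 0"
 shows "(\<integral>t. Ipos t *\<^sub>R (of_real (f t - \<kappa>) * exp (- of_real \<sigma> * of_real t)) * of_real (exp (- (c * (t0 - t))\<^sup>2 / 2)) \<partial>lborel)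
   = (\<integral>x. gauss x *\<^sub>R (iexp (c * t0 * x) * G (Complex \<sigma> (c * x))) \<partial>lborel)"
proof -
 define u :: "real => complex" where "u t = Ipos t *\<^sub>R (of_real (f t - \<kappa>) * exp (- of_real \<sigma> * of_real t))" for t :: real
 define \<phi> :: "real => real => complex" where "\<phi> t x = u t * (gauss x *\<^sub>R iexp ((c * (t0 - t)) * x))" for t x
 have intu: "integrable lborel u" unfolding u_def using laplace_f(1)[of "of_real \<sigma>"] assms by simp
 have mu [measurable]: "u \<in> borel_measurable borel" using borel_measurable_integrable[OF intu] by simp
 have nphi: "norm (\<phi> t x) = norm (u t) * gauss x" for t x
  by (simp add: \<phi>_def norm_mult)
 have m: "case_prod \<phi> \<in> borel_measurable (lborel \<Otimes>\<^sub>M lborel)"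
  unfolding \<phi>_def std_normal_density_def by measurable
 have int: "integrable (lborel \<Otimes>\<^sub>M lborel) (case_prod \<phi>)"
 proof (rule lborel_pair.Fubini_integrable[OF m])
  show "integrable lborel (\<lambda>t. \<integral>x. norm (case_prod \<phi> (t, x)) \<partial>lborel)"
   using integrable_norm[OF intu] by (simp add: nphi)
  show "AE t in lborel. integrable lborel (\<lambda>x. case_prod \<phi> (t, x))"
  proof (rule AE_I2)
   fix t
   show "integrable lborel (\<lambda>x. case_prod \<phi> (t, x))"
   proof (rule Bochner_Integration.integrable_bound[of _ "\<lambda>x. norm (u t) * gauss x"])
    show "(\<lambda>x. case_prod \<phi> (t, x)) \<in> borel_measurable lborel" unfolding \<phi>_def std_normal_density_def by simp
   qed (auto simp: nphi)
  qed
 qed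
 have "(\<integral>t. (\<integral>x. \<phi> t x \<partial>lborel) \<partial>lborel) = (\<integral>x. (\<integral>t. \<phi> t x \<partial>lborel) \<partial>lborel)"
  by (rule lborel_pair.Fubini_integral[OF int, symmetric])
 moreover have "(\<integral>x. \<phi> t x \<partial>lborel) = u t * of_real (exp (- (c * (t0 - t))\<^sup>2 / 2))" for t
  unfolding \<phi>_def by (subst integral_mult_right_zero) (simp only: gaussian_fourier)
 moreover have "(\<integral>t. \<phi> t x \<partial>lborel) = gauss x *\<^sub>R (iexp (c * t0 * x) * G (Complex \<sigma> (c * x)))" for x
 proof -
  have "\<phi> t x = (gauss x *\<^sub>R iexp (c * t0 * x)) * (Ipos t *\<^sub>R (of_real (f t - \<kappa>) * exp (- Complex \<sigma> (c * x) * of_real t)))" for t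
  proof -
   have "exp (- of_real \<sigma> * of_real t) * iexp ((c * (t0 - t)) * x) = iexp (c * t0 * x) * exp (- Complex \<sigma> (c * x) * of_real t)"
    unfolding exp_add[symmetric] by (rule arg_cong[of _ _ exp]) (simp add: complex_eq_iff algebra_simps)
   thus ?thesis unfolding \<phi>_def u_def by (simp add: scaleR_conv_of_real mult_ac)
  qed
  hence "(\<integral>t. \<phi> t x \<partial>lborel) = (gauss x *\<^sub>R iexp (c * t0 * x)) * G (Complex \<sigma> (c * x))"
   using laplace_f(2)[of "Complex \<sigma> (c * x)"] assms by (simp only: integral_mult_right_zero) simp
  thus ?thesis by simp
 qed
 ultimately show ?thesis unfolding u_def by simp
qed

text \<open>The estimate is made with the damping exp (- \<sigma> t) in place, which is then removed
  by dominated convergence; f t <= t provides the majorant. The frequency is c * t0 with c = 1 / d,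
  which is the source of the gain 1 / t0.\<close>

lemma smoothed_bound:
 assumes "0 < d" "d \<le> 1" "t0 > 0"
 shows "\<bar>\<integral>t. Ipos t * (f t - \<kappa>) * normal_density t0 d t \<partial>lborel\<bar> \<le> D * E / (d ^ (N + 1) * t0)"
proof -
 define c where "c = 1 / d"
 have c: "c \<ge> 1" "c > 0" using assms by (auto simp: c_def)
 define g where "g t = exp (- (c * (t0 - t))\<^sup>2 / 2)" for t
 have gn: "normal_density t0 d t = (1 / (d * sqrt (2 * pi))) * g t" for t
 proof -
  have "(t - t0)\<^sup>2 / (2 * d\<^sup>2) = (c * (t0 - t))\<^sup>2 / 2"
   using assms by (simp add: c_def power2_eq_square field_simps)
  thus ?thesis using assms by (simp add: normal_density_def g_def real_sqrt_mult mult.commute)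
 qed
 have gi: "integrable lborel (\<lambda>t. (\<bar>t\<bar> + \<kappa>) * g t)"
 proof -
  have "integrable lborel (\<lambda>t. (d * sqrt (2 * pi)) * (normal_density t0 d t * \<bar>t - t0\<bar> ^ 1 + (\<bar>t0\<bar> + \<kappa>) * normal_density t0 d t))"
   using assms by (intro integrable_mult_right Bochner_Integration.integrable_add integrable_normal_moment_abs integrable_normal_density)
  thus ?thesis
  proof (rule Bochner_Integration.integrable_bound)
   have e: "(d * sqrt (2 * pi)) * (normal_density t0 d t * \<bar>t - t0\<bar> ^ 1 + (\<bar>t0\<bar> + \<kappa>) * normal_density t0 d t) = (\<bar>t - t0\<bar> + \<bar>t0\<bar> + \<kappa>) * g t" for t
    unfolding gn using assms by (simp add: field_simps)
   have "(\<bar>t\<bar> + \<kappa>) * g t \<le> (\<bar>t - t0\<bar> + \<bar>t0\<bar> + \<kappa>) * g t" for t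
    by (intro mult_right_mono) (auto simp: g_def)
   thus "AE t in lborel. norm ((\<bar>t\<bar> + \<kappa>) * g t) \<le> norm ((d * sqrt (2 * pi)) * (normal_density t0 d t * \<bar>t - t0\<bar> ^ 1 + (\<bar>t0\<bar> + \<kappa>) * normal_density t0 d t))"
    unfolding e using kappa by (intro AE_I2) (auto simp: g_def abs_mult)
  qed (simp add: g_def)
 qed
 define J where "J \<sigma> = (\<integral>t. Ipos t * ((f t - \<kappa>) * exp (- \<sigma> * t)) * g t \<partial>lborel)" for \<sigma>
 have Jb: "\<bar>J \<sigma>\<bar> \<le> D * E * c ^ (N + 1) / (c * t0)" if "0 < \<sigma>" "\<sigma> \<le> 1" for \<sigma>
 proof -
  have eq: "(of_real (J \<sigma>) :: complex) = (\<integral>t. Ipos t *\<^sub>R (of_real (f t - \<kappa>) * exp (- of_real \<sigma> * of_real t)) * of_real (g t) \<partial>lborel)"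
   unfolding J_def integral_complex_of_real[symmetric]
   by (intro Bochner_Integration.integral_cong refl) (auto simp: scaleR_conv_of_real exp_of_real[symmetric])
  have "norm (of_real (J \<sigma>) :: complex) \<le> D * E * c ^ (N + 1) / (c * t0)"
   unfolding eq unfolding g_def smoothing_identity[OF that(1) c(2)]
   by (rule fourier_parts[OF that c(1)]) (use c assms in simp)
  thus ?thesis by simp
 qed
 have lim: "(\<lambda>n. J (1 / real (Suc n))) \<longlonglongrightarrow> (\<integral>t. Ipos t * (f t - \<kappa>) * g t \<partial>lborel)"
  unfolding J_def
 proof (rule integral_dominated_convergence[where w = "\<lambda>t. (\<bar>t\<bar> + \<kappa>) * g t"])
  show "AE t in lborel. (\<lambda>n. Ipos t * ((f t - \<kappa>) * exp (- (1 / real (Suc n)) * t)) * g t) \<longlonglongrightarrow> Ipos t * (f t - \<kappa>) * g t"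
  proof (rule AE_I2)
   fix t :: real
   have "(\<lambda>n. 1 / real (Suc n)) \<longlonglongrightarrow> 0" by (rule LIMSEQ_inverse_real_of_nat[unfolded inverse_eq_divide])
   hence "(\<lambda>n. Ipos t * ((f t - \<kappa>) * exp (- (1 / real (Suc n)) * t)) * g t) \<longlonglongrightarrow> Ipos t * ((f t - \<kappa>) * exp (- 0 * t)) * g t"
    by (intro tendsto_intros)
   thus "(\<lambda>n. Ipos t * ((f t - \<kappa>) * exp (- (1 / real (Suc n)) * t)) * g t) \<longlonglongrightarrow> Ipos t * (f t - \<kappa>) * g t"
    by simp
  qed
  show "AE t in lborel. norm (Ipos t * ((f t - \<kappa>) * exp (- (1 / real (Suc n)) * t)) * g t) \<le> (\<bar>t\<bar> + \<kappa>) * g t" for n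
  proof (rule AE_I2)
   fix t :: real
   show "norm (Ipos t * ((f t - \<kappa>) * exp (- (1 / real (Suc n)) * t)) * g t) \<le> (\<bar>t\<bar> + \<kappa>) * g t"
   proof (cases "t \<ge> 0")
    case True
    have "\<bar>f t - \<kappa>\<bar> \<le> \<bar>t\<bar> + \<kappa>" using f_le[OF True] f_nonneg[of t] kappa by linarith
    moreover have "exp (- (1 / real (Suc n)) * t) \<le> 1" using True by simp
    ultimately have "\<bar>f t - \<kappa>\<bar> * exp (- (1 / real (Suc n)) * t) * g t \<le> (\<bar>t\<bar> + \<kappa>) * 1 * g t"
     using kappa by (intro mult_mono) (auto simp: g_def)
    thus ?thesis using True by (simp add: abs_mult g_def)
   qed (use kappa in "simp add: g_def")
  qed
 qed (use gi in "auto simp: g_def")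
 have "\<bar>\<integral>t. Ipos t * (f t - \<kappa>) * g t \<partial>lborel\<bar> \<le> D * E * c ^ (N + 1) / (c * t0)"
  by (rule LIMSEQ_le_const2[OF tendsto_rabs[OF lim]]) (use Jb in auto)
 moreover have "(\<integral>t. Ipos t * (f t - \<kappa>) * normal_density t0 d t \<partial>lborel) =
   (1 / (d * sqrt (2 * pi))) * (\<integral>t. Ipos t * (f t - \<kappa>) * g t \<partial>lborel)"
  unfolding gn by (subst integral_mult_right_zero[symmetric]) (simp add: mult_ac)
 ultimately have "\<bar>\<integral>t. Ipos t * (f t - \<kappa>) * normal_density t0 d t \<partial>lborel\<bar> \<le>
   (1 / (d * sqrt (2 * pi))) * (D * E * c ^ (N + 1) / (c * t0))"
  using assms by (simp only: abs_mult) (intro mult_mono; simp)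
 also have "\<dots> \<le> (1 / d) * (D * E * c ^ (N + 1) / (c * t0))"
 proof (rule mult_right_mono)
  have "1 \<le> sqrt (2 * pi)" using pi_gt3 by simp
  hence "d * 1 \<le> d * sqrt (2 * pi)" using assms by (intro mult_left_mono) auto
  thus "1 / (d * sqrt (2 * pi)) \<le> 1 / d" using assms by (intro divide_left_mono) auto
 qed (use D_nonneg E_nonneg c assms in auto)
 also have "\<dots> = D * E / (d ^ (N + 1) * t0)" using assms by (simp add: c_def power_divide field_simps)
 finally show ?thesis .
qed

end

text \<open>Chebyshev's inequality for variance d^2.\<close>

lemma normal_window_mass:
 assumes "d > 0" "w > 0"
 shows "integrable lborel (\<lambda>t. indicator {t0 - w..t0 + w} t * normal_density t0 d t)"
  "1 - d\<^sup>2 / w\<^sup>2 \<le> (\<integral>t. indicator {t0 - w..t0 + w} t * normal_density t0 d t \<partial>lborel)"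
proof -
 let ?P = "normal_density t0 d" and ?I = "indicator {t0 - w..t0 + w} :: real => real"
 show int: "integrable lborel (\<lambda>t. ?I t * ?P t)"
  using integrable_mult_indicator[of "{t0 - w..t0 + w}" lborel ?P] assms by simp
 have m: "has_bochner_integral lborel (\<lambda>t. ?P t * (t - t0)\<^sup>2) (d\<^sup>2)"
  using normal_moment_even[OF assms(1), of t0 1] by simp
 have "(\<integral>t. ?P t - ?I t * ?P t \<partial>lborel) \<le> (\<integral>t. ?P t * (t - t0)\<^sup>2 / w\<^sup>2 \<partial>lborel)"
 proof (rule integral_mono)
  show "integrable lborel (\<lambda>t. ?P t - ?I t * ?P t)" using int assms by (intro Bochner_Integration.integrable_diff) auto
  show "integrable lborel (\<lambda>t. ?P t * (t - t0)\<^sup>2 / w\<^sup>2)" using integrable.intros[OF m] by (rule integrable_divide)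
  show "?P t - ?I t * ?P t \<le> ?P t * (t - t0)\<^sup>2 / w\<^sup>2" for t
  proof (cases "t \<in> {t0 - w..t0 + w}")
   case False
   hence "w\<^sup>2 \<le> (t - t0)\<^sup>2" using assms by (intro power2_le_iff_abs_le[THEN iffD2, of "\<bar>t - t0\<bar>", simplified] | auto simp: abs_le_square_iff[symmetric])+
   hence "?P t * 1 \<le> ?P t * ((t - t0)\<^sup>2 / w\<^sup>2)" using assms by (intro mult_left_mono) auto
   thus ?thesis using False by simp
  qed simp
 qed
 also have "\<dots> = d\<^sup>2 / w\<^sup>2" using has_bochner_integral_integral_eq[OF m] by simp
 also have "(\<integral>t. ?P t - ?I t * ?P t \<partial>lborel) = 1 - (\<integral>t. ?I t * ?P t \<partial>lborel)"
  using int assms by (subst Bochner_Integration.integral_diff) auto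
 finally show "1 - d\<^sup>2 / w\<^sup>2 \<le> (\<integral>t. ?I t * ?P t \<partial>lborel)" by linarith
qed

context tauberian
begin

lemma f_density_integrable:
 assumes "d > 0"
 shows "integrable lborel (\<lambda>t. Ipos t * f t * normal_density t0 d t)"
proof (rule Bochner_Integration.integrable_bound)
 show "integrable lborel (\<lambda>t. normal_density t0 d t * \<bar>t - t0\<bar> ^ 1 + \<bar>t0\<bar> * normal_density t0 d t)"
  using assms by (intro Bochner_Integration.integrable_add integrable_mult_right integrable_normal_moment_abs integrable_normal_density)
 have "Ipos t * f t * normal_density t0 d t \<le> (\<bar>t - t0\<bar> + \<bar>t0\<bar>) * normal_density t0 d t" for t
 proof (rule mult_right_mono)
  show "Ipos t * f t \<le> \<bar>t - t0\<bar> + \<bar>t0\<bar>" using f_le[of t] by (cases "t \<ge> 0") auto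
 qed simp
 thus "AE t in lborel. norm (Ipos t * f t * normal_density t0 d t) \<le>
   norm (normal_density t0 d t * \<bar>t - t0\<bar> ^ 1 + \<bar>t0\<bar> * normal_density t0 d t)"
  by (intro AE_I2) (auto simp: abs_mult f_nonneg algebra_simps)
qed simp

lemma mean_bounds:
 assumes "0 < d" "d \<le> 1" "t0 > 0"
 shows "(\<integral>t. Ipos t * f t * normal_density t0 d t \<partial>lborel) \<le> \<kappa> + D * E / (d ^ (N + 1) * t0)"
  "\<lbrakk>0 < w; w \<le> t0\<rbrakk> \<Longrightarrow> \<kappa> * (1 - d\<^sup>2 / w\<^sup>2) - D * E / (d ^ (N + 1) * t0) \<le> (\<integral>t. Ipos t * f t * normal_density t0 d t \<partial>lborel)"
proof -
 let ?P = "normal_density t0 d"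
 have i0: "integrable lborel (\<lambda>t. Ipos t * ?P t)"
  using integrable_mult_indicator[of "{0..}" lborel ?P] assms by simp
 have "(\<integral>t. Ipos t * (f t - \<kappa>) * ?P t \<partial>lborel) = (\<integral>t. Ipos t * f t * ?P t - \<kappa> * (Ipos t * ?P t) \<partial>lborel)"
  by (intro Bochner_Integration.integral_cong refl) (simp add: algebra_simps)
 also have "\<dots> = (\<integral>t. Ipos t * f t * ?P t \<partial>lborel) - \<kappa> * (\<integral>t. Ipos t * ?P t \<partial>lborel)"
  by (subst Bochner_Integration.integral_diff) (use f_density_integrable i0 assms in auto)
 finally have J: "\<bar>(\<integral>t. Ipos t * f t * ?P t \<partial>lborel) - \<kappa> * (\<integral>t. Ipos t * ?P t \<partial>lborel)\<bar> \<le> D * E / (d ^ (N + 1) * t0)"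
  using smoothed_bound[OF assms] by simp
 have "(\<integral>t. Ipos t * ?P t \<partial>lborel) \<le> (\<integral>t. ?P t \<partial>lborel)"
  using i0 assms by (intro integral_mono) (auto split: split_indicator)
 hence "\<kappa> * (\<integral>t. Ipos t * ?P t \<partial>lborel) \<le> \<kappa> * 1" using assms kappa by (intro mult_left_mono) auto
 with J show "(\<integral>t. Ipos t * f t * ?P t \<partial>lborel) \<le> \<kappa> + D * E / (d ^ (N + 1) * t0)" by linarith
 assume w: "0 < w" "w \<le> t0"
 have "(\<integral>t. indicator {t0 - w..t0 + w} t * ?P t \<partial>lborel) \<le> (\<integral>t. Ipos t * ?P t \<partial>lborel)"
  using i0 w by (intro integral_mono normal_window_mass assms) (auto split: split_indicator)
 hence "\<kappa> * (1 - d\<^sup>2 / w\<^sup>2) \<le> \<kappa> * (\<integral>t. Ipos t * ?P t \<partial>lborel)"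
  using normal_window_mass(2)[OF assms(1) w(1), of t0] kappa by (intro mult_left_mono) auto
 with J show "\<kappa> * (1 - d\<^sup>2 / w\<^sup>2) - D * E / (d ^ (N + 1) * t0) \<le> (\<integral>t. Ipos t * f t * ?P t \<partial>lborel)" by linarith
qed

text \<open>The window [s, s + 2w] lies to the right of s, where f is at least f s * exp (-2w). A
  Gaussian of standard deviation w^2 has all but w^2 of its mass there.\<close>

lemma f_upper:
 assumes "s > 0" "0 < w" "w \<le> 1/2"
 shows "f s * (exp (- 2 * w) * (1 - w\<^sup>2)) \<le> \<kappa> + D * E / (w ^ (2 * N + 2) * s)"
proof -
 define d where "d = w\<^sup>2"
 have d: "0 < d" "d \<le> 1" using assms by (auto simp: d_def power_le_one)
 define t0 where "t0 = s + w"
 let ?P = "normal_density t0 d"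
 note wm = normal_window_mass[OF d(1) assms(2), of t0]
 have dw: "d\<^sup>2 / w\<^sup>2 = w\<^sup>2" using assms by (simp add: d_def power2_eq_square)
 have "f s * exp (- 2 * w) * (1 - w\<^sup>2) \<le> f s * exp (- 2 * w) * (\<integral>t. indicator {t0 - w..t0 + w} t * ?P t \<partial>lborel)"
  using wm(2) f_nonneg[of s] unfolding dw by (intro mult_left_mono) auto
 also have "\<dots> = (\<integral>t. f s * exp (- 2 * w) * (indicator {t0 - w..t0 + w} t * ?P t) \<partial>lborel)"
  by (rule integral_mult_right_zero[symmetric])
 also have "\<dots> \<le> (\<integral>t. Ipos t * f t * ?P t \<partial>lborel)"
 proof (rule integral_mono)
  show "f s * exp (- 2 * w) * (indicator {t0 - w..t0 + w} t * ?P t) \<le> Ipos t * f t * ?P t" for t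
  proof (cases "t \<in> {t0 - w..t0 + w}")
   case True
   hence t: "s \<le> t" "t \<le> s + 2 * w" by (auto simp: t0_def)
   have "f s * exp (- 2 * w) \<le> f s * exp (s - t)" using t f_nonneg[of s] by (intro mult_left_mono) auto
   also have "\<dots> \<le> f t" by (rule f_mono[OF t(1)])
   finally have "f s * exp (- 2 * w) * ?P t \<le> f t * ?P t" by (intro mult_right_mono) auto
   thus ?thesis using True t assms by simp
  qed (simp add: f_nonneg)
 qed (use wm f_density_integrable[OF d(1)] in auto)
 also have "\<dots> \<le> \<kappa> + D * E / (d ^ (N + 1) * t0)" by (rule mean_bounds(1)) (use d assms in "auto simp: t0_def")
 also have "\<dots> \<le> \<kappa> + D * E / (d ^ (N + 1) * s)"
  using D_nonneg E_nonneg d assms by (intro add_left_mono divide_left_mono mult_left_mono mult_pos_pos) (auto simp: t0_def)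
 also have "d ^ (N + 1) = w ^ (2 * N + 2)" unfolding d_def power_mult[symmetric] by (rule arg_cong[of _ _ "\<lambda>n. w ^ n"]) simp
 finally show ?thesis by (simp only: mult.assoc)
qed

text \<open>The mirror image, with the window to the left of s. Mass outside the window is now a
  loss and has to be paid for with a global bound for f.\<close>

lemma f_lower:
 assumes "s > 0" "0 < w" "w \<le> 1/2" "2 * w \<le> s" and Fm: "\<And>t. t \<ge> 0 ==> f t \<le> Fm"
 shows "\<kappa> * (1 - w\<^sup>2) - D * E / (w ^ (2 * N + 2) * (s / 2)) \<le> f s * exp (2 * w) + Fm * w\<^sup>2"
proof -
 define d where "d = w\<^sup>2"
 have d: "0 < d" "d \<le> 1" using assms by (auto simp: d_def power_le_one)
 define t0 where "t0 = s - w"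
 have t0: "t0 \<ge> s / 2" "t0 > 0" "w \<le> t0" using assms by (auto simp: t0_def)
 let ?P = "normal_density t0 d" and ?I = "indicator {t0 - w..t0 + w} :: real => real"
 have Fm0: "Fm \<ge> 0" using Fm[of 0] f_nonneg[of 0] by simp
 note wm = normal_window_mass[OF d(1) assms(2), of t0]
 have dw: "d\<^sup>2 / w\<^sup>2 = w\<^sup>2" using assms by (simp add: d_def power2_eq_square)
 have de: "d ^ (N + 1) = w ^ (2 * N + 2)" unfolding d_def power_mult[symmetric] by (rule arg_cong[of _ _ "\<lambda>n. w ^ n"]) simp
 have "D * E / (d ^ (N + 1) * t0) \<le> D * E / (d ^ (N + 1) * (s / 2))"
  using D_nonneg E_nonneg d assms t0 by (intro divide_left_mono mult_left_mono mult_pos_pos) auto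
 hence "\<kappa> * (1 - w\<^sup>2) - D * E / (w ^ (2 * N + 2) * (s / 2)) \<le> \<kappa> * (1 - d\<^sup>2 / w\<^sup>2) - D * E / (d ^ (N + 1) * t0)"
  unfolding dw de by linarith
 also have "\<dots> \<le> (\<integral>t. Ipos t * f t * ?P t \<partial>lborel)" by (rule mean_bounds(2)) (use d t0 assms in auto)
 also have "\<dots> \<le> (\<integral>t. (f s * exp (2 * w)) * (?I t * ?P t) + Fm * (?P t - ?I t * ?P t) \<partial>lborel)"
 proof (rule integral_mono)
  show "Ipos t * f t * ?P t \<le> (f s * exp (2 * w)) * (?I t * ?P t) + Fm * (?P t - ?I t * ?P t)" for t
  proof (cases "t \<in> {t0 - w..t0 + w}")
   case True
   hence t: "t \<le> s" "s - 2 * w \<le> t" by (auto simp: t0_def)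
   have "f t = f t * exp (t - s) * exp (s - t)" by (simp flip: exp_add add: mult.assoc)
   also have "\<dots> \<le> f s * exp (2 * w)" using f_mono[OF t(1)] f_nonneg t by (intro mult_mono) auto
   finally have "f t * ?P t \<le> f s * exp (2 * w) * ?P t" by (intro mult_right_mono) auto
   thus ?thesis using True t assms by simp
  next
   case False
   have "Ipos t * f t * ?P t \<le> Fm * ?P t" using Fm[of t] Fm0 by (intro mult_right_mono) (auto split: split_indicator)
   thus ?thesis using False by simp
  qed
  show "integrable lborel (\<lambda>t. (f s * exp (2 * w)) * (?I t * ?P t) + Fm * (?P t - ?I t * ?P t))"
   using wm d by (intro Bochner_Integration.integrable_add integrable_mult_right Bochner_Integration.integrable_diff) auto
 qed (rule f_density_integrable[OF d(1)])
 also have "\<dots> = (f s * exp (2 * w)) * (\<integral>t. ?I t * ?P t \<partial>lborel) + Fm * (1 - (\<integral>t. ?I t * ?P t \<partial>lborel))"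
  using wm d by (simp add: Bochner_Integration.integral_add Bochner_Integration.integral_diff)
 also have "\<dots> \<le> (f s * exp (2 * w)) * 1 + Fm * w\<^sup>2"
 proof (intro add_mono mult_left_mono)
  have "(\<integral>t. ?I t * ?P t \<partial>lborel) \<le> (\<integral>t. ?P t \<partial>lborel)" using wm d by (intro integral_mono) (auto split: split_indicator)
  thus "(\<integral>t. ?I t * ?P t \<partial>lborel) \<le> 1" using d by simp
  show "1 - (\<integral>t. ?I t * ?P t \<partial>lborel) \<le> w\<^sup>2" using wm(2) unfolding dw by linarith
 qed (use Fm0 f_nonneg in auto)
 finally show ?thesis by simp
qed

text \<open>The errors are of order w and 1 / (w^(2N+2) s); the choice w = s^(-1/(2N+3)) makes them
  equal.\<close>

theorem tauberian_rate: "\<exists>K b. b > 0 \<and> (\<forall>s\<ge>1. \<bar>f s - \<kappa>\<bar> \<le> K * s powr (- b))"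
proof -
 define m where "m = 2 * N + 3"
 define b where "b = 1 / real m"
 have b: "b > 0" by (simp add: b_def m_def)
 \<comment> \<open>W s equals 1/2 exactly at s1; below s1 only the trivial bound f s <= s is
   used.\<close>
 define s1 where "s1 = (2::real) ^ m"
 have s1: "s1 \<ge> 1" by (simp add: s1_def)
 define W where "W s = s powr (- b)" for s
 have W: "0 < W s" "W s \<le> 1/2" "2 * W s \<le> s" "W s ^ (2 * N + 2) * s = 1 / W s" if "s \<ge> s1" for s
 proof -
  have s: "s \<ge> 1" using that s1 by linarith
  show "0 < W s" using s by (simp add: W_def)
  have "s powr (- b) \<le> s1 powr (- b)" using b s1 that by (intro powr_mono2') auto
  also have "s1 = 2 powr real m" by (simp add: s1_def powr_realpow)
  also have "(2 powr real m) powr (- b) = 2 powr (- 1)" unfolding powr_powr by (simp add: b_def m_def)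
  finally show W2: "W s \<le> 1/2" by (simp add: W_def powr_minus)
  thus "2 * W s \<le> s" using s by linarith
  have "W s ^ m = s powr (- b * real m)" using s by (simp add: W_def powr_powr flip: powr_realpow)
  also have "\<dots> = 1 / s" using s by (simp add: b_def m_def powr_minus divide_inverse)
  also have "W s ^ m = W s ^ (2 * N + 2) * W s" unfolding m_def by (simp add: eval_nat_numeral)
  finally have "W s ^ (2 * N + 2) * W s * s = 1" using s by simp
  thus "W s ^ (2 * N + 2) * s = 1 / W s" using \<open>0 < W s\<close> by (simp add: field_simps)
 qed
 define R where "R = D * E"
 have R: "R \<ge> 0" using D_nonneg E_nonneg by (simp add: R_def)
 have up: "f s \<le> \<kappa> + (7 * \<kappa> + 9 * R) * W s" if "s \<ge> s1" for s
 proof -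
  note w = W[OF that]
  define w where "w = W s"
  have w': "0 < w" "w \<le> 1/2" using w by (auto simp: w_def)
  have s: "s > 0" using that s1 by linarith
  have w2: "w\<^sup>2 \<le> 1/4" using power_mono[OF w'(2), of 2] w' by (simp add: power2_eq_square)
  have "f s * (exp (- 2 * w) * (1 - w\<^sup>2)) \<le> \<kappa> + R * w"
   using f_upper[OF s w(1,2)] w(4) unfolding R_def w_def by simp
  moreover have "1 - w\<^sup>2 > 0" using w2 by linarith
  ultimately have "f s \<le> (\<kappa> + R * w) * (exp (2 * w) / (1 - w\<^sup>2))"
   by (simp add: exp_minus field_simps)
  also have "\<dots> \<le> (\<kappa> + R * w) * (1 + 7 * w)"
  proof (rule mult_left_mono)
   have "exp (2 * w) \<le> 1 + 2 * w + (2 * w)\<^sup>2" using w' by (intro exp_bound) auto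
   also have "\<dots> \<le> 1 + 4 * w" using w' by (simp add: power2_eq_square)
   finally have 1: "exp (2 * w) \<le> 1 + 4 * w" .
   have "w * w\<^sup>2 \<le> w * (1/4)" using w2 w' by (intro mult_left_mono) auto
   moreover have "w\<^sup>2 \<le> w * (1/2)" unfolding power2_eq_square using w' by (intro mult_left_mono) auto
   moreover have "(1 + 7 * w) * (1 - w\<^sup>2) = 1 + 7 * w - w\<^sup>2 - 7 * (w * w\<^sup>2)" by (simp add: algebra_simps)
   ultimately have "1 + 4 * w \<le> (1 + 7 * w) * (1 - w\<^sup>2)" using w' by linarith
   thus "exp (2 * w) / (1 - w\<^sup>2) \<le> 1 + 7 * w" using 1 \<open>1 - w\<^sup>2 > 0\<close> by (simp add: pos_divide_le_eq)
  qed (use kappa R w' in auto)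
  also have "\<dots> \<le> \<kappa> + (7 * \<kappa> + 9 * R) * w"
  proof -
   have "R * w * (7 * w) \<le> R * w * 8" using R w' by (intro mult_left_mono) auto
   moreover have "(\<kappa> + R * w) * (1 + 7 * w) = \<kappa> + 7 * \<kappa> * w + R * w + R * w * (7 * w)" by (simp add: algebra_simps)
   moreover have "(7 * \<kappa> + 9 * R) * w = 7 * \<kappa> * w + R * w + R * w * 8" by (simp add: algebra_simps)
   ultimately show ?thesis by linarith
  qed
  finally show ?thesis by (simp add: w_def)
 qed
 \<comment> \<open>The global bound required by \<open>f_lower\<close>: the upper estimate beyond
   s1, the trivial bound before it.\<close>
 define Fm where "Fm = s1 + 5 * \<kappa> + 5 * R"
 have Fm: "f t \<le> Fm" if "t \<ge> 0" for t
 proof (cases "t \<ge> s1")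
  case True
  have "(7 * \<kappa> + 9 * R) * W t \<le> (7 * \<kappa> + 9 * R) * (1/2)" using W[OF True] kappa R by (intro mult_left_mono) auto
  hence "f t \<le> \<kappa> + (7 * \<kappa> + 9 * R) * (1/2)" using up[OF True] by linarith
  thus ?thesis using kappa R s1 unfolding Fm_def by (simp add: field_simps)
 next
  case False
  thus ?thesis using f_le[OF that] kappa R unfolding Fm_def by linarith
 qed
 have Fm0: "Fm \<ge> 0" using Fm[of 0] f_nonneg[of 0] by simp
 have lo: "f s \<ge> \<kappa> - (3 * \<kappa> + 2 * R + Fm) * W s" if "s \<ge> s1" for s
 proof -
  note w = W[OF that]
  define w where "w = W s"
  have w': "0 < w" "w \<le> 1/2" using w by (auto simp: w_def)
  have s: "s > 0" using that s1 by linarith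
  define X where "X = \<kappa> * (1 - w\<^sup>2) - 2 * R * w - Fm * w\<^sup>2"
  have ww: "w\<^sup>2 \<le> w" unfolding power2_eq_square using w' mult_left_mono[of w 1 w] by simp
  have Rw: "D * E / (w ^ (2 * N + 2) * (s / 2)) = 2 * R * w"
   using w(4) unfolding R_def w_def by (simp add: divide_divide_eq_right)
  have "X \<le> f s * exp (2 * w)" using f_lower[OF s w(1-3) Fm] unfolding X_def w_def[symmetric] Rw by linarith
  hence XX: "X * exp (- 2 * w) \<le> f s" by (simp add: exp_minus field_simps)
  have "X \<le> \<kappa>" using kappa R Fm0 w' by (simp add: X_def algebra_simps)
  have "X - 2 * w * \<kappa> \<le> f s"
  proof (cases "X \<ge> 0")
   case True
   have "1 - 2 * w \<le> exp (- 2 * w)" using exp_ge_add_one_self[of "- 2 * w"] by simp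
   hence "X * (1 - 2 * w) \<le> X * exp (- 2 * w)" using True by (intro mult_left_mono)
   moreover have "X * (2 * w) \<le> \<kappa> * (2 * w)" using \<open>X \<le> \<kappa>\<close> w' by (intro mult_right_mono) auto
   ultimately show ?thesis using XX by (simp add: algebra_simps)
  next
   case False
   have "0 \<le> 2 * w * \<kappa>" using w' kappa by simp
   thus ?thesis using False f_nonneg[of s] by linarith
  qed
  moreover have "\<kappa> - (\<kappa> + 2 * R + Fm) * w \<le> X"
  proof -
   have "\<kappa> * w\<^sup>2 \<le> \<kappa> * w" "Fm * w\<^sup>2 \<le> Fm * w" using ww kappa Fm0 by (auto intro: mult_left_mono)
   thus ?thesis by (simp add: X_def algebra_simps)
  qed
  ultimately show ?thesis unfolding w_def[symmetric] by (simp add: algebra_simps)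
 qed
 define K where "K = (s1 + \<kappa>) * s1 powr b + 10 * \<kappa> + 11 * R + Fm"
 have "\<bar>f s - \<kappa>\<bar> \<le> K * s powr (- b)" if s: "s \<ge> 1" for s
 proof (cases "s \<ge> s1")
  case True
  have Wn: "W s \<ge> 0" using W(1)[OF True] by simp
  have K1: "7 * \<kappa> + 9 * R \<le> K" "3 * \<kappa> + 2 * R + Fm \<le> K" using kappa R Fm0 s1 unfolding K_def by (auto intro: add_nonneg_nonneg)
  have "(7 * \<kappa> + 9 * R) * W s \<le> K * W s" "(3 * \<kappa> + 2 * R + Fm) * W s \<le> K * W s" using K1 Wn by (auto intro: mult_right_mono)
  thus ?thesis using up[OF True] lo[OF True] unfolding W_def[symmetric] by (simp add: abs_le_iff)
 next
  case False
  have "\<bar>f s - \<kappa>\<bar> \<le> s1 + \<kappa>" using f_le[of s] f_nonneg[of s] False s kappa by (simp add: abs_le_iff)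
  also have "\<dots> = (s1 + \<kappa>) * s1 powr b * s1 powr (- b)" using s1 by (simp add: powr_minus)
  also have "\<dots> \<le> (s1 + \<kappa>) * s1 powr b * s powr (- b)" using False s b s1 kappa by (intro mult_left_mono powr_mono2') auto
  also have "\<dots> \<le> K * s powr (- b)" using kappa R Fm0 unfolding K_def by (intro mult_right_mono) auto
  finally show ?thesis .
 qed
 thus ?thesis using b by blast
qed

end

section \<open>The prime number theorem for weights attached to residue classes\<close>

text \<open>The factor phi(q) gives every class density 1 among the primes. Class weights and
  \<open>all_weight\<close> then obey the same prime number theorem and differ only in their Mertens
  constants.\<close>

definition class_weight :: "nat => int => nat => real" where
 "class_weight q c p = (if prime p \<and> [int p = c] (mod int q) then rphi q else 0)"

definition all_weight :: "nat => nat => real" where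
 "all_weight q p = (if prime p \<and> coprime p q then 1 else 0)"

definition th :: "(nat => real) => real => real" where "th u x = (\<Sum>p\<le>nfloor x. u p * ln (real p))"
definition mu :: "(nat => real) => real => real" where "mu u x = (\<Sum>p\<le>nfloor x. u p / real p)"

text \<open>Proper prime powers up to x have a base of at most sqrt x, and all powers of one base
  together contribute at most ln x.\<close>

lemma mangoldt_nonprime_sum_le:
 assumes "x \<ge> 1"
 shows "(\<Sum>n | n \<le> nfloor x \<and> \<not> prime n. mangoldt n) \<le> sqrt x * ln x"
proof -
 define P where "P = {p. prime p \<and> real p \<le> sqrt x}"
 have finP: "finite P" by (rule finite_subset[of _ "{..nfloor (sqrt x)}"]) (auto simp: P_def le_nat_floor)
 define R where "R p = {1..nfloor (ln x / ln (real p))}" for p :: nat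
 let ?S = "{n. n \<le> nfloor x \<and> \<not> prime n \<and> primepow n}"
 have sub: "?S \<subseteq> (\<lambda>(p, k). p ^ k) ` (Sigma P R)"
 proof
  fix n assume n: "n \<in> ?S"
  then obtain p k where pk: "prime p" "k > 0" "n = p ^ k" by (auto simp: primepow_def)
  hence k2: "k \<ge> 2" using n by (cases "k = 1") auto
  have nx: "real p ^ k \<le> x" using n pk assms by (metis (no_types, lifting) mem_Collect_eq le_nat_floor of_nat_floor of_nat_le_iff of_nat_power order_trans zero_le_one)
  have p2: "real p \<ge> 2" using prime_ge_2_nat[OF pk(1)] by simp
  have "real p ^ 2 \<le> real p ^ k" using k2 p2 by (intro power_increasing) auto
  hence "real p \<le> sqrt x" using nx by (intro real_le_rsqrt) simp
  moreover have "real k * ln (real p) \<le> ln x"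
   using nx p2 assms ln_mono[of "real p ^ k" x] by (simp add: ln_realpow)
  hence "real k \<le> ln x / ln (real p)" using p2 by (simp add: pos_le_divide_eq)
  hence "k \<in> R p" using pk(2) by (auto simp: R_def le_nat_floor)
  ultimately have "(p, k) \<in> Sigma P R" using pk by (auto simp: P_def)
  thus "n \<in> (\<lambda>(p, k). p ^ k) ` (Sigma P R)" using pk(3) by force
 qed
 have finS: "finite (Sigma P R)" using finP by (auto simp: R_def)
 have "(\<Sum>n | n \<le> nfloor x \<and> \<not> prime n. mangoldt n) = (\<Sum>n\<in>?S. mangoldt n :: real)"
  by (rule sum.mono_neutral_right) (auto simp: mangoldt_def)
 also have "\<dots> \<le> (\<Sum>n\<in>(\<lambda>(p, k). p ^ k) ` (Sigma P R). mangoldt n)"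
  by (rule sum_mono2[OF finite_imageI[OF finS] sub]) (simp add: mangoldt_nonneg)
 also have "\<dots> \<le> (\<Sum>pk\<in>Sigma P R. mangoldt ((\<lambda>(p, k). p ^ k) pk))"
  proof (rule order_trans[OF sum_image_le[OF finS]])
  show "0 \<le> (mangoldt ((\<lambda>(p, k). p ^ k) i) :: real)" for i by (rule mangoldt_nonneg)
 qed (simp add: o_def)
 also have "\<dots> = (\<Sum>p\<in>P. \<Sum>k\<in>R p. mangoldt (p ^ k))"
  using finP by (subst sum.Sigma) (auto simp: R_def case_prod_unfold)
 also have "\<dots> \<le> (\<Sum>p\<in>P. ln x)"
 proof (rule sum_mono)
  fix p assume p: "p \<in> P"
  hence p2: "real p \<ge> 2" and pr: "prime p" using prime_ge_2_nat[of p] by (auto simp: P_def)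
  have "(\<Sum>k\<in>R p. mangoldt (p ^ k) :: real) = real (nfloor (ln x / ln (real p))) * ln (real p)"
   using pr by (simp add: R_def)
  also have "\<dots> \<le> ln x / ln (real p) * ln (real p)" using assms p2 by (intro mult_right_mono) auto
  also have "\<dots> = ln x" using p2 by simp
  finally show "(\<Sum>k\<in>R p. mangoldt (p ^ k)) \<le> ln x" .
 qed
 also have "\<dots> = real (card P) * ln x" by simp
 also have "real (card P) * ln x \<le> sqrt x * ln x"
 proof (rule mult_right_mono)
  have "card P \<le> card {1..nfloor (sqrt x)}"
   by (rule card_mono) (auto simp: P_def le_nat_floor Suc_le_eq prime_gt_0_nat)
  hence "real (card P) \<le> real (nfloor (sqrt x))" by simp
  also have "\<dots> \<le> sqrt x" using assms by (intro of_nat_floor) auto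
  finally show "real (card P) \<le> sqrt x" .
 qed (use assms in auto)
 finally show ?thesis .
qed

lemma sqrt_ln_le: assumes "x \<ge> 3" "b \<le> 1" shows "sqrt x * ln x \<le> 16 * x * ln x powr (- b)"
proof -
 have l: "1 \<le> ln x" using assms(1) exp_le ln_ge_iff[of x 1] by simp
 have "ln x \<le> x powr (1/4) / (1/4)" using assms by (intro ln_powr_bound) auto
 hence "(ln x)\<^sup>2 \<le> (4 * x powr (1/4))\<^sup>2" using l by (intro power_mono) auto
 also have "\<dots> = 16 * (x powr (1/4) * x powr (1/4))" by (simp add: power2_eq_square)
 also have "\<dots> = 16 * sqrt x" using assms by (simp add: powr_half_sqrt flip: powr_add)
 finally have "sqrt x * (ln x)\<^sup>2 \<le> sqrt x * (16 * sqrt x)" using assms by (intro mult_left_mono) auto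
 moreover have "sqrt x * (16 * sqrt x) = 16 * x" using assms(1) by simp
 ultimately have "sqrt x * (ln x)\<^sup>2 \<le> 16 * x" by linarith
 hence "sqrt x * ln x \<le> 16 * x / ln x" using l by (simp add: field_simps power2_eq_square)
 also have "16 * x / ln x = 16 * x * ln x powr (- 1)" using l by (simp add: powr_minus divide_inverse)
 also have "\<dots> \<le> 16 * x * ln x powr (- b)" using assms l by (intro mult_left_mono powr_mono) auto
 finally show ?thesis .
qed

text \<open>The Tauberian theorem at t = ln x. Passing from prime powers to primes costs sqrt x * ln
  x, which the error term absorbs once b is cut down to at most 1.\<close>

theorem PNT_class:
 assumes "q > 0" "coprime c (int q)"
 shows "\<exists>K b. 0 < b \<and> b \<le> 1 \<and> (\<forall>x\<ge>3. \<bar>th (class_weight q c) x - x\<bar> \<le> K * x * ln x powr (- b))"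
proof -
 define r where "r = nat (c mod int q)"
 have rc: "int r = c mod int q" using assms(1) by (simp add: r_def)
 have cong: "[int p = c] (mod int q) \<longleftrightarrow> [p = r] (mod q)" for p
  unfolding cong_int_iff[symmetric] rc by (simp add: cong_def)
 have cr: "coprime r q"
  using assms by (metis coprime_int_iff coprime_mod_left_iff gcd_0_int of_nat_0_less_iff order_less_irrefl rc)
 define a where "a n = (if [n = r] (mod q) then mangoldt n else (0::real))" for n
 define \<kappa> where "\<kappa> = 1 / rphi q"
 obtain H H' B where HH: "\<forall>s. Re s > 1 --> (H has_field_derivative H' s) (at s)" "B \<ge> 0"
   "\<forall>s. 1 < Re s --> Re s \<le> 2 --> norm (H s) \<le> B * (1 + \<bar>Im s\<bar>) ^ 32 \<and> norm (H' s) \<le> B * (1 + \<bar>Im s\<bar>) ^ 32"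
   "\<forall>s. Re s > 1 --> (\<lambda>n. (if [n = r] (mod q) then mangoldt n else 0) * npow n s) sums
    (1 / of_nat (totient q) / (s - 1) + H s)"
  using mangoldt_class_series[OF assms(1) cr] by (elim exE conjE)
 have ac: "(if [n = r] (mod q) then mangoldt n else 0) = complex_of_real (a n)" for n by (simp add: a_def)
 interpret tauberian a \<kappa> H H' B 32
 proof
  show "(\<lambda>n. of_real (a n) * npow n s) sums (of_real \<kappa> / (s - 1) + H s)" if "Re s > 1" for s
   using HH(4) that unfolding ac by (simp add: \<kappa>_def)
  show "a n \<le> ln (real n)" if "n > 0" for n using mangoldt_le_ln[OF that] that by (auto simp: a_def)
 qed (use HH in "auto simp: a_def mangoldt_nonneg \<kappa>_def")
 obtain K b where Kb: "b > 0" "\<And>s. s \<ge> 1 ==> \<bar>f s - \<kappa>\<bar> \<le> K * s powr (- b)" using tauberian_rate by blast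
 define b' where "b' = min b 1"
 define phi where "phi = rphi q"
 have phi: "phi \<ge> 1" using assms(1) by (simp add: phi_def Suc_le_eq)
 show ?thesis
 proof (rule exI[of _ "phi * (\<bar>K\<bar> + 16)"], rule exI[of _ b'], intro conjI allI impI)
  show "0 < b'" "b' \<le> 1" using Kb by (auto simp: b'_def)
  fix x :: real assume x: "x \<ge> 3"
  have l: "1 \<le> ln x" using x exp_le ln_ge_iff[of x 1] by simp
  have "\<bar>f (ln x) - \<kappa>\<bar> \<le> K * ln x powr (- b)" by (rule Kb(2)[OF l])
  also have "\<dots> \<le> \<bar>K\<bar> * ln x powr (- b')" using l by (intro mult_mono powr_mono) (auto simp: b'_def)
  finally have "x * \<bar>f (ln x) - \<kappa>\<bar> \<le> x * (\<bar>K\<bar> * ln x powr (- b'))" using x by (intro mult_left_mono) auto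
  moreover have "x * \<bar>f (ln x) - \<kappa>\<bar> = \<bar>A (ln x) - x / phi\<bar>"
  proof -
   have "x * (f (ln x) - \<kappa>) = A (ln x) - x / phi" using x by (simp add: f_def \<kappa>_def phi_def exp_minus field_simps)
   thus ?thesis using x by (metis abs_mult abs_of_nonneg order_trans zero_le_numeral)
  qed
  ultimately have 1: "\<bar>A (ln x) - x / phi\<bar> \<le> x * (\<bar>K\<bar> * ln x powr (- b'))" by simp
  define n0 where "n0 = nfloor x"
  have "A (ln x) = (\<Sum>n=1..n0. a n)" unfolding A_def index_eq n0_def using x by simp
  also have "\<dots> = (\<Sum>n\<le>n0. a n)" by (rule sum.mono_neutral_left) (auto simp: a0 not_less_eq_eq)
  also have "\<dots> = (\<Sum>n | n \<le> n0 \<and> prime n. a n) + (\<Sum>n | n \<le> n0 \<and> \<not> prime n. a n)"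
   by (subst sum.union_disjoint[symmetric]) (auto intro!: sum.cong)
  also have "(\<Sum>n | n \<le> n0 \<and> prime n. a n) = th (class_weight q c) x / phi"
  proof -
   have "th (class_weight q c) x = (\<Sum>n | n \<le> n0 \<and> prime n. phi * a n)"
    unfolding th_def n0_def[symmetric]
    by (rule sum.mono_neutral_cong_right) (auto simp: class_weight_def a_def phi_def cong)
   thus ?thesis using phi by (simp flip: sum_distrib_left)
  qed
  finally have A: "A (ln x) = th (class_weight q c) x / phi + (\<Sum>n | n \<le> n0 \<and> \<not> prime n. a n)" .
  have "(\<Sum>n | n \<le> n0 \<and> \<not> prime n. a n) \<le> (\<Sum>n | n \<le> n0 \<and> \<not> prime n. mangoldt n)"
   by (intro sum_mono) (auto simp: a_def mangoldt_nonneg)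
  also have "\<dots> \<le> sqrt x * ln x" unfolding n0_def using x by (intro mangoldt_nonprime_sum_le) auto
  also have "\<dots> \<le> 16 * x * ln x powr (- b')" by (rule sqrt_ln_le[OF x]) (simp add: b'_def)
  finally have 2: "(\<Sum>n | n \<le> n0 \<and> \<not> prime n. a n) \<le> 16 * x * ln x powr (- b')" .
  have 3: "(\<Sum>n | n \<le> n0 \<and> \<not> prime n. a n) \<ge> 0" by (intro sum_nonneg a_nonneg)
  have "\<bar>th (class_weight q c) x / phi - x / phi\<bar> \<le> (\<bar>K\<bar> + 16) * x * ln x powr (- b')"
   using 1 2 3 unfolding A by (simp add: abs_le_iff algebra_simps)
  hence "phi * \<bar>th (class_weight q c) x / phi - x / phi\<bar> \<le> phi * ((\<bar>K\<bar> + 16) * x * ln x powr (- b'))"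
   using phi by (intro mult_left_mono) auto
  moreover have "phi * \<bar>th (class_weight q c) x / phi - x / phi\<bar> = \<bar>th (class_weight q c) x - x\<bar>"
  proof -
   have "th (class_weight q c) x / phi - x / phi = (th (class_weight q c) x - x) / phi" by (simp add: diff_divide_distrib)
   thus ?thesis using phi by (simp add: abs_divide)
  qed
  ultimately show "\<bar>th (class_weight q c) x - x\<bar> \<le> phi * (\<bar>K\<bar> + 16) * x * ln x powr (- b')" by (simp add: mult.assoc)
 qed
qed

lemma all_weight_average:
 assumes "q > 0"
 shows "all_weight q p = (\<Sum>c | c < q \<and> coprime c q. class_weight q (int c) p) / rphi q"
proof (cases "prime p \<and> coprime p q")
 case True
 have phi: "totient q > 0" using assms by simp
 have "(\<Sum>c | c < q \<and> coprime c q. class_weight q (int c) p) = (\<Sum>c | c < q \<and> coprime c q. if c = p mod q then rphi q else 0)"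
  using True unfolding class_weight_def cong_int_iff by (intro sum.cong refl) (auto simp: cong_def)
 also have "\<dots> = rphi q" using True assms by (subst sum.delta) auto
 finally show ?thesis using True phi by (simp add: all_weight_def)
next
 case False
 have "class_weight q (int c) p = 0" if "c < q" "coprime c q" for c
 proof (cases "prime p")
  case True
  hence "\<not> coprime p q" using False by simp
  hence "\<not> [p = c] (mod q)" using that by (metis cong_imp_coprime cong_sym)
  thus ?thesis by (simp add: class_weight_def cong_int_iff)
 qed (simp add: class_weight_def)
 hence "(\<Sum>c | c < q \<and> coprime c q. class_weight q (int c) p) = 0" by (intro sum.neutral) auto
 moreover have "all_weight q p = 0" using False by (auto simp: all_weight_def)
 ultimately show ?thesis by simp
qed

lemma card_coprime_below:
 assumes "q \<ge> 2" shows "card {c. c < q \<and> coprime c q} = totient q"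
proof -
 have "c < q \<and> coprime c q \<longleftrightarrow> c \<in> totatives q" for c
  using assms totatives_less[of c q] by (cases "c = 0") (auto simp: totatives_def)
 hence "{c. c < q \<and> coprime c q} = totatives q" by blast
 thus ?thesis by (simp add: totient_def)
qed

text \<open>U collects all weights in play so that one pair K, b serves them all. This uniformity is
  needed because the tuple of residues is quantified after the constants and may vary with
  x.\<close>

locale prime_weights =
 fixes U :: "(nat => real) set" and M K b :: real
 assumes u_nonneg: "\<And>u p. u \<in> U ==> u p \<ge> 0" and u_le: "\<And>u p. u \<in> U ==> u p \<le> M"
  and u_prime: "\<And>u p. u \<in> U ==> \<not> prime p ==> u p = 0"
  and M: "M \<ge> 1" and K: "K \<ge> 1" and b: "0 < b" "b \<le> 1"
  and pnt: "\<And>u x. u \<in> U ==> x \<ge> 3 ==> \<bar>th u x - x\<bar> \<le> K * x * ln x powr (- b)"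

text \<open>A class weight depends on c only modulo q, so constants of finitely many classes have to
  be merged. \<open>all_weight\<close> is the mean of the class weights and inherits their
  estimate.\<close>

lemma PNT_weights:
 assumes "q \<ge> 2"
 shows "\<exists>K b. prime_weights (insert (all_weight q) (class_weight q ` {c. coprime c (int q)})) (rphi q) K b"
proof -
 let ?A = "class_weight q ` {c. coprime c (int q)}"
 have q0: "q > 0" using assms by simp
 define R where "R = {c. c < q \<and> coprime c q}"
 have finR: "finite R" and neR: "R \<noteq> {}" using assms by (auto simp: R_def intro!: exI[of _ 1])
 have "\<forall>c\<in>R. \<exists>K b. 0 < b \<and> b \<le> 1 \<and> (\<forall>x\<ge>3. \<bar>th (class_weight q (int c)) x - x\<bar> \<le> K * x * ln x powr (- b))"
  using PNT_class[OF q0] by (auto simp: R_def)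
 then obtain K b where Kb: "\<And>c. c \<in> R ==> 0 < b c \<and> b c \<le> 1"
   "\<And>c x. c \<in> R ==> x \<ge> 3 ==> \<bar>th (class_weight q (int c)) x - x\<bar> \<le> K c * x * ln x powr (- b c)" by metis
 define K0 where "K0 = 1 + (\<Sum>c\<in>R. \<bar>K c\<bar>)"
 define b0 where "b0 = Min (b ` R)"
 have b0: "0 < b0" "b0 \<le> 1" "\<And>c. c \<in> R ==> b0 \<le> b c"
  using finR neR Kb unfolding b0_def by (auto simp: Min_le_iff)
 have cls: "\<bar>th (class_weight q (int c)) x - x\<bar> \<le> K0 * x * ln x powr (- b0)" if "c \<in> R" "x \<ge> 3" for c x
 proof -
  have l: "1 \<le> ln x" using that exp_le ln_ge_iff[of x 1] by simp
  have "\<bar>K c\<bar> \<le> (\<Sum>c\<in>R. \<bar>K c\<bar>)" by (rule member_le_sum) (use that finR in auto)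
  hence "K c * x * ln x powr (- b c) \<le> K0 * x * ln x powr (- b0)"
   using that l b0(3)[OF that(1)] by (intro mult_mono powr_mono) (auto simp: K0_def intro: add_nonneg_nonneg sum_nonneg)
  with Kb(2)[OF that] show ?thesis by linarith
 qed
 have allw: "\<bar>th (all_weight q) x - x\<bar> \<le> K0 * x * ln x powr (- b0)" if "x \<ge> 3" for x
 proof -
  define phi where "phi = rphi q"
  have phi: "phi > 0" using q0 by (simp add: phi_def)
  have cR: "real (card R) = phi" using card_coprime_below[OF assms] by (simp add: R_def phi_def)
  have "th (all_weight q) x = (\<Sum>c\<in>R. th (class_weight q (int c)) x) / phi"
   unfolding th_def all_weight_average[OF q0] R_def[symmetric] phi_def[symmetric]
   by (subst sum.swap) (simp add: sum_divide_distrib sum_distrib_right)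
  also have "\<dots> - x = (\<Sum>c\<in>R. th (class_weight q (int c)) x - x) / phi"
   using phi cR by (simp add: sum_subtractf diff_divide_distrib)
  also have "\<bar>\<dots>\<bar> \<le> (\<Sum>c\<in>R. \<bar>th (class_weight q (int c)) x - x\<bar>) / phi"
   using phi by (simp add: abs_divide divide_right_mono sum_abs)
  also have "\<dots> \<le> (\<Sum>c\<in>R. K0 * x * ln x powr (- b0)) / phi"
   using phi cls that by (intro divide_right_mono sum_mono) auto
  also have "\<dots> = K0 * x * ln x powr (- b0)" using phi cR by simp
  finally show ?thesis .
 qed
 have red: "class_weight q c = class_weight q (int (nat (c mod int q)))" "nat (c mod int q) \<in> R" if "coprime c (int q)" for c
 proof -
  have rc: "int (nat (c mod int q)) = c mod int q" using q0 by simp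
  show "class_weight q c = class_weight q (int (nat (c mod int q)))"
   unfolding rc class_weight_def by (auto simp: cong_def)
  have "coprime (int (nat (c mod int q))) (int q)" unfolding rc using that q0 by simp
  hence "coprime (nat (c mod int q)) q" by (simp only: coprime_int_iff)
  moreover have "nat (c mod int q) < q" using q0 by (simp add: nat_less_iff)
  ultimately show "nat (c mod int q) \<in> R" by (simp add: R_def)
 qed
 have "prime_weights (insert (all_weight q) ?A) (rphi q) K0 b0"
 proof
  have "totient q \<ge> 1" using q0 by (simp add: Suc_le_eq)
  thus tq: "rphi q \<ge> 1" by simp
  show "u p \<le> rphi q" if "u \<in> insert (all_weight q) ?A" for u p
  proof -
   have "all_weight q p \<le> rphi q" "class_weight q c p \<le> rphi q" for c
    using tq by (auto simp: all_weight_def class_weight_def)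
   thus ?thesis using that by blast
  qed
  show "K0 \<ge> 1" by (simp add: K0_def sum_nonneg)
  show "\<bar>th u x - x\<bar> \<le> K0 * x * ln x powr (- b0)" if "u \<in> insert (all_weight q) ?A" "x \<ge> 3" for u x
  proof (cases "u = all_weight q")
   case False
   with that(1) have "u \<in> class_weight q ` {c. coprime c (int q)}" by (simp only: insert_iff simp_thms)
   then obtain c where c: "u = class_weight q c" "c \<in> {c. coprime c (int q)}" by (rule imageE)
   hence c: "coprime c (int q)" "u = class_weight q c" by (simp_all only: mem_Collect_eq)
   have "u = class_weight q (int (nat (c mod int q)))" by (rule trans[OF c(2) red(1)[OF c(1)]])
   thus ?thesis using cls[OF red(2)[OF c(1)] that(2)] by (simp only:)
  qed (use allw that in simp)
  show "u p \<ge> 0" if "u \<in> insert (all_weight q) ?A" for u p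
   using that by (elim insertE imageE) (simp_all add: all_weight_def class_weight_def)
  show "u p = 0" if "u \<in> insert (all_weight q) ?A" "\<not> prime p" for u p
   using that by (elim insertE imageE) (simp_all add: all_weight_def class_weight_def)
 qed (use b0 in auto)
 thus ?thesis by blast
qed

section \<open>Chebyshev and Mertens estimates, uniform over the weights\<close>

text \<open>The telescoping majorant Q provides convergence and an explicit rate at the same
  time.\<close>

lemma telescoping_limit:
 fixes W Q :: "nat => real"
 assumes step: "\<And>n. n \<ge> n0 ==> \<bar>W (Suc n) - W n\<bar> \<le> Q n - Q (Suc n)" and Q: "Q \<longlonglongrightarrow> 0"
 shows "\<exists>L. \<forall>n\<ge>n0. \<bar>W n - L\<bar> \<le> Q n"
proof -
 have diff: "\<bar>W n - W m\<bar> \<le> Q m - Q n" if "n0 \<le> m" "m \<le> n" for m n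
  using that(2)
 proof (induction n rule: dec_induct)
  case (step n)
  thus ?case using assms(1)[of n] that(1) by linarith
 qed simp
 have Qdec: "Q n \<le> Q m" if "n0 \<le> m" "m \<le> n" for m n using diff[OF that] by linarith
 have Qnn: "Q m \<ge> 0" if "n0 \<le> m" for m
  by (rule LIMSEQ_le_const2[OF Q]) (use Qdec[OF that] in blast)
 have "Cauchy W"
 proof (rule metric_CauchyI)
  fix e :: real assume "e > 0"
  hence "\<forall>\<^sub>F n in sequentially. Q n < e / 2" using order_tendstoD(2)[OF Q, of "e / 2"] by simp
  then obtain m0 where m0: "\<And>n. n \<ge> m0 ==> Q n < e / 2" by (auto simp: eventually_sequentially)
  define m where "m = max m0 n0"
  have "dist (W i) (W j) < e" if "i \<ge> m" "j \<ge> m" for i j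
   using diff[of m i] diff[of m j] Qnn[of i] Qnn[of j] m0[of m] that by (simp add: dist_real_def m_def)
  thus "\<exists>m. \<forall>i\<ge>m. \<forall>j\<ge>m. dist (W i) (W j) < e" by blast
 qed
 then obtain L where L: "W \<longlonglongrightarrow> L" using Cauchy_convergent convergent_def by blast
 have "\<bar>W m - L\<bar> \<le> Q m" if m: "n0 \<le> m" for m
 proof (rule LIMSEQ_le_const2[OF tendsto_rabs[OF tendsto_diff[OF tendsto_const L]]])
  show "\<exists>N. \<forall>n\<ge>N. \<bar>W m - W n\<bar> \<le> Q m"
  proof (intro exI[of _ m] allI impI)
   fix n assume "n \<ge> m"
   thus "\<bar>W m - W n\<bar> \<le> Q m" using diff[OF m, of n] Qnn[of n] m by linarith
  qed
 qed
 thus ?thesis by blast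
qed

lemma ln_ge_1: "x \<ge> 3 ==> ln x \<ge> (1::real)"
 using exp_le ln_ge_iff[of x 1] by simp

text \<open>The derivative of ln ln at n, and at the same time the factor that turns u p * ln p into
  u p / p.\<close>

definition lngap :: "nat => real" where "lngap n = 1 / (real n * ln (real n))"

lemma ln_diff_bounds:
 fixes a c :: real assumes "a > 0" "c > 0"
 shows "(c - a) / c \<le> ln c - ln a" "ln c - ln a \<le> (c - a) / a"
proof -
 have "ln (a / c) \<le> a / c - 1" using assms by (intro ln_le_minus_one) auto
 thus "(c - a) / c \<le> ln c - ln a" using assms by (simp add: ln_div diff_divide_distrib)
 have "ln (c / a) \<le> c / a - 1" using assms by (intro ln_le_minus_one) auto
 thus "ln c - ln a \<le> (c - a) / a" using assms by (simp add: ln_div diff_divide_distrib)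
qed

lemma lnln_step:
 assumes "n \<ge> 3"
 shows "lngap (Suc n) \<le> lnln (real (Suc n)) - lnln (real n)"
  "lnln (real (Suc n)) - lnln (real n) \<le> lngap n"
  "real (Suc n) * (lngap (Suc n) - lngap (Suc (Suc n))) \<le> 2 * lngap (Suc n)"
  "lngap (Suc n) \<le> lngap n"
proof -
 have l: "ln (real n) \<ge> 1" "ln (real (Suc n)) \<ge> 1" "ln (real (Suc (Suc n))) \<ge> 1" using assms by (auto intro!: ln_ge_1)
 have mono: "ln (real n) \<le> ln (real (Suc n))" using assms by simp
 have r: "ln (real (Suc n)) - ln (real n) = ln (real (Suc n) / real n)" using assms by (simp add: ln_div)
 have up: "ln (real (Suc k)) - ln (real k) \<le> 1 / real k" if "k > 0" for k
 proof -
  have "ln (real (Suc k) / real k) \<le> real (Suc k) / real k - 1" using that by (intro ln_le_minus_one) auto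
  thus ?thesis using that by (simp add: ln_div field_simps)
 qed
 have lo: "1 / real (Suc n) \<le> ln (real (Suc n)) - ln (real n)"
 proof -
  have "ln (real n / real (Suc n)) \<le> real n / real (Suc n) - 1" using assms by (intro ln_le_minus_one) auto
  moreover have "real n / real (Suc n) - 1 = - (1 / real (Suc n))" by (simp add: field_simps)
  ultimately show ?thesis using assms by (simp add: ln_div)
 qed
 have "(ln (real (Suc n)) - ln (real n)) / ln (real (Suc n)) \<le> lnln (real (Suc n)) - lnln (real n)"
  by (rule ln_diff_bounds) (use l in linarith)+
 moreover have "lngap (Suc n) \<le> (ln (real (Suc n)) - ln (real n)) / ln (real (Suc n))"
  using divide_right_mono[OF lo, of "ln (real (Suc n))"] l by (simp add: lngap_def)
 ultimately show "lngap (Suc n) \<le> lnln (real (Suc n)) - lnln (real n)" by linarith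
 have "lnln (real (Suc n)) - lnln (real n) \<le> (ln (real (Suc n)) - ln (real n)) / ln (real n)"
  by (rule ln_diff_bounds) (use l in linarith)+
 also have "\<dots> \<le> lngap n" using divide_right_mono[OF up[of n], of "ln (real n)"] l assms by (simp add: lngap_def)
 finally show "lnln (real (Suc n)) - lnln (real n) \<le> lngap n" .
 show "lngap (Suc n) \<le> lngap n" unfolding lngap_def using assms l mono
  by (intro divide_left_mono mult_mono mult_pos_pos) auto
 define a where "a = ln (real (Suc n))"
 define c where "c = ln (real (Suc (Suc n)))"
 have ac: "a \<ge> 1" "c \<ge> 1" "c - a \<le> 1 / real (Suc n)" using l up[of "Suc n"] by (auto simp: a_def c_def)
 have "real (Suc n) * (lngap (Suc n) - lngap (Suc (Suc n))) = 1 / a - real (Suc n) / (real (Suc (Suc n)) * c)"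
  using ac unfolding lngap_def a_def[symmetric] c_def[symmetric] by (simp add: right_diff_distrib del: of_nat_Suc)
 also have "real (Suc n) / (real (Suc (Suc n)) * c) = 1 / c - 1 / (real (Suc (Suc n)) * c)"
 proof -
  have "(r - 1) / (r * c) = 1 / c - 1 / (r * c)" if "r > 0" for r
   using that ac by (simp add: diff_divide_distrib)
  from this[of "real (Suc (Suc n))"] show ?thesis by simp
 qed
 also have "1 / a - (1 / c - 1 / (real (Suc (Suc n)) * c)) = (c - a) / (a * c) + 1 / (real (Suc (Suc n)) * c)"
  using ac by (simp add: field_simps)
 also have "\<dots> \<le> 1 / (real (Suc n) * a) + 1 / (real (Suc n) * a)"
 proof (rule add_mono)
  have "(c - a) / (a * c) \<le> (1 / real (Suc n)) / (a * c)" using ac by (intro divide_right_mono) auto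
  also have "\<dots> \<le> (1 / real (Suc n)) / (a * 1)" using ac by (intro divide_left_mono mult_left_mono) auto
  finally show "(c - a) / (a * c) \<le> 1 / (real (Suc n) * a)" by simp
  have "a \<le> c" by (simp add: a_def c_def)
  thus "1 / (real (Suc (Suc n)) * c) \<le> 1 / (real (Suc n) * a)"
   using ac by (intro divide_left_mono mult_mono mult_pos_pos) auto
 qed
 finally show "real (Suc n) * (lngap (Suc n) - lngap (Suc (Suc n))) \<le> 2 * lngap (Suc n)"
  by (simp add: lngap_def a_def)
qed

context prime_weights
begin

text \<open>A common Chebyshev constant: K + 1 comes from the prime number theorem for x >= 3, and M
  from the prime 2, the only one below 3.\<close>

definition Ch where "Ch = K + 1 + M"

lemma Ch: "Ch \<ge> 3" using K M by (simp add: Ch_def)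

lemma th_nonneg: "u \<in> U ==> th u x \<ge> 0"
proof -
 assume u: "u \<in> U"
 have "0 \<le> u p * ln (real p)" for p using u_nonneg[OF u, of p] by (cases "p = 0") auto
 thus ?thesis unfolding th_def by (intro sum_nonneg)
qed

lemma u_0: "u \<in> U ==> u 0 = 0" using u_prime[of u 0] by simp

lemma chebyshev:
 assumes "u \<in> U" "x \<ge> 0" shows "th u x \<le> Ch * x"
proof (cases "x \<ge> 3")
 case True
 have "ln x powr (- b) \<le> 1" using ln_ge_1[OF True] b powr_mono[of "-b" 0 "ln x"] by simp
 hence "K * x * ln x powr (- b) \<le> K * x * 1" using K True by (intro mult_left_mono) auto
 moreover have "th u x \<le> x + K * x * ln x powr (- b)" using pnt[OF assms(1) True] by linarith
 moreover have "0 \<le> M * x" using M assms by simp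
 ultimately show ?thesis unfolding Ch_def distrib_right by linarith
next
 case False
 define n where "n = nfloor x"
 have n: "n \<le> 2" using False by (simp add: n_def) linarith
 have z: "u 0 = 0" "u 1 = 0" using u_prime[OF assms(1), of 0] u_prime[OF assms(1), of 1] by auto
 have "th u x \<le> M * x"
 proof (cases "n = 2")
  case True
  hence "x \<ge> 2" unfolding n_def by linarith
  have "th u x = u 2 * ln 2" unfolding th_def n_def[symmetric] True using z by (simp add: numeral_2_eq_2)
  also have "\<dots> \<le> M * x" using u_le[OF assms(1), of 2] u_nonneg[OF assms(1), of 2] M \<open>x \<ge> 2\<close> ln_le_minus_one[of 2]
   by (intro mult_mono) auto
  finally show ?thesis .
 next
  case False
  hence "{..n} \<subseteq> {0, 1}" using n by auto
  hence "th u x = 0" unfolding th_def n_def[symmetric] using z by (intro sum.neutral) auto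
  thus ?thesis using M assms by simp
 qed
 thus ?thesis using K assms M unfolding Ch_def by (smt (verit) mult_right_mono)
qed

lemma th_Suc: "th u (real (Suc n)) = th u (real n) + u (Suc n) * ln (real (Suc n))"
 unfolding th_def floor_of_nat nat_int by simp

lemma mu_Suc: "mu u (real (Suc n)) = mu u (real n) + u (Suc n) / real (Suc n)"
 unfolding mu_def floor_of_nat nat_int by simp

text \<open>Partial summation from Chebyshev's bound. The 1 added to the logarithm is the boundary
  term th(n) / n, which has to stay in the statement for the induction on n.\<close>

lemma mertens_window:
 assumes u: "u \<in> U" and "0 < v" "v \<le> y"
 shows "(\<Sum>p\<in>{nfloor v<..nfloor y}. u p * ln (real p) / real p) \<le> Ch * (ln (y / v) + 1)"
proof -
 define m where "m = nfloor v"
 have main: "(\<Sum>p\<in>{m<..n}. u p * ln (real p) / real p) \<le> th u (real n) / real n + Ch * ln (real n / real (Suc m))"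
  if "n \<ge> Suc m" for n
  using that
 proof (induction n rule: dec_induct)
  case base
  have "{m<..Suc m} = {Suc m}" by auto
  moreover have "u (Suc m) * ln (real (Suc m)) \<le> th u (real (Suc m))" unfolding th_Suc using th_nonneg[OF u] by simp
  ultimately show ?case by (simp add: divide_right_mono del: of_nat_Suc)
 next
  case (step n)
  have n: "real n > 0" using step by auto
  have "{m<..Suc n} = insert (Suc n) {m<..n}" using step by auto
  hence "(\<Sum>p\<in>{m<..Suc n}. u p * ln (real p) / real p) = u (Suc n) * ln (real (Suc n)) / real (Suc n) + (\<Sum>p\<in>{m<..n}. u p * ln (real p) / real p)"
   by simp
  also have "\<dots> \<le> (th u (real (Suc n)) - th u (real n)) / real (Suc n) + (th u (real n) / real n + Ch * ln (real n / real (Suc m)))"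
   using step.IH unfolding th_Suc by (intro add_mono) auto
  also have "\<dots> = th u (real (Suc n)) / real (Suc n) + Ch * ln (real n / real (Suc m)) + th u (real n) / (real n * real (Suc n))"
  proof -
   have "(T' - T) / (r + 1) + (T / r + X) = T' / (r + 1) + X + T / (r * (r + 1))" if "r > 0" for T T' X r :: real
   proof -
    have "T / r = (T * (r + 1)) / (r * (r + 1))" using that by simp
    also have "T * (r + 1) = T * r + T" by (simp add: algebra_simps)
    also have "(T * r + T) / (r * (r + 1)) = T * r / (r * (r + 1)) + T / (r * (r + 1))" by (rule add_divide_distrib)
    also have "T * r / (r * (r + 1)) = T / (r + 1)" using that by simp
    finally show ?thesis by (simp add: diff_divide_distrib)
   qed
   from this[OF n, of "th u (real (Suc n))" "th u (real n)"] show ?thesis by (simp add: add.commute)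
  qed
  also have "th u (real n) / (real n * real (Suc n)) \<le> Ch * real n / (real n * real (Suc n))"
   using chebyshev[OF u, of "real n"] n by (intro divide_right_mono) auto
  also have "\<dots> = Ch * (1 / real (Suc n))" using n by simp
  also have "\<dots> \<le> Ch * ln (real (Suc n) / real n)"
  proof (rule mult_left_mono)
   have "ln (real n / real (Suc n)) \<le> real n / real (Suc n) - 1" using n by (intro ln_le_minus_one) auto
   moreover have "real n / real (Suc n) - 1 = - (1 / real (Suc n))" by (simp add: field_simps)
   ultimately show "1 / real (Suc n) \<le> ln (real (Suc n) / real n)" using n by (simp add: ln_div)
  qed (use Ch in simp)
  finally show ?case using n by (simp add: ln_div algebra_simps)
 qed
 show ?thesis
 proof (cases "nfloor y \<ge> Suc m")
  case True
  define n where "n = nfloor y"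
  have n: "real n > 0" "real n \<le> y" using True of_nat_floor[of y] assms unfolding n_def by linarith+
  have "v < real (Suc m)" using assms by (simp add: m_def) linarith
  have "th u (real n) / real n \<le> Ch" using chebyshev[OF u, of "real n"] n by (simp add: divide_le_eq)
  moreover have "ln (real n / real (Suc m)) \<le> ln (y / v)" using n \<open>v < real (Suc m)\<close> assms
   by (intro ln_mono frac_le divide_pos_pos) auto
  hence "Ch * ln (real n / real (Suc m)) \<le> Ch * ln (y / v)" using Ch by (intro mult_left_mono) auto
  ultimately show ?thesis using main[of n] True unfolding n_def[symmetric] m_def[symmetric] by (simp add: algebra_simps)
 next
  case False
  hence "{m<..nfloor y} = {}" by auto
  moreover have "0 \<le> ln (y / v)" using assms by simp
  ultimately show ?thesis using Ch unfolding m_def[symmetric] by simp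
 qed
qed

text \<open>The sum is the integral of th(t) / t up to y, hence at most Ch * y by Chebyshev.
  Induction handles integers; passing to real y costs the second Ch * y.\<close>

lemma log_weighted_sum:
 assumes u: "u \<in> U" and y: "y \<ge> 1"
 shows "(\<Sum>p\<le>nfloor y. u p * ln (real p) * ln (y / real p)) \<le> 2 * Ch * y"
proof -
 have main: "(\<Sum>p\<le>n. u p * ln (real p) * ln (real n / real p)) \<le> Ch * real n" for n
 proof (induction n)
  case (Suc n)
  show ?case
  proof (cases "n = 0")
   case False
   have "(\<Sum>p\<le>Suc n. u p * ln (real p) * ln (real (Suc n) / real p)) = (\<Sum>p\<le>n. u p * ln (real p) * ln (real (Suc n) / real p))" by simp
   also have "\<dots> = (\<Sum>p\<le>n. u p * ln (real p) * ln (real n / real p) + u p * ln (real p) * ln (real (Suc n) / real n))"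
   proof (intro sum.cong refl)
    fix p assume "p \<in> {..n}"
    show "u p * ln (real p) * ln (real (Suc n) / real p) = u p * ln (real p) * ln (real n / real p) + u p * ln (real p) * ln (real (Suc n) / real n)"
     using False by (cases "p = 0") (auto simp: ln_div algebra_simps)
   qed
   also have "\<dots> = (\<Sum>p\<le>n. u p * ln (real p) * ln (real n / real p)) + th u (real n) * ln (real (Suc n) / real n)"
    by (simp add: sum.distrib th_def sum_distrib_right)
   also have "th u (real n) * ln (real (Suc n) / real n) \<le> (Ch * real n) * (1 / real n)"
   proof (rule mult_mono)
    have "ln (real (Suc n) / real n) \<le> real (Suc n) / real n - 1" using False by (intro ln_le_minus_one) auto
    thus "ln (real (Suc n) / real n) \<le> 1 / real n" using False by (simp add: field_simps)
   qed (use chebyshev[OF u, of "real n"] Ch False in auto)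
   also have "\<dots> = Ch" using False by simp
   finally show ?thesis using Suc by (simp add: algebra_simps)
  qed (use Ch u_0[OF u] in simp)
 qed (use u_0[OF u] in simp)
 define n where "n = nfloor y"
 have n: "real n \<le> y" "n > 0" "y < real n + 1" using y of_nat_floor[of y] unfolding n_def by linarith+
 have "(\<Sum>p\<le>n. u p * ln (real p) * ln (y / real p)) = (\<Sum>p\<le>n. u p * ln (real p) * ln (real n / real p) + u p * ln (real p) * ln (y / real n))"
 proof (intro sum.cong refl)
  fix p assume "p \<in> {..n}"
  show "u p * ln (real p) * ln (y / real p) = u p * ln (real p) * ln (real n / real p) + u p * ln (real p) * ln (y / real n)"
   using n y by (cases "p = 0") (auto simp: ln_div algebra_simps)
 qed
 also have "\<dots> = (\<Sum>p\<le>n. u p * ln (real p) * ln (real n / real p)) + th u (real n) * ln (y / real n)"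
  by (simp add: sum.distrib th_def sum_distrib_right)
 also have "th u (real n) * ln (y / real n) \<le> (Ch * real n) * (1 / real n)"
 proof (rule mult_mono)
  have "ln (y / real n) \<le> y / real n - 1" using n y by (intro ln_le_minus_one) auto
  also have "\<dots> = (y - real n) / real n" using n by (simp add: diff_divide_distrib)
  also have "\<dots> \<le> 1 / real n" using n by (intro divide_right_mono) auto
  finally show "ln (y / real n) \<le> 1 / real n" .
 qed (use chebyshev[OF u, of "real n"] Ch n in auto)
 also have "(Ch * real n) * (1 / real n) = Ch" using n by simp
 also have "(\<Sum>p\<le>n. u p * ln (real p) * ln (real n / real p)) + Ch \<le> Ch * y + Ch * y"
  using main[of n] n y Ch by (intro add_mono order_trans[OF main]) auto
 finally show ?thesis unfolding n_def by (simp add: mult_ac)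
qed

text \<open>Partial summation with the error of the prime number theorem. The convergence of the
  error against 1 / (n ln n) in the scale of ln ln is what yields the power (ln x)^-b.\<close>

lemma mertens:
 "\<exists>C\<ge>1. \<exists>B. \<forall>u\<in>U. \<forall>x\<ge>3. \<bar>mu u x - lnln x - B u\<bar> \<le> C * ln x powr (- b)"
proof -
 define V where "V n = ln (real n) powr (- b)" for n :: nat
 define Q where "Q n = lngap n + 2 * K / b * V n" for n
 have gV: "lngap n \<le> V n" "V n \<ge> 0" "V n \<le> 1" if "n \<ge> 3" for n
 proof -
  have l: "ln (real n) \<ge> 1" using that by (intro ln_ge_1) simp
  have "lngap n \<le> 1 / (1 * ln (real n))" unfolding lngap_def using that l by (intro divide_left_mono mult_right_mono mult_pos_pos) auto
  also have "\<dots> = ln (real n) powr (- 1)" using l by (simp add: powr_minus divide_inverse)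
  also have "\<dots> \<le> V n" unfolding V_def using l b by (intro powr_mono) auto
  finally show "lngap n \<le> V n" .
  show "V n \<le> 1" unfolding V_def using powr_mono[of "-b" 0 "ln (real n)"] l b by simp
 qed (simp add: V_def)
 \<comment> \<open>The discrete form of dV = - b V d(ln ln n), as V = exp (- b ln ln n).\<close>
 have Vstep: "b * (lngap (Suc n) * V (Suc n)) \<le> V n - V (Suc n)" if "n \<ge> 3" for n
 proof -
  have l: "ln (real n) \<ge> 1" "ln (real (Suc n)) \<ge> 1" using that by (auto intro!: ln_ge_1)
  define d where "d = lnln (real (Suc n)) - lnln (real n)"
  have "V n = exp (- b * lnln (real n))" "V (Suc n) = exp (- b * lnln (real (Suc n)))"
   using l that by (auto simp: V_def powr_def)
  hence "V n = V (Suc n) * exp (b * d)" by (simp add: d_def exp_add[symmetric] algebra_simps)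
  moreover have "1 + b * d \<le> exp (b * d)" by (rule exp_ge_add_one_self)
  moreover have "V (Suc n) \<ge> 0" by (simp add: V_def)
  ultimately have "V (Suc n) * (1 + b * d) \<le> V n" using mult_left_mono by metis
  moreover have "V (Suc n) * (b * lngap (Suc n)) \<le> V (Suc n) * (b * d)"
   using lnln_step(1)[OF that] b \<open>V (Suc n) \<ge> 0\<close> unfolding d_def by (intro mult_left_mono) auto
  ultimately show ?thesis by (simp add: algebra_simps)
 qed
 have V0: "V \<longlonglongrightarrow> 0" unfolding V_def
 proof (rule tendsto_neg_powr)
  show "filterlim (\<lambda>n. ln (real n)) at_top sequentially" by real_asymp
 qed (use b in simp)
 have Q0: "Q \<longlonglongrightarrow> 0"
 proof -
  have "lngap \<longlonglongrightarrow> 0" unfolding lngap_def by real_asymp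
  hence "(\<lambda>n. lngap n + 2 * K / b * V n) \<longlonglongrightarrow> 0 + 2 * K / b * 0" using V0 by (intro tendsto_intros)
  thus ?thesis by (simp add: Q_def[abs_def])
 qed
 have "\<exists>B. \<forall>n\<ge>3. \<bar>mu u (real n) - lnln (real n) - B\<bar> \<le> (1 + 2 * K / b + K) * V n" if u: "u \<in> U" for u
 proof -
  define E where "E n = th u (real n) - real n" for n :: nat
  have Eb: "\<bar>E n\<bar> \<le> K * real n * V n" if "n \<ge> 3" for n
   using pnt[OF u, of "real n"] that by (simp add: E_def V_def)
  \<comment> \<open>The boundary term of the partial summation is removed, so that the increments of
    W contain only differences of \<open>lngap\<close> and are dominated by those of Q.\<close>
  define W where "W n = mu u (real n) - lnln (real n) - E n * lngap (Suc n)" for n :: nat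
  have "\<bar>W (Suc n) - W n\<bar> \<le> Q n - Q (Suc n)" if n: "n \<ge> 3" for n
  proof -
   note st = lnln_step[OF n] and st' = lnln_step[of "Suc n"]
   have "u (Suc n) / real (Suc n) = (E (Suc n) - E n + 1) * lngap (Suc n)"
   proof -
    have "E (Suc n) - E n + 1 = u (Suc n) * ln (real (Suc n))" unfolding E_def th_Suc by simp
    moreover have "ln (real (Suc n)) \<ge> 1" using n by (intro ln_ge_1) simp
    ultimately show ?thesis using n by (simp add: lngap_def del: of_nat_Suc)
   qed
   hence "W (Suc n) - W n = (lngap (Suc n) - (lnln (real (Suc n)) - lnln (real n))) + E (Suc n) * (lngap (Suc n) - lngap (Suc (Suc n)))"
    unfolding W_def mu_Suc by (simp add: algebra_simps)
   hence "\<bar>W (Suc n) - W n\<bar> \<le> \<bar>lngap (Suc n) - (lnln (real (Suc n)) - lnln (real n))\<bar> + \<bar>E (Suc n)\<bar> * (lngap (Suc n) - lngap (Suc (Suc n)))"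
    using st'(4) n by (simp add: abs_mult) (metis abs_triangle_ineq abs_mult abs_of_nonneg diff_ge_0_iff_ge le_Suc_eq)
   also have "\<dots> \<le> (lngap n - lngap (Suc n)) + (2 * K / b) * (V n - V (Suc n))"
   proof (rule add_mono)
    show "\<bar>lngap (Suc n) - (lnln (real (Suc n)) - lnln (real n))\<bar> \<le> lngap n - lngap (Suc n)" using st by linarith
    have "\<bar>E (Suc n)\<bar> * (lngap (Suc n) - lngap (Suc (Suc n))) \<le> (K * real (Suc n) * V (Suc n)) * (lngap (Suc n) - lngap (Suc (Suc n)))"
     using Eb[of "Suc n"] st'(4) n by (intro mult_right_mono) auto
    also have "\<dots> = K * V (Suc n) * (real (Suc n) * (lngap (Suc n) - lngap (Suc (Suc n))))" by (simp only: mult_ac)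
    also have "\<dots> \<le> K * V (Suc n) * (2 * lngap (Suc n))" using st(3) K gV(2)[of "Suc n"] n by (intro mult_left_mono) auto
    also have "\<dots> = (2 * K / b) * (b * (lngap (Suc n) * V (Suc n)))" using b by simp
    also have "\<dots> \<le> (2 * K / b) * (V n - V (Suc n))" using Vstep[OF n] K b by (intro mult_left_mono) auto
    finally show "\<bar>E (Suc n)\<bar> * (lngap (Suc n) - lngap (Suc (Suc n))) \<le> (2 * K / b) * (V n - V (Suc n))" .
   qed
   also have "\<dots> = Q n - Q (Suc n)" unfolding Q_def right_diff_distrib by simp
   finally show ?thesis .
  qed
  from telescoping_limit[OF this Q0] obtain B where B: "\<And>n. n \<ge> 3 ==> \<bar>W n - B\<bar> \<le> Q n" by blast
  have "\<bar>mu u (real n) - lnln (real n) - B\<bar> \<le> (1 + 2 * K / b + K) * V n" if n: "n \<ge> 3" for n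
  proof -
   have l: "ln (real (Suc n)) \<ge> 1" using n by (intro ln_ge_1) simp
   have "real (Suc n) * lngap (Suc n) \<le> 1" using l by (simp add: lngap_def divide_le_eq del: of_nat_Suc)
   moreover have "real n * lngap (Suc n) \<le> real (Suc n) * lngap (Suc n)"
    using l by (intro mult_right_mono) (auto simp: lngap_def)
   ultimately have g: "real n * lngap (Suc n) \<le> 1" by linarith
   have "0 \<le> lngap (Suc n)" using l by (simp add: lngap_def)
   hence "\<bar>E n * lngap (Suc n)\<bar> \<le> (K * real n * V n) * lngap (Suc n)"
    using Eb[OF n] by (simp add: abs_mult mult_right_mono)
   also have "\<dots> = K * V n * (real n * lngap (Suc n))" by (simp only: mult_ac)
   also have "\<dots> \<le> K * V n * 1" using g K gV(2)[OF n] by (intro mult_left_mono) auto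
   finally have "\<bar>E n * lngap (Suc n)\<bar> \<le> K * V n" by simp
   moreover have "Q n \<le> (1 + 2 * K / b) * V n" using gV(1)[OF n] unfolding Q_def distrib_right by simp
   ultimately show ?thesis using B[OF n] unfolding W_def distrib_right by linarith
  qed
  thus ?thesis by blast
 qed
 then obtain B where B: "\<And>u n. u \<in> U ==> n \<ge> 3 ==> \<bar>mu u (real n) - lnln (real n) - B u\<bar> \<le> (1 + 2 * K / b + K) * V n" by metis
 define C where "C = 2 * (2 + 2 * K / b + K)"
 have "1 \<le> C" using K b by (simp add: C_def)
 moreover have "\<bar>mu u x - lnln x - B u\<bar> \<le> C * ln x powr (- b)" if u: "u \<in> U" and x: "x \<ge> 3" for u x
 proof -
  define n where "n = nfloor x"
  have n: "real n \<le> x" "n \<ge> 3" "x < real (Suc n)" using x by (auto simp: n_def le_nat_floor intro!: of_nat_floor) linarith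
  have l: "ln (real n) \<ge> 1" "ln x \<ge> 1" using n x by (auto intro!: ln_ge_1)
  have "\<bar>mu u (real n) - lnln (real n) - B u\<bar> \<le> (1 + 2 * K / b + K) * V n" by (rule B[OF u n(2)])
  moreover have "mu u (real n) = mu u x" by (simp add: mu_def n_def)
  moreover have "lnln (real n) \<le> lnln x" using n l by (intro ln_mono) auto
  moreover have "lnln x \<le> lnln (real (Suc n))" using n l by (intro ln_mono) auto
  moreover have "lnln (real (Suc n)) - lnln (real n) \<le> V n" using lnln_step(2)[OF n(2)] gV(1)[OF n(2)] by linarith
  ultimately have 1: "\<bar>mu u x - lnln x - B u\<bar> \<le> (2 + 2 * K / b + K) * V n" unfolding distrib_right by linarith
  have "x \<le> real n * real n"
  proof -
   have "3 * real n \<le> real n * real n" using n(2) by (intro mult_right_mono) auto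
   thus ?thesis using n by linarith
  qed
  hence "ln x \<le> ln (real n * real n)" using x by (intro ln_mono) auto
  hence "ln x \<le> 2 * ln (real n)" using n by (simp add: ln_mult)
  hence "(2 * ln (real n)) powr (- b) \<le> ln x powr (- b)" using l b by (intro powr_mono2') auto
  hence "2 powr (- b) * V n \<le> ln x powr (- b)" using l by (simp add: V_def powr_mult)
  moreover have "2 powr (- 1) \<le> (2::real) powr (- b)" using b by (intro powr_mono) auto
  hence "2 powr (- 1) * V n \<le> 2 powr (- b) * V n" using gV(2)[OF n(2)] by (intro mult_right_mono)
  ultimately have "V n \<le> 2 * ln x powr (- b)" by (simp add: powr_minus)
  hence "(2 + 2 * K / b + K) * V n \<le> (2 + 2 * K / b + K) * (2 * ln x powr (- b))" using K b by (intro mult_left_mono) auto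
  moreover have "C * ln x powr (- b) = (2 + 2 * K / b + K) * (2 * ln x powr (- b))" by (simp add: C_def)
  ultimately show ?thesis using 1 by linarith
 qed
 ultimately show ?thesis by blast
qed

end

section \<open>Weighted sums over tuples of distinct primes\<close>

text \<open>Tuples are extensional functions on an index set, so a coordinate can be deleted without
  renumbering and no tuple is counted twice.\<close>

definition tup :: "'i set => real => ('i => nat) set" where
 "tup I x = {f \<in> I \<rightarrow>\<^sub>E Collect prime. inj_on f I \<and> real (\<Prod>i\<in>I. f i) \<le> x}"

definition pr :: "'i set => ('i => nat) => real" where "pr I f = real (\<Prod>i\<in>I. f i)"

definition wt :: "('i => nat => real) => 'i set => ('i => nat) => real" where
 "wt v I f = (\<Prod>i\<in>I. v i (f i) / real (f i))"

definition Tsum :: "'i set => ('i => nat => real) => real => real" where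
 "Tsum I v x = (\<Sum>f\<in>tup I x. wt v I f)"

definition Nsum :: "'i set => ('i => nat => real) => real => real" where
 "Nsum I v x = (\<Sum>f\<in>tup I x. \<Prod>i\<in>I. v i (f i))"

lemma tupD:
 assumes "f \<in> tup I x"
 shows "\<And>i. i \<in> I ==> prime (f i)" "inj_on f I" "pr I f \<le> x" "f \<in> extensional I" "pr I f \<ge> 1"
  "\<And>i. i \<in> I ==> f i > 0"
proof -
 show p: "\<And>i. i \<in> I ==> prime (f i)" using assms by (auto simp: tup_def)
 thus p0: "\<And>i. i \<in> I ==> f i > 0" using prime_gt_0_nat by blast
 hence "(\<Prod>i\<in>I. f i) > 0" by (intro prod_pos) auto
 thus "pr I f \<ge> 1" unfolding pr_def by linarith
qed (use assms in "auto simp: tup_def pr_def PiE_def")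

lemma le_prod_nat:
 fixes f :: "'i => nat" assumes "finite I" "i \<in> I" "\<And>j. j \<in> I ==> f j > 0"
 shows "f i \<le> (\<Prod>j\<in>I. f j)"
proof -
 have "(\<Prod>j\<in>I. f j) = f i * (\<Prod>j\<in>I - {i}. f j)" using assms by (simp add: prod.remove)
 moreover have "(\<Prod>j\<in>I - {i}. f j) > 0" using assms by (intro prod_pos) auto
 ultimately show ?thesis by (cases "(\<Prod>j\<in>I - {i}. f j)") auto
qed

lemma finite_tup: "finite I ==> finite (tup I x)"
proof -
 assume I: "finite I"
 have "tup I x \<subseteq> I \<rightarrow>\<^sub>E {..nfloor x}"
 proof
  fix f assume f: "f \<in> tup I x"
  have "f i \<le> nfloor x" if "i \<in> I" for i
  proof -
   have "real (f i) \<le> real (\<Prod>j\<in>I. f j)" using le_prod_nat[OF I that, of f] tupD(6)[OF f] by (simp only: of_nat_le_iff)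
   hence "real (f i) \<le> x" using tupD(3)[OF f] by (simp add: pr_def)
   thus ?thesis by (rule le_nat_floor)
  qed
  thus "f \<in> I \<rightarrow>\<^sub>E {..nfloor x}" using f by (auto simp: tup_def PiE_def)
 qed
 thus ?thesis using I by (meson finite_PiE finite_atMost finite_subset)
qed

lemma prod_fun_upd_notin: "i \<notin> J ==> (\<Prod>j\<in>J. F j ((g(i := p)) j)) = (\<Prod>j\<in>J. F j (g j))"
 by (intro prod.cong refl) auto

lemma pr_fun_upd: "i \<notin> J ==> finite J ==> pr (insert i J) (g(i := p)) = real p * pr J g"
 unfolding pr_def using prod_fun_upd_notin[of i J "\<lambda>_ x. x" g p] by (simp add: prod.insert del: fun_upd_apply) simp

lemma wt_fun_upd: "i \<notin> J ==> finite J ==> wt v (insert i J) (g(i := p)) = v i p / real p * wt v J g"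
 unfolding wt_def using prod_fun_upd_notin[of i J "\<lambda>i p. v i p / real p" g p] by (simp add: prod.insert del: fun_upd_apply) simp

lemma tup_insert_sum:
 assumes "i \<notin> J" "finite J"
 shows "(\<Sum>f\<in>tup (insert i J) x. G f) =
  (\<Sum>g\<in>tup J x. \<Sum>p | prime p \<and> p \<notin> g ` J \<and> real p * pr J g \<le> x. G (g(i := p)))"
proof -
 let ?A = "\<lambda>g. {p. prime p \<and> p \<notin> g ` J \<and> real p * pr J g \<le> x}"
 have fin: "finite {p. prime p \<and> p \<notin> g ` J \<and> real p * pr J g \<le> x}" if "g \<in> tup J x" for g
 proof (rule finite_subset)
  show "{p. prime p \<and> p \<notin> g ` J \<and> real p * pr J g \<le> x} \<subseteq> {..nfloor x}"
  proof clarsimp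
   fix p assume "prime p" "real p * pr J g \<le> x"
   moreover have "real p * 1 \<le> real p * pr J g" using tupD(5)[OF that] by (intro mult_left_mono) auto
   ultimately show "p \<le> nfloor x" by (intro le_nat_floor) simp
  qed
 qed simp
 have "(\<Sum>g\<in>tup J x. \<Sum>p | prime p \<and> p \<notin> g ` J \<and> real p * pr J g \<le> x. G (g(i := p))) =
  (\<Sum>gp\<in>Sigma (tup J x) ?A. G ((fst gp)(i := snd gp)))"
  using fin finite_tup[OF assms(2)] by (subst sum.Sigma) (auto simp: case_prod_unfold)
 also have "\<dots> = (\<Sum>f\<in>tup (insert i J) x. G f)"
 proof (rule sum.reindex_bij_witness[of _ "\<lambda>f. (f(i := undefined), f i)" "\<lambda>gp. (fst gp)(i := snd gp)"])
  fix gp assume "gp \<in> Sigma (tup J x) ?A"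
  then obtain g p where gp: "gp = (g, p)" "g \<in> tup J x" "prime p" "p \<notin> g ` J" "real p * pr J g \<le> x" by auto
  have "g i = undefined" using tupD(4)[OF gp(2)] assms(1) by (simp add: extensional_def)
  thus "(((fst gp)(i := snd gp))(i := undefined), ((fst gp)(i := snd gp)) i) = gp" using gp(1) by auto
  have "inj_on (g(i := p)) (insert i J)"
   using gp(2,4) assms(1) by (auto simp: tup_def inj_on_def image_iff)
  moreover have "pr (insert i J) (g(i := p)) \<le> x" unfolding pr_fun_upd[OF assms] by (rule gp(5))
  ultimately show "(fst gp)(i := snd gp) \<in> tup (insert i J) x"
   using gp assms(1) by (auto simp: tup_def pr_def PiE_def extensional_def)
 next
  fix f assume f: "f \<in> tup (insert i J) x"
  define g where "g = f(i := undefined)"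
  have gf: "g j = f j" if "j \<in> J" for j using that assms(1) by (auto simp: g_def)
  have fg: "f = g(i := f i)" by (simp add: g_def)
  have prod_f: "pr (insert i J) f = real (f i) * pr J g" by (subst fg) (rule pr_fun_upd[OF assms])
  have "pr J g \<le> real (f i) * pr J g" proof -
   have "real (f i) \<ge> 1" using tupD(6)[OF f, of i] by simp
   hence "1 * pr J g \<le> real (f i) * pr J g" by (rule mult_right_mono) (simp add: pr_def del: of_nat_prod)
   thus ?thesis by simp
  qed
  hence "pr J g \<le> x" using tupD(3)[OF f] prod_f by linarith
  moreover have "inj_on g J" using tupD(2)[OF f] gf by (auto simp: inj_on_def)
  moreover have "f i \<notin> g ` J" using tupD(2)[OF f] gf assms(1) by (auto simp: inj_on_def)
  moreover have "g \<in> J \<rightarrow>\<^sub>E Collect prime" using f assms(1) gf by (auto simp: tup_def PiE_def extensional_def g_def)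
  ultimately show "(f(i := undefined), f i) \<in> Sigma (tup J x) ?A"
   using prod_f tupD(1)[OF f, of i] tupD(3)[OF f] unfolding g_def[symmetric] by (auto simp: tup_def pr_def simp del: of_nat_prod)
  show "(fst (f(i := undefined), f i))(i := snd (f(i := undefined), f i)) = f" by simp
 qed simp
 finally show ?thesis by simp
qed

text \<open>Distinctness becomes a subtraction of the primes already used; injectivity of g turns
  that correction into a sum over coordinates.\<close>

lemma prime_sum_excluding:
 fixes w :: "nat => real"
 assumes g: "g \<in> tup J x" and J: "finite J" and w: "\<And>p. \<not> prime p ==> w p = 0"
 shows "(\<Sum>p | prime p \<and> p \<notin> g ` J \<and> real p * pr J g \<le> x. w p) =
   (\<Sum>p\<le>nfloor (x / pr J g). w p) - (\<Sum>j\<in>J. if real (g j) * pr J g \<le> x then w (g j) else 0)"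
proof -
 define m where "m = pr J g"
 have m: "m \<ge> 1" "m \<le> x" using tupD(3,5)[OF g] by (auto simp: m_def)
 have le: "real p * m \<le> x \<longleftrightarrow> p \<le> nfloor (x / m)" for p
 proof -
  have "real p * m \<le> x \<longleftrightarrow> real p \<le> x / m" using m by (simp add: pos_le_divide_eq)
  also have "\<dots> \<longleftrightarrow> p \<le> nfloor (x / m)"
  proof
   assume "p \<le> nfloor (x / m)"
   hence "real p \<le> real (nfloor (x / m))" by simp
   also have "\<dots> \<le> x / m" using m by (intro of_nat_floor) auto
   finally show "real p \<le> x / m" .
  qed (rule le_nat_floor)
  finally show ?thesis .
 qed
 have "(\<Sum>p\<le>nfloor (x / m). w p) = (\<Sum>p | prime p \<and> p \<notin> g ` J \<and> real p * m \<le> x. w p) + (\<Sum>p | p \<in> g ` J \<and> real p * m \<le> x. w p)"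
 proof -
  have "(\<Sum>p\<le>nfloor (x / m). w p) = (\<Sum>p\<in>{p. prime p \<and> p \<notin> g ` J \<and> real p * m \<le> x} \<union> {p. p \<in> g ` J \<and> real p * m \<le> x}. w p)"
   by (rule sum.mono_neutral_right) (use w le in auto)
  also have "\<dots> = (\<Sum>p | prime p \<and> p \<notin> g ` J \<and> real p * m \<le> x. w p) + (\<Sum>p | p \<in> g ` J \<and> real p * m \<le> x. w p)"
   by (rule sum.union_disjoint) (auto intro: finite_subset[of _ "{..nfloor (x / m)}"] simp: le)
  finally show ?thesis .
 qed
 moreover have "(\<Sum>p | p \<in> g ` J \<and> real p * m \<le> x. w p) = (\<Sum>j\<in>J. if real (g j) * m \<le> x then w (g j) else 0)"
 proof -
  have "(\<Sum>p | p \<in> g ` J \<and> real p * m \<le> x. w p) = (\<Sum>p\<in>g ` J. if real p * m \<le> x then w p else 0)"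
   using J by (intro sum.mono_neutral_cong_left) auto
  also have "\<dots> = (\<Sum>j\<in>J. if real (g j) * m \<le> x then w (g j) else 0)"
   using tupD(2)[OF g] by (subst sum.reindex) auto
  finally show ?thesis .
 qed
 ultimately show ?thesis unfolding m_def[symmetric] by simp
qed

text \<open>The basis of every argument that isolates one coordinate: coordinate i is summed first.
  H may depend on the product of the other coordinates, since that product determines the range x /
  pr of the new prime.\<close>

lemma coord_sum:
 assumes I: "finite I" "i \<in> I" and v: "\<And>p. \<not> prime p ==> v i p = 0"
 shows "(\<Sum>f\<in>tup I x. wt v I f * H (pr (I - {i}) f) (f i)) =
  (\<Sum>g\<in>tup (I - {i}) x. wt v (I - {i}) g * ((\<Sum>p\<le>nfloor (x / pr (I - {i}) g). v i p / real p * H (pr (I - {i}) g) p)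
    - (\<Sum>j\<in>I - {i}. if real (g j) * pr (I - {i}) g \<le> x then v i (g j) / real (g j) * H (pr (I - {i}) g) (g j) else 0)))"
proof -
 define J where "J = I - {i}"
 have J: "i \<notin> J" "finite J" "I = insert i J" using I by (auto simp: J_def)
 have prg: "pr J (g(i := p)) = pr J g" for g p unfolding pr_def using J(1) by (intro arg_cong[of _ _ real] prod.cong) auto
 have "(\<Sum>f\<in>tup I x. wt v I f * H (pr J f) (f i)) =
  (\<Sum>g\<in>tup J x. \<Sum>p | prime p \<and> p \<notin> g ` J \<and> real p * pr J g \<le> x. wt v J g * (v i p / real p * H (pr J g) p))"
  unfolding J(3) tup_insert_sum[OF J(1,2)] wt_fun_upd[OF J(1,2)] prg by (intro sum.cong refl) simp
 also have "\<dots> = (\<Sum>g\<in>tup J x. wt v J g * (\<Sum>p | prime p \<and> p \<notin> g ` J \<and> real p * pr J g \<le> x. v i p / real p * H (pr J g) p))"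
  by (simp add: sum_distrib_left)
 also have "\<dots> = (\<Sum>g\<in>tup J x. wt v J g * ((\<Sum>p\<le>nfloor (x / pr J g). v i p / real p * H (pr J g) p)
    - (\<Sum>j\<in>J. if real (g j) * pr J g \<le> x then v i (g j) / real (g j) * H (pr J g) (g j) else 0)))"
  using v J(2) by (intro sum.cong refl) (subst prime_sum_excluding, auto)
 finally show ?thesis unfolding J_def[symmetric] .
qed

lemma wt_nonneg: "(\<And>i p. i \<in> I ==> v i p \<ge> 0) ==> wt v I f \<ge> 0"
 unfolding wt_def by (intro prod_nonneg) auto

lemma Tsum_nonneg: "(\<And>i p. i \<in> I ==> v i p \<ge> 0) ==> Tsum I v x \<ge> 0"
 unfolding Tsum_def by (intro sum_nonneg wt_nonneg)

lemma coord_sum_le: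
 assumes I: "finite I" "i \<in> I" and v: "\<And>p. \<not> prime p ==> v i p = 0" and nn: "\<And>i p. i \<in> I ==> v i p \<ge> 0"
  and H: "\<And>m p. H m p \<ge> 0"
 shows "(\<Sum>f\<in>tup I x. wt v I f * H (pr (I - {i}) f) (f i)) \<le>
  (\<Sum>g\<in>tup (I - {i}) x. wt v (I - {i}) g * (\<Sum>p\<le>nfloor (x / pr (I - {i}) g). v i p / real p * H (pr (I - {i}) g) p))"
proof -
 have "wt v (I - {i}) g * (s - (\<Sum>j\<in>I - {i}. if real (g j) * pr (I - {i}) g \<le> x then v i (g j) / real (g j) * H (pr (I - {i}) g) (g j) else 0)) \<le> wt v (I - {i}) g * s" for g s
 proof (rule mult_left_mono)
  have "0 \<le> (\<Sum>j\<in>I - {i}. if real (g j) * pr (I - {i}) g \<le> x then v i (g j) / real (g j) * H (pr (I - {i}) g) (g j) else 0)"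
   using nn[OF I(2)] H by (intro sum_nonneg) auto
  thus "s - (\<Sum>j\<in>I - {i}. if real (g j) * pr (I - {i}) g \<le> x then v i (g j) / real (g j) * H (pr (I - {i}) g) (g j) else 0) \<le> s" by simp
 qed (use nn in "auto intro: wt_nonneg")
 note le = this
 have "(\<Sum>f\<in>tup I x. wt v I f * H (pr (I - {i}) f) (f i)) = (\<Sum>g\<in>tup (I - {i}) x. wt v (I - {i}) g * ((\<Sum>p\<le>nfloor (x / pr (I - {i}) g). v i p / real p * H (pr (I - {i}) g) p)
    - (\<Sum>j\<in>I - {i}. if real (g j) * pr (I - {i}) g \<le> x then v i (g j) / real (g j) * H (pr (I - {i}) g) (g j) else 0)))"
  by (rule coord_sum) (use I v in auto)
 also have "\<dots> \<le> (\<Sum>g\<in>tup (I - {i}) x. wt v (I - {i}) g * (\<Sum>p\<le>nfloor (x / pr (I - {i}) g). v i p / real p * H (pr (I - {i}) g) p))"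
  by (rule sum_mono) (rule le)
 finally show ?thesis .
qed

lemma Tsum_coord:
 assumes I: "finite I" "i \<in> I" and v: "\<And>p. \<not> prime p ==> v i p = 0"
 shows "Tsum I v x = (\<Sum>g\<in>tup (I - {i}) x. wt v (I - {i}) g * (mu (v i) (x / pr (I - {i}) g)
    - (\<Sum>j\<in>I - {i}. if real (g j) * pr (I - {i}) g \<le> x then v i (g j) / real (g j) else 0)))"
 using coord_sum[of I i v, OF I v, where H = "\<lambda>_ _. 1" and x = x] by (simp add: Tsum_def mu_def cong: if_cong)

lemma mu_mono:
 assumes "\<And>p. w p \<ge> 0" "x \<le> y" shows "mu w x \<le> mu w y"
 unfolding mu_def using assms by (intro sum_mono2) (auto intro: nat_mono floor_mono order_trans)

lemma floor_div_le: "m \<ge> 1 ==> x \<ge> 0 ==> x / m \<le> (x::real)"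
 using mult_left_mono[of 1 m x] by (simp add: divide_le_eq)

lemma coord_sum_le_prod:
 assumes I: "finite I" "i \<in> I" and v: "\<And>p. \<not> prime p ==> v i p = 0" and nn: "\<And>i p. i \<in> I ==> v i p \<ge> 0"
  and h: "\<And>p. h p \<ge> 0"
 shows "(\<Sum>f\<in>tup I x. wt v I f * h (f i)) \<le> (\<Sum>p\<le>nfloor x. v i p / real p * h p) * Tsum (I - {i}) v x"
proof -
 have "(\<Sum>f\<in>tup I x. wt v I f * h (f i)) \<le> (\<Sum>g\<in>tup (I - {i}) x. wt v (I - {i}) g * (\<Sum>p\<le>nfloor (x / pr (I - {i}) g). v i p / real p * h p))"
  by (rule coord_sum_le[of I i v "\<lambda>_. h", OF I v nn h])
 also have "\<dots> \<le> (\<Sum>g\<in>tup (I - {i}) x. wt v (I - {i}) g * (\<Sum>p\<le>nfloor x. v i p / real p * h p))"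
 proof (intro sum_mono mult_left_mono wt_nonneg sum_mono2)
  fix g assume "g \<in> tup (I - {i}) x"
  hence "x / pr (I - {i}) g \<le> x" using tupD(3,5)[of g "I - {i}" x] by (intro floor_div_le) auto
  thus "{..nfloor (x / pr (I - {i}) g)} \<subseteq> {..nfloor x}" by (auto intro: nat_mono floor_mono order_trans)
 qed (use nn h I in auto)
 finally show ?thesis unfolding Tsum_def sum_distrib_right[symmetric] by (simp only: mult.commute)
qed

lemma Tsum_empty: "Tsum {} v x = (if x \<ge> 1 then 1 else 0)"
 by (auto simp: Tsum_def tup_def wt_def)

lemma wt_cong: "(\<And>i. i \<in> I ==> v i (f i) = w i (f i)) ==> wt v I f = wt w I f"
 unfolding wt_def by (intro prod.cong) auto

lemma prod_eq_pr_wt: "f \<in> tup I x ==> vprod I v f = pr I f * wt v I f"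
proof -
 assume f: "f \<in> tup I x"
 have "vprod I v f = (\<Prod>i\<in>I. real (f i) * (v i (f i) / real (f i)))"
  using tupD(6)[OF f] by (intro prod.cong refl) auto
 also have "\<dots> = (\<Prod>i\<in>I. real (f i)) * (\<Prod>i\<in>I. v i (f i) / real (f i))" by (rule prod.distrib)
 finally show ?thesis unfolding pr_def wt_def of_nat_prod .
qed

lemma pr_remove: "finite I ==> i \<in> I ==> pr I f = real (f i) * pr (I - {i}) f"
 unfolding pr_def by (simp add: prod.remove)

lemma ln_pr: "f \<in> tup I x ==> finite I ==> ln (pr I f) = (\<Sum>i\<in>I. ln (real (f i)))"
 unfolding pr_def of_nat_prod using tupD(6)[of f I x] by (subst ln_prod) auto

section \<open>Tuples with product close to x, collisions, and the deletion of a coordinate\<close>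

context prime_weights
begin

text \<open>Covers the restrictions of weights in U to large primes; Chebyshev-type upper bounds
  carry over to them with unchanged constants.\<close>

definition dom :: "(nat => real) => bool" where "dom v \<longleftrightarrow> (\<exists>u\<in>U. \<forall>p. 0 \<le> v p \<and> v p \<le> u p)"

definition adm :: "real => (nat => real) => bool" where
 "adm C v \<longleftrightarrow> dom v \<and> (\<forall>y\<ge>3. \<bar>mu v y - lnln y\<bar> \<le> C)"

text \<open>The share of T with product within a factor V of x. These are the tuples that leave a
  range shorter than V for one more prime.\<close>

definition win :: "'i set => ('i => nat => real) => real => real => real" where
 "win I v x V = (\<Sum>f | f \<in> tup I x \<and> x / V < pr I f. wt v I f)"

lemma domD:
 assumes "dom v" shows "v p \<ge> 0" "v p \<le> M" "\<not> prime p ==> v p = 0"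
proof -
 obtain u where u: "u \<in> U" "\<And>p. 0 \<le> v p" "\<And>p. v p \<le> u p" using assms by (auto simp: dom_def)
 show "v p \<ge> 0" "v p \<le> M" using u(2)[of p] u(3)[of p] u_le[OF u(1), of p] by linarith+
 show "\<not> prime p ==> v p = 0" using u(2)[of p] u(3)[of p] u_prime[OF u(1), of p] by linarith
qed

text \<open>On these tuples ln (pr I f) is at least ln (x / V). Inserting it and splitting it into
  the logarithms of the coordinates frees one of them; with the others fixed it runs over an
  interval of ratio V, where \<open>mertens_window\<close> applies.\<close>

lemma window_bound:
 assumes I: "finite I" and v: "\<And>i. i \<in> I ==> dom (v i)" and V: "1 \<le> V" "V < x"
 shows "win I v x V \<le> Ch * (ln V + 1) / ln (x / V) * (\<Sum>i\<in>I. Tsum (I - {i}) v x)"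
proof -
 \<comment> \<open>Here m is the product of the other coordinates, so the condition says that the
   full product exceeds x / V.\<close>
 define H where "H m p = (if x / V < real p * m then ln (real p) else 0)" for m p
 have nn: "i \<in> I ==> v i p \<ge> 0" for i p using domD v by blast
 have H0: "H m p \<ge> 0" for m p by (cases "p = 0") (auto simp: H_def)
 have lx: "ln (x / V) > 0" using V by simp
 have inner: "(\<Sum>p\<le>nfloor y. v i p / real p * H (x / y) p) \<le> Ch * (ln V + 1)" if i: "i \<in> I" and y: "y > 0" for i y
 proof -
  obtain u where u: "u \<in> U" "\<And>p. 0 \<le> v i p" "\<And>p. v i p \<le> u p" using v[OF i] by (auto simp: dom_def)
  have "v i p / real p * H (x / y) p \<le> (if p \<in> {nfloor (y / V)<..nfloor y} then u p * ln (real p) / real p else 0)" if p: "p \<le> nfloor y" for p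
  proof (cases "x / V < real p * (x / y)")
   case True
   hence "y / V < real p" using y V by (simp add: field_simps)
   moreover have "real (nfloor (y / V)) \<le> y / V" using y V by (intro of_nat_floor) auto
   ultimately have "nfloor (y / V) < p" by linarith
   moreover have "v i p * ln (real p) / real p \<le> u p * ln (real p) / real p"
    using u(3)[of p] calculation by (intro divide_right_mono mult_right_mono) auto
   moreover have "H (x / y) p = ln (real p)" unfolding H_def by (rule if_P[OF True])
   ultimately show ?thesis using p by simp
  next
   case False
   hence "H (x / y) p = 0" unfolding H_def by (rule if_not_P)
   moreover have "0 \<le> u p * ln (real p) / real p" using u_nonneg[OF u(1), of p] by (cases "p = 0") auto
   ultimately show ?thesis by simp
  qed
  hence "(\<Sum>p\<le>nfloor y. v i p / real p * H (x / y) p) \<le> (\<Sum>p\<le>nfloor y. if p \<in> {nfloor (y / V)<..nfloor y} then u p * ln (real p) / real p else 0)"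
   by (intro sum_mono) auto
  also have "\<dots> = (\<Sum>p\<in>{nfloor (y / V)<..nfloor y}. u p * ln (real p) / real p)"
   by (rule sum.mono_neutral_cong_right) auto
  also have "\<dots> \<le> Ch * (ln (y / (y / V)) + 1)"
   by (rule mertens_window[OF u(1)]) (use y V in "auto simp: field_simps")
  also have "y / (y / V) = V" using y V by simp
  finally show ?thesis .
 qed
 have "ln (x / V) * win I v x V \<le> (\<Sum>f | f \<in> tup I x \<and> x / V < pr I f. wt v I f * ln (pr I f))"
  unfolding win_def sum_distrib_left
 proof (rule sum_mono)
  fix f assume f: "f \<in> {f. f \<in> tup I x \<and> x / V < pr I f}"
  hence "ln (x / V) \<le> ln (pr I f)" using V by (intro ln_mono) auto
  moreover have "0 \<le> wt v I f" using nn by (rule wt_nonneg)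
  ultimately show "ln (x / V) * wt v I f \<le> wt v I f * ln (pr I f)" using mult_right_mono[of "ln (x / V)" "ln (pr I f)" "wt v I f"] by (simp add: mult.commute)
 qed
 also have "\<dots> = (\<Sum>f\<in>tup I x. \<Sum>i\<in>I. wt v I f * H (pr (I - {i}) f) (f i))"
 proof (rule sum.mono_neutral_cong_left[OF finite_tup[OF I]])
  fix f assume f: "f \<in> {f. f \<in> tup I x \<and> x / V < pr I f}"
  hence "ln (pr I f) = (\<Sum>i\<in>I. ln (real (f i)))" by (intro ln_pr[OF _ I]) auto
  also have "\<dots> = (\<Sum>i\<in>I. H (pr (I - {i}) f) (f i))"
   using f by (intro sum.cong refl) (auto simp: H_def pr_remove[OF I])
  finally show "wt v I f * ln (pr I f) = (\<Sum>i\<in>I. wt v I f * H (pr (I - {i}) f) (f i))" by (simp only: sum_distrib_left)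
 next
  show "\<forall>f\<in>tup I x - {f \<in> tup I x. x / V < pr I f}. (\<Sum>i\<in>I. wt v I f * H (pr (I - {i}) f) (f i)) = 0"
  proof (intro ballI sum.neutral)
   fix f i assume f: "f \<in> tup I x - {f \<in> tup I x. x / V < pr I f}" and i: "i \<in> I"
   hence "\<not> x / V < real (f i) * pr (I - {i}) f" using pr_remove[OF I i, of f] by simp
   thus "wt v I f * H (pr (I - {i}) f) (f i) = 0" by (simp only: H_def if_False mult_zero_right)
  qed
 qed auto
 also have "\<dots> = (\<Sum>i\<in>I. \<Sum>f\<in>tup I x. wt v I f * H (pr (I - {i}) f) (f i))" by (rule sum.swap)
 also have "\<dots> \<le> (\<Sum>i\<in>I. Ch * (ln V + 1) * Tsum (I - {i}) v x)"
 proof (rule sum_mono)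
  fix i assume i: "i \<in> I"
  have "(\<Sum>f\<in>tup I x. wt v I f * H (pr (I - {i}) f) (f i)) \<le>
    (\<Sum>g\<in>tup (I - {i}) x. wt v (I - {i}) g * (\<Sum>p\<le>nfloor (x / pr (I - {i}) g). v i p / real p * H (pr (I - {i}) g) p))"
   by (rule coord_sum_le[of I i v H]) (use I i domD(3)[OF v[OF i]] nn H0 in auto)
  also have "\<dots> \<le> (\<Sum>g\<in>tup (I - {i}) x. wt v (I - {i}) g * (Ch * (ln V + 1)))"
  proof (intro sum_mono mult_left_mono wt_nonneg)
   fix g assume "g \<in> tup (I - {i}) x"
   hence m: "pr (I - {i}) g \<ge> 1" using tupD(5) by blast
   have "x > 0" using V by simp
   thus "(\<Sum>p\<le>nfloor (x / pr (I - {i}) g). v i p / real p * H (pr (I - {i}) g) p) \<le> Ch * (ln V + 1)"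
    using inner[OF i, of "x / pr (I - {i}) g"] m by simp
  qed (use nn in auto)
  finally show "(\<Sum>f\<in>tup I x. wt v I f * H (pr (I - {i}) f) (f i)) \<le> Ch * (ln V + 1) * Tsum (I - {i}) v x"
   by (simp add: Tsum_def sum_distrib_left mult_ac)
 qed
 finally show ?thesis using lx unfolding sum_distrib_left[symmetric] by (simp add: field_simps)
qed

lemma inverse_square_sum: "(\<Sum>p\<in>{m<..n}. 1 / real p ^ 2) \<le> 2 / real (Suc m)"
proof (cases "Suc m \<le> n")
 case True
 hence "(\<Sum>p\<in>{m<..n}. 1 / real p ^ 2) \<le> 2 / real (Suc m) - 1 / real n"
 proof (induction n rule: dec_induct)
  case base
  have "{m<..Suc m} = {Suc m}" by auto
  moreover have "1 / (real (Suc m) * real (Suc m)) \<le> 1 / real (Suc m)" by (simp add: divide_le_eq del: of_nat_Suc)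
  ultimately show ?case by (simp add: power2_eq_square del: of_nat_Suc)
 next
  case (step n)
  have n: "n > 0" using step by simp
  have "1 / real n - 1 / real (Suc n) = 1 / (real n * real (Suc n))" using n by (simp add: field_simps)
  moreover have "1 / (real (Suc n) * real (Suc n)) \<le> 1 / (real n * real (Suc n))"
   using n by (intro divide_left_mono mult_right_mono mult_pos_pos) auto
  moreover have "{m<..Suc n} = insert (Suc n) {m<..n}" using step by auto
  ultimately show ?case using step.IH by (simp add: power2_eq_square del: of_nat_Suc)
 qed
 thus ?thesis by (smt (verit) divide_nonneg_nonneg of_nat_0_le_iff)
qed simp

text \<open>A collision puts the same prime into the denominator twice, and the sum of 1 / p^2 over
  p > Y is at most 2 / (Y + 1).\<close>

lemma collision_bound:
 assumes J: "finite J" and v: "\<And>i. i \<in> J ==> dom (v i)" and w: "dom w"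
  and w0: "\<And>p. p \<le> Y ==> w p = 0" and x: "x > 0"
 shows "(\<Sum>g\<in>tup J x. wt v J g * (\<Sum>j\<in>J. if real (g j) * pr J g \<le> x then w (g j) / real (g j) else 0))
  \<le> 2 * M\<^sup>2 / real (Suc Y) * (\<Sum>j\<in>J. Tsum (J - {j}) v x)" (is "?l \<le> _")
  and "(\<Sum>g\<in>tup J x. wt v J g * (\<Sum>j\<in>J. if real (g j) * pr J g \<le> x then w (g j) / real (g j) else 0)) \<ge> 0"
proof -
 have nn: "i \<in> J ==> v i p \<ge> 0" for i p using domD v by blast
 have "?l \<le> (\<Sum>g\<in>tup J x. wt v J g * (\<Sum>j\<in>J. w (g j) / real (g j)))"
  using nn domD(1)[OF w] by (intro sum_mono mult_left_mono wt_nonneg) auto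
 also have "\<dots> = (\<Sum>j\<in>J. \<Sum>g\<in>tup J x. wt v J g * (w (g j) / real (g j)))"
  by (simp only: sum_distrib_left) (rule sum.swap)
 also have "\<dots> \<le> (\<Sum>j\<in>J. 2 * M\<^sup>2 / real (Suc Y) * Tsum (J - {j}) v x)"
 proof (rule sum_mono)
  fix j assume j: "j \<in> J"
  have "(\<Sum>g\<in>tup J x. wt v J g * (w (g j) / real (g j))) \<le> (\<Sum>p\<le>nfloor x. v j p / real p * (w p / real p)) * Tsum (J - {j}) v x"
   by (rule coord_sum_le_prod) (use J j v domD nn w in auto)
  also have "\<dots> \<le> (2 * M\<^sup>2 / real (Suc Y)) * Tsum (J - {j}) v x"
  proof (rule mult_right_mono)
   have "(\<Sum>p\<le>nfloor x. v j p / real p * (w p / real p)) = (\<Sum>p\<in>{Y<..nfloor x}. v j p / real p * (w p / real p))"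
    using w0 by (intro sum.mono_neutral_right) auto
   also have "\<dots> \<le> (\<Sum>p\<in>{Y<..nfloor x}. M\<^sup>2 * (1 / real p ^ 2))"
   proof (rule sum_mono)
    fix p
    have "v j p * w p \<le> M * M" using domD[OF v[OF j]] domD[OF w] M by (intro mult_mono) auto
    thus "v j p / real p * (w p / real p) \<le> M\<^sup>2 * (1 / real p ^ 2)" by (simp add: power2_eq_square divide_right_mono)
   qed
   also have "\<dots> \<le> M\<^sup>2 * (2 / real (Suc Y))" unfolding sum_distrib_left[symmetric]
    by (intro mult_left_mono inverse_square_sum) auto
   finally show "(\<Sum>p\<le>nfloor x. v j p / real p * (w p / real p)) \<le> 2 * M\<^sup>2 / real (Suc Y)" by (simp add: mult.commute)
   show "Tsum (J - {j}) v x \<ge> 0" using nn by (intro Tsum_nonneg) auto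
  qed
  finally show "(\<Sum>g\<in>tup J x. wt v J g * (w (g j) / real (g j))) \<le> 2 * M\<^sup>2 / real (Suc Y) * Tsum (J - {j}) v x" .
 qed
 finally show "?l \<le> 2 * M\<^sup>2 / real (Suc Y) * (\<Sum>j\<in>J. Tsum (J - {j}) v x)" by (simp only: sum_distrib_left)
 show "?l \<ge> 0" using nn domD(1)[OF w] by (intro sum_nonneg mult_nonneg_nonneg wt_nonneg) auto
qed


text \<open>The estimates for large x below are uniform over all such I and v, whose influence is
  confined to A and C.\<close>

definition good :: "real => real => real => 'i set => ('i => nat => real) => bool" where
 "good A C x I v \<longleftrightarrow> finite I \<and> (\<forall>i\<in>I. adm C (v i)) \<and> real (card I) \<le> A * lnln x"

abbreviation T_near where "T_near C' x I v \<equiv> (\<forall>i\<in>I. \<bar>Tsum I v x - lnln x * Tsum (I - {i}) v x\<bar> \<le> C' * Tsum (I - {i}) v x)"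

lemma admD: assumes "adm C v" shows "dom v" "y \<ge> 3 ==> \<bar>mu v y - lnln y\<bar> \<le> C"
 using assms by (auto simp: adm_def)

lemma good_nn: "good A C x I v ==> i \<in> I ==> v i p \<ge> 0"
 using domD(1) admD(1) by (auto simp: good_def)

lemma good_subset: "good A C x I v ==> J \<subseteq> I ==> good A C x J v"
 unfolding good_def using card_mono[of I J] finite_subset[of J I] by force

lemma mu_nonneg: "(\<And>p. v p \<ge> 0) ==> mu v y \<ge> 0" unfolding mu_def by (intro sum_nonneg) auto

text \<open>The nested scales \<open>4 exp (e\<^sup>-\<^sup>n ln x)\<close> count how far \<open>ln ln y\<close> lies below \<open>ln ln x\<close>.\<close>

lemma mu_lower_count:
 assumes v: "adm C v" and C: "C \<ge> 0" and L: "L \<ge> 0" and y: "1 \<le> y" "ln y \<le> exp L"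
 shows "L - C - 1 - (\<Sum>n\<in>{1..nfloor L}. of_bool (y < 4 * exp (exp (L - real n)))) \<le> mu v y"
proof -
 \<comment> \<open>The deficit of ln ln y against L. Below 3, where the Mertens estimate says
   nothing, all of L counts as deficit.\<close>
 define d where "d = (if y \<ge> 3 then L - lnln y else L)"
 have d0: "0 \<le> d" "d \<le> L"
 proof -
  have "lnln y \<le> L" if "y \<ge> 3" using y(2) ln_ge_1[OF that] by (metis exp_gt_zero less_le_trans ln_exp ln_mono zero_less_one)
  moreover have "0 \<le> lnln y" if "y \<ge> 3" using ln_ge_1[OF that] by simp
  ultimately show "0 \<le> d" "d \<le> L" using L by (auto simp: d_def)
 qed
 \<comment> \<open>The factor 4 in the scales places every y < 3 below all of them.\<close>
 have small: "y < 4 * exp (exp (L - real n))" if "real n \<le> d" for n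
 proof (cases "y \<ge> 3")
  case True
  hence "ln y = exp (lnln y)" using ln_ge_1[OF True] by simp
  also have "\<dots> \<le> exp (L - real n)" unfolding exp_le_cancel_iff using that True by (simp add: d_def)
  finally have "y \<le> exp (exp (L - real n))" using y by (metis exp_le_cancel_iff exp_ln less_le_trans zero_less_one)
  moreover have "exp (exp (L - real n)) > 0" by simp
  ultimately show ?thesis by linarith
 next
  case False
  moreover have "exp (exp (L - real n)) \<ge> 1" by simp
  ultimately show ?thesis by linarith
 qed
 have "real (nfloor d) = (\<Sum>n\<in>{1..nfloor d}. 1)" by simp
 also have "\<dots> = (\<Sum>n\<in>{1..nfloor d}. of_bool (y < 4 * exp (exp (L - real n))))"
 proof (intro sum.cong refl)
  fix n assume "n \<in> {1..nfloor d}"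
  hence "real n \<le> d" using of_nat_floor[of d] d0 by simp linarith
  thus "1 = of_bool (y < 4 * exp (exp (L - real n)))" using small by simp
 qed
 also have "\<dots> \<le> (\<Sum>n\<in>{1..nfloor L}. of_bool (y < 4 * exp (exp (L - real n))))"
 proof (rule sum_mono2)
  show "{1..nfloor d} \<subseteq> {1..nfloor L}" using d0 by (auto intro: order_trans[OF _ nat_mono[OF floor_mono]])
 qed auto
 finally have "d - 1 \<le> (\<Sum>n\<in>{1..nfloor L}. of_bool (y < 4 * exp (exp (L - real n))))" using d0 by linarith
 moreover have "L - d - C \<le> mu v y"
 proof (cases "y \<ge> 3")
  case True thus ?thesis using admD(2)[OF v True] by (simp add: d_def)
 next
  case False thus ?thesis using mu_nonneg[of v y] domD(1)[OF admD(1)[OF v]] C by (simp add: d_def)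
 qed
 ultimately show ?thesis by linarith
qed

text \<open>The logarithms of the scales decrease geometrically from ln x, so their sum is O(ln x)
  even though there are about ln ln x scales.\<close>

lemma scale_sum:
 assumes l: "exp L \<ge> 20" and L: "L \<ge> 0"
 shows "n \<ge> 1 ==> ln (4 * exp (exp (L - real n))) \<le> exp L / 2"
  and "(\<Sum>n\<in>{1..nfloor L}. ln (4 * exp (exp (L - real n))) + 1) \<le> 4 * exp L"
proof -
 have e2: "2 \<le> exp (1::real)" using exp_ge_add_one_self[of 1] by simp
 have e25: "5 / 2 \<le> exp (1::real)" using exp_lower_Taylor_quadratic[of 1] by simp
 have l4: "ln (4::real) \<le> 2" using ln_add_one_self_le_self[of 1] ln_mult[of 2 "2::real"] by simp
 have lnV: "ln (4 * exp (exp (L - real n))) = ln 4 + exp (L - real n)" for n by (simp add: ln_mult)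
 show "ln (4 * exp (exp (L - real n))) \<le> exp L / 2" if "n \<ge> 1"
 proof -
  have "exp (L - real n) \<le> exp (L - 1)" using that by simp
  also have "\<dots> = exp L / exp 1" by (rule exp_diff)
  also have "\<dots> \<le> exp L / (5 / 2)" using e25 by (intro divide_left_mono) auto
  finally show ?thesis using l4 l unfolding lnV by simp
 qed
 have half: "exp (L - real n) \<le> exp L * (1 / 2) ^ n" for n
 proof -
  have "exp (L - real n) = exp L / exp 1 ^ n" by (simp add: exp_diff exp_of_nat_mult[symmetric])
  also have "\<dots> \<le> exp L / 2 ^ n" using e2 by (intro divide_left_mono power_mono) auto
  finally show ?thesis by (simp add: power_one_over)
 qed
 have geo: "(\<Sum>n\<in>{1..N}. (1 / 2 :: real) ^ n) \<le> 1" for N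
 proof -
  have "(\<Sum>n\<in>{1..N}. (1 / 2 :: real) ^ n) = 1 - (1 / 2) ^ N" by (induction N) auto
  thus ?thesis by simp
 qed
 have "(\<Sum>n\<in>{1..nfloor L}. ln (4 * exp (exp (L - real n))) + 1) \<le> (\<Sum>n\<in>{1..nfloor L}. 3 + exp L * (1 / 2) ^ n)"
  using half l4 unfolding lnV by (intro sum_mono) (smt (verit))
 also have "\<dots> = 3 * real (nfloor L) + exp L * (\<Sum>n\<in>{1..nfloor L}. (1 / 2) ^ n)"
  by (simp add: sum.distrib sum_distrib_left)
 also have "\<dots> \<le> 3 * exp L + exp L * 1"
 proof (intro add_mono mult_left_mono geo)
  have "real (nfloor L) \<le> L" using L by (intro of_nat_floor)
  also have "L \<le> exp L" using exp_ge_add_one_self[of L] by linarith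
  finally show "real (nfloor L) \<le> exp L" .
 qed auto
 finally show "(\<Sum>n\<in>{1..nfloor L}. ln (4 * exp (exp (L - real n))) + 1) \<le> 4 * exp L" by simp
qed

text \<open>With g fixed, coordinate i contributes about ln ln (x / pr g), which falls short of L
  when pr g is close to x. The shortfall is counted scale by scale; each scale carries a share of
  order ln (V n) / ln x, and by \<open>scale_sum\<close> the total is O(1).\<close>

lemma ratio_step:
 assumes g: "good A C x I v" and i: "i \<in> I" and C: "C \<ge> 0" and A: "A \<ge> 0"
  and x: "x > 1" "ln x \<ge> 20" and L0: "L > 0" and L: "L = lnln x"
  and IH: "\<And>j. j \<in> I - {i} ==> Tsum (I - {i} - {j}) v x \<le> 2 / L * Tsum (I - {i}) v x"
 shows "(L - (C + 1 + 16 * A * Ch + 4 * A * M\<^sup>2)) * Tsum (I - {i}) v x \<le> Tsum I v x"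
proof -
 define J where "J = I - {i}"
 have gJ: "good A C x J v" unfolding J_def by (rule good_subset[OF g]) auto
 have finJ: "finite J" and finI: "finite I" using gJ g by (auto simp: good_def)
 have domJ: "\<And>i. i \<in> J ==> dom (v i)" and vi: "adm C (v i)" using g i by (auto simp: good_def adm_def J_def)
 have nn: "\<And>i p. i \<in> J ==> v i p \<ge> 0" using good_nn[OF gJ] by auto
 have eL: "exp L = ln x" using x L by simp
 define V where "V n = 4 * exp (exp (L - real n))" for n :: nat
 \<comment> \<open>There are at most A L coordinates, and IH bounds each summand by 2 / L times T,
   so L cancels. This is why index sets of size A ln ln x are tolerated.\<close>
 have S: "(\<Sum>j\<in>J. Tsum (J - {j}) v x) \<le> 2 * A * Tsum J v x"
 proof -
  have "(\<Sum>j\<in>J. Tsum (J - {j}) v x) \<le> (\<Sum>j\<in>J. 2 / L * Tsum J v x)" using IH unfolding J_def by (intro sum_mono)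
  also have "\<dots> = real (card J) * (2 / L * Tsum J v x)" by simp
  also have "\<dots> \<le> (A * L) * (2 / L * Tsum J v x)"
   using gJ L L0 Tsum_nonneg[of J v x] nn by (intro mult_right_mono) (auto simp: good_def)
  also have "\<dots> = 2 * A * Tsum J v x" using L0 by simp
  finally show ?thesis .
 qed
 define col where "col = (\<Sum>g\<in>tup J x. wt v J g * (\<Sum>j\<in>J. if real (g j) * pr J g \<le> x then v i (g j) / real (g j) else 0))"
 have "col \<le> 2 * M\<^sup>2 / real (Suc 0) * (\<Sum>j\<in>J. Tsum (J - {j}) v x)" unfolding col_def
  by (rule collision_bound) (use finJ domJ vi x domD(3)[OF admD(1)[OF vi], of 0] in \<open>auto simp: adm_def\<close>)
 also have "\<dots> \<le> 2 * M\<^sup>2 * (2 * A * Tsum J v x)" using mult_left_mono[OF S, of "2 * M\<^sup>2"] by simp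
 finally have col: "col \<le> 4 * A * M\<^sup>2 * Tsum J v x" by (simp add: mult_ac)
 have T: "Tsum I v x = (\<Sum>g\<in>tup J x. wt v J g * mu (v i) (x / pr J g)) - col"
  using Tsum_coord[of I i v, OF finI i] domD(3)[OF admD(1)[OF vi]]
  by (simp add: J_def col_def right_diff_distrib sum_subtractf)
 have "(\<Sum>n\<in>{1..nfloor L}. win J v x (V n)) \<le> (\<Sum>n\<in>{1..nfloor L}. (ln (V n) + 1) * (2 * Ch / exp L * (2 * A * Tsum J v x)))"
 proof (rule sum_mono)
  fix n assume n: "n \<in> {1..nfloor L}"
  have lnV: "ln (V n) \<le> ln x / 2" using scale_sum(1)[of L n] n L0 x eL by (simp add: V_def)
  have "1 \<le> exp (exp (L - real n))" by simp
  hence V1: "1 \<le> V n" unfolding V_def by linarith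
  hence lV0: "ln (V n) \<ge> 0" by simp
  have "ln (V n) < ln x" using lnV x by linarith
  hence Vx: "V n < x" using V1 x by simp
  have "win J v x (V n) \<le> Ch * (ln (V n) + 1) / ln (x / V n) * (\<Sum>j\<in>J. Tsum (J - {j}) v x)"
   by (rule window_bound[OF finJ domJ V1 Vx])
  also have "\<dots> \<le> Ch * (ln (V n) + 1) / (ln x / 2) * (2 * A * Tsum J v x)"
  proof (intro mult_mono divide_left_mono S)
   show "ln x / 2 \<le> ln (x / V n)" using lnV V1 x by (simp add: ln_div)
   hence "0 < ln (x / V n)" using x by linarith
   thus "0 < ln (x / V n) * (ln x / 2)" using x by (intro mult_pos_pos) auto
  qed (use Ch lV0 x nn in "auto intro!: sum_nonneg Tsum_nonneg divide_nonneg_nonneg mult_nonneg_nonneg")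
  finally show "win J v x (V n) \<le> (ln (V n) + 1) * (2 * Ch / exp L * (2 * A * Tsum J v x))" unfolding eL by (simp add: field_simps)
 qed
 also have "\<dots> = (\<Sum>n\<in>{1..nfloor L}. ln (V n) + 1) * (2 * Ch / exp L * (2 * A * Tsum J v x))" by (simp only: sum_distrib_right)
 also have "\<dots> \<le> (4 * exp L) * (2 * Ch / exp L * (2 * A * Tsum J v x))"
  unfolding V_def using scale_sum(2)[of L] eL x L0 A Ch Tsum_nonneg[of J v x] nn
  by (intro mult_right_mono mult_nonneg_nonneg divide_nonneg_nonneg) auto
 finally have W: "(\<Sum>n\<in>{1..nfloor L}. win J v x (V n)) \<le> 16 * A * Ch * Tsum J v x" by (simp add: mult_ac)
 have win: "win J v x (V n) = (\<Sum>g\<in>tup J x. wt v J g * of_bool (x / pr J g < V n))" for n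
  unfolding win_def
 proof (rule sum.mono_neutral_cong_left[OF finite_tup[OF finJ]])
  have *: "x / pr J g < V n \<longleftrightarrow> x / V n < pr J g" if "g \<in> tup J x" for g
   using tupD(5)[OF that] by (simp add: V_def field_simps)
  show "\<forall>g\<in>tup J x - {f \<in> tup J x. x / V n < pr J f}. wt v J g * of_bool (x / pr J g < V n) = 0" using * by auto
  show "\<And>g. g \<in> {f \<in> tup J x. x / V n < pr J f} ==> wt v J g = wt v J g * of_bool (x / pr J g < V n)" using * by auto
 qed auto
 have "(\<Sum>g\<in>tup J x. wt v J g * (L - C - 1 - (\<Sum>n\<in>{1..nfloor L}. of_bool (x / pr J g < V n)))) \<le> (\<Sum>g\<in>tup J x. wt v J g * mu (v i) (x / pr J g))"
 proof (intro sum_mono mult_left_mono wt_nonneg)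
  fix g assume "g \<in> tup J x"
  from tupD(3,5)[OF this] have "1 \<le> x / pr J g" "x / pr J g \<le> x" using floor_div_le x by auto
  moreover have "ln (x / pr J g) \<le> exp L" unfolding eL using calculation by simp
  ultimately show "L - C - 1 - (\<Sum>n\<in>{1..nfloor L}. of_bool (x / pr J g < V n)) \<le> mu (v i) (x / pr J g)"
   using mu_lower_count[OF vi C, of L "x / pr J g"] L0 by (simp add: V_def)
 qed (use nn in auto)
 also have "(\<Sum>g\<in>tup J x. wt v J g * (L - C - 1 - (\<Sum>n\<in>{1..nfloor L}. of_bool (x / pr J g < V n)))) =
   (L - C - 1) * Tsum J v x - (\<Sum>g\<in>tup J x. \<Sum>n\<in>{1..nfloor L}. wt v J g * of_bool (x / pr J g < V n))"
  unfolding right_diff_distrib[of "wt v J _" "L - C - 1"] sum_subtractf sum_distrib_left Tsum_def by (simp add: mult.commute)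
 also have "(\<Sum>g\<in>tup J x. \<Sum>n\<in>{1..nfloor L}. wt v J g * of_bool (x / pr J g < V n)) = (\<Sum>n\<in>{1..nfloor L}. win J v x (V n))"
  unfolding win by (rule sum.swap)
 finally have "(L - C - 1) * Tsum J v x - 16 * A * Ch * Tsum J v x - 4 * A * M\<^sup>2 * Tsum J v x \<le> Tsum I v x" using W col unfolding T by linarith
 thus ?thesis unfolding J_def[symmetric] by (simp add: left_diff_distrib distrib_right)
qed

text \<open>For the upper bound, distinctness is dropped and x / pr g enlarged to x. The lower bound
  needs induction over index sets, because \<open>ratio_step\<close> presupposes control of the
  deletions from I - {i}.\<close>

theorem T_ratio:
 assumes A: "A \<ge> 0" and C: "C \<ge> 0"
 shows "\<exists>C'\<ge>0. EV x. \<forall>(I :: 'i set) v. good A C x I v --> T_near C' x I v"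
proof -
 define C' where "C' = C + 1 + 16 * A * Ch + 4 * A * M\<^sup>2"
 have C': "C' \<ge> C + 1" using A Ch unfolding C'_def by simp
 \<comment> \<open>L >= 2 C' gives L - C' >= L / 2 and thereby the hypothesis IH of
   \<open>ratio_step\<close>; ln x >= 20 is required by \<open>scale_sum\<close>.\<close>
 have "EV x. lnln x \<ge> 2 * C' \<and> ln (x::real) \<ge> 20 \<and> x \<ge> 3"
  by (intro eventually_conj) (rule eventually_ge_at_top | real_asymp)+
 hence "EV x. \<forall>(I :: 'i set) v. good A C x I v --> T_near C' x I v"
 proof (eventually_elim, intro allI impI, goal_cases)
  case (1 x I v)
  hence x: "2 * C' \<le> lnln x \<and> 20 \<le> ln x \<and> 3 \<le> x" and good: "good A C x I v" by auto
  define L where "L = lnln x"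
  have L: "L \<ge> 2 * C'" "L > 0" using x C' C by (auto simp: L_def)
  have low: "\<forall>i\<in>I. (L - C') * Tsum (I - {i}) v x \<le> Tsum I v x" if "finite I" "good A C x I v" for I
   using that
  proof (induction I rule: finite_psubset_induct)
   case (psubset I)
   show ?case
   proof
    fix i assume i: "i \<in> I"
    show "(L - C') * Tsum (I - {i}) v x \<le> Tsum I v x" unfolding C'_def
    proof (rule ratio_step[OF psubset.prems i C A _ _ L(2) L_def])
     fix j assume j: "j \<in> I - {i}"
     have g: "good A C x (I - {i}) v" by (rule good_subset[OF psubset.prems]) auto
     have nn: "Tsum (I - {i} - {j}) v x \<ge> 0" using good_nn[OF g] by (intro Tsum_nonneg) auto
     have "(L - C') * Tsum (I - {i} - {j}) v x \<le> Tsum (I - {i}) v x"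
      using psubset.IH[of "I - {i}"] g i j by blast
     moreover have "L / 2 * Tsum (I - {i} - {j}) v x \<le> (L - C') * Tsum (I - {i} - {j}) v x"
      using L nn by (intro mult_right_mono) auto
     ultimately show "Tsum (I - {i} - {j}) v x \<le> 2 / L * Tsum (I - {i}) v x" using L by (simp add: field_simps)
    qed (use x in auto)
   qed
  qed
  show ?case
  proof
   fix i assume i: "i \<in> I"
   have fin: "finite I" and vi: "adm C (v i)" using good i by (auto simp: good_def)
   have nn: "0 \<le> Tsum (I - {i}) v x" using good_nn[OF good] by (intro Tsum_nonneg) auto
   have mi: "mu (v i) x \<le> L + C" using admD(2)[OF vi, of x] x by (simp add: L_def)
   have "(\<Sum>f\<in>tup I x. wt v I f * (\<lambda>_. 1) (f i)) \<le> (\<Sum>p\<le>nfloor x. v i p / real p * (\<lambda>_. 1) p) * Tsum (I - {i}) v x"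
    by (rule coord_sum_le_prod) (use fin i domD(3)[OF admD(1)[OF vi]] good_nn[OF good] in auto)
   hence "Tsum I v x \<le> mu (v i) x * Tsum (I - {i}) v x" by (simp add: Tsum_def mu_def)
   also have "\<dots> \<le> (L + C') * Tsum (I - {i}) v x" using mi C' nn by (intro mult_right_mono) auto
   finally have "Tsum I v x \<le> (L + C') * Tsum (I - {i}) v x" .
   moreover have "(L - C') * Tsum (I - {i}) v x \<le> Tsum I v x" using low[OF fin good] i by blast
   ultimately show "\<bar>Tsum I v x - lnln x * Tsum (I - {i}) v x\<bar> \<le> C' * Tsum (I - {i}) v x"
    unfolding L_def[symmetric] left_diff_distrib distrib_right by linarith
  qed
 qed
 thus ?thesis using C' C by (intro exI[of _ C']) auto
qed


abbreviation "Tdel I v x \<equiv> (\<Sum>i\<in>I. Tsum (I - {i}) v x)"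

abbreviation "T_regular A x I v \<equiv> 0 < Tsum I v x \<and>
  (\<forall>i\<in>I. Tsum (I - {i}) v x \<le> 2 / lnln x * Tsum I v x \<and> Tsum I v x \<le> 2 * lnln x * Tsum (I - {i}) v x) \<and>
  Tdel I v x \<le> 2 * A * Tsum I v x \<and>
  (\<forall>V. 1 \<le> V \<and> V < x --> win I v x V \<le> Ch * (ln V + 1) / ln (x / V) * (2 * A * Tsum I v x))"

lemma T_facts:
 assumes A: "A \<ge> 0" and C: "C \<ge> 0"
 shows "EV x. \<forall>(I :: 'i set) v. good A C x I v --> T_regular A x I v"
proof -
 from T_ratio[OF A C, where 'i = 'i] obtain C' where C': "C' \<ge> 0" and ev: "EV x. \<forall>(I :: 'i set) v. good A C x I v --> T_near C' x I v" by blast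
 have "EV x. lnln x \<ge> 2 * C' + 1 \<and> (x::real) \<ge> 1"
  by (intro eventually_conj) (rule eventually_ge_at_top | real_asymp)+
 with ev show ?thesis
 proof (eventually_elim, intro allI impI, goal_cases)
  case (1 x I v)
  note rat = 1(1) and g = 1(5)
  from 1 C' have L: "lnln x \<ge> 2 * C'" "lnln x > 0" "x \<ge> 1" by auto
  define L where "L = lnln x"
  have fin: "finite I" and dI: "\<And>i. i \<in> I ==> dom (v i)" using g by (auto simp: good_def adm_def)
  have two: "L / 2 * Tsum (J - {i}) v x \<le> Tsum J v x \<and> Tsum J v x \<le> 2 * L * Tsum (J - {i}) v x" if "J \<subseteq> I" "i \<in> J" for i J
  proof -
   have gJ: "good A C x J v" using good_subset[OF g that(1)] .
   have nn: "Tsum (J - {i}) v x \<ge> 0" using good_nn[OF gJ] by (intro Tsum_nonneg) auto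
   have "\<bar>Tsum J v x - L * Tsum (J - {i}) v x\<bar> \<le> C' * Tsum (J - {i}) v x" using rat gJ that(2) by (auto simp: L_def)
   moreover have "C' * Tsum (J - {i}) v x \<le> L / 2 * Tsum (J - {i}) v x" using L nn by (intro mult_right_mono) (auto simp: L_def)
   moreover have "0 \<le> L * Tsum (J - {i}) v x" using L nn by (simp add: L_def)
   ultimately show ?thesis by linarith
  qed
  have pos: "0 < Tsum J v x" if "J \<subseteq> I" for J
   using finite_subset[OF that fin] that
  proof (induction J rule: finite_induct)
   case (insert i J)
   hence "0 < L / 2 * Tsum J v x" using L by (simp add: L_def)
   also have "\<dots> \<le> Tsum (insert i J) v x" using two[of "insert i J" i] insert by auto
   finally show ?case .
  qed (use L in "simp add: Tsum_empty")
  have dn: "Tsum (I - {i}) v x \<le> 2 / L * Tsum I v x" if "i \<in> I" for i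
   using two[of I i] that L by (simp add: L_def field_simps)
  have S: "Tdel I v x \<le> 2 * A * Tsum I v x"
  proof -
   have "Tdel I v x \<le> (\<Sum>i\<in>I. 2 / L * Tsum I v x)" using dn by (intro sum_mono)
   also have "\<dots> = real (card I) * (2 / L * Tsum I v x)" by simp
   also have "\<dots> \<le> (A * L) * (2 / L * Tsum I v x)"
    using g pos[of I] L by (intro mult_right_mono) (auto simp: good_def L_def)
   also have "\<dots> = 2 * A * Tsum I v x" using L by (simp add: L_def)
   finally show ?thesis .
  qed
  have W: "win I v x V \<le> Ch * (ln V + 1) / ln (x / V) * (2 * A * Tsum I v x)" if V: "1 \<le> V" "V < x" for V
  proof -
   have "win I v x V \<le> Ch * (ln V + 1) / ln (x / V) * Tdel I v x" by (rule window_bound[OF fin dI V])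
   also have "\<dots> \<le> Ch * (ln V + 1) / ln (x / V) * (2 * A * Tsum I v x)"
    using V Ch by (intro mult_left_mono[OF S] divide_nonneg_nonneg mult_nonneg_nonneg) auto
   finally show ?thesis .
  qed
  show ?case
   using pos[of I] dn two[of I] S W by (auto simp: L_def)
 qed
qed

section \<open>From weighted counts to reciprocal sums\<close>

text \<open>The part of ln x not accounted for by the prime factors. Products up to sqrt x are
  negligible; for larger ones the factor 2 ln (pr I f) / ln x >= 1 is inserted, so that one
  coordinate becomes free for \<open>log_weighted_sum\<close>.\<close>

lemma log_remainder:
 assumes I: "finite I" and v: "\<And>i. i \<in> I ==> v i \<in> U" and x: "x > 1"
 shows "(\<Sum>f\<in>tup I x. vprod I v f * ln (x / pr I f)) \<le>
  sqrt x * ln x * Tsum I v x + 4 * Ch * x / ln x * Tdel I v x"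
  and "0 \<le> (\<Sum>f\<in>tup I x. vprod I v f * ln (x / pr I f))"
proof -
 have nn: "i \<in> I ==> v i p \<ge> 0" for i p using u_nonneg v by blast
 have wn: "wt v I f \<ge> 0" for f using nn by (rule wt_nonneg)
 have lx: "ln x > 0" using x by simp
 define H where "H m p = (if m * real p \<le> x \<and> m \<ge> 1 then m * real p * (ln (real p) * ln (x / (m * real p))) else 0)" for m p
 have H0: "H m p \<ge> 0" for m p by (cases "p = 0") (auto simp: H_def)
 have "(\<Sum>f\<in>tup I x. vprod I v f * ln (x / pr I f)) \<le>
  (\<Sum>f\<in>tup I x. sqrt x * ln x * wt v I f + 2 / ln x * (\<Sum>i\<in>I. wt v I f * H (pr (I - {i}) f) (f i)))"
 proof (rule sum_mono)
  fix f assume f: "f \<in> tup I x"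
  note m = tupD(3,5)[OF f]
  have l0: "0 \<le> ln (x / pr I f)" using m by simp
  have "pr (I - {i}) f \<ge> 1" if "i \<in> I" for i
   using prod_ge_1[of "I - {i}" "\<lambda>j. real (f j)"] tupD(6)[OF f] unfolding pr_def by (simp add: Suc_leI)
  hence "(\<Sum>i\<in>I. wt v I f * H (pr (I - {i}) f) (f i)) = (\<Sum>i\<in>I. wt v I f * (pr I f * (ln (real (f i)) * ln (x / pr I f))))"
   using m by (intro sum.cong refl) (simp add: H_def pr_remove[OF I] mult.commute)
  also have "\<dots> = wt v I f * pr I f * ln (pr I f) * ln (x / pr I f)"
   unfolding ln_pr[OF f I] by (simp add: sum_distrib_left sum_distrib_right mult_ac)
  finally have Heq: "(\<Sum>i\<in>I. wt v I f * H (pr (I - {i}) f) (f i)) = wt v I f * pr I f * ln (pr I f) * ln (x / pr I f)" .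
  have "pr I f * ln (x / pr I f) \<le> sqrt x * ln x + 2 / ln x * (pr I f * ln (pr I f) * ln (x / pr I f))"
  proof (cases "pr I f \<le> sqrt x")
   case True
   have "pr I f * ln (x / pr I f) \<le> sqrt x * ln x" using True m x floor_div_le[of "pr I f" x] by (intro mult_mono) auto
   moreover have "0 \<le> 2 / ln x * (pr I f * ln (pr I f) * ln (x / pr I f))" using lx l0 m by simp
   ultimately show ?thesis by linarith
  next
   case False
   hence "ln (sqrt x) \<le> ln (pr I f)" using x by (intro ln_mono) auto
   hence "ln x \<le> 2 * ln (pr I f)" using x by (simp add: ln_sqrt)
   hence "1 \<le> 2 / ln x * ln (pr I f)" using lx by (simp add: field_simps)
   hence "1 * (pr I f * ln (x / pr I f)) \<le> 2 / ln x * ln (pr I f) * (pr I f * ln (x / pr I f))"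
    using m l0 by (intro mult_right_mono) auto
   moreover have "0 \<le> sqrt x * ln x" using x by simp
   ultimately show ?thesis by (simp add: mult_ac)
  qed
  from mult_left_mono[OF this wn[of f]] show "vprod I v f * ln (x / pr I f) \<le> sqrt x * ln x * wt v I f + 2 / ln x * (\<Sum>i\<in>I. wt v I f * H (pr (I - {i}) f) (f i))"
   unfolding Heq prod_eq_pr_wt[OF f] by (simp add: algebra_simps)
 qed
 also have "\<dots> = sqrt x * ln x * Tsum I v x + 2 / ln x * (\<Sum>i\<in>I. \<Sum>f\<in>tup I x. wt v I f * H (pr (I - {i}) f) (f i))"
  unfolding sum.distrib Tsum_def by (subst sum.swap[where A = I]) (simp add: sum_distrib_left)
 finally have F: "(\<Sum>f\<in>tup I x. vprod I v f * ln (x / pr I f)) \<le> sqrt x * ln x * Tsum I v x + 2 / ln x * (\<Sum>i\<in>I. \<Sum>f\<in>tup I x. wt v I f * H (pr (I - {i}) f) (f i))" .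
 have "(\<Sum>i\<in>I. \<Sum>f\<in>tup I x. wt v I f * H (pr (I - {i}) f) (f i)) \<le> (\<Sum>i\<in>I. 2 * Ch * x * Tsum (I - {i}) v x)"
 proof (rule sum_mono)
  fix i assume i: "i \<in> I"
  have "(\<Sum>f\<in>tup I x. wt v I f * H (pr (I - {i}) f) (f i)) \<le>
    (\<Sum>g\<in>tup (I - {i}) x. wt v (I - {i}) g * (\<Sum>p\<le>nfloor (x / pr (I - {i}) g). v i p / real p * H (pr (I - {i}) g) p))"
   by (rule coord_sum_le[of I i v H]) (use I i u_prime[OF v[OF i]] nn H0 in auto)
  also have "\<dots> \<le> (\<Sum>g\<in>tup (I - {i}) x. wt v (I - {i}) g * (2 * Ch * x))"
  proof (intro sum_mono mult_left_mono wt_nonneg)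
   fix g assume "g \<in> tup (I - {i}) x"
   note m = tupD(3,5)[OF this]
   define y where "y = x / pr (I - {i}) g"
   have y: "y \<ge> 1" using m by (simp add: y_def)
   have "(\<Sum>p\<le>nfloor y. v i p / real p * H (pr (I - {i}) g) p) = (\<Sum>p\<le>nfloor y. pr (I - {i}) g * (v i p * ln (real p) * ln (y / real p)))"
   proof (intro sum.cong refl)
    fix p assume "p \<in> {..nfloor y}"
    hence "real p \<le> y" using of_nat_floor[of y] y by simp linarith
    hence "pr (I - {i}) g * real p \<le> x" using m by (simp add: y_def field_simps)
    thus "v i p / real p * H (pr (I - {i}) g) p = pr (I - {i}) g * (v i p * ln (real p) * ln (y / real p))"
     using m by (cases "p = 0") (auto simp: H_def y_def)
   qed
   also have "\<dots> \<le> pr (I - {i}) g * (2 * Ch * y)" unfolding sum_distrib_left[symmetric]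
    using m log_weighted_sum[OF v[OF i] y] by (intro mult_left_mono) auto
   also have "\<dots> = 2 * Ch * x" using m by (simp add: y_def)
   finally show "(\<Sum>p\<le>nfloor (x / pr (I - {i}) g). v i p / real p * H (pr (I - {i}) g) p) \<le> 2 * Ch * x" by (simp only: y_def)
  qed (use nn in auto)
  finally show "(\<Sum>f\<in>tup I x. wt v I f * H (pr (I - {i}) f) (f i)) \<le> 2 * Ch * x * Tsum (I - {i}) v x"
   by (simp add: Tsum_def sum_distrib_left mult_ac)
 qed
 also have "\<dots> = 2 * Ch * x * Tdel I v x" by (simp add: sum_distrib_left)
 finally have G: "(\<Sum>i\<in>I. \<Sum>f\<in>tup I x. wt v I f * H (pr (I - {i}) f) (f i)) \<le> 2 * Ch * x * Tdel I v x" .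
 show "(\<Sum>f\<in>tup I x. vprod I v f * ln (x / pr I f)) \<le>
  sqrt x * ln x * Tsum I v x + 4 * Ch * x / ln x * Tdel I v x"
  using F mult_left_mono[OF G, of "2 / ln x"] lx by (simp add: mult_ac)
 show "0 \<le> (\<Sum>f\<in>tup I x. vprod I v f * ln (x / pr I f))"
 proof (intro sum_nonneg mult_nonneg_nonneg prod_nonneg)
  fix f assume "f \<in> tup I x"
  from tupD(3,5)[OF this] show "0 \<le> ln (x / pr I f)" by simp
 qed (use nn in auto)
qed

text \<open>Summing coordinate i with weight ln p gives \<open>th\<close> at y = x / pr g, and pr g
  * y = x turns the main term into x T. For y >= V the prime number theorem is used; for y < V
  Chebyshev's bound suffices, those g being counted by \<open>win\<close>.\<close>

lemma log_coordinate:
 assumes I: "finite I" "i \<in> I" and v: "\<And>i. i \<in> I ==> v i \<in> U" and V: "V \<ge> 3" and x: "x > 0"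
 shows "\<bar>(\<Sum>f\<in>tup I x. vprod I v f * ln (real (f i))) - x * Tsum (I - {i}) v x\<bar> \<le>
  x * ((K * ln V powr (- b) + 2 * real (card I) * M / sqrt V) * Tsum (I - {i}) v x + (Ch + real (card I) * M) * win (I - {i}) v x V)"
proof -
 define J where "J = I - {i}"
 have J: "finite J" "card J \<le> card I" using I by (auto simp: J_def card_mono)
 have nn: "i \<in> I ==> v i p \<ge> 0" for i p using u_nonneg v by blast
 define e where "e = K * ln V powr (- b) + 2 * real (card I) * M / sqrt V"
 define cl where "cl g = (\<Sum>j\<in>J. if real (g j) * pr J g \<le> x then v i (g j) * ln (real (g j)) else 0)" for g
 have "(\<Sum>f\<in>tup I x. vprod I v f * ln (real (f i))) = (\<Sum>f\<in>tup I x. wt v I f * (\<lambda>m p. m * real p * ln (real p)) (pr (I - {i}) f) (f i))"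
  by (intro sum.cong refl) (simp add: prod_eq_pr_wt pr_remove[OF I] mult_ac)
 also have "\<dots> = (\<Sum>g\<in>tup (I - {i}) x. wt v (I - {i}) g * ((\<Sum>p\<le>nfloor (x / pr (I - {i}) g). v i p / real p * (\<lambda>m p. m * real p * ln (real p)) (pr (I - {i}) g) p)
    - (\<Sum>j\<in>I - {i}. if real (g j) * pr (I - {i}) g \<le> x then v i (g j) / real (g j) * (\<lambda>m p. m * real p * ln (real p)) (pr (I - {i}) g) (g j) else 0)))"
  by (rule coord_sum) (use I u_prime[OF v[OF I(2)]] in auto)
 also have "\<dots> = (\<Sum>g\<in>tup J x. wt v J g * (pr J g * (th (v i) (x / pr J g) - cl g)))"
 proof (unfold J_def[symmetric], intro sum.cong refl arg_cong2[of _ _ _ _ "(*)"])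
  fix g assume g: "g \<in> tup J x"
  have "(\<Sum>p\<le>nfloor (x / pr J g). v i p / real p * (pr J g * real p * ln (real p))) = pr J g * th (v i) (x / pr J g)"
   unfolding th_def sum_distrib_left by (intro sum.cong refl) (auto simp: u_0[OF v[OF I(2)]])
  moreover have "(\<Sum>j\<in>J. if real (g j) * pr J g \<le> x then v i (g j) / real (g j) * (pr J g * real (g j) * ln (real (g j))) else 0) = pr J g * cl g"
   unfolding cl_def sum_distrib_left using tupD(6)[OF g] by (intro sum.cong refl) auto
  ultimately show "(\<Sum>p\<le>nfloor (x / pr J g). v i p / real p * (pr J g * real p * ln (real p))) - (\<Sum>j\<in>J. if real (g j) * pr J g \<le> x then v i (g j) / real (g j) * (pr J g * real (g j) * ln (real (g j))) else 0) = pr J g * (th (v i) (x / pr J g) - cl g)"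
   by (simp add: right_diff_distrib)
 qed
 finally have eq: "(\<Sum>f\<in>tup I x. vprod I v f * ln (real (f i))) - x * Tsum J v x = (\<Sum>g\<in>tup J x. wt v J g * (pr J g * (th (v i) (x / pr J g) - cl g) - x))"
  by (simp add: Tsum_def right_diff_distrib sum_subtractf sum_distrib_left mult.commute)
 have pt: "\<bar>pr J g * (th (v i) (x / pr J g) - cl g) - x\<bar> \<le> x * (e + (Ch + real (card I) * M) * of_bool (x / V < pr J g))" if g: "g \<in> tup J x" for g
 proof -
  note m = tupD(3,5)[OF g]
  define y where "y = x / pr J g"
  have y: "y \<ge> 1" "x = pr J g * y" using m by (auto simp: y_def)
  have cl0: "0 \<le> cl g" unfolding cl_def using nn[OF I(2)] tupD(6)[OF g] by (intro sum_nonneg) (simp add: Suc_leI)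
  have "cl g \<le> (\<Sum>j\<in>J. M * ln y)" unfolding cl_def
  proof (rule sum_mono)
   fix j assume j: "j \<in> J"
   have p: "real (g j) \<ge> 1" using tupD(6)[OF g j] by linarith
   show "(if real (g j) * pr J g \<le> x then v i (g j) * ln (real (g j)) else 0) \<le> M * ln y"
   proof (cases "real (g j) * pr J g \<le> x")
    case True
    hence "real (g j) \<le> y" using m by (simp add: y_def field_simps)
    hence "v i (g j) * ln (real (g j)) \<le> M * ln y" using u_le[OF v[OF I(2)]] nn[OF I(2)] p M by (intro mult_mono) auto
    thus ?thesis using True by simp
   qed (use M y in simp)
  qed
  also have "\<dots> = real (card J) * (M * ln y)" by simp
  also have "\<dots> \<le> real (card I) * (M * ln y)" using J y M by (intro mult_right_mono) auto
  finally have cl1: "cl g \<le> real (card I) * (M * ln y)" .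
  have "\<bar>th (v i) y - cl g - y\<bar> \<le> y * (e + (Ch + real (card I) * M) * of_bool (x / V < pr J g))"
  proof (cases "y < V")
   case True
   have "\<bar>th (v i) y - y\<bar> \<le> Ch * y" using th_nonneg[OF v[OF I(2)], of y] chebyshev[OF v[OF I(2)], of y] Ch
    mult_right_mono[of 1 Ch y] y(1) by linarith
   moreover have "ln y \<le> y" using ln_le_minus_one[of y] y by simp
   hence "real (card I) * (M * ln y) \<le> real (card I) * (M * y)" using M by (intro mult_left_mono) auto
   moreover have "0 \<le> y * e" using y K M V by (simp add: e_def)
   moreover have "x / V < pr J g" using True m V by (simp add: y_def field_simps)
   ultimately show ?thesis using cl0 cl1 by (simp add: algebra_simps)
  next
   case False
   have lV: "ln V \<ge> 1" by (rule ln_ge_1[OF V])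
   have "\<bar>th (v i) y - y\<bar> \<le> K * y * ln y powr (- b)" using pnt[OF v[OF I(2)], of y] False V by simp
   also have "\<dots> \<le> K * y * ln V powr (- b)" using False V K y b lV by (intro mult_left_mono powr_mono2') auto
   finally have 1: "\<bar>th (v i) y - y\<bar> \<le> K * y * ln V powr (- b)" .
   \<comment> \<open>Collisions cost at most card I * M * ln y, and ln y <= 2 y / sqrt V is small
     compared with y.\<close>
   have "ln y = 2 * ln (sqrt y)" using y by (simp add: ln_sqrt)
   also have "\<dots> \<le> 2 * sqrt y" using ln_le_minus_one[of "sqrt y"] y by simp
   also have "\<dots> = 2 * (y / sqrt y)" using real_div_sqrt[of y] y(1) by linarith
   also have "\<dots> \<le> 2 * (y / sqrt V)" using False V y by (intro mult_left_mono divide_left_mono mult_pos_pos) auto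
   finally have "real (card I) * (M * ln y) \<le> real (card I) * (M * (2 * (y / sqrt V)))" using M by (intro mult_left_mono) auto
   moreover have "0 \<le> y * ((Ch + real (card I) * M) * of_bool (x / V < pr J g))" using y Ch M by simp
   moreover have "y * e = K * y * ln V powr (- b) + real (card I) * (M * (2 * (y / sqrt V)))" by (simp add: e_def distrib_left)
   ultimately show ?thesis using 1 cl0 cl1 unfolding distrib_left[of y] by linarith
  qed
  hence "pr J g * \<bar>th (v i) y - cl g - y\<bar> \<le> pr J g * (y * (e + (Ch + real (card I) * M) * of_bool (x / V < pr J g)))"
   using m by (intro mult_left_mono) auto
  moreover have "\<bar>pr J g * (th (v i) y - cl g) - x\<bar> = pr J g * \<bar>th (v i) y - cl g - y\<bar>"
   using m y(2) abs_mult[of "pr J g" "th (v i) y - cl g - y"] by (simp add: right_diff_distrib)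
  ultimately show ?thesis using y(2) by (simp add: y_def[symmetric] mult.assoc[symmetric])
 qed
 have "\<bar>\<Sum>g\<in>tup J x. wt v J g * (pr J g * (th (v i) (x / pr J g) - cl g) - x)\<bar> \<le> (\<Sum>g\<in>tup J x. wt v J g * (x * (e + (Ch + real (card I) * M) * of_bool (x / V < pr J g))))"
 proof (rule order_trans[OF sum_abs], rule sum_mono)
  fix g assume g: "g \<in> tup J x"
  have "wt v J g \<ge> 0" using nn by (intro wt_nonneg) (auto simp: J_def)
  thus "\<bar>wt v J g * (pr J g * (th (v i) (x / pr J g) - cl g) - x)\<bar> \<le> wt v J g * (x * (e + (Ch + real (card I) * M) * of_bool (x / V < pr J g)))"
   using mult_left_mono[OF pt[OF g], of "wt v J g"] by (simp only: abs_mult abs_of_nonneg)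
 qed
 also have "\<dots> = x * (e * Tsum J v x + (Ch + real (card I) * M) * (\<Sum>g\<in>tup J x. wt v J g * of_bool (x / V < pr J g)))"
  unfolding Tsum_def by (simp only: distrib_left sum.distrib sum_distrib_left) (simp only: mult_ac)
 also have "(\<Sum>g\<in>tup J x. wt v J g * of_bool (x / V < pr J g)) = win J v x V"
  unfolding win_def by (rule sum.mono_neutral_cong_right[OF finite_tup[OF J(1)]]) auto
 finally show ?thesis using eq unfolding J_def e_def by simp
qed

end

text \<open>Weights are exchanged one at a time, each exchange starting from a mixture of old and
  new ones; \<beta> depends only on the weight removed, so the main terms add up.\<close>

lemma replace_all_bound:
 fixes \<Phi> :: "('i => 'w) => real"
 assumes J: "finite J" and w: "w \<in> W" and v: "\<forall>i\<in>J. v i \<in> W"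
  and step: "\<And>v i. \<forall>i\<in>J. v i \<in> W ==> i \<in> J ==> \<bar>\<Phi> v - \<Phi> (v(i := w)) - \<beta> (v i)\<bar> \<le> e"
 shows "\<bar>\<Phi> v - \<Phi> (\<lambda>i. if i \<in> J then w else v i) - (\<Sum>i\<in>J. \<beta> (v i))\<bar> \<le> real (card J) * e"
proof -
 have "\<bar>\<Phi> v - \<Phi> (\<lambda>i. if i \<in> Z then w else v i) - (\<Sum>i\<in>Z. \<beta> (v i))\<bar> \<le> real (card Z) * e" if "finite Z" "Z \<subseteq> J" for Z
  using that
 proof (induction Z rule: finite_induct)
  case (insert i Z)
  define v' where "v' = (\<lambda>i. if i \<in> Z then w else v i)"
  have v': "\<forall>i\<in>J. v' i \<in> W" "v' i = v i" "v'(i := w) = (\<lambda>j. if j \<in> insert i Z then w else v j)"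
   using v w insert.hyps by (auto simp: v'_def)
  have "\<bar>\<Phi> v' - \<Phi> (v'(i := w)) - \<beta> (v i)\<bar> \<le> e" using step[OF v'(1), of i] insert.prems unfolding v'(2) by simp
  moreover have "\<bar>\<Phi> v - \<Phi> v' - (\<Sum>i\<in>Z. \<beta> (v i))\<bar> \<le> real (card Z) * e" using insert unfolding v'_def by auto
  moreover have "real (card (insert i Z)) * e = real (card Z) * e + e" using insert.hyps by (simp add: distrib_right)
  moreover have "(\<Sum>i\<in>insert i Z. \<beta> (v i)) = (\<Sum>i\<in>Z. \<beta> (v i)) + \<beta> (v i)" using insert.hyps by simp
  ultimately show ?case unfolding v'(3) by linarith
 qed simp
 thus ?thesis using J by blast
qed

context prime_weights
begin

text \<open>All losses are powers of ln ln x while the saving is a power of ln x, so any power of ln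
  ln x could be gained; the third is enough to be negligible against the error term of order (ln ln
  x)^-2.\<close>

theorem Nsum_Tsum:
 assumes A: "A \<ge> 0" and C: "C \<ge> 0"
 shows "EV x. \<forall>(I :: 'i set) v. good A C x I v \<and> (\<forall>i\<in>I. v i \<in> U) \<and> I \<noteq> {} -->
  \<bar>Nsum I v x * ln x / x - Tdel I v x\<bar> \<le> Tdel I v x / lnln x ^ 3"
proof -
 \<comment> \<open>The terms are the prime number theorem at V, collisions, tuples within V of x,
   and the two parts of \<open>log_remainder\<close>.\<close>
 define E where "E x = K * sqrt (ln x) powr (- b) + 2 * (A * lnln x) * M / sqrt (exp (sqrt (ln x)))
   + (Ch + A * lnln x * M) * (Ch * (sqrt (ln x) + 1) / (ln x - sqrt (ln x)) * (2 * A)) + 4 * Ch / ln x + 2 * lnln x * ln x / sqrt x" for x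
 have "((\<lambda>x. lnln x ^ 3 * E x) \<longlongrightarrow> 0) at_top"
 proof -
  have 1: "((\<lambda>x. lnln x ^ 3 * sqrt (ln x) powr (- b)) \<longlongrightarrow> 0) at_top" using b by real_asymp
  have 2: "((\<lambda>x::real. lnln x ^ 3 * (lnln x / sqrt (exp (sqrt (ln x))))) \<longlongrightarrow> 0) at_top" by real_asymp
  have 3: "((\<lambda>x::real. lnln x ^ 3 * ((sqrt (ln x) + 1) / (ln x - sqrt (ln x)))) \<longlongrightarrow> 0) at_top" by real_asymp
  have 4: "((\<lambda>x::real. lnln x ^ 3 * (lnln x * ((sqrt (ln x) + 1) / (ln x - sqrt (ln x))))) \<longlongrightarrow> 0) at_top" by real_asymp
  have 5: "((\<lambda>x::real. lnln x ^ 3 * (1 / ln x)) \<longlongrightarrow> 0) at_top" by real_asymp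
  have 6: "((\<lambda>x::real. lnln x ^ 3 * (lnln x * ln x / sqrt x)) \<longlongrightarrow> 0) at_top" by real_asymp
  have "((\<lambda>x. K * (lnln x ^ 3 * sqrt (ln x) powr (- b)) + 2 * A * M * (lnln x ^ 3 * (lnln x / sqrt (exp (sqrt (ln x)))))
   + 2 * A * Ch * Ch * (lnln x ^ 3 * ((sqrt (ln x) + 1) / (ln x - sqrt (ln x))))
   + 2 * A * Ch * A * M * (lnln x ^ 3 * (lnln x * ((sqrt (ln x) + 1) / (ln x - sqrt (ln x)))))
   + 4 * Ch * (lnln x ^ 3 * (1 / ln x)) + 2 * (lnln x ^ 3 * (lnln x * ln x / sqrt x))) \<longlongrightarrow> 0) at_top"
   using tendsto_add[OF tendsto_add[OF tendsto_add[OF tendsto_add[OF tendsto_add[OF tendsto_mult[OF tendsto_const[of K] 1]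
     tendsto_mult[OF tendsto_const[of "2 * A * M"] 2]] tendsto_mult[OF tendsto_const[of "2 * A * Ch * Ch"] 3]] tendsto_mult[OF tendsto_const[of "2 * A * Ch * A * M"] 4]]
     tendsto_mult[OF tendsto_const[of "4 * Ch"] 5]] tendsto_mult[OF tendsto_const[of 2] 6]] by simp
  thus ?thesis
  proof (rule Lim_transform_eventually)
   show "EV x. K * (lnln x ^ 3 * sqrt (ln x) powr (- b)) + 2 * A * M * (lnln x ^ 3 * (lnln x / sqrt (exp (sqrt (ln x)))))
   + 2 * A * Ch * Ch * (lnln x ^ 3 * ((sqrt (ln x) + 1) / (ln x - sqrt (ln x))))
   + 2 * A * Ch * A * M * (lnln x ^ 3 * (lnln x * ((sqrt (ln x) + 1) / (ln x - sqrt (ln x)))))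
   + 4 * Ch * (lnln x ^ 3 * (1 / ln x)) + 2 * (lnln x ^ 3 * (lnln x * ln x / sqrt x)) = lnln x ^ 3 * E x"
    unfolding E_def by (rule always_eventually) (simp add: divide_inverse distrib_left distrib_right mult_ac)
  qed
 qed
 hence "EV x. lnln x ^ 3 * E x < 1" by (rule order_tendstoD) simp
 moreover have "EV x. (x::real) > 1 \<and> ln x > 1 \<and> lnln x > 0 \<and> sqrt (ln x) < ln x \<and> sqrt (ln x) \<ge> 2"
  by (intro eventually_conj) (rule eventually_gt_at_top | real_asymp)+
 moreover note T_facts[OF A C, where 'i = 'i]
 ultimately show ?thesis
 proof (eventually_elim, intro allI impI, goal_cases)
  case (1 x I v)
  note E1 = 1(1) and tf = 1(3)
  from 1 have x: "x > 1" "ln x > 1" "lnln x > 0" "sqrt (ln x) < ln x" "sqrt (ln x) \<ge> 2" and g: "good A C x I v"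
   and vU: "\<And>i. i \<in> I ==> v i \<in> U" and I: "I \<noteq> {}" by auto
  have fin: "finite I" and cI: "real (card I) \<le> A * lnln x" using g by (auto simp: good_def)
  define S where "S = Tdel I v x"
  have nn: "Tsum J v x \<ge> 0" if "J \<subseteq> I" for J using good_nn[OF g] that by (intro Tsum_nonneg) auto
  have S0: "S \<ge> 0" unfolding S_def using nn by (intro sum_nonneg) auto
  \<comment> \<open>With ln V = sqrt (ln x), both the error of the prime number theorem at V and the
    ratio ln V / ln x tend to 0.\<close>
  define V where "V = exp (sqrt (ln x))"
  have V: "V \<ge> 3" using exp_ge_add_one_self[of "sqrt (ln x)"] x unfolding V_def by linarith
  have lV: "ln V = sqrt (ln x)" by (simp add: V_def)
  have "V < exp (ln x)" unfolding V_def exp_less_cancel_iff by (rule x(4))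
  hence Vx: "V < x" using x by simp
  define e where "e = K * sqrt (ln x) powr (- b) + 2 * (A * lnln x) * M / sqrt V
   + (Ch + A * lnln x * M) * (Ch * (sqrt (ln x) + 1) / (ln x - sqrt (ln x)) * (2 * A))"
  have each: "\<bar>(\<Sum>f\<in>tup I x. vprod I v f * ln (real (f i))) - x * Tsum (I - {i}) v x\<bar> \<le> x * (e * Tsum (I - {i}) v x)" if i: "i \<in> I" for i
  proof -
   have gi: "good A C x (I - {i}) v" by (rule good_subset[OF g]) auto
   define T where "T = Tsum (I - {i}) v x"
   have T0: "T \<ge> 0" using nn by (simp add: T_def)
   have "win (I - {i}) v x V \<le> Ch * (ln V + 1) / ln (x / V) * (2 * A * T)" using tf gi V Vx unfolding T_def by auto
   also have "ln (x / V) = ln x - sqrt (ln x)" using x V lV by (simp add: ln_div)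
   finally have W: "win (I - {i}) v x V \<le> Ch * (sqrt (ln x) + 1) / (ln x - sqrt (ln x)) * (2 * A) * T" by (simp add: lV mult_ac)
   have "\<bar>(\<Sum>f\<in>tup I x. vprod I v f * ln (real (f i))) - x * T\<bar> \<le>
    x * ((K * ln V powr (- b) + 2 * real (card I) * M / sqrt V) * T + (Ch + real (card I) * M) * win (I - {i}) v x V)"
    unfolding T_def by (rule log_coordinate[OF fin i vU V]) (use x in auto)
   also have "\<dots> \<le> x * ((K * sqrt (ln x) powr (- b) + 2 * (A * lnln x) * M / sqrt V) * T + (Ch + A * lnln x * M) * (Ch * (sqrt (ln x) + 1) / (ln x - sqrt (ln x)) * (2 * A) * T))"
    unfolding lV using x cI M Ch V T0 W A
    by (intro mult_left_mono add_mono mult_right_mono mult_mono divide_right_mono) (auto intro!: mult_nonneg_nonneg divide_nonneg_nonneg add_nonneg_nonneg sum_nonneg wt_nonneg good_nn[OF gi] simp: win_def)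
   also have "\<dots> = x * (e * T)" unfolding e_def by (simp add: distrib_right mult.assoc)
   finally show ?thesis by (simp only: T_def)
  qed
  define R where "R = (\<Sum>f\<in>tup I x. vprod I v f * ln (x / pr I f))"
  have "Nsum I v x * ln x = (\<Sum>f\<in>tup I x. vprod I v f * ln (x / pr I f) + (\<Sum>i\<in>I. vprod I v f * ln (real (f i))))"
   unfolding Nsum_def sum_distrib_right
  proof (intro sum.cong refl)
   fix f assume f: "f \<in> tup I x"
   have "ln x = ln (x / pr I f) + (\<Sum>i\<in>I. ln (real (f i)))" using tupD(5)[OF f] x ln_pr[OF f fin] by (simp add: ln_div)
   thus "vprod I v f * ln x = vprod I v f * ln (x / pr I f) + (\<Sum>i\<in>I. vprod I v f * ln (real (f i)))"
    by (simp only: distrib_left sum_distrib_left)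
  qed
  also have "\<dots> = R + (\<Sum>i\<in>I. \<Sum>f\<in>tup I x. vprod I v f * ln (real (f i)))" unfolding sum.distrib R_def by (subst sum.swap[where A = I]) simp
  finally have N: "Nsum I v x * ln x - x * S = R + (\<Sum>i\<in>I. (\<Sum>f\<in>tup I x. vprod I v f * ln (real (f i))) - x * Tsum (I - {i}) v x)"
   by (simp add: S_def sum_subtractf sum_distrib_left)
  have "\<bar>\<Sum>i\<in>I. (\<Sum>f\<in>tup I x. vprod I v f * ln (real (f i))) - x * Tsum (I - {i}) v x\<bar> \<le> (\<Sum>i\<in>I. x * (e * Tsum (I - {i}) v x))"
   by (rule order_trans[OF sum_abs]) (intro sum_mono each)
  also have "\<dots> = x * (e * S)" by (simp only: S_def sum_distrib_left)
  finally have D: "\<bar>\<Sum>i\<in>I. (\<Sum>f\<in>tup I x. vprod I v f * ln (real (f i))) - x * Tsum (I - {i}) v x\<bar> \<le> x * (e * S)" .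
  obtain i where i: "i \<in> I" using I by blast
  have "Tsum I v x \<le> 2 * lnln x * Tsum (I - {i}) v x" using tf g i by blast
  also have "\<dots> \<le> 2 * lnln x * S" unfolding S_def using x nn fin i by (intro mult_left_mono member_le_sum) auto
  finally have TS: "sqrt x * ln x * Tsum I v x \<le> sqrt x * ln x * (2 * lnln x * S)" using x by (intro mult_left_mono) auto
  have R: "0 \<le> R" "R \<le> sqrt x * ln x * Tsum I v x + 4 * Ch * x / ln x * S"
   unfolding R_def S_def using log_remainder[OF fin vU x(1)] by auto
  have sx: "sqrt x = x / sqrt x" using real_div_sqrt[of x] x(1) by simp
  have "\<bar>Nsum I v x * ln x - x * S\<bar> \<le> x * (e * S) + (x / sqrt x * ln x * (2 * lnln x * S) + 4 * Ch * x / ln x * S)"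
  proof -
   have "x / sqrt x * ln x * (2 * lnln x * S) = sqrt x * ln x * (2 * lnln x * S)" by (simp only: sx[symmetric])
   thus ?thesis unfolding N using D R TS by linarith
  qed
  also have "\<dots> = x * (E x * S)" unfolding E_def e_def V_def by (simp add: algebra_simps)
  finally have "\<bar>Nsum I v x * ln x - x * S\<bar> / x \<le> E x * S" using x by (simp add: divide_le_eq mult.commute)
  moreover have "\<bar>Nsum I v x * ln x - x * S\<bar> / x = \<bar>Nsum I v x * ln x / x - S\<bar>"
  proof -
   have "Nsum I v x * ln x / x - S = (Nsum I v x * ln x - x * S) / x" using x by (simp add: diff_divide_distrib)
   thus ?thesis using x by (simp only: abs_divide)
  qed
  moreover have "E x \<le> 1 / lnln x ^ 3" using E1 x by (simp add: field_simps)
  hence "E x * S \<le> 1 / lnln x ^ 3 * S" using S0 by (rule mult_right_mono)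
  ultimately show ?case
   by (simp add: S_def[symmetric])
 qed
qed

section \<open>Exchanging weights, and the first-order bias for fixed k\<close>

text \<open>Both sums share the coordinates other than i, so apart from collisions only mu (v i) -
  mu w at x / pr g enters. B is its limiting value, e the error for arguments from V on, D the extra
  error below V. Vanishing up to Y makes the collisions small for restricted weights.\<close>

lemma swap_weight:
 assumes I: "finite I" "i \<in> I" and v: "\<And>i. i \<in> I ==> dom (v i)" and w: "dom w" and x: "x > 0"
  and Y: "\<And>p. p \<le> Y ==> w p = 0" "\<And>p. p \<le> Y ==> v i p = 0"
  and D: "\<And>y. 1 \<le> y ==> y \<le> x ==> \<bar>mu (v i) y - mu w y - B\<bar> \<le> e + D * of_bool (y < V)" and e: "e \<ge> 0" "D \<ge> 0" and V: "V > 0"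
 shows "\<bar>Tsum I v x - Tsum I (v(i := w)) x - B * Tsum (I - {i}) v x\<bar> \<le>
  e * Tsum (I - {i}) v x + D * win (I - {i}) v x V + 2 * M\<^sup>2 / real (Suc Y) * (\<Sum>j\<in>I - {i}. Tsum (I - {i} - {j}) v x)"
proof -
 define J where "J = I - {i}"
 have J: "finite J" "i \<notin> J" using I by (auto simp: J_def)
 define cl where "cl w = (\<Sum>g\<in>tup J x. wt v J g * (\<Sum>j\<in>J. if real (g j) * pr J g \<le> x then w (g j) / real (g j) else 0))" for w :: "nat => real"
 have 1: "Tsum I v x = (\<Sum>g\<in>tup J x. wt v J g * mu (v i) (x / pr J g)) - cl (v i)"
  using Tsum_coord[of I i v, OF I] domD(3)[OF v[OF I(2)]] by (simp add: J_def cl_def right_diff_distrib sum_subtractf)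
 have "wt (v(i := w)) J g = wt v J g" for g by (rule wt_cong) (use J in auto)
 hence 2: "Tsum I (v(i := w)) x = (\<Sum>g\<in>tup J x. wt v J g * mu w (x / pr J g)) - cl w"
  using Tsum_coord[of I i "v(i := w)", unfolded fun_upd_same, OF I domD(3)[OF w]] by (simp add: J_def cl_def right_diff_distrib sum_subtractf)
 have dJ: "\<And>j. j \<in> J ==> dom (v j)" using v by (auto simp: J_def)
 have c: "0 \<le> cl (v i)" "0 \<le> cl w" "cl (v i) \<le> 2 * M\<^sup>2 / real (Suc Y) * (\<Sum>j\<in>J. Tsum (J - {j}) v x)" "cl w \<le> 2 * M\<^sup>2 / real (Suc Y) * (\<Sum>j\<in>J. Tsum (J - {j}) v x)"
  unfolding cl_def using collision_bound[of J v w Y x, OF J(1) dJ w Y(1) x] collision_bound[of J v "v i" Y x, OF J(1) dJ v[OF I(2)] Y(2) x] by auto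
 have N: "Tsum I v x - Tsum I (v(i := w)) x - B * Tsum J v x = (\<Sum>g\<in>tup J x. wt v J g * (mu (v i) (x / pr J g) - mu w (x / pr J g) - B)) - (cl (v i) - cl w)"
  unfolding 1 2 by (simp add: Tsum_def right_diff_distrib sum_subtractf sum_distrib_left mult.commute)
 have "\<bar>\<Sum>g\<in>tup J x. wt v J g * (mu (v i) (x / pr J g) - mu w (x / pr J g) - B)\<bar> \<le> (\<Sum>g\<in>tup J x. wt v J g * (e + D * of_bool (x / V < pr J g)))"
 proof (rule order_trans[OF sum_abs], rule sum_mono)
  fix g assume g: "g \<in> tup J x"
  note m = tupD(3,5)[OF g]
  have "x / pr J g < V \<longleftrightarrow> x / V < pr J g" using m V by (simp add: field_simps)
  hence "\<bar>mu (v i) (x / pr J g) - mu w (x / pr J g) - B\<bar> \<le> e + D * of_bool (x / V < pr J g)"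
   using D[of "x / pr J g"] m floor_div_le[of "pr J g" x] x by simp
  moreover have w0: "wt v J g \<ge> 0" using domD(1)[OF dJ] by (rule wt_nonneg)
  ultimately show "\<bar>wt v J g * (mu (v i) (x / pr J g) - mu w (x / pr J g) - B)\<bar> \<le> wt v J g * (e + D * of_bool (x / V < pr J g))"
   using mult_left_mono[of _ _ "wt v J g"] by (simp only: abs_mult abs_of_nonneg)
 qed
 also have "\<dots> = e * Tsum J v x + D * (\<Sum>g\<in>tup J x. wt v J g * of_bool (x / V < pr J g))"
  unfolding Tsum_def by (simp only: distrib_left sum.distrib sum_distrib_left) (simp only: mult_ac)
 also have "(\<Sum>g\<in>tup J x. wt v J g * of_bool (x / V < pr J g)) = win J v x V"
  unfolding win_def by (rule sum.mono_neutral_cong_right[OF finite_tup[OF J(1)]]) auto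
 finally show ?thesis using c N unfolding J_def[symmetric] by linarith
qed

end

text \<open>Zv and Zw stand for normalised N-sums, Sv and Sw for the sums of T they approximate, P
  for the common main term. Clearing the denominator leaves four errors of order P / L^2, while Zw
  >= P / 4.\<close>

lemma quotient_estimate:
 fixes L P c \<beta> :: real
 assumes L: "L \<ge> 4 * c + 4" and P: "P > 0" and c: "c \<ge> 0"
  and Z: "\<bar>Zv - Sv\<bar> \<le> Sv / L ^ 3" "\<bar>Zw - Sw\<bar> \<le> Sw / L ^ 3"
  and S: "\<bar>Sw - P\<bar> \<le> c * P / L" "\<bar>Sv - Sw - \<beta> * P / L\<bar> \<le> c * P / L\<^sup>2" and \<beta>: "\<bar>\<beta>\<bar> \<le> c"
 shows "\<bar>Zv / Zw - (1 + \<beta> / L)\<bar> \<le> 4 * (c\<^sup>2 + c + 7) / L\<^sup>2"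
proof -
 have L1: "L \<ge> 4" "L > 0" using L c by auto
 have q: "c * P / L \<le> P / 4" using L L1 P c by (simp add: field_simps)
 have L3: "L\<^sup>2 \<le> L ^ 3" "4 \<le> L\<^sup>2" "4 \<le> L ^ 3"
 proof -
  show a: "L\<^sup>2 \<le> L ^ 3" using L1 by (intro power_increasing) auto
  show "4 \<le> L\<^sup>2" using L1 power_mono[of 2 L 2] by simp
  thus "4 \<le> L ^ 3" using a by simp
 qed
 have q2: "c * P / L\<^sup>2 \<le> P / 4"
 proof -
  have "c * P / L\<^sup>2 \<le> c * P / L" using L1 c P by (intro divide_left_mono) (auto simp: power2_eq_square)
  thus ?thesis using q by linarith
 qed
 have bP: "\<bar>\<beta> * P / L\<bar> \<le> c * P / L" using \<beta> P L1 by (simp add: abs_mult divide_right_mono)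
 have Sw: "P / 2 \<le> Sw" "Sw \<le> 2 * P" using S(1) q P by linarith+
 have Sv: "Sv \<le> 3 * P" using S(2) q2 bP Sw q S(1) by linarith
 have e1: "Sv / L ^ 3 \<le> 3 * P / L\<^sup>2"
 proof -
  have "Sv / L ^ 3 \<le> 3 * P / L ^ 3" using Sv L1 by (intro divide_right_mono) auto
  also have "\<dots> \<le> 3 * P / L\<^sup>2" using L3 L1 P by (intro divide_left_mono) auto
  finally show ?thesis .
 qed
 have e2: "Sw / L ^ 3 \<le> 2 * P / L\<^sup>2"
 proof -
  have "Sw / L ^ 3 \<le> 2 * P / L ^ 3" using Sw L1 by (intro divide_right_mono) auto
  also have "\<dots> \<le> 2 * P / L\<^sup>2" using L3 L1 P by (intro divide_left_mono) auto
  finally show ?thesis .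
 qed
 have "Sw / L ^ 3 \<le> Sw / 4" using L3 Sw P L1 by (intro divide_left_mono) auto
 hence Zw: "Zw \<ge> P / 4" using Z(2) Sw by linarith
 have b1: "\<bar>\<beta> / L\<bar> \<le> c / L" using \<beta> L1 by (simp add: divide_right_mono)
 have "c / L \<le> 1" using L L1 c by (simp add: divide_le_eq)
 hence b2: "\<bar>1 + \<beta> / L\<bar> \<le> 2" using b1 by linarith
 have "Zv - Zw * (1 + \<beta> / L) = (Zv - Sv) + (Sv - Sw - \<beta> * P / L) + \<beta> / L * (P - Sw) - (1 + \<beta> / L) * (Zw - Sw)"
  by (simp add: algebra_simps diff_divide_distrib)
 also have "\<bar>\<dots>\<bar> \<le> 3 * P / L\<^sup>2 + c * P / L\<^sup>2 + c / L * (c * P / L) + 2 * (2 * P / L\<^sup>2)"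
 proof -
  have "\<bar>\<beta> / L * (P - Sw)\<bar> \<le> c / L * (c * P / L)" unfolding abs_mult using b1 S(1) c L1 by (intro mult_mono) (auto simp: abs_minus_commute)
  moreover have "\<bar>(1 + \<beta> / L) * (Zw - Sw)\<bar> \<le> 2 * (2 * P / L\<^sup>2)" unfolding abs_mult using b2 Z(2) e2 by (intro mult_mono) auto
  moreover have "\<bar>p + q + r - s\<bar> \<le> \<bar>p\<bar> + \<bar>q\<bar> + \<bar>r\<bar> + \<bar>s\<bar>" for p q r s :: real by linarith
  note this[of "Zv - Sv" "Sv - Sw - \<beta> * P / L" "\<beta> / L * (P - Sw)" "(1 + \<beta> / L) * (Zw - Sw)"]
  ultimately show ?thesis using Z(1) S(2) e1 by linarith
 qed
 also have "\<dots> = (c\<^sup>2 + c + 7) / L\<^sup>2 * P" by (simp add: power2_eq_square add_divide_distrib distrib_right)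
 also have "\<dots> \<le> (c\<^sup>2 + c + 7) / L\<^sup>2 * (4 * Zw)" using Zw c by (intro mult_left_mono) auto
 finally have "\<bar>Zv - Zw * (1 + \<beta> / L)\<bar> \<le> 4 * (c\<^sup>2 + c + 7) / L\<^sup>2 * Zw" by (simp add: mult_ac)
 moreover have "Zw > 0" using Zw P by linarith
 moreover have "Zv / Zw - (1 + \<beta> / L) = (Zv - Zw * (1 + \<beta> / L)) / Zw" using \<open>Zw > 0\<close> by (simp add: diff_divide_distrib)
 ultimately show ?thesis by (simp add: abs_divide divide_le_eq)
qed

context prime_weights
begin

lemma eventually_card: "EV x. real r \<le> lnln x" by real_asymp

abbreviation "T_approx C r D x J v \<equiv> finite J \<and> card J = r \<and> (\<forall>i\<in>J. adm C (v i)) --> \<bar>Tsum J v x - lnln x ^ r\<bar> \<le> D * lnln x ^ r / lnln x"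

lemma T_power:
 assumes C: "C \<ge> 0"
 shows "\<exists>D\<ge>0. EV x. \<forall>(J :: 'i set) v. T_approx C r D x J v"
proof (induction r)
 case 0
 have "\<forall>\<^sub>F x::real in at_top. x \<ge> 1" by (rule eventually_ge_at_top)
 hence "EV x. \<forall>(J :: 'i set) v. T_approx C 0 0 x J v" by eventually_elim (auto simp: Tsum_empty)
 thus ?case by blast
next
 case (Suc r)
 then obtain D where D: "D \<ge> 0" and evD: "EV x. \<forall>(J :: 'i set) v. T_approx C r D x J v" by blast
 from T_ratio[OF zero_le_one C, where 'i = 'i] obtain C' where C': "C' \<ge> 0" and evC: "EV x. \<forall>(I :: 'i set) v. good 1 C x I v --> T_near C' x I v" by blast
 define D' where "D' = D + C' * (1 + D)"
 have "EV x. \<forall>(J :: 'i set) v. T_approx C (Suc r) D' x J v"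
  using evD evC eventually_card[of "Suc r"] eventually_card[of 1]
 proof (eventually_elim, intro allI impI, goal_cases)
  case (1 x J v)
  note a = 1(1-4) and J = 1(9)
  define L where "L = lnln x"
  have L: "L \<ge> 1" using a by (simp add: L_def)
  have "good 1 C x J v" using J a(3) by (simp add: good_def)
  obtain i where i: "i \<in> J" using J by fastforce
  define T where "T = Tsum (J - {i}) v x"
  have 1: "\<bar>Tsum J v x - L * T\<bar> \<le> C' * T" using a(2) \<open>good 1 C x J v\<close> i by (simp add: L_def T_def)
  have 2: "\<bar>T - L ^ r\<bar> \<le> D * L ^ r / L" using a(1) J i by (simp add: L_def T_def)
  have "D * L ^ r / L \<le> D * L ^ r" using L D mult_left_mono[of 1 L "D * L ^ r"] by (simp add: divide_le_eq)
  hence 3: "T \<le> (1 + D) * L ^ r" using 2 by (simp add: algebra_simps)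
  have "\<bar>Tsum J v x - L ^ Suc r\<bar> \<le> \<bar>Tsum J v x - L * T\<bar> + \<bar>L * T - L ^ Suc r\<bar>" by linarith
  also have "\<dots> \<le> C' * ((1 + D) * L ^ r) + D * L ^ r"
  proof (rule add_mono)
   show "\<bar>Tsum J v x - L * T\<bar> \<le> C' * ((1 + D) * L ^ r)" using 1 mult_left_mono[OF 3 C'] by linarith
   have "\<bar>L * T - L ^ Suc r\<bar> = L * \<bar>T - L ^ r\<bar>" using L abs_mult[of L "T - L ^ r"] by (simp add: right_diff_distrib)
   also have "\<dots> \<le> L * (D * L ^ r / L)" using 2 L by (intro mult_left_mono) auto
   finally show "\<bar>L * T - L ^ Suc r\<bar> \<le> D * L ^ r" using L by simp
  qed
  also have "\<dots> = D' * L ^ Suc r / L" using L by (simp add: D'_def field_simps)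
  finally show ?case by (simp only: L_def)
 qed
 moreover have "D' \<ge> 0" using D C' by (simp add: D'_def)
 ultimately show ?case by blast
qed

text \<open>B u is the Mertens constant of u. In \<open>adm\<close> it is swallowed by C; here it
  must stay visible, because differences of such constants are the bias.\<close>

definition Mconst where "Mconst B C \<longleftrightarrow> C \<ge> 1 \<and> (\<forall>u\<in>U. \<forall>x\<ge>3. \<bar>mu u x - lnln x - B u\<bar> \<le> C * ln x powr (- b))"

lemma Mconst_bounds:
 assumes "Mconst B C" "u \<in> U"
 shows "x \<ge> 3 ==> \<bar>mu u x - lnln x - B u\<bar> \<le> C" "\<bar>B u\<bar> \<le> C + 4 * M" "adm (2 * C + 4 * M) u" "dom u"
  "y \<le> 3 ==> 0 \<le> mu u y \<and> mu u y \<le> 4 * M"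
proof -
 have C1: "C \<ge> 1" using assms by (simp add: Mconst_def)
 have 1: "\<bar>mu u x - lnln x - B u\<bar> \<le> C" if "x \<ge> 3" for x
 proof -
  have "ln x powr (- b) \<le> 1" using ln_ge_1[OF that] b powr_mono[of "-b" 0 "ln x"] by simp
  hence "C * ln x powr (- b) \<le> C" using C1 by simp
  moreover have "\<bar>mu u x - lnln x - B u\<bar> \<le> C * ln x powr (- b)" using assms that by (simp add: Mconst_def)
  ultimately show ?thesis by linarith
 qed
 show "x \<ge> 3 ==> \<bar>mu u x - lnln x - B u\<bar> \<le> C" by (rule 1)
 show small: "0 \<le> mu u y \<and> mu u y \<le> 4 * M" if "y \<le> 3" for y
 proof
  show "0 \<le> mu u y" using mu_nonneg u_nonneg[OF assms(2)] by blast
  have "mu u y \<le> (\<Sum>p\<le>nfloor y. M)" unfolding mu_def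
  proof (rule sum_mono)
   fix p
   show "u p / real p \<le> M" using u_le[OF assms(2), of p] u_nonneg[OF assms(2), of p] M
    divide_left_mono[of 1 "real p" "u p"] by (cases "p = 0") auto
  qed
  also have "\<dots> = real (nfloor y + 1) * M" by simp
  also have "\<dots> \<le> 4 * M" using that M by (intro mult_right_mono) (auto simp: floor_le_iff, linarith)
  finally show "mu u y \<le> 4 * M" .
 qed
 have "0 \<le> lnln (3::real)" "lnln (3::real) \<le> 1"
 proof -
  show "0 \<le> lnln (3::real)" using ln_ge_1[of 3] by simp
  have "ln (3::real) \<le> 2" using ln_le_minus_one[of 3] by simp
  hence "lnln (3::real) \<le> ln 2" using ln_ge_1[of 3] by (intro ln_mono) auto
  also have "\<dots> \<le> 1" using ln_le_minus_one[of 2] by simp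
  finally show "lnln (3::real) \<le> 1" .
 qed
 thus Bb: "\<bar>B u\<bar> \<le> C + 4 * M" using 1[of 3] small[of 3] M by linarith
 show d: "dom u" using assms(2) u_nonneg by (auto simp: dom_def)
 show "adm (2 * C + 4 * M) u" unfolding adm_def
 proof (intro conjI allI impI d)
  fix y :: real assume "y \<ge> 3" thus "\<bar>mu u y - lnln y\<bar> \<le> 2 * C + 4 * M" using 1[of y] Bb by linarith
 qed
qed

abbreviation "T_swap B r D x J v w \<equiv> \<forall>i\<in>J. finite J \<and> card J = r \<and> (\<forall>i\<in>J. v i \<in> U) \<and> w \<in> U -->
  \<bar>Tsum J v x - Tsum J (v(i := w)) x - (B (v i) - B w) * Tsum (J - {i}) v x\<bar> \<le> D * Tsum (J - {i}) v x / lnln x"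

text \<open>The cut is at V = sqrt x. From there on the Mertens error is a negative power of ln x;
  below, the difference is merely bounded, but \<open>win\<close> is O(T / L) since it is bounded by
  sums with one more coordinate deleted.\<close>

lemma T_swap_fixed:
 assumes B: "Mconst B C"
 shows "\<exists>D\<ge>0. EV x. \<forall>(J :: 'i set) v w. T_swap B r D x J v w"
proof -
 define C0 where "C0 = 2 * C + 4 * M"
 have C1: "C \<ge> 1" using B by (simp add: Mconst_def)
 have C0: "C0 \<ge> 0" using C1 M by (simp add: C0_def)
 \<comment> \<open>Covers both ranges of y: 2 C for y >= 3, and below 3 the sums contribute 4 M and
   the two constants 2 (C + 4 M).\<close>
 define D where "D = 2 * C + 12 * M"
 define D' where "D' = 1 + D * (6 * Ch * real r) + 4 * M\<^sup>2 * real r"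
 have "((\<lambda>x. 2 * C * (ln (sqrt x) powr (- b) * lnln x)) \<longlongrightarrow> 2 * C * 0) at_top"
  by (intro tendsto_mult tendsto_const) (use b in real_asymp)
 hence "EV x. 2 * C * (ln (sqrt x) powr (- b) * lnln x) < 1" by (auto intro: order_tendstoD)
 moreover have "EV x. sqrt x \<ge> 3 \<and> sqrt x < x \<and> lnln x > 0 \<and> ln x \<ge> (4::real)"
  by (intro eventually_conj) real_asymp+
 moreover note T_facts[OF zero_le_one C0, where 'i = 'i] eventually_card[of r]
 ultimately have "EV x. \<forall>(J :: 'i set) v w. T_swap B r D' x J v w"
 proof (eventually_elim, intro allI impI ballI, goal_cases)
  case (1 x J v w i)
  note e1 = 1(1) and tf = 1(3) and r = 1(4) and i = 1(9) and J = 1(10)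
  from 1 have x: "sqrt x \<ge> 3" "sqrt x < x" "lnln x > 0" "ln x \<ge> 4" by auto
  define L where "L = lnln x"
  define T where "T = Tsum (J - {i}) v x"
  have gJ: "good 1 C0 x J v" using J r Mconst_bounds(3)[OF B] by (auto simp: good_def C0_def)
  have g: "good 1 C0 x (J - {i}) v" by (rule good_subset[OF gJ]) auto
  have T0: "T > 0" using tf g by (simp add: T_def)
  have S: "(\<Sum>j\<in>J - {i}. Tsum (J - {i} - {j}) v x) \<le> real r * (2 / L * T)"
  proof -
   have "(\<Sum>j\<in>J - {i}. Tsum (J - {i} - {j}) v x) \<le> (\<Sum>j\<in>J - {i}. 2 / L * T)" using tf g unfolding T_def L_def by (intro sum_mono) blast
   also have "\<dots> = real (card (J - {i})) * (2 / L * T)" by simp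
   also have "\<dots> \<le> real r * (2 / L * T)" using J T0 x i by (intro mult_right_mono) (auto simp: L_def)
   finally show ?thesis .
  qed
  have sx: "ln (x / sqrt x) = ln x / 2" "ln (sqrt x) = ln x / 2" using x by (auto simp: ln_div ln_sqrt)
  have "win (J - {i}) v x (sqrt x) \<le> Ch * (ln (sqrt x) + 1) / ln (x / sqrt x) * (\<Sum>j\<in>J - {i}. Tsum (J - {i} - {j}) v x)"
   by (rule window_bound) (use J x Mconst_bounds(4)[OF B] in auto)
  also have "\<dots> \<le> (3 * Ch) * (real r * (2 / L * T))"
  proof (rule mult_mono[OF _ S])
   have "Ch * 8 \<le> ln x * (Ch * 2)" using x Ch mult_right_mono[of 4 "ln x" "Ch * 2"] by simp
   thus "Ch * (ln (sqrt x) + 1) / ln (x / sqrt x) \<le> 3 * Ch" unfolding sx using x Ch by (simp add: field_simps)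
  qed (use Ch good_nn[OF g] in "auto intro!: sum_nonneg Tsum_nonneg")
  finally have W: "win (J - {i}) v x (sqrt x) \<le> 6 * Ch * real r * (T / L)" by (simp add: mult_ac)
  have "\<bar>Tsum J v x - Tsum J (v(i := w)) x - (B (v i) - B w) * T\<bar> \<le>
   (2 * C * ln (sqrt x) powr (- b)) * T + D * win (J - {i}) v x (sqrt x) + 2 * M\<^sup>2 / real (Suc 0) * (\<Sum>j\<in>J - {i}. Tsum (J - {i} - {j}) v x)"
   unfolding T_def
  proof (rule swap_weight)
   fix y assume y: "1 \<le> y" "y \<le> x"
   have vi: "v i \<in> U" "w \<in> U" using J i by auto
   show "\<bar>mu (v i) y - mu w y - (B (v i) - B w)\<bar> \<le> 2 * C * ln (sqrt x) powr (- b) + D * of_bool (y < sqrt x)"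
   proof (cases "y < sqrt x")
    case True
    have "\<bar>mu (v i) y - mu w y - (B (v i) - B w)\<bar> \<le> D"
    proof (cases "y \<ge> 3")
     case True
     thus ?thesis using Mconst_bounds(1)[OF B vi(1) True] Mconst_bounds(1)[OF B vi(2) True] M unfolding D_def by linarith
    next
     case False
     thus ?thesis using Mconst_bounds(2,5)[OF B vi(1)] Mconst_bounds(2,5)[OF B vi(2)] unfolding D_def by (smt (verit))
    qed
    moreover have "0 \<le> 2 * C * ln (sqrt x) powr (- b)" using C1 by simp
    ultimately show ?thesis using True by simp
   next
    case False
    hence y3: "y \<ge> 3" "y \<ge> sqrt x" using x by auto
    have "ln y powr (- b) \<le> ln (sqrt x) powr (- b)" using y3 x b ln_ge_1[OF x(1)] by (intro powr_mono2') auto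
    hence "C * ln y powr (- b) \<le> C * ln (sqrt x) powr (- b)" using C1 by (intro mult_left_mono) auto
    moreover have "\<bar>mu (v i) y - lnln y - B (v i)\<bar> \<le> C * ln y powr (- b)" "\<bar>mu w y - lnln y - B w\<bar> \<le> C * ln y powr (- b)"
     using B vi y3(1) by (auto simp: Mconst_def)
    ultimately show ?thesis using False by simp
   qed
  qed (use J i x C1 M Mconst_bounds(4)[OF B] u_0 in \<open>auto simp: D_def\<close>)
  also have "\<dots> \<le> (1 / L) * T + D * (6 * Ch * real r * (T / L)) + 2 * M\<^sup>2 * (real r * (2 / L * T))"
  proof (intro add_mono mult_right_mono mult_left_mono W)
   show "2 * C * ln (sqrt x) powr (- b) \<le> 1 / L" using e1 x by (simp add: L_def field_simps)
   show "2 * M\<^sup>2 / real (Suc 0) * (\<Sum>j\<in>J - {i}. Tsum (J - {i} - {j}) v x) \<le> 2 * M\<^sup>2 * (real r * (2 / L * T))" using mult_left_mono[OF S, of "2 * M\<^sup>2"] by simp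
  qed (use T0 C1 M in "auto simp: D_def")
  also have "\<dots> = D' * T / L" by (simp add: D'_def algebra_simps add_divide_distrib)
  finally show ?case
   by (simp only: T_def L_def)
 qed
 moreover have "D' \<ge> 0" using C1 M Ch by (simp add: D'_def D_def)
 ultimately show ?thesis by blast
qed


abbreviation "T_replace B r D x J v w \<equiv> finite J \<and> card J = r \<and> (\<forall>i\<in>J. v i \<in> U) \<and> w \<in> U -->
  \<bar>Tsum J v x - Tsum J (\<lambda>_. w) x - (\<Sum>i\<in>J. B (v i) - B w) * (lnln x ^ r / lnln x)\<bar> \<le> D * (lnln x ^ r / lnln x) / lnln x"

text \<open>The main term is of order L^(r - 1), written as \<open>lnln x ^ r / lnln x\<close> so
  that r = 0, where nothing is replaced, fits the same form.\<close>

lemma T_replace_fixed: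
 assumes B: "Mconst B C"
 shows "\<exists>D\<ge>0. EV x. \<forall>(J :: 'i set) v w. T_replace B r D x J v w"
proof (cases r)
 case 0
 have "\<forall>(J :: 'i set) v w. T_replace B r 0 x J v w" for x
  using 0 by (auto simp: Tsum_empty)
 thus ?thesis by (intro exI[of _ 0]) (simp add: always_eventually)
next
 case (Suc s)
 define C0 where "C0 = 2 * C + 4 * M"
 have C1: "C \<ge> 1" using B by (simp add: Mconst_def)
 have C0: "C0 \<ge> 0" using C1 M by (simp add: C0_def)
 from T_swap_fixed[OF B, of r, where 'i = 'i] obtain D where D: "D \<ge> 0" and evD: "EV x. \<forall>(J :: 'i set) v w. T_swap B r D x J v w" by blast
 from T_power[OF C0, of s, where 'i = 'i] obtain D' where D': "D' \<ge> 0" and evD': "EV x. \<forall>(J :: 'i set) v. T_approx C0 s D' x J v" by blast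
 define E where "E = D * (1 + D') + 2 * C0 * D'"
 have E: "E \<ge> 0" using D D' C0 by (simp add: E_def)
 have "EV x. \<forall>(J :: 'i set) v w. T_replace B r (real r * E) x J v w"
  using evD evD' eventually_card[of 1]
 proof (eventually_elim, intro allI impI, goal_cases)
  case (1 x J v w)
  note a = 1(1-3) and J = 1(7)
  define L where "L = lnln x"
  have L: "L \<ge> 1" using a by (simp add: L_def)
  have X: "L ^ r / L = L ^ s" using L Suc by simp
  have "\<bar>Tsum J v' x - Tsum J (v'(i := w)) x - (B (v' i) - B w) * L ^ s\<bar> \<le> E * L ^ s / L"
   if v': "\<forall>i\<in>J. v' i \<in> U" and i: "i \<in> J" for v' i
  proof -
   define T where "T = Tsum (J - {i}) v' x"
   have 1: "\<bar>Tsum J v' x - Tsum J (v'(i := w)) x - (B (v' i) - B w) * T\<bar> \<le> D * T / L"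
    using a(1)[rule_format, OF i, of v' w] J v' unfolding T_def L_def by blast
   have "finite (J - {i}) \<and> card (J - {i}) = s \<and> (\<forall>j\<in>J - {i}. adm C0 (v' j))"
    using J i v' Suc Mconst_bounds(3)[OF B] by (auto simp: C0_def)
   hence 2: "\<bar>T - L ^ s\<bar> \<le> D' * L ^ s / L" using a(2) unfolding T_def L_def by blast
   have "D' * L ^ s / L \<le> D' * L ^ s" using L D' mult_left_mono[of 1 L "D' * L ^ s"] by (simp add: divide_le_eq)
   hence "T \<le> (1 + D') * L ^ s" using 2 by (simp add: algebra_simps)
   hence 3: "D * T / L \<le> D * ((1 + D') * L ^ s) / L" using D L by (intro divide_right_mono mult_left_mono) auto
   have "\<bar>B (v' i) - B w\<bar> \<le> 2 * C0"
    using Mconst_bounds(2)[OF B, of "v' i"] Mconst_bounds(2)[OF B, of w] J i v' M C1 unfolding C0_def by (smt (verit))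
   hence 4: "\<bar>(B (v' i) - B w) * (T - L ^ s)\<bar> \<le> 2 * C0 * (D' * L ^ s / L)" using 2 C0 unfolding abs_mult by (intro mult_mono) auto
   have "E * L ^ s / L = D * ((1 + D') * L ^ s) / L + 2 * C0 * (D' * L ^ s / L)" by (simp add: E_def algebra_simps add_divide_distrib)
   thus ?thesis using 1 3 4 unfolding right_diff_distrib by linarith
  qed
  from replace_all_bound[of J w U v "\<lambda>v. Tsum J v x" "\<lambda>u. (B u - B w) * L ^ s", OF _ _ _ this] J
  have "\<bar>Tsum J v x - Tsum J (\<lambda>i. if i \<in> J then w else v i) x - (\<Sum>i\<in>J. B (v i) - B w) * L ^ s\<bar> \<le> real r * (E * L ^ s / L)"
   by (simp add: sum_distrib_right)
  moreover have "Tsum J (\<lambda>i. if i \<in> J then w else v i) x = Tsum J (\<lambda>_. w) x" unfolding Tsum_def by (intro sum.cong refl wt_cong) auto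
  ultimately show ?case
   unfolding L_def[symmetric] X by (simp add: mult_ac)
 qed
 thus ?thesis using E by (intro exI[of _ "real r * E"]) simp
qed

text \<open>N is governed by the sum of T over the k deletions of one coordinate. Each coordinate
  survives in k - 1 of them, which produces the factor (k - 1) / k in front of the biases.\<close>

theorem N_ratio_fixed:
 fixes I :: "'i set"
 assumes B: "Mconst B C" and I: "finite I" "card I = k" "k \<ge> 2"
 shows "\<exists>c\<ge>0. EV x. \<forall>v w. (\<forall>i\<in>I. v i \<in> U) \<and> w \<in> U -->
  \<bar>Nsum I v x / Nsum I (\<lambda>_. w) x - (1 + (real k - 1) / real k * (\<Sum>i\<in>I. B (v i) - B w) / lnln x)\<bar> \<le> c / (lnln x)\<^sup>2"
proof -
 define r where "r = k - 1"
 define C0 where "C0 = 2 * C + 4 * M"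
 have C1: "C \<ge> 1" using B by (simp add: Mconst_def)
 have C0: "C0 \<ge> 0" using C1 M by (simp add: C0_def)
 from T_replace_fixed[OF B, of r, where 'i = 'i] obtain D where D: "D \<ge> 0" and evD: "EV x. \<forall>(J :: 'i set) v w. T_replace B r D x J v w" by blast
 from T_power[OF C0, of r, where 'i = 'i] obtain D' where D': "D' \<ge> 0" and evD': "EV x. \<forall>(J :: 'i set) v. T_approx C0 r D' x J v" by blast
 define c where "c = D + D' + 2 * C0 * real k"
 have c: "c \<ge> 0" "D \<le> c" "D' \<le> c" "2 * C0 * real k \<le> c" using D D' C0 by (auto simp: c_def)
 have "EV x. lnln x \<ge> 4 * c + 4 \<and> x > (1::real)"
  by (intro eventually_conj) (rule eventually_gt_at_top | real_asymp)+
 with evD evD' Nsum_Tsum[OF zero_le_one C0, where 'i = 'i] eventually_card[of k]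
 have "EV x. \<forall>v w. (\<forall>i\<in>I. v i \<in> U) \<and> w \<in> U -->
  \<bar>Nsum I v x / Nsum I (\<lambda>_. w) x - (1 + (real k - 1) / real k * (\<Sum>i\<in>I. B (v i) - B w) / lnln x)\<bar> \<le> 4 * (c\<^sup>2 + c + 7) / (lnln x)\<^sup>2"
 proof (eventually_elim, intro allI impI, goal_cases)
  case (1 x v w)
  note a = 1(1-5) and v = 1(11)
  define L where "L = lnln x"
  have L: "L \<ge> 4 * c + 4" "L > 0" using a(5) c unfolding L_def by linarith+
  have lx: "ln x > 0" using a(5) by simp
  define S where "S v = (\<Sum>i\<in>I. Tsum (I - {i}) v x)" for v
  have Ine: "I \<noteq> {}" using I by auto
  have g: "good 1 C0 x I v'" if "\<forall>i\<in>I. v' i \<in> U" for v' using that I a(4) Mconst_bounds(3)[OF B] by (auto simp: good_def C0_def)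
  \<comment> \<open>The main term: k deletions, each of size L^(k - 1).\<close>
  define P where "P = real k * L ^ r"
  define G where "G = (\<Sum>i\<in>I. B (v i) - B w)"
  have J: "finite (I - {i})" "card (I - {i}) = r" if "i \<in> I" for i using I that by (auto simp: r_def)
  have GJ: "(\<Sum>i\<in>I. \<Sum>j\<in>I - {i}. B (v j) - B w) = real r * G"
  proof -
   have "(\<Sum>i\<in>I. \<Sum>j\<in>I - {i}. B (v j) - B w) = (\<Sum>i\<in>I. G - (B (v i) - B w))"
    using I by (intro sum.cong refl) (simp add: G_def sum_diff1)
   also have "\<dots> = real k * G - G" using I by (simp add: sum_subtractf G_def)
   finally show ?thesis using I by (simp add: r_def of_nat_diff algebra_simps)
  qed
  have Sw: "\<bar>S (\<lambda>_. w) - P\<bar> \<le> c * P / L"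
  proof -
   have "S (\<lambda>_. w) - P = (\<Sum>i\<in>I. Tsum (I - {i}) (\<lambda>_. w) x - L ^ r)" using I by (simp add: S_def P_def sum_subtractf)
   also have "\<bar>\<dots>\<bar> \<le> (\<Sum>i\<in>I. D' * L ^ r / L)"
    by (rule order_trans[OF sum_abs], rule sum_mono) (use a(2) J v Mconst_bounds(3)[OF B] in \<open>auto simp: L_def C0_def\<close>)
   also have "\<dots> = D' * P / L" using I by (simp add: P_def)
   also have "\<dots> \<le> c * P / L" using c L by (intro divide_right_mono mult_right_mono) (auto simp: P_def)
   finally show ?thesis .
  qed
  have Sv: "\<bar>S v - S (\<lambda>_. w) - (real r / real k * G) * P / L\<bar> \<le> c * P / L\<^sup>2"
  proof -
   have "(real r / real k * G) * P / L = real r * G * (L ^ r / L)" using I by (simp add: P_def)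
   also have "\<dots> = (\<Sum>i\<in>I. (\<Sum>j\<in>I - {i}. B (v j) - B w) * (L ^ r / L))" unfolding GJ[symmetric] by (rule sum_distrib_right)
   finally have "S v - S (\<lambda>_. w) - (real r / real k * G) * P / L = (\<Sum>i\<in>I. Tsum (I - {i}) v x - Tsum (I - {i}) (\<lambda>_. w) x - (\<Sum>j\<in>I - {i}. B (v j) - B w) * (L ^ r / L))"
    by (simp only: S_def sum_subtractf)
   also have "\<bar>\<dots>\<bar> \<le> (\<Sum>i\<in>I. D * (L ^ r / L) / L)"
    by (rule order_trans[OF sum_abs], rule sum_mono) (use a(1) J v in \<open>auto simp: L_def\<close>)
   also have "\<dots> = D * P / L\<^sup>2" using I by (simp add: P_def power2_eq_square)
   also have "\<dots> \<le> c * P / L\<^sup>2" using c L by (intro divide_right_mono mult_right_mono) (auto simp: P_def)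
   finally show ?thesis .
  qed
  have "\<bar>real r / real k * G\<bar> \<le> c"
  proof -
   have "\<bar>G\<bar> \<le> (\<Sum>i\<in>I. 2 * C0)" unfolding G_def
   proof (rule order_trans[OF sum_abs], rule sum_mono)
    fix i assume "i \<in> I"
    thus "\<bar>B (v i) - B w\<bar> \<le> 2 * C0"
     using Mconst_bounds(2)[OF B, of "v i"] Mconst_bounds(2)[OF B, of w] v M C1 unfolding C0_def by (smt (verit))
   qed
   also have "\<dots> \<le> c" using c I by (simp add: mult_ac)
   finally have "\<bar>G\<bar> \<le> c" .
   moreover have "real r / real k \<le> 1" using I by (simp add: r_def divide_le_eq)
   hence "\<bar>real r / real k\<bar> * \<bar>G\<bar> \<le> 1 * \<bar>G\<bar>" by (intro mult_right_mono) auto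
   ultimately show ?thesis by (simp add: abs_mult)
  qed
  moreover have "P > 0" using L I by (simp add: P_def)
  moreover have "\<bar>Nsum I v x * ln x / x - S v\<bar> \<le> S v / L ^ 3" "\<bar>Nsum I (\<lambda>_. w) x * ln x / x - S (\<lambda>_. w)\<bar> \<le> S (\<lambda>_. w) / L ^ 3"
   using a(3) g v Ine unfolding S_def L_def by auto
  ultimately have "\<bar>(Nsum I v x * ln x / x) / (Nsum I (\<lambda>_. w) x * ln x / x) - (1 + (real r / real k * G) / L)\<bar> \<le> 4 * (c\<^sup>2 + c + 7) / L\<^sup>2"
   using quotient_estimate[OF L(1) _ c(1)] Sw Sv by blast
  moreover have "(Nsum I v x * ln x / x) / (Nsum I (\<lambda>_. w) x * ln x / x) = Nsum I v x / Nsum I (\<lambda>_. w) x"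
   using lx a(5) by simp
  moreover have "real r = real k - 1" using I by (simp add: r_def of_nat_diff)
  ultimately show ?case
   unfolding L_def[symmetric] G_def[symmetric] by simp
 qed
 thus ?thesis using c by (intro exI[of _ "4 * (c\<^sup>2 + c + 7)"]) auto
qed

end

section \<open>Restriction to large primes\<close>

definition rough :: "nat => (nat => real) => nat => real" where "rough n u p = (if n < p then u p else 0)"

lemma mu_rough: "mu (rough n u) y = (if real n \<le> y then mu u y - mu u (real n) else 0)"
proof (cases "real n \<le> y")
 case True
 hence n: "n \<le> nfloor y" by (rule le_nat_floor)
 have "mu u y = (\<Sum>p\<in>{..n}. u p / real p) + (\<Sum>p\<in>{n<..nfloor y}. u p / real p)"
  unfolding mu_def using n by (subst sum.union_disjoint[symmetric]) (auto intro: sum.cong)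
 moreover have "mu (rough n u) y = (\<Sum>p\<in>{n<..nfloor y}. u p / real p)"
  unfolding mu_def rough_def by (rule sum.mono_neutral_cong_right) auto
 ultimately show ?thesis using True by (simp add: mu_def)
next
 case False
 hence "nfloor y \<le> n" by linarith
 thus ?thesis using False unfolding mu_def rough_def by (auto intro!: sum.neutral)
qed

lemma tup_div:
 assumes "p \<ge> 1" shows "tup J (x / p) = {g \<in> tup J x. pr J g \<le> x / p}"
proof (cases "x \<ge> 0")
 case True
 thus ?thesis using floor_div_le[OF assms True] by (auto simp: tup_def pr_def)
next
 case False
 hence "x / p < 1" using assms by (simp add: divide_less_eq)
 thus ?thesis using tupD(3,5)[of _ J "x / p"] tupD(5)[of _ J x] by fastforce
qed

text \<open>By injectivity at most one coordinate equals n + 1, and then the others have product at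
  most x / (n + 1). If n + 1 is not prime, all additional terms are 0.\<close>

lemma Tsum_peel:
 fixes n :: nat
 assumes I: "finite I" and v: "\<And>i p. i \<in> I ==> \<not> prime p ==> v i p = 0"
 shows "Tsum I (\<lambda>i. rough n (v i)) x = Tsum I (\<lambda>i. rough (Suc n) (v i)) x
  + (\<Sum>i\<in>I. v i (Suc n) / real (Suc n) * Tsum (I - {i}) (\<lambda>i. rough (Suc n) (v i)) (x / real (Suc n)))"
proof -
 define R where "R i = rough n (v i)" for i
 define R' where "R' i = rough (Suc n) (v i)" for i
 define p where "p = Suc n"
 have R: "R i q = (if q = p then v i p else R' i q)" for i q by (auto simp: R_def R'_def rough_def p_def)
 have R'p: "R' i p = 0" for i by (simp add: R'_def rough_def p_def)
 \<comment> \<open>\<open>R'\<close> vanishes at p, so restoring \<open>v i\<close> in coordinate i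
   alone selects the tuples whose i-th coordinate is p and whose other coordinates exceed p in every
   nonzero term.\<close>
 have pt: "wt R I f = wt R' I f + (\<Sum>i\<in>I. wt (R'(i := v i)) I f * of_bool (f i = p))" if f: "f \<in> tup I x" for f
 proof (cases "\<exists>i\<in>I. f i = p")
  case False
  hence "wt R I f = wt R' I f" by (intro wt_cong) (auto simp: R)
  moreover have "(\<Sum>i\<in>I. wt (R'(i := v i)) I f * of_bool (f i = p)) = 0" using False by (intro sum.neutral) auto
  ultimately show ?thesis by simp
 next
  case True
  then obtain i where i: "i \<in> I" "f i = p" by blast
  have u: "f j \<noteq> p" if "j \<in> I" "j \<noteq> i" for j using tupD(2)[OF f] i that by (auto simp: inj_on_def)
  have "wt R' I f = 0" unfolding wt_def using I i R'p by (intro prod_zero) (auto intro!: bexI[of _ i])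
  moreover have "wt R I f = wt (R'(i := v i)) I f" using i u by (intro wt_cong) (auto simp: R)
  moreover have "(\<Sum>j\<in>I. wt (R'(j := v j)) I f * of_bool (f j = p)) = (\<Sum>j\<in>I. if j = i then wt (R'(i := v i)) I f else 0)"
   using u i by (intro sum.cong refl) auto
  ultimately show ?thesis using I i by simp
 qed
 have each: "(\<Sum>f\<in>tup I x. wt (R'(i := v i)) I f * of_bool (f i = p)) = v i p / real p * Tsum (I - {i}) R' (x / real p)" if i: "i \<in> I" for i
 proof -
  have w: "wt (R'(i := v i)) (I - {i}) g = wt R' (I - {i}) g" for g by (rule wt_cong) auto
  have "(\<Sum>f\<in>tup I x. wt (R'(i := v i)) I f * (\<lambda>m q. of_bool (q = p)) (pr (I - {i}) f) (f i)) =
   (\<Sum>g\<in>tup (I - {i}) x. wt (R'(i := v i)) (I - {i}) g * ((\<Sum>q\<le>nfloor (x / pr (I - {i}) g). (R'(i := v i)) i q / real q * (\<lambda>m q. of_bool (q = p)) (pr (I - {i}) g) q)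
    - (\<Sum>j\<in>I - {i}. if real (g j) * pr (I - {i}) g \<le> x then (R'(i := v i)) i (g j) / real (g j) * (\<lambda>m q. of_bool (q = p)) (pr (I - {i}) g) (g j) else 0)))"
   by (rule coord_sum) (use I i v in auto)
  also have "\<dots> = (\<Sum>g\<in>tup (I - {i}) x. if pr (I - {i}) g \<le> x / real p then v i p / real p * wt R' (I - {i}) g else 0)"
  proof (rule sum.cong[OF refl])
   fix g assume g: "g \<in> tup (I - {i}) x"
   have m: "pr (I - {i}) g \<ge> 1" using tupD(5)[OF g] .
   have *: "p \<le> nfloor (x / pr (I - {i}) g) \<longleftrightarrow> pr (I - {i}) g \<le> x / real p"
   proof -
    have "p \<le> nfloor (x / pr (I - {i}) g) \<longleftrightarrow> real p \<le> x / pr (I - {i}) g"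
    proof
     have "0 \<le> x / pr (I - {i}) g" using tupD(3)[OF g] m by simp
     from of_nat_floor[OF this] show "real p \<le> x / pr (I - {i}) g" if "p \<le> nfloor (x / pr (I - {i}) g)" using that by linarith
    qed (rule le_nat_floor)
    also have "\<dots> \<longleftrightarrow> pr (I - {i}) g \<le> x / real p" using m by (simp add: p_def field_simps)
    finally show ?thesis .
   qed
   have "(\<Sum>q\<le>nfloor (x / pr (I - {i}) g). v i q / real q * of_bool (q = p)) = (\<Sum>q\<le>nfloor (x / pr (I - {i}) g). if q = p then v i p / real p else 0)"
    by (intro sum.cong refl) auto
   hence 1: "(\<Sum>q\<le>nfloor (x / pr (I - {i}) g). v i q / real q * of_bool (q = p)) = (if pr (I - {i}) g \<le> x / real p then v i p / real p else 0)"
    using * by simp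
   have 2: "wt R' (I - {i}) g * (\<Sum>j\<in>I - {i}. if real (g j) * pr (I - {i}) g \<le> x then v i (g j) / real (g j) * of_bool (g j = p) else 0) = 0"
   proof (cases "\<exists>j\<in>I - {i}. g j = p")
    case True
    hence "wt R' (I - {i}) g = 0" unfolding wt_def using I R'p by (intro prod_zero) auto
    thus ?thesis by simp
   next
    case False
    hence "(\<Sum>j\<in>I - {i}. if real (g j) * pr (I - {i}) g \<le> x then v i (g j) / real (g j) * of_bool (g j = p) else 0) = 0"
     by (intro sum.neutral) auto
    thus ?thesis by simp
   qed
   show "wt (R'(i := v i)) (I - {i}) g * ((\<Sum>q\<le>nfloor (x / pr (I - {i}) g). (R'(i := v i)) i q / real q * of_bool (q = p))
    - (\<Sum>j\<in>I - {i}. if real (g j) * pr (I - {i}) g \<le> x then (R'(i := v i)) i (g j) / real (g j) * of_bool (g j = p) else 0)) =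
    (if pr (I - {i}) g \<le> x / real p then v i p / real p * wt R' (I - {i}) g else 0)"
    unfolding w fun_upd_same right_diff_distrib 1 2 by simp
  qed
  also have "\<dots> = (\<Sum>g\<in>tup (I - {i}) (x / real p). v i p / real p * wt R' (I - {i}) g)"
  proof (rule sum.mono_neutral_cong_right[OF finite_tup])
   have "tup (I - {i}) (x / real p) = {g \<in> tup (I - {i}) x. pr (I - {i}) g \<le> x / real p}" by (rule tup_div) (simp add: p_def)
   thus "tup (I - {i}) (x / real p) \<subseteq> tup (I - {i}) x"
    "\<forall>g\<in>tup (I - {i}) x - tup (I - {i}) (x / real p). (if pr (I - {i}) g \<le> x / real p then v i p / real p * wt R' (I - {i}) g else 0) = 0"
    "\<And>g. g \<in> tup (I - {i}) (x / real p) ==> (if pr (I - {i}) g \<le> x / real p then v i p / real p * wt R' (I - {i}) g else 0) = v i p / real p * wt R' (I - {i}) g"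
    by auto
  qed (use I in auto)
  finally show ?thesis by (simp add: Tsum_def sum_distrib_left)
 qed
 have "Tsum I R x = Tsum I R' x + (\<Sum>f\<in>tup I x. \<Sum>i\<in>I. wt (R'(i := v i)) I f * of_bool (f i = p))"
  unfolding Tsum_def using pt by (simp add: sum.distrib)
 also have "(\<Sum>f\<in>tup I x. \<Sum>i\<in>I. wt (R'(i := v i)) I f * of_bool (f i = p)) = (\<Sum>i\<in>I. v i p / real p * Tsum (I - {i}) R' (x / real p))"
  using each by (subst sum.swap) simp
 finally show ?thesis by (simp only: R_def[abs_def] R'_def[abs_def] p_def)
qed

context prime_weights
begin

text \<open>The constant grows with n. This is harmless, as n stays fixed while x tends to infinity
  and the final error \<open>rough_err\<close> does not contain it.\<close>

lemma rough_adm: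
 assumes B: "Mconst B C" and u: "u \<in> U"
 shows "adm (2 * C + 4 * M + M * (real n + 1)) (rough n u)"
 unfolding adm_def
proof (intro conjI allI impI)
 show "dom (rough n u)" unfolding dom_def rough_def using u u_nonneg[OF u] by (intro bexI[of _ u]) auto
 fix y :: real assume y: "y \<ge> 3"
 have "mu u (real n) \<le> (\<Sum>p\<le>n. M)" unfolding mu_def floor_of_nat nat_int
 proof (rule sum_mono)
  fix p
  show "u p / real p \<le> M" using u_le[OF u, of p] u_nonneg[OF u, of p] M
   divide_left_mono[of 1 "real p" "u p"] by (cases "p = 0") auto
 qed
 hence 1: "mu u (real n) \<le> M * (real n + 1)" by (simp add: algebra_simps)
 have 2: "\<bar>mu u y - lnln y\<bar> \<le> 2 * C + 4 * M" using Mconst_bounds(3)[OF B u] y by (simp add: adm_def)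
 have 3: "0 \<le> mu u (real n)" "0 \<le> mu u y" using mu_nonneg u_nonneg[OF u] by blast+
 show "\<bar>mu (rough n u) y - lnln y\<bar> \<le> 2 * C + 4 * M + M * (real n + 1)"
 proof (cases "real n \<le> y")
  case True thus ?thesis using 1 2 3 unfolding mu_rough by simp
 next
  case False
  hence "mu u y \<le> mu u (real n)" using u_nonneg[OF u] by (intro mu_mono) auto
  moreover have "0 \<le> lnln y" using ln_ge_1[OF y] by simp
  ultimately show ?thesis using 1 2 3 False unfolding mu_rough by simp
 qed
qed

text \<open>Subtracting the sums up to n cancels the Mertens constants. Four error terms remain,
  each at most C (ln n)^-b.\<close>

lemma rough_diff:
 assumes B: "Mconst B C" and u: "u \<in> U" "w \<in> U" and n: "n \<ge> 3"
 shows "\<bar>mu (rough n u) y - mu (rough n w) y\<bar> \<le> 4 * C * ln (real n) powr (- b)"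
proof -
 have C1: "C \<ge> 1" using B by (simp add: Mconst_def)
 show ?thesis
 proof (cases "real n \<le> y")
  case True
  have "ln y powr (- b) \<le> ln (real n) powr (- b)" using n True b ln_ge_1[of "real n"] by (intro powr_mono2') auto
  hence "C * ln y powr (- b) \<le> C * ln (real n) powr (- b)" using C1 by (intro mult_left_mono) auto
  moreover have "\<bar>mu u' z - lnln z - B u'\<bar> \<le> C * ln z powr (- b)" if "u' \<in> U" "z \<ge> 3" for u' z using B that by (simp add: Mconst_def)
  note this[OF u(1), of y] this[OF u(2), of y] this[OF u(1), of "real n"] this[OF u(2), of "real n"]
  ultimately show ?thesis using True n unfolding mu_rough by simp
 next
  case False
  thus ?thesis using C1 unfolding mu_rough by simp
 qed
qed

text \<open>At most A L replacements, each changing ln T by at most 4 e / L, where e is the bracket: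
  the difference of the weights plus the collisions among primes above n.\<close>

definition rough_err where "rough_err A C n = 4 * A * (4 * C * ln (real n) powr (- b) + 4 * A * M\<^sup>2 / real (Suc n))"

text \<open>Each replacement changes T by a factor 1 + O(e / L); in terms of ln T these changes add
  up.\<close>

lemma T_rough_replace:
 assumes B: "Mconst B C" and A: "A \<ge> 0" and n: "n \<ge> 3"
 shows "EV x. \<forall>(I :: 'i set) v w. finite I \<and> real (card I) \<le> A * lnln x \<and> (\<forall>i\<in>I. v i \<in> U) \<and> w \<in> U -->
  \<bar>ln (Tsum I (\<lambda>i. rough n (v i)) x / Tsum I (\<lambda>_. rough n w) x)\<bar> \<le> rough_err A C n"
proof -
 define C0 where "C0 = 2 * C + 4 * M + M * (real n + 1)"
 have C1: "C \<ge> 1" using B by (simp add: Mconst_def)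
 have C0: "C0 \<ge> 0" using C1 M by (simp add: C0_def)
 define e where "e = 4 * C * ln (real n) powr (- b) + 4 * A * M\<^sup>2 / real (Suc n)"
 have e0: "e \<ge> 0" using C1 A by (simp add: e_def)
 have "EV x. lnln x \<ge> 4 * e + 1 \<and> (x::real) > 0" by (intro eventually_conj) (rule eventually_gt_at_top | real_asymp)+
 with T_facts[OF A C0, where 'i = 'i] show ?thesis
 proof (eventually_elim, intro allI impI, goal_cases)
  case (1 x I v w)
  note tf = 1(1) and x = 1(2) and I = 1(5)
  define L where "L = lnln x"
  have L: "L \<ge> 4 * e" "L > 0" using x e0 unfolding L_def by linarith+
  have good: "good A C0 x I (\<lambda>i. rough n (v i))" if "\<forall>i\<in>I. v i \<in> U" for v
   using that I rough_adm[OF B] by (auto simp: good_def C0_def)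
  have step: "\<bar>ln (Tsum I (\<lambda>i. rough n (v i)) x) - ln (Tsum I (\<lambda>j. rough n ((v(i := w)) j)) x)\<bar> \<le> 4 * e / L"
   if v: "\<forall>i\<in>I. v i \<in> U" and i: "i \<in> I" for v i
  proof -
   define R where "R j = rough n (v j)" for j
   have gR: "good A C0 x I R" using good[OF v] by (simp add: R_def[abs_def])
   have gJ: "good A C0 x (I - {i}) R" by (rule good_subset[OF gR]) auto
   define T where "T = Tsum I R x"
   define T' where "T' = Tsum I (R(i := rough n w)) x"
   have T0: "T > 0" using tf gR by (simp add: T_def)
   have "\<forall>j\<in>I. (v(i := w)) j \<in> U" using v I by auto
   hence "0 < Tsum I (\<lambda>j. rough n ((v(i := w)) j)) x" using tf good by blast
   moreover have eq: "(\<lambda>j. rough n ((v(i := w)) j)) = R(i := rough n w)" by (auto simp: R_def)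
   ultimately have T'0: "T' > 0" by (simp add: T'_def)
   have "\<bar>T - T' - 0 * Tsum (I - {i}) R x\<bar> \<le> (4 * C * ln (real n) powr (- b)) * Tsum (I - {i}) R x + 0 * win (I - {i}) R x 1
    + 2 * M\<^sup>2 / real (Suc n) * (\<Sum>j\<in>I - {i}. Tsum (I - {i} - {j}) R x)"
    unfolding T_def T'_def
   proof (rule swap_weight)
    show "\<And>i. i \<in> I ==> dom (R i)" "dom (rough n w)" using rough_adm[OF B] v I by (auto simp: R_def adm_def)
    show "\<bar>mu (R i) y - mu (rough n w) y - 0\<bar> \<le> 4 * C * ln (real n) powr (- b) + 0 * of_bool (y < 1)" for y
     using rough_diff[OF B _ _ n, of "v i" w y] v i I by (simp add: R_def)
   qed (use I i x C1 in "auto simp: rough_def R_def")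
   also have "\<dots> \<le> (4 * C * ln (real n) powr (- b)) * Tsum (I - {i}) R x + 0 * win (I - {i}) R x 1
    + 2 * M\<^sup>2 / real (Suc n) * (2 * A * Tsum (I - {i}) R x)"
    using tf gJ by (intro add_left_mono mult_left_mono) auto
   also have "\<dots> = e * Tsum (I - {i}) R x" by (simp add: e_def distrib_right)
   also have "\<dots> \<le> e * (2 / L * T)" using tf gR i e0 unfolding T_def L_def by (intro mult_left_mono) auto
   finally have d: "\<bar>T - T'\<bar> \<le> 2 * e / L * T" by (simp add: mult_ac)
   \<comment> \<open>Ensures T' >= T / 2, so the change may be measured relative to either
     sum.\<close>
   have "2 * e / L \<le> 1 / 2" using L by (simp add: field_simps)
   hence "2 * e / L * T \<le> 1 / 2 * T" using T0 by (intro mult_right_mono) auto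
   hence T2: "T / 2 \<le> T'" using d by linarith
   have k: "(2 * e / L * T) / T = 2 * e / L" "(2 * e / L * T) / (T / 2) = 4 * e / L" using T0 by auto
   have "ln T - ln T' \<le> (T - T') / T'" by (rule ln_diff_bounds) (use T0 T'0 in auto)
   also have "\<dots> \<le> (2 * e / L * T) / T'" using d T'0 by (intro divide_right_mono) auto
   also have "\<dots> \<le> (2 * e / L * T) / (T / 2)" using T0 T'0 T2 e0 L by (intro divide_left_mono) auto
   finally have 1: "ln T - ln T' \<le> 4 * e / L" using k by simp
   have "ln T' - ln T \<le> (T' - T) / T" by (rule ln_diff_bounds) (use T0 T'0 in auto)
   also have "\<dots> \<le> (2 * e / L * T) / T" using d T0 by (intro divide_right_mono) auto
   also have "\<dots> = 2 * e / L" by (rule k)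
   also have "\<dots> \<le> 4 * e / L" using e0 L by (intro divide_right_mono) auto
   finally have "ln T' - ln T \<le> 4 * e / L" .
   thus ?thesis using 1 unfolding eq T_def T'_def R_def[abs_def] by linarith
  qed
  from replace_all_bound[of I w U v "\<lambda>v. ln (Tsum I (\<lambda>i. rough n (v i)) x)" "\<lambda>_. 0" "4 * e / L"] step I
  have "\<bar>ln (Tsum I (\<lambda>i. rough n (v i)) x) - ln (Tsum I (\<lambda>i. rough n (if i \<in> I then w else v i)) x)\<bar> \<le> real (card I) * (4 * e / L)" by simp
  also have "Tsum I (\<lambda>i. rough n (if i \<in> I then w else v i)) x = Tsum I (\<lambda>_. rough n w) x" unfolding Tsum_def by (intro sum.cong refl wt_cong) auto
  also have "real (card I) * (4 * e / L) \<le> (A * L) * (4 * e / L)" using I e0 L by (intro mult_right_mono) (auto simp: L_def)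
  also have "\<dots> = rough_err A C n" using L by (simp add: rough_err_def e_def)
  finally have "\<bar>ln (Tsum I (\<lambda>i. rough n (v i)) x) - ln (Tsum I (\<lambda>_. rough n w) x)\<bar> \<le> rough_err A C n" .
  moreover have "0 < Tsum I (\<lambda>i. rough n (v i)) x" "0 < Tsum I (\<lambda>_. rough n w) x" using tf good[of v] good[of "\<lambda>_. w"] I by auto
  ultimately show ?case by (simp add: ln_div)
 qed
qed

abbreviation "T_peel n \<epsilon> x I v \<equiv> 0 < Tsum I (\<lambda>i. rough (Suc n) (v i)) x \<and>
  \<bar>Tsum I (\<lambda>i. rough n (v i)) x / Tsum I (\<lambda>i. rough (Suc n) (v i)) x - (1 + (\<Sum>i\<in>I. v i (Suc n)) / lnln x / real (Suc n))\<bar> \<le> \<epsilon>"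

text \<open>In the peeling identity each sum without coordinate i and with x / (n + 1) in place of x
  is about T / L: the deletion is governed by \<open>T_ratio\<close>, and the change of x loses only
  a window of fixed ratio. Summing over i leaves the average of the weights at the prime.\<close>

lemma T_peel_limit:
 assumes B: "Mconst B C" and A: "A \<ge> 0" and eps: "\<epsilon> > 0"
 shows "EV x. \<forall>(I :: 'i set) v. finite I \<and> real (card I) \<le> A * lnln x \<and> (\<forall>i\<in>I. v i \<in> U) -->
  T_peel n \<epsilon> x I v"
proof -
 define C0 where "C0 = 2 * C + 4 * M + M * (real (Suc n) + 1)"
 define p where "p = real (Suc n)"
 have C1: "C \<ge> 1" using B by (simp add: Mconst_def)
 have C0: "C0 \<ge> 0" using C1 M by (simp add: C0_def)
 from T_ratio[OF A C0, where 'i = 'i] obtain C' where C': "C' \<ge> 0" and evC: "EV x. \<forall>(I :: 'i set) v. good A C0 x I v --> T_near C' x I v" by blast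
 define d where "d x = A * M * (2 * C' / lnln x + 4 * A * (Ch * (ln p + 1) / ln (x / p)))" for x
 have "((\<lambda>x. A * M * (2 * C' / lnln x + 4 * A * (Ch * (ln p + 1) / ln (x / p)))) \<longlongrightarrow> A * M * (0 + 4 * A * 0)) at_top"
 proof (intro tendsto_intros)
  show "((\<lambda>x::real. 2 * C' / lnln x) \<longlongrightarrow> 0) at_top" by real_asymp
  have "p > 0" by (simp add: p_def)
  hence "((\<lambda>x::real. 1 / ln (x / p)) \<longlongrightarrow> 0) at_top" by real_asymp
  from tendsto_mult[OF tendsto_const[of "Ch * (ln p + 1)"] this] show "((\<lambda>x. Ch * (ln p + 1) / ln (x / p)) \<longlongrightarrow> 0) at_top" by simp
 qed
 hence "EV x. d x < \<epsilon>" unfolding d_def using eps by (intro order_tendstoD) auto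
 moreover have "EV x. p < x \<and> lnln x > 0" by (intro eventually_conj) (rule eventually_gt_at_top | real_asymp)+
 ultimately show ?thesis using T_facts[OF A C0, where 'i = 'i] evC
 proof (eventually_elim, intro allI impI, goal_cases)
  case (1 x I v)
  note dx = 1(1) and x = 1(2) and tf = 1(3) and rat = 1(4) and I = 1(9)
  define L where "L = lnln x"
  have L: "L > 0" using x by (simp add: L_def)
  define R where "R j = rough (Suc n) (v j)" for j
  have gR: "good A C0 x I R" using I rough_adm[OF B, of _ "Suc n"] by (auto simp: good_def C0_def R_def)
  define T where "T = Tsum I R x"
  have T0: "T > 0" using tf gR by (simp add: T_def)
  have p1: "p \<ge> 1" by (simp add: p_def)
  define \<delta> where "\<delta> = 2 * C' / L + 4 * A * (Ch * (ln p + 1) / ln (x / p))"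
  have each: "\<bar>Tsum (I - {i}) R (x / p) - T / L\<bar> \<le> \<delta> * T / L" if i: "i \<in> I" for i
  proof -
   have gJ: "good A C0 x (I - {i}) R" by (rule good_subset[OF gR]) auto
   define S where "S = Tsum (I - {i}) R x"
   have S: "0 \<le> S" "S \<le> 2 / L * T" "\<bar>T - L * S\<bar> \<le> C' * S" using tf gJ gR i rat unfolding S_def T_def L_def by (auto intro: less_imp_le)
   have "tup (I - {i}) x = tup (I - {i}) (x / p) \<union> {g \<in> tup (I - {i}) x. x / p < pr (I - {i}) g}"
    unfolding tup_div[OF p1] by auto
   moreover have "sum (wt R (I - {i})) (tup (I - {i}) (x / p) \<union> {g \<in> tup (I - {i}) x. x / p < pr (I - {i}) g}) = Tsum (I - {i}) R (x / p) + win (I - {i}) R x p"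
    unfolding Tsum_def win_def using I finite_tup[of "I - {i}" x] unfolding tup_div[OF p1] by (intro sum.union_disjoint) auto
   ultimately have "S = Tsum (I - {i}) R (x / p) + win (I - {i}) R x p" by (simp add: S_def Tsum_def)
   moreover have w: "win (I - {i}) R x p \<le> Ch * (ln p + 1) / ln (x / p) * (2 * A * S)" using tf gJ x p1 unfolding S_def by blast
   moreover have "Ch * (ln p + 1) / ln (x / p) * (2 * A * S) \<le> Ch * (ln p + 1) / ln (x / p) * (2 * A * (2 / L * T))"
    using S A Ch p1 x by (intro mult_left_mono divide_nonneg_nonneg mult_nonneg_nonneg) auto
   moreover have "0 \<le> win (I - {i}) R x p" unfolding win_def using good_nn[OF gJ] by (intro sum_nonneg wt_nonneg) auto
   moreover have "\<bar>S - T / L\<bar> \<le> 2 * C' / L * (T / L)"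
   proof -
    have "\<bar>T - L * S\<bar> \<le> C' * (2 / L * T)" using S mult_left_mono[OF S(2) C'] by linarith
    hence "\<bar>T - L * S\<bar> / L \<le> C' * (2 / L * T) / L" using L by (intro divide_right_mono) auto
    moreover have "\<bar>S - T / L\<bar> = \<bar>T - L * S\<bar> / L"
    proof -
     have "S - T / L = (L * S - T) / L" using L by (simp add: diff_divide_distrib)
     thus ?thesis using L by (simp add: abs_minus_commute)
    qed
    ultimately show ?thesis by (simp add: mult_ac)
   qed
   moreover have "\<delta> * T / L = 2 * C' / L * (T / L) + Ch * (ln p + 1) / ln (x / p) * (2 * A * (2 / L * T))"
    by (simp add: \<delta>_def algebra_simps add_divide_distrib)
   ultimately show ?thesis by linarith
  qed
  have d0: "0 \<le> \<delta>" using C' L A Ch p1 x by (simp add: \<delta>_def)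
  have peel: "Tsum I (\<lambda>i. rough n (v i)) x = T + (\<Sum>i\<in>I. v i (Suc n) / p * Tsum (I - {i}) R (x / p))"
   unfolding T_def R_def[abs_def] p_def by (rule Tsum_peel) (use I u_prime in auto)
  have "Tsum I (\<lambda>i. rough n (v i)) x - T * (1 + (\<Sum>i\<in>I. v i (Suc n)) / L / p) = (\<Sum>i\<in>I. v i (Suc n) / p * (Tsum (I - {i}) R (x / p) - T / L))"
  proof -
   have "T * (1 + (\<Sum>i\<in>I. v i (Suc n)) / L / p) = T + (\<Sum>i\<in>I. v i (Suc n) / p * (T / L))"
    by (simp add: distrib_left sum_distrib_left sum_divide_distrib mult_ac)
   thus ?thesis unfolding peel right_diff_distrib sum_subtractf by linarith
  qed
  also have "\<bar>\<dots>\<bar> \<le> (\<Sum>i\<in>I. M * (\<delta> * T / L))"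
  proof (rule order_trans[OF sum_abs], rule sum_mono)
   fix i assume i: "i \<in> I"
   have v: "0 \<le> v i (Suc n)" "v i (Suc n) \<le> M" using u_nonneg u_le I i by auto
   hence "v i (Suc n) / p \<le> M" using p1 divide_left_mono[of 1 p "v i (Suc n)"] by simp
   thus "\<bar>v i (Suc n) / p * (Tsum (I - {i}) R (x / p) - T / L)\<bar> \<le> M * (\<delta> * T / L)"
    unfolding abs_mult using each[OF i] v p1 M by (intro mult_mono) auto
  qed
  also have "\<dots> = real (card I) * (M * (\<delta> * T / L))" by simp
  also have "\<dots> \<le> (A * L) * (M * (\<delta> * T / L))" using I M d0 T0 L by (intro mult_right_mono) (auto simp: L_def)
  also have "\<dots> = d x * T" using L by (simp add: d_def \<delta>_def L_def[symmetric])
  also have "\<dots> \<le> \<epsilon> * T" using dx T0 by (intro mult_right_mono) auto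
  finally have "\<bar>Tsum I (\<lambda>i. rough n (v i)) x - T * (1 + (\<Sum>i\<in>I. v i (Suc n)) / L / p)\<bar> / T \<le> \<epsilon>" using T0 by (simp add: divide_le_eq)
  moreover have "Tsum I (\<lambda>i. rough n (v i)) x / T - (1 + (\<Sum>i\<in>I. v i (Suc n)) / L / p) = (Tsum I (\<lambda>i. rough n (v i)) x - T * (1 + (\<Sum>i\<in>I. v i (Suc n)) / L / p)) / T"
   using T0 by (simp add: diff_divide_distrib)
  ultimately have "\<bar>Tsum I (\<lambda>i. rough n (v i)) x / T - (1 + (\<Sum>i\<in>I. v i (Suc n)) / L / p)\<bar> \<le> \<epsilon>" using T0 by (simp add: abs_divide)
  thus ?case
   using T0 unfolding T_def R_def[abs_def] p_def L_def by simp
 qed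
qed

end

text \<open>An exchange of limits. Two indices are compared at a common large x, which shows that a
  is Cauchy; f then has the same limit.\<close>

lemma approximated_limit:
 fixes f :: "real => real" and a \<eta> :: "nat => real"
 assumes f: "\<And>n \<delta>. n \<ge> N ==> \<delta> > 0 ==> EV x. \<bar>f x - a n\<bar> \<le> \<eta> n + \<delta>" and \<eta>: "\<eta> \<longlonglongrightarrow> 0"
 shows "\<exists>l. a \<longlonglongrightarrow> l \<and> (f \<longlongrightarrow> l) at_top"
proof -
 have diff: "\<bar>a n - a m\<bar> \<le> \<eta> n + \<eta> m" if "n \<ge> N" "m \<ge> N" for n m
 proof (rule field_le_epsilon)
  fix \<delta> :: real assume "\<delta> > 0"
  hence "EV x. \<bar>f x - a n\<bar> \<le> \<eta> n + \<delta> / 2 \<and> \<bar>f x - a m\<bar> \<le> \<eta> m + \<delta> / 2"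
   using that by (intro eventually_conj f) auto
  then obtain x where "\<bar>f x - a n\<bar> \<le> \<eta> n + \<delta> / 2 \<and> \<bar>f x - a m\<bar> \<le> \<eta> m + \<delta> / 2"
   using eventually_happens trivial_limit_at_top_linorder by blast
  thus "\<bar>a n - a m\<bar> \<le> \<eta> n + \<eta> m + \<delta>" by linarith
 qed
 have small: "\<exists>n0\<ge>N. \<forall>n\<ge>n0. \<eta> n < e" if "e > 0" for e
 proof -
  from order_tendstoD(2)[OF \<eta> that] obtain n1 where "\<And>n. n \<ge> n1 ==> \<eta> n < e" by (auto simp: eventually_sequentially)
  thus ?thesis by (intro exI[of _ "max N n1"]) auto
 qed
 have "Cauchy a"
 proof (rule metric_CauchyI)
  fix e :: real assume "e > 0"
  then obtain n0 where n0: "n0 \<ge> N" "\<forall>n\<ge>n0. \<eta> n < e / 2" using small[of "e / 2"] by auto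
  hence "dist (a m) (a n) < e" if "m \<ge> n0" "n \<ge> n0" for m n
   unfolding dist_real_def using diff[of m n] n0(1) n0(2)[rule_format, OF that(1)] n0(2)[rule_format, OF that(2)] that by linarith
  thus "\<exists>M. \<forall>m\<ge>M. \<forall>n\<ge>M. dist (a m) (a n) < e" by blast
 qed
 then obtain l where l: "a \<longlonglongrightarrow> l" using Cauchy_convergent convergent_def by blast
 have "(f \<longlongrightarrow> l) at_top"
 proof (rule tendstoI)
  fix e :: real assume e: "e > 0"
  from small[of "e / 4"] e obtain n0 where n0: "n0 \<ge> N" "\<forall>n\<ge>n0. \<eta> n < e / 4" by auto
  from tendstoD[OF l, of "e / 4"] e obtain n1 where n1: "\<And>n. n \<ge> n1 ==> dist (a n) l < e / 4" by (auto simp: eventually_sequentially)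
  define n where "n = max n0 n1"
  have n: "n \<ge> N" "\<eta> n < e / 4" "\<bar>a n - l\<bar> < e / 4" using n0 n1[of n] by (auto simp: n_def dist_real_def)
  from f[OF n(1), of "e / 4"] e have "EV x. \<bar>f x - a n\<bar> \<le> \<eta> n + e / 4" by simp
  thus "EV x. dist (f x) l < e" unfolding dist_real_def by eventually_elim (use n in linarith)
 qed
 thus ?thesis using l by blast
qed

section \<open>The limit of the quotient when k is of order ln ln x\<close>

context prime_weights
begin

lemma rough_0: "u \<in> U ==> rough 0 u = u" using u_0 by (fastforce simp: rough_def)

lemma rough_err_tendsto: "rough_err A C \<longlonglongrightarrow> 0"
proof -
 have "(\<lambda>n. ln (real n) powr (- b)) \<longlonglongrightarrow> 0" using b by real_asymp
 moreover have "(\<lambda>n. 1 / real (Suc n)) \<longlonglongrightarrow> 0" by real_asymp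
 ultimately have "(\<lambda>n. 4 * A * (4 * C * ln (real n) powr (- b) + 4 * A * M\<^sup>2 * (1 / real (Suc n)))) \<longlonglongrightarrow> 4 * A * (4 * C * 0 + 4 * A * M\<^sup>2 * 0)"
  by (intro tendsto_intros)
 thus ?thesis by (simp add: rough_err_def[abs_def])
qed

text \<open>Finite products of F compare the full quotient with the one for primes above n, whose
  logarithm is eventually at most \<open>rough_err\<close> in modulus. Convergence of the infinite
  product is not shown in advance; it comes out of \<open>approximated_limit\<close> together with
  the limit.\<close>

theorem T_limit:
 fixes I :: "real => 'i set" and v :: "real => 'i => nat => real"
 assumes B: "Mconst B C" and A: "A \<ge> 0" and w: "w \<in> U"
  and I: "EV x. finite (I x) \<and> real (card (I x)) \<le> A * lnln x \<and> (\<forall>i\<in>I x. v x i \<in> U)"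
  and s: "\<And>p. ((\<lambda>x. (\<Sum>i\<in>I x. v x i p) / lnln x) \<longlongrightarrow> s p) at_top"
  and \<alpha>: "((\<lambda>x. real (card (I x)) / lnln x) \<longlongrightarrow> \<alpha>) at_top"
 defines "F \<equiv> \<lambda>p. (1 + s p / real p) / (1 + \<alpha> * w p / real p)"
 shows "convergent_prod F" "((\<lambda>x. Tsum (I x) (v x) x / Tsum (I x) (\<lambda>_. w) x) \<longlongrightarrow> prodinf F) at_top"
proof -
 define Tv where "Tv n x = Tsum (I x) (\<lambda>i. rough n (v x i)) x" for n x
 define Tw where "Tw n x = Tsum (I x) (\<lambda>_. rough n w) x" for n x
 define Q where "Q n x = Tv n x / Tw n x" for n x
 have L0: "\<forall>\<^sub>F x::real in at_top. lnln x > 0" by real_asymp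
 have s0: "s p \<ge> 0" for p
 proof (rule tendsto_lowerbound[OF s])
  show "EV x. 0 \<le> (\<Sum>i\<in>I x. v x i p) / lnln x"
   using I L0
  proof eventually_elim
   case (elim x)
   hence "0 \<le> (\<Sum>i\<in>I x. v x i p)" by (intro sum_nonneg) (use u_nonneg in blast)
   thus ?case using elim by simp
  qed
 qed simp
 have \<alpha>0: "\<alpha> \<ge> 0"
 proof (rule tendsto_lowerbound[OF \<alpha>])
  show "EV x. 0 \<le> real (card (I x)) / lnln x" using L0 by eventually_elim auto
 qed simp
 have den: "1 + \<alpha> * w p / real p > 0" for p using \<alpha>0 u_nonneg[OF w, of p] by (intro add_pos_nonneg) auto
 have F0: "F p > 0" for p unfolding F_def by (rule divide_pos_pos[OF add_pos_nonneg den]) (use s0[of p] in auto)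
 have peel: "((\<lambda>x. Tsum (I x) (\<lambda>i. rough n (v' x i)) x / Tsum (I x) (\<lambda>i. rough (Suc n) (v' x i)) x) \<longlongrightarrow> 1 + s' / real (Suc n)) at_top
   \<and> (EV x. 0 < Tsum (I x) (\<lambda>i. rough (Suc n) (v' x i)) x)"
  if v': "EV x. \<forall>i\<in>I x. v' x i \<in> U" and s': "((\<lambda>x. (\<Sum>i\<in>I x. v' x i (Suc n)) / lnln x) \<longlongrightarrow> s') at_top" for v' :: "real => 'i => nat => real" and n s'
 proof
  have ev: "EV x. T_peel n \<epsilon> x (I x) (v' x)" if "\<epsilon> > 0" for \<epsilon>
   using T_peel_limit[OF B A that, where 'i = 'i and n = n] I v' by eventually_elim blast
  from ev[OF zero_less_one] show "EV x. 0 < Tsum (I x) (\<lambda>i. rough (Suc n) (v' x i)) x" by eventually_elim simp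
  have "((\<lambda>x. Tsum (I x) (\<lambda>i. rough n (v' x i)) x / Tsum (I x) (\<lambda>i. rough (Suc n) (v' x i)) x - (1 + (\<Sum>i\<in>I x. v' x i (Suc n)) / lnln x / real (Suc n))) \<longlongrightarrow> 0) at_top"
  proof (rule tendstoI)
   fix e :: real assume "e > 0"
   hence "e / 2 > 0" by simp
   from ev[OF this] show "EV x. dist (Tsum (I x) (\<lambda>i. rough n (v' x i)) x / Tsum (I x) (\<lambda>i. rough (Suc n) (v' x i)) x - (1 + (\<Sum>i\<in>I x. v' x i (Suc n)) / lnln x / real (Suc n))) 0 < e"
    by eventually_elim (use \<open>e > 0\<close> in "simp add: dist_real_def")
  qed
  from tendsto_add[OF this tendsto_add[OF tendsto_const[of 1] tendsto_divide[OF s' tendsto_const[of "real (Suc n)"]]]]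
  show "((\<lambda>x. Tsum (I x) (\<lambda>i. rough n (v' x i)) x / Tsum (I x) (\<lambda>i. rough (Suc n) (v' x i)) x) \<longlongrightarrow> 1 + s' / real (Suc n)) at_top" by simp
 qed
 have vU: "EV x. \<forall>i\<in>I x. v x i \<in> U" using I by eventually_elim simp
 have wU: "EV x. \<forall>i\<in>I x. w \<in> U" using w by simp
 have sw: "((\<lambda>x. (\<Sum>i\<in>I x. w p) / lnln x) \<longlongrightarrow> \<alpha> * w p) at_top" for p
  using tendsto_mult[OF \<alpha> tendsto_const[of "w p"]] by simp
 have step: "((\<lambda>x. Q n x / Q (Suc n) x) \<longlongrightarrow> F (Suc n)) at_top" for n
 proof -
  have "((\<lambda>x. (Tv n x / Tv (Suc n) x) / (Tw n x / Tw (Suc n) x)) \<longlongrightarrow> F (Suc n)) at_top"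
   unfolding F_def Tv_def Tw_def using peel[OF vU s] peel[OF wU sw] den[of "Suc n"] by (intro tendsto_divide) auto
  thus ?thesis by (simp add: Q_def mult.commute)
 qed
 have Qpos: "EV x. Q (Suc n) x > 0" for n
  using conjunct2[OF peel[OF vU s[of "Suc n"]]] conjunct2[OF peel[OF wU sw[of "Suc n"]]] unfolding Q_def Tv_def Tw_def
  by eventually_elim simp
 have prodlim: "((\<lambda>x. Q 0 x / Q (Suc n) x) \<longlongrightarrow> (\<Prod>p\<le>Suc n. F p)) at_top" for n
 proof (induction n)
  case 0
  \<comment> \<open>Division by \<open>real 0\<close> yields 0, so the index 0 is neutral.\<close>
  have "F 0 = 1" by (simp add: F_def)
  thus ?case using step[of 0] by simp
 next
  case (Suc n)
  have "((\<lambda>x. Q 0 x / Q (Suc n) x * (Q (Suc n) x / Q (Suc (Suc n)) x)) \<longlongrightarrow> (\<Prod>p\<le>Suc n. F p) * F (Suc (Suc n))) at_top"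
   by (intro tendsto_mult Suc step)
  moreover have "EV x. Q 0 x / Q (Suc n) x * (Q (Suc n) x / Q (Suc (Suc n)) x) = Q 0 x / Q (Suc (Suc n)) x"
   using Qpos[of n] by eventually_elim simp
  ultimately show ?case by (simp add: Lim_transform_eventually)
 qed
 define P where "P n = (\<Prod>p\<le>n. F p)" for n
 have P0: "P n > 0" for n unfolding P_def using F0 by (intro prod_pos) auto
 have Q0pos: "EV x. Q 0 x > 0"
  using order_tendstoD(1)[OF prodlim[of 0] P0[of "Suc 0", unfolded P_def]] Qpos[of 0]
  by eventually_elim (simp add: zero_less_divide_iff)
 have "\<exists>l. (\<lambda>n. ln (P n)) \<longlonglongrightarrow> l \<and> ((\<lambda>x. ln (Q 0 x)) \<longlongrightarrow> l) at_top"
 proof (rule approximated_limit[OF _ rough_err_tendsto])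
  fix n :: nat and \<delta> :: real assume n: "n \<ge> 3" and \<delta>: "\<delta> > 0"
  then obtain n' where n': "n = Suc n'" by (cases n) auto
  have "((\<lambda>x. ln (Q 0 x / Q n x)) \<longlongrightarrow> ln (P n)) at_top"
   using prodlim[of n'] P0[of n] unfolding n' P_def[symmetric] by (intro tendsto_ln) auto
  from tendstoD[OF this \<delta>] have "EV x. \<bar>ln (Q 0 x / Q n x) - ln (P n)\<bar> < \<delta>" by (simp add: dist_real_def)
  moreover have "EV x. \<bar>ln (Q n x)\<bar> \<le> rough_err A C n"
   using T_rough_replace[OF B A n, where 'i = 'i] I unfolding Q_def Tv_def Tw_def by eventually_elim (use w in blast)
  ultimately show "EV x. \<bar>ln (Q 0 x) - ln (P n)\<bar> \<le> rough_err A C n + \<delta>"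
   using Q0pos Qpos[of n'] unfolding n'[symmetric]
  proof eventually_elim
   case (elim x)
   hence "ln (Q 0 x / Q n x) = ln (Q 0 x) - ln (Q n x)" by (simp add: ln_div)
   thus ?case using elim by linarith
  qed
 qed
 then obtain l where l: "(\<lambda>n. ln (P n)) \<longlonglongrightarrow> l" "((\<lambda>x. ln (Q 0 x)) \<longlongrightarrow> l) at_top" by blast
 have Pl: "P \<longlonglongrightarrow> exp l" using tendsto_exp[OF l(1)] P0 by simp
 thus conv: "convergent_prod F"
  using F0 unfolding P_def by (subst convergent_prod_iff_nz_lim) (auto intro!: exI[of _ "exp l"] simp: less_imp_neq[symmetric])
 have "P \<longlonglongrightarrow> prodinf F" unfolding P_def by (rule convergent_prod_LIMSEQ[OF conv])
 hence pl: "prodinf F = exp l" using Pl by (rule LIMSEQ_unique)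
 have "((\<lambda>x. exp (ln (Q 0 x))) \<longlongrightarrow> exp l) at_top" by (rule tendsto_exp[OF l(2)])
 moreover have "EV x. exp (ln (Q 0 x)) = Tsum (I x) (v x) x / Tsum (I x) (\<lambda>_. w) x"
  using Q0pos vU
 proof eventually_elim
  case (elim x)
  have "Tv 0 x = Tsum (I x) (v x) x" unfolding Tv_def Tsum_def using elim rough_0 by (intro sum.cong refl wt_cong) auto
  thus ?case using elim rough_0[OF w] by (simp add: Q_def Tw_def)
 qed
 ultimately show "((\<lambda>x. Tsum (I x) (v x) x / Tsum (I x) (\<lambda>_. w) x) \<longlongrightarrow> prodinf F) at_top"
  unfolding pl by (rule Lim_transform_eventually)
qed

text \<open>By \<open>Nsum_Tsum\<close> the quotient of the N-sums is one of sums of T over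
  deletions of a coordinate, so the limit of the T-quotients is needed uniformly in the deleted
  index.\<close>

theorem N_limit:
 fixes I :: "real => 'i set" and v :: "real => 'i => nat => real"
 assumes B: "Mconst B C" and A: "A \<ge> 0" and w: "w \<in> U"
  and I: "EV x. I x \<noteq> {} \<and> finite (I x) \<and> real (card (I x)) \<le> A * lnln x \<and> (\<forall>i\<in>I x. v x i \<in> U)"
  and s: "\<And>p. ((\<lambda>x. (\<Sum>i\<in>I x. v x i p) / lnln x) \<longlongrightarrow> s p) at_top"
  and \<alpha>: "((\<lambda>x. real (card (I x)) / lnln x) \<longlongrightarrow> \<alpha>) at_top"
 defines "F \<equiv> \<lambda>p. (1 + s p / real p) / (1 + \<alpha> * w p / real p)"
 shows "convergent_prod F" "((\<lambda>x. Nsum (I x) (v x) x / Nsum (I x) (\<lambda>_. w) x) \<longlongrightarrow> prodinf F) at_top"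
proof -
 define C0 where "C0 = 2 * C + 4 * M"
 have C1: "C \<ge> 1" using B by (simp add: Mconst_def)
 have C0: "C0 \<ge> 0" using C1 M by (simp add: C0_def)
 have I': "EV x. finite (I x) \<and> real (card (I x)) \<le> A * lnln x \<and> (\<forall>i\<in>I x. v x i \<in> U)"
  using I by eventually_elim simp
 show "convergent_prod F" unfolding F_def by (rule T_limit(1)[OF B A w I' s \<alpha>])
 have Linf: "((\<lambda>x. c / lnln x) \<longlongrightarrow> 0) at_top" for c :: real by real_asymp
 define rat where "rat x i = Tsum (I x - {i}) (v x) x / Tsum (I x - {i}) (\<lambda>_. w) x" for x i
 have unif: "EV x. \<forall>i\<in>I x. \<bar>rat x i - prodinf F\<bar> \<le> \<epsilon>" if \<epsilon>: "\<epsilon> > 0" for \<epsilon>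
 proof -
  \<comment> \<open>A bad index whenever there is one, otherwise any element. Applying
    \<open>T_limit\<close> to I x without \<open>ch x\<close> gives uniformity over all indices at
    once; losing one coordinate does not affect the averages.\<close>
  define ch where "ch x = (if \<exists>i\<in>I x. \<not> \<bar>rat x i - prodinf F\<bar> \<le> \<epsilon> then SOME i. i \<in> I x \<and> \<not> \<bar>rat x i - prodinf F\<bar> \<le> \<epsilon> else SOME i. i \<in> I x)" for x
  have chI: "ch x \<in> I x" if "I x \<noteq> {}" for x
  proof (cases "\<exists>i\<in>I x. \<not> \<bar>rat x i - prodinf F\<bar> \<le> \<epsilon>")
   case True
   thus ?thesis using someI_ex[of "\<lambda>i. i \<in> I x \<and> \<not> \<bar>rat x i - prodinf F\<bar> \<le> \<epsilon>"] by (auto simp: ch_def)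
  next
   case False
   have "ch x = (SOME i. i \<in> I x)" unfolding ch_def by (rule if_not_P[OF False])
   thus ?thesis using that by (simp add: some_in_eq)
  qed
  have bad: "\<not> \<bar>rat x (ch x) - prodinf F\<bar> \<le> \<epsilon>" if "\<exists>i\<in>I x. \<not> \<bar>rat x i - prodinf F\<bar> \<le> \<epsilon>" for x
  proof -
   have "ch x = (SOME i. i \<in> I x \<and> \<not> \<bar>rat x i - prodinf F\<bar> \<le> \<epsilon>)" unfolding ch_def by (rule if_P[OF that])
   thus ?thesis using someI_ex[of "\<lambda>i. i \<in> I x \<and> \<not> \<bar>rat x i - prodinf F\<bar> \<le> \<epsilon>"] that by auto
  qed
  have "((\<lambda>x. Tsum (I x - {ch x}) (v x) x / Tsum (I x - {ch x}) (\<lambda>_. w) x) \<longlongrightarrow> prodinf F) at_top"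
   unfolding F_def
  proof (rule T_limit(2)[OF B A w])
   show "EV x. finite (I x - {ch x}) \<and> real (card (I x - {ch x})) \<le> A * lnln x \<and> (\<forall>i\<in>I x - {ch x}. v x i \<in> U)"
    using I
   proof eventually_elim
    case (elim x)
    have "real (card (I x - {ch x})) \<le> real (card (I x))" using elim by (simp add: card_mono)
    thus ?case using elim by auto
   qed
   show "((\<lambda>x. (\<Sum>i\<in>I x - {ch x}. v x i p) / lnln x) \<longlongrightarrow> s p) at_top" for p
   proof -
    have "((\<lambda>x. v x (ch x) p / lnln x) \<longlongrightarrow> 0) at_top"
    proof (rule Lim_null_comparison[OF _ Linf[of M]])
     have "\<forall>\<^sub>F x::real in at_top. lnln x > 0" by real_asymp
     with I show "EV x. norm (v x (ch x) p / lnln x) \<le> M / lnln x"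
     proof eventually_elim
      case (elim x)
      hence "v x (ch x) \<in> U" using chI by blast
      thus ?case using u_nonneg u_le elim by (simp add: divide_right_mono)
     qed
    qed
    from tendsto_diff[OF s this] have "((\<lambda>x. (\<Sum>i\<in>I x. v x i p) / lnln x - v x (ch x) p / lnln x) \<longlongrightarrow> s p) at_top" by simp
    moreover have "EV x. (\<Sum>i\<in>I x. v x i p) / lnln x - v x (ch x) p / lnln x = (\<Sum>i\<in>I x - {ch x}. v x i p) / lnln x"
     using I by eventually_elim (use chI in "simp add: sum_diff1 diff_divide_distrib")
    ultimately show ?thesis by (rule Lim_transform_eventually)
   qed
   have "((\<lambda>x. real (card (I x)) / lnln x - 1 / lnln x) \<longlongrightarrow> \<alpha>) at_top" using tendsto_diff[OF \<alpha> Linf[of 1]] by simp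
   moreover have "EV x. real (card (I x)) / lnln x - 1 / lnln x = real (card (I x - {ch x})) / lnln x"
    using I
   proof eventually_elim
    case (elim x)
    hence "card (I x) = Suc (card (I x - {ch x}))" using chI by (metis card.remove)
    thus ?case by (simp add: diff_divide_distrib[symmetric])
   qed
   ultimately show "((\<lambda>x. real (card (I x - {ch x})) / lnln x) \<longlongrightarrow> \<alpha>) at_top" by (rule Lim_transform_eventually)
  qed
  from tendstoD[OF this \<epsilon>] have "EV x. \<bar>rat x (ch x) - prodinf F\<bar> < \<epsilon>" by (simp add: dist_real_def rat_def)
  thus ?thesis by eventually_elim (use bad in fastforce)
 qed
 define Sv where "Sv x = Tdel (I x) (v x) x" for x
 define Sw where "Sw x = Tdel (I x) (\<lambda>_. w) x" for x
 have good: "EV x. good A C0 x (I x) (v x) \<and> good A C0 x (I x) (\<lambda>_. w)"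
  using I by eventually_elim (use Mconst_bounds(3)[OF B] w in \<open>auto simp: good_def C0_def\<close>)
 have pos: "EV x. 0 < Sv x \<and> 0 < Sw x \<and> (\<forall>i\<in>I x. 0 < Tsum (I x - {i}) (\<lambda>_. w) x)"
  using T_facts[OF A C0, where 'i = 'i] good I
 proof eventually_elim
  case (elim x)
  have "good A C0 x (I x - {i}) (v x) \<and> good A C0 x (I x - {i}) (\<lambda>_. w)" for i
   using good_subset[of A C0 x "I x" _ "I x - {i}"] elim(2) by auto
  hence "0 < Tsum (I x - {i}) (v x) x \<and> 0 < Tsum (I x - {i}) (\<lambda>_. w) x" for i using elim(1) by blast
  thus ?case unfolding Sv_def Sw_def using elim(3) by (auto intro!: sum_pos)
 qed
 \<comment> \<open>A quotient of two sums is a weighted mean of the termwise quotients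
   \<open>rat x i\<close>.\<close>
 have SS: "((\<lambda>x. Sv x / Sw x) \<longlongrightarrow> prodinf F) at_top"
 proof (rule tendstoI)
  fix e :: real assume "e > 0"
  hence "e / 2 > 0" by simp
  from unif[OF this] pos show "EV x. dist (Sv x / Sw x) (prodinf F) < e"
  proof eventually_elim
   case (elim x)
   have "\<bar>Sv x - prodinf F * Sw x\<bar> \<le> (\<Sum>i\<in>I x. e / 2 * Tsum (I x - {i}) (\<lambda>_. w) x)"
   proof -
    have "Sv x - prodinf F * Sw x = (\<Sum>i\<in>I x. (rat x i - prodinf F) * Tsum (I x - {i}) (\<lambda>_. w) x)"
     unfolding Sv_def Sw_def sum_distrib_left sum_subtractf[symmetric] using elim(2)
     by (intro sum.cong refl) (simp add: rat_def left_diff_distrib order.strict_implies_not_eq[symmetric])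
    also have "\<bar>\<dots>\<bar> \<le> (\<Sum>i\<in>I x. e / 2 * Tsum (I x - {i}) (\<lambda>_. w) x)"
    proof (rule order_trans[OF sum_abs], rule sum_mono)
     fix i assume i: "i \<in> I x"
     hence "0 \<le> Tsum (I x - {i}) (\<lambda>_. w) x" using elim(2) by (auto intro: less_imp_le)
     thus "\<bar>(rat x i - prodinf F) * Tsum (I x - {i}) (\<lambda>_. w) x\<bar> \<le> e / 2 * Tsum (I x - {i}) (\<lambda>_. w) x"
      using elim(1) i unfolding abs_mult by (simp only: abs_of_nonneg) (blast intro: mult_right_mono)
    qed
    finally show ?thesis .
   qed
   also have "\<dots> = e / 2 * Sw x" by (simp only: Sw_def sum_distrib_left)
   finally have "\<bar>Sv x - prodinf F * Sw x\<bar> / Sw x \<le> e / 2" using elim(2) by (simp add: divide_le_eq)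
   moreover have "Sv x / Sw x - prodinf F = (Sv x - prodinf F * Sw x) / Sw x" using elim(2) by (simp add: diff_divide_distrib)
   ultimately have "\<bar>Sv x / Sw x - prodinf F\<bar> \<le> e / 2" using elim(2) by (simp add: abs_divide)
   thus ?case using \<open>e > 0\<close> unfolding dist_real_def by linarith
  qed
 qed
 have one: "((\<lambda>x. Nsum (I x) (v' x) x * ln x / x / S x) \<longlongrightarrow> 1) at_top"
  if "EV x. 0 < S x \<and> good A C0 x (I x) (v' x) \<and> (\<forall>i\<in>I x. v' x i \<in> U) \<and> I x \<noteq> {}"
   and S: "\<And>x. S x = Tdel (I x) (v' x) x" for v' :: "real => 'i => nat => real" and S
 proof -
  have "((\<lambda>x. Nsum (I x) (v' x) x * ln x / x / S x - 1) \<longlongrightarrow> 0) at_top"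
  proof (rule Lim_null_comparison)
   show "((\<lambda>x::real. 1 / lnln x ^ 3) \<longlongrightarrow> 0) at_top" by real_asymp
   show "EV x. norm (Nsum (I x) (v' x) x * ln x / x / S x - 1) \<le> 1 / lnln x ^ 3"
    using that(1) Nsum_Tsum[OF A C0, where 'i = 'i]
   proof eventually_elim
    case (elim x)
    hence "\<bar>Nsum (I x) (v' x) x * ln x / x - S x\<bar> \<le> S x / lnln x ^ 3" unfolding S by blast
    hence "\<bar>Nsum (I x) (v' x) x * ln x / x - S x\<bar> / S x \<le> (S x / lnln x ^ 3) / S x" using elim by (intro divide_right_mono) auto
    moreover have "Nsum (I x) (v' x) x * ln x / x / S x - 1 = (Nsum (I x) (v' x) x * ln x / x - S x) / S x"
     using elim by (simp add: diff_divide_distrib)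
    ultimately show ?case using elim by (simp add: abs_divide)
   qed
  qed
  from tendsto_add[OF this tendsto_const[of 1]] show ?thesis by simp
 qed
 have 1: "((\<lambda>x. Nsum (I x) (v x) x * ln x / x / Sv x) \<longlongrightarrow> 1) at_top"
 proof (rule one)
  show "EV x. 0 < Sv x \<and> good A C0 x (I x) (v x) \<and> (\<forall>i\<in>I x. v x i \<in> U) \<and> I x \<noteq> {}"
   using pos good I by eventually_elim simp
 qed (simp add: Sv_def)
 have 2: "((\<lambda>x. Nsum (I x) (\<lambda>_. w) x * ln x / x / Sw x) \<longlongrightarrow> 1) at_top"
 proof (rule one)
  show "EV x. 0 < Sw x \<and> good A C0 x (I x) (\<lambda>_. w) \<and> (\<forall>i\<in>I x. w \<in> U) \<and> I x \<noteq> {}"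
   using pos good I by eventually_elim (use w in simp)
 qed (simp add: Sw_def)
 have "((\<lambda>x. (Nsum (I x) (v x) x * ln x / x / Sv x) / (Nsum (I x) (\<lambda>_. w) x * ln x / x / Sw x) * (Sv x / Sw x)) \<longlongrightarrow> 1 / 1 * prodinf F) at_top"
  by (intro tendsto_mult tendsto_divide 1 2 SS) simp
 moreover have "EV x. (Nsum (I x) (v x) x * ln x / x / Sv x) / (Nsum (I x) (\<lambda>_. w) x * ln x / x / Sw x) * (Sv x / Sw x) = Nsum (I x) (v x) x / Nsum (I x) (\<lambda>_. w) x"
  using pos eventually_gt_at_top[of 1] by eventually_elim simp
 ultimately show "((\<lambda>x. Nsum (I x) (v x) x / Nsum (I x) (\<lambda>_. w) x) \<longlongrightarrow> prodinf F) at_top"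
  by (simp add: Lim_transform_eventually)
qed

end

section \<open>Counting integers by tuples\<close>

text \<open>Class by class the number is a falling factorial; multiplying by the leftover factorials
  avoids division in nat. Only equal class sizes are needed in the end, but the induction on I
  passes through unequal ones.\<close>

lemma card_class_injections:
 fixes c :: "'i => 'c" and \<kappa> :: "'a => 'c"
 assumes "finite I" and Q: "finite Q" and J: "finite J" "c ` I \<subseteq> J" and le: "\<And>j. j \<in> J ==> card {i\<in>I. c i = j} \<le> card {p\<in>Q. \<kappa> p = j}"
 shows "card {f \<in> I \<rightarrow>\<^sub>E Q. inj_on f I \<and> (\<forall>i\<in>I. \<kappa> (f i) = c i)} * (\<Prod>j\<in>J. fact (card {p\<in>Q. \<kappa> p = j} - card {i\<in>I. c i = j}))
  = (\<Prod>j\<in>J. fact (card {p\<in>Q. \<kappa> p = j}) :: nat)"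
 using assms(1,4,5)
proof (induction I rule: finite_induct)
 case empty
 have "{f \<in> {} \<rightarrow>\<^sub>E Q. inj_on f {} \<and> (\<forall>i\<in>{}. \<kappa> (f i) = c i)} = {\<lambda>_. undefined}" by auto
 thus ?case by simp
next
 case (insert i I)
 define G where "G = {f \<in> I \<rightarrow>\<^sub>E Q. inj_on f I \<and> (\<forall>i\<in>I. \<kappa> (f i) = c i)}"
 define j0 where "j0 = c i"
 define q where "q j = card {p\<in>Q. \<kappa> p = j}" for j
 define t where "t j = card {i\<in>I. c i = j}" for j
 have j0: "j0 \<in> J" using insert.prems by (simp add: j0_def)
 have t: "card {i' \<in> insert i I. c i' = j} = (if j = j0 then Suc (t j) else t j)" for j
 proof -
  have "{i' \<in> insert i I. c i' = j} = (if j = j0 then insert i {i\<in>I. c i = j} else {i\<in>I. c i = j})" by (auto simp: j0_def)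
  thus ?thesis using insert.hyps by (simp add: t_def)
 qed
 have tq: "Suc (t j0) \<le> q j0" using insert.prems(2)[OF j0] unfolding t q_def by simp
 have IH: "card G * (\<Prod>j\<in>J. fact (q j - t j)) = (\<Prod>j\<in>J. fact (q j))" unfolding G_def q_def t_def
 proof (rule insert.IH)
  fix j assume "j \<in> J"
  thus "card {i \<in> I. c i = j} \<le> card {p \<in> Q. \<kappa> p = j}" using insert.prems(2)[of j] unfolding t by (auto simp: t_def split: if_splits)
 qed (use insert.prems in auto)
 have "finite G" unfolding G_def by (rule finite_subset[OF _ finite_PiE[OF insert.hyps(1), of "\<lambda>_. Q"]]) (use Q in auto)
 define H where "H = {f \<in> insert i I \<rightarrow>\<^sub>E Q. inj_on f (insert i I) \<and> (\<forall>i\<in>insert i I. \<kappa> (f i) = c i)}"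
 have "card H = card (Sigma G (\<lambda>g. {p\<in>Q. \<kappa> p = j0} - g ` I))"
 proof (rule bij_betw_same_card[of "\<lambda>f. (f(i := undefined), f i)"], rule bij_betw_byWitness[where f' = "\<lambda>gp. (fst gp)(i := snd gp)"])
  show "\<forall>f\<in>H. (fst (f(i := undefined), f i))(i := snd (f(i := undefined), f i)) = f" by auto
  show "\<forall>gp\<in>Sigma G (\<lambda>g. {p\<in>Q. \<kappa> p = j0} - g ` I). (((fst gp)(i := snd gp))(i := undefined), ((fst gp)(i := snd gp)) i) = gp"
   using insert.hyps by (auto simp: G_def PiE_def extensional_def fun_eq_iff)
  show "(\<lambda>f. (f(i := undefined), f i)) ` H \<subseteq> Sigma G (\<lambda>g. {p\<in>Q. \<kappa> p = j0} - g ` I)"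
  proof (rule image_subsetI)
   fix f assume "f \<in> H"
   hence f: "f \<in> insert i I \<rightarrow>\<^sub>E Q" "inj_on f (insert i I)" "\<forall>i\<in>insert i I. \<kappa> (f i) = c i" unfolding H_def by blast+
   define g where "g = f(i := undefined)"
   have gf: "g j = f j" if "j \<in> I" for j using that insert.hyps by (auto simp: g_def)
   have "g \<in> I \<rightarrow>\<^sub>E Q" unfolding g_def using insert.hyps f(1) by (intro fun_upd_in_PiE)
   moreover have "inj_on g I" using f(2) gf by (simp add: inj_on_def)
   moreover have "f i \<notin> g ` I" using f(2) gf insert.hyps by (auto simp: inj_on_def)
   moreover have "f i \<in> Q" using f(1) by auto
   ultimately show "(f(i := undefined), f i) \<in> Sigma G (\<lambda>g. {p\<in>Q. \<kappa> p = j0} - g ` I)"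
    unfolding g_def[symmetric] using f(3) gf by (simp add: G_def j0_def)
  qed
  show "(\<lambda>gp. (fst gp)(i := snd gp)) ` Sigma G (\<lambda>g. {p\<in>Q. \<kappa> p = j0} - g ` I) \<subseteq> H"
  proof (rule image_subsetI)
   fix gp assume "gp \<in> Sigma G (\<lambda>g. {p\<in>Q. \<kappa> p = j0} - g ` I)"
   then obtain g p where gp: "gp = (g, p)" and g: "g \<in> G" and p: "p \<in> Q" "\<kappa> p = j0" "p \<notin> g ` I" by blast
   define f where "f = g(i := p)"
   have gf: "f j = g j" if "j \<in> I" for j using that insert.hyps by (auto simp: f_def)
   have "f \<in> insert i I \<rightarrow>\<^sub>E Q" unfolding f_def using g p by (intro PiE_fun_upd) (auto simp: G_def)
   moreover have "inj_on f (insert i I)" using g p gf insert.hyps by (auto simp: inj_on_def G_def f_def image_iff)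
   moreover have "\<forall>i\<in>insert i I. \<kappa> (f i) = c i" using g p gf by (simp add: G_def f_def j0_def)
   ultimately have "f \<in> H" unfolding H_def by blast
   thus "(fst gp)(i := snd gp) \<in> H"
    by (simp only: f_def gp fst_conv snd_conv)
  qed
 qed
 also have "\<dots> = (\<Sum>g\<in>G. card ({p\<in>Q. \<kappa> p = j0} - g ` I))" using \<open>finite G\<close> Q by (intro card_SigmaI) auto
 also have "\<dots> = (\<Sum>g\<in>G. q j0 - t j0)"
 proof (rule sum.cong[OF refl])
  fix g assume g: "g \<in> G"
  have "{p\<in>Q. \<kappa> p = j0} - g ` I = {p\<in>Q. \<kappa> p = j0} - g ` {i\<in>I. c i = j0}" using g by (auto simp: G_def)
  moreover have "card (g ` {i\<in>I. c i = j0}) = t j0" unfolding t_def using g by (intro card_image) (auto simp: G_def inj_on_def)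
  moreover have "g ` {i\<in>I. c i = j0} \<subseteq> {p\<in>Q. \<kappa> p = j0}" using g by (auto simp: G_def)
  ultimately show "card ({p\<in>Q. \<kappa> p = j0} - g ` I) = q j0 - t j0" using Q by (simp add: card_Diff_subset finite_subset q_def)
 qed
 finally have cd: "card H = card G * (q j0 - t j0)" by simp
 have "(\<Prod>j\<in>J. fact (q j - (if j = j0 then Suc (t j) else t j))) = fact (q j0 - Suc (t j0)) * (\<Prod>j\<in>J - {j0}. fact (q j - t j) :: nat)"
  using J j0 by (subst prod.remove[of J j0]) auto
 moreover have "(\<Prod>j\<in>J. fact (q j - t j)) = fact (q j0 - t j0) * (\<Prod>j\<in>J - {j0}. fact (q j - t j) :: nat)"
  using J j0 by (subst prod.remove[of J j0]) auto
 moreover have "fact (q j0 - t j0) = (q j0 - t j0) * (fact (q j0 - Suc (t j0)) :: nat)"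
  using tq by (metis Suc_diff_Suc Suc_le_lessD fact_Suc of_nat_id)
 ultimately show ?case using IH unfolding H_def[symmetric] cd t q_def[symmetric] by (simp add: mult_ac)
qed

lemma prime_image_of_prod:
 assumes "finite I" "\<And>i. i \<in> I ==> prime (f i :: nat)"
 shows "prime_factors (\<Prod>i\<in>I. f i) = f ` I"
proof -
 have "prime_factors (\<Prod>i\<in>I. f i) = (\<Union>i\<in>I. prime_factors (f i))"
  using assms prime_gt_0_nat by (subst prime_factors_prod) (auto simp: image_iff)
 also have "\<dots> = (\<Union>i\<in>I. {f i})" using assms by (intro SUP_cong refl) (simp add: prime_factorization_prime)
 finally show ?thesis by auto
qed

text \<open>By unique factorisation the tuples over a given integer are the class-preserving
  bijections onto its set of prime factors, and their number depends on the class sizes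
  alone.\<close>

lemma card_tup_fibres:
 fixes c :: "'i => 'c" and \<kappa> :: "nat => 'c" and x :: real
 assumes I: "finite I" and J: "finite J" "c ` I \<subseteq> J"
 defines "G \<equiv> {f \<in> tup I x. \<forall>i\<in>I. \<kappa> (f i) = c i}"
 shows "card G = (\<Prod>j\<in>J. fact (card {i\<in>I. c i = j})) * card ((\<lambda>f. \<Prod>i\<in>I. f i) ` G)"
proof -
 have finG: "finite G" unfolding G_def using finite_tup[OF I] by auto
 have fibre: "card {f\<in>G. (\<Prod>i\<in>I. f i) = n} = (\<Prod>j\<in>J. fact (card {i\<in>I. c i = j}))" if n: "n \<in> (\<lambda>f. \<Prod>i\<in>I. f i) ` G" for n
 proof -
  from n obtain f0 where f0: "f0 \<in> G" "n = (\<Prod>i\<in>I. f0 i)" by auto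
  define Q where "Q = f0 ` I"
  have pf0: "\<And>i. i \<in> I ==> prime (f0 i)" and inj0: "inj_on f0 I" and nx: "real n \<le> x" using f0 by (auto simp: G_def tup_def)
  have "{f\<in>G. (\<Prod>i\<in>I. f i) = n} = {f \<in> I \<rightarrow>\<^sub>E Q. inj_on f I \<and> (\<forall>i\<in>I. \<kappa> (f i) = c i)}"
  proof (intro equalityI subsetI)
   fix f assume f: "f \<in> {f\<in>G. (\<Prod>i\<in>I. f i) = n}"
   hence "\<And>i. i \<in> I ==> prime (f i)" by (auto simp: G_def tup_def)
   hence "f ` I = Q" using prime_image_of_prod[OF I, of f] prime_image_of_prod[OF I, of f0] pf0 f f0(2) by (simp add: Q_def)
   thus "f \<in> {f \<in> I \<rightarrow>\<^sub>E Q. inj_on f I \<and> (\<forall>i\<in>I. \<kappa> (f i) = c i)}" using f by (auto simp: G_def tup_def PiE_def)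
  next
   fix f assume f: "f \<in> {f \<in> I \<rightarrow>\<^sub>E Q. inj_on f I \<and> (\<forall>i\<in>I. \<kappa> (f i) = c i)}"
   have "card (f ` I) = card Q" using f inj0 by (simp add: Q_def card_image)
   moreover have "f ` I \<subseteq> Q" using f by auto
   ultimately have "f ` I = Q" using I by (intro card_subset_eq) (auto simp: Q_def)
   moreover have "(\<Prod>i\<in>I. f i) = (\<Prod>p\<in>f ` I. p)" using f by (subst prod.reindex) auto
   moreover have "n = (\<Prod>p\<in>Q. p)" using inj0 unfolding Q_def f0(2) by (subst prod.reindex) auto
   ultimately have pn: "(\<Prod>i\<in>I. f i) = n" by simp
   have "f \<in> I \<rightarrow>\<^sub>E Collect prime" using f pf0 by (auto simp: Q_def PiE_def Pi_def)
   moreover have "real (\<Prod>i\<in>I. f i) \<le> x" unfolding pn by (rule nx)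
   ultimately show "f \<in> {f\<in>G. (\<Prod>i\<in>I. f i) = n}" using f pn by (simp add: G_def tup_def del: of_nat_prod)
  qed
  moreover have cls: "card {p\<in>Q. \<kappa> p = j} = card {i\<in>I. c i = j}" for j
  proof -
   have "{p\<in>Q. \<kappa> p = j} = f0 ` {i\<in>I. c i = j}" using f0 by (auto simp: Q_def G_def)
   thus ?thesis using inj0 by (simp add: card_image inj_on_def)
  qed
  ultimately show ?thesis using card_class_injections[OF I, of Q J c \<kappa>] J I cls by (simp add: Q_def)
 qed
 have "card G = (\<Sum>n\<in>(\<lambda>f. \<Prod>i\<in>I. f i) ` G. \<Sum>f | f \<in> G \<and> (\<Prod>i\<in>I. f i) = n. 1)"
  using sum.image_gen[OF finG, of "\<lambda>_. 1::nat" "\<lambda>f. \<Prod>i\<in>I. f i"] by simp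
 also have "\<dots> = (\<Sum>n\<in>(\<lambda>f. \<Prod>i\<in>I. f i) ` G. \<Prod>j\<in>J. fact (card {i\<in>I. c i = j}))"
  using fibre by (intro sum.cong refl) simp
 finally show ?thesis by simp
qed

lemma tup_products:
 assumes "finite I"
 shows "{n::nat. real n \<le> x \<and> (\<exists>p. inj_on p I \<and> (\<forall>j\<in>I. prime (p j) \<and> R j (p j)) \<and> n = (\<Prod>j\<in>I. p j))}
  = (\<lambda>f. \<Prod>i\<in>I. f i) ` {f \<in> tup I x. \<forall>i\<in>I. R i (f i)}"
proof (intro equalityI subsetI)
 fix n assume "n \<in> {n::nat. real n \<le> x \<and> (\<exists>p. inj_on p I \<and> (\<forall>j\<in>I. prime (p j) \<and> R j (p j)) \<and> n = (\<Prod>j\<in>I. p j))}"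
 then obtain p where p: "real n \<le> x" "inj_on p I" "\<forall>j\<in>I. prime (p j) \<and> R j (p j)" "n = (\<Prod>j\<in>I. p j)" by auto
 have pr: "(\<Prod>j\<in>I. restrict p I j) = n" unfolding p(4) by (intro prod.cong) auto
 moreover have "restrict p I \<in> {f \<in> tup I x. \<forall>i\<in>I. R i (f i)}" using p pr by (auto simp: tup_def inj_on_def)
 ultimately show "n \<in> (\<lambda>f. \<Prod>i\<in>I. f i) ` {f \<in> tup I x. \<forall>i\<in>I. R i (f i)}" by (metis (no_types, lifting) image_eqI)
qed (auto simp: tup_def)

lemma Nsum_indicator:
 assumes I: "finite I" and v: "\<And>i p. i \<in> I ==> prime p ==> v i p = (if R i p then c else 0)"
 shows "Nsum I v x = c ^ card I * real (card {f \<in> tup I x. \<forall>i\<in>I. R i (f i)})"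
proof -
 define G where "G = {f \<in> tup I x. \<forall>i\<in>I. R i (f i)}"
 have "Nsum I v x = (\<Sum>f\<in>G. c ^ card I)"
  unfolding Nsum_def
 proof (rule sum.mono_neutral_cong_right[OF finite_tup[OF I]])
  show "\<forall>f\<in>tup I x - G. vprod I v f = 0"
  proof
   fix f assume f: "f \<in> tup I x - G"
   then obtain i where "i \<in> I" "\<not> R i (f i)" by (auto simp: G_def)
   thus "vprod I v f = 0" using v[of i "f i"] tupD(1)[of f I x i] I f by (auto intro!: prod_zero)
  qed
  show "vprod I v f = c ^ card I" if "f \<in> G" for f
  proof -
   have "vprod I v f = (\<Prod>i\<in>I. c)" using v tupD(1)[of f I x] that by (intro prod.cong refl) (simp add: G_def)
   thus ?thesis by simp
  qed
 qed (simp add: G_def)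
 thus ?thesis by (simp add: G_def mult.commute)
qed

lemma Nsum_class_weight:
 assumes pf: "residue_profile q k a l b m"
 shows "Nsum {1..k} (\<lambda>i. class_weight q (a i)) x = rphi q ^ k * (\<Prod>j=1..l. fact (m j)) * real (M_count q k a x)"
proof -
 define G where "G = {f \<in> tup {1..k} x. \<forall>i\<in>{1..k}. int (f i) mod int q = a i mod int q}"
 \<comment> \<open>Classes are represented by reduced residues, so congruence becomes equality and
   the class of a coordinate is a function value.\<close>
 define J where "J = (\<lambda>j. b j mod int q) ` {1..l}"
 have pf1: "\<forall>i\<in>{1..k}. \<exists>j\<in>{1..l}. a i mod int q = b j mod int q"
  and pf2: "\<forall>i\<in>{1..l}. \<forall>j\<in>{1..l}. b i mod int q = b j mod int q --> i = j"
  using pf unfolding residue_profile_def cong_def by blast+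
 have "Nsum {1..k} (\<lambda>i. class_weight q (a i)) x = rphi q ^ card {1..k} * real (card G)"
  unfolding G_def by (rule Nsum_indicator) (auto simp: class_weight_def cong_def)
 also have "card G = (\<Prod>j\<in>J. fact (card {i\<in>{1..k}. a i mod int q = j})) * card ((\<lambda>f. \<Prod>i\<in>{1..k}. f i) ` G)"
  unfolding G_def
 proof (rule card_tup_fibres)
  show "(\<lambda>i. a i mod int q) ` {1..k} \<subseteq> J" unfolding J_def using pf1 by (intro image_subsetI) (metis imageI)
 qed (auto simp: J_def)
 also have "(\<Prod>j\<in>J. fact (card {i\<in>{1..k}. a i mod int q = j})) = (\<Prod>j=1..l. fact (m j) :: nat)"
 proof -
  have "inj_on (\<lambda>j. b j mod int q) {1..l}" unfolding inj_on_def using pf2 by blast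
  hence "(\<Prod>j\<in>J. fact (card {i\<in>{1..k}. a i mod int q = j})) = (\<Prod>j=1..l. fact (card {i\<in>{1..k}. a i mod int q = b j mod int q}) :: nat)"
   unfolding J_def by (simp only: prod.reindex comp_def)
  also have "\<dots> = (\<Prod>j=1..l. fact (m j))"
  proof (rule prod.cong[OF refl])
   fix j assume "j \<in> {1..l}"
   hence "m j = card {i\<in>{1..k}. a i mod int q = b j mod int q}" using pf unfolding residue_profile_def cong_def by blast
   thus "fact (card {i\<in>{1..k}. a i mod int q = b j mod int q}) = (fact (m j) :: nat)" by simp
  qed
  finally show ?thesis .
 qed
 also have "card ((\<lambda>f. \<Prod>i\<in>{1..k}. f i) ` G) = M_count q k a x"
  unfolding M_count_def G_def cong_def by (subst tup_products) auto
 finally show ?thesis by (simp add: of_nat_prod mult_ac)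
qed

lemma Nsum_all_weight: "Nsum {1..k} (\<lambda>_. all_weight q) x = fact k * real (S_count q k x)"
proof -
 \<comment> \<open>Equating with True presents coprimality as a class map into bool; all k
   coordinates then lie in one class, and the fibres have size k!.\<close>
 define G where "G = {f \<in> tup {1..k} x. \<forall>i\<in>{1..k}. coprime (f i) q = True}"
 have "Nsum {1..k} (\<lambda>_. all_weight q) x = 1 ^ card {1..k} * real (card G)"
  unfolding G_def by (rule Nsum_indicator) (auto simp: all_weight_def)
 also have "card G = fact k * card ((\<lambda>f. \<Prod>i\<in>{1..k}. f i) ` G)"
 proof -
  have "card G = (\<Prod>j\<in>{True}. fact (card {i\<in>{1..k}. True = j})) * card ((\<lambda>f. \<Prod>i\<in>{1..k}. f i) ` G)"
   unfolding G_def by (rule card_tup_fibres) auto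
  moreover have "{i\<in>{1..k}. True = True} = {1..k}" by auto
  ultimately show ?thesis by (simp only: prod.insert finite.emptyI empty_iff not_False_eq_True prod.empty mult_1_right card_atLeastAtMost) simp
 qed
 also have "card ((\<lambda>f. \<Prod>i\<in>{1..k}. f i) ` G) = S_count q k x"
 proof -
  have "{n::nat. real n \<le> x \<and> coprime n q \<and> (\<exists>p. inj_on p {1..k} \<and> (\<forall>j\<in>{1..k}. prime (p j)) \<and> n = (\<Prod>j=1..k. p j))}
   = {n::nat. real n \<le> x \<and> (\<exists>p. inj_on p {1..k} \<and> (\<forall>j\<in>{1..k}. prime (p j) \<and> coprime (p j) q = True) \<and> n = (\<Prod>j\<in>{1..k}. p j))}"
   (is "?l = ?r")
  proof -
   have cop: "coprime (\<Prod>j=1..k. p j) q \<longleftrightarrow> (\<forall>j\<in>{1..k}. coprime (p j) q)" for p :: "nat => nat"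
   proof (intro iffI ballI)
    fix j assume "coprime (\<Prod>j=1..k. p j) q" and j: "j \<in> {1..k}"
    moreover have "p j dvd (\<Prod>j=1..k. p j)" using j by (intro dvd_prodI) auto
    ultimately show "coprime (p j) q" by (meson coprime_divisors dvd_refl)
   qed (intro prod_coprime_left, blast)
   show ?thesis
   proof (intro Collect_cong iffI; elim conjE exE)
    fix n p assume "real n \<le> x" "coprime n q" "inj_on p {1..k}" "\<forall>j\<in>{1..k}. prime (p j)" and n: "n = (\<Prod>j=1..k. p j)"
    moreover have "\<forall>j\<in>{1..k}. coprime (p j) q" using \<open>coprime n q\<close> cop[of p] unfolding n by blast
    ultimately show "real n \<le> x \<and> (\<exists>p. inj_on p {1..k} \<and> (\<forall>j\<in>{1..k}. prime (p j) \<and> coprime (p j) q = True) \<and> n = (\<Prod>j\<in>{1..k}. p j))" by blast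
   next
    fix n p assume "real n \<le> x" "inj_on p {1..k}" "\<forall>j\<in>{1..k}. prime (p j) \<and> coprime (p j) q = True" and n: "n = (\<Prod>j=1..k. p j)"
    moreover have "coprime n q" using calculation(3) cop[of p] unfolding n by blast
    ultimately show "real n \<le> x \<and> coprime n q \<and> (\<exists>p. inj_on p {1..k} \<and> (\<forall>j\<in>{1..k}. prime (p j)) \<and> n = (\<Prod>j=1..k. p j))" by blast
   qed
  qed
  thus ?thesis unfolding S_count_def G_def by (simp only: tup_products[of "{1..k}" x "\<lambda>_ p. coprime p q = True"] finite_atLeastAtMost)
 qed
 finally show ?thesis by simp
qed

text \<open>The power of phi(q) and the multinomial coefficient in \<open>M_ratio\<close> are
  precisely the normalisations produced by the two fibre counts.\<close>

lemma M_ratio_eq: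
 assumes "residue_profile q k a l b m"
 shows "M_ratio q k a l m x = Nsum {1..k} (\<lambda>i. class_weight q (a i)) x / Nsum {1..k} (\<lambda>_. all_weight q) x"
 unfolding Nsum_class_weight[OF assms] Nsum_all_weight M_ratio_def by (simp add: divide_simps)

section \<open>Bias constants and the factors of the limit product\<close>

lemma sum_primes_eq_mu:
 assumes u: "\<And>p. u p = (if prime p \<and> R p then c else 0)"
 shows "c * (\<Sum>p | prime p \<and> real p \<le> x \<and> R p. 1 / real p) = mu u x"
proof -
 have "(\<Sum>p | prime p \<and> real p \<le> x \<and> R p. c * (1 / real p)) = mu u x"
  unfolding mu_def
 proof (rule sum.mono_neutral_cong_left)
  show "{p. prime p \<and> real p \<le> x \<and> R p} \<subseteq> {..nfloor x}" by (auto intro: le_nat_floor)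
  show "\<forall>i\<in>{..nfloor x} - {p. prime p \<and> real p \<le> x \<and> R p}. u i / real i = 0"
  proof
   fix i assume i: "i \<in> {..nfloor x} - {p. prime p \<and> real p \<le> x \<and> R p}"
   show "u i / real i = 0"
   proof (cases "i = 0")
    case False
    hence "real i \<le> x" using i by simp linarith
    thus ?thesis using i by (auto simp: u)
   qed simp
  qed
 qed (auto simp: u)
 thus ?thesis by (simp only: sum_distrib_left)
qed

lemma mu_class_weight: "rphi q * (\<Sum>p | prime p \<and> real p \<le> x \<and> [int p = a] (mod int q). 1 / real p) = mu (class_weight q a) x"
 by (rule sum_primes_eq_mu) (simp add: class_weight_def)

lemma mu_all_weight: "(\<Sum>p | prime p \<and> real p \<le> x \<and> coprime p q. 1 / real p) = mu (all_weight q) x"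
 using sum_primes_eq_mu[of "all_weight q" "\<lambda>p. coprime p q" 1 x] by (simp add: all_weight_def)

text \<open>The two divergent sums share the main term ln ln x, so the limit exists and is the
  difference of the Mertens constants.\<close>

lemma (in prime_weights) bias_const_eq:
 assumes B: "Mconst B C" and U: "class_weight q a \<in> U" "all_weight q \<in> U"
 shows "bias_const q a = B (class_weight q a) - B (all_weight q)"
proof -
 have lim: "((\<lambda>x. mu u x - lnln x - B u) \<longlongrightarrow> 0) at_top" if "u \<in> U" for u
 proof (rule Lim_null_comparison)
  have "((\<lambda>x. C * ln x powr (- b)) \<longlongrightarrow> C * 0) at_top" by (intro tendsto_mult tendsto_const) (use b in real_asymp)
  thus "((\<lambda>x. C * ln x powr (- b)) \<longlongrightarrow> 0) at_top" by simp
  show "EV x. norm (mu u x - lnln x - B u) \<le> C * ln x powr (- b)"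
   using eventually_ge_at_top[of 3] by eventually_elim (use B that in "simp add: Mconst_def")
 qed
 have "((\<lambda>x. (mu (class_weight q a) x - lnln x - B (class_weight q a)) - (mu (all_weight q) x - lnln x - B (all_weight q)) + (B (class_weight q a) - B (all_weight q))) \<longlongrightarrow> 0 - 0 + (B (class_weight q a) - B (all_weight q))) at_top"
  by (intro tendsto_intros lim U)
 hence "((\<lambda>x. mu (class_weight q a) x - mu (all_weight q) x) \<longlongrightarrow> B (class_weight q a) - B (all_weight q)) at_top" by simp
 thus ?thesis unfolding bias_const_def mu_class_weight mu_all_weight by (intro tendsto_Lim) auto
qed

lemma profile_sum_class_weight:
 assumes pf: "residue_profile q k a l b m"
 shows "(\<Sum>i\<in>{1..k}. class_weight q (a i) p) = (if prime p then rphi q * (\<Sum>j=1..l. of_bool ([int p = b j] (mod int q)) * real (m j)) else 0)"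
proof (cases "prime p")
 case True
 have pf1: "\<forall>i\<in>{1..k}. \<exists>j\<in>{1..l}. [a i = b j] (mod int q)"
  and pf2: "\<forall>i\<in>{1..l}. \<forall>j\<in>{1..l}. [b i = b j] (mod int q) --> i = j"
  and pf3: "\<forall>j\<in>{1..l}. m j = card {i\<in>{1..k}. [a i = b j] (mod int q)}"
  using pf unfolding residue_profile_def by blast+
 have "class_weight q (a i) p = (\<Sum>j=1..l. rphi q * of_bool ([int p = b j] (mod int q)) * of_bool ([a i = b j] (mod int q)))" if i: "i \<in> {1..k}" for i
 proof -
  obtain j where j: "j \<in> {1..l}" "[a i = b j] (mod int q)" using pf1 i by blast
  have "\<not> [a i = b j'] (mod int q)" if "j' \<in> {1..l} - {j}" for j'
   using pf2 j that by (metis DiffD1 DiffD2 cong_sym cong_trans insertI1)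
  hence S: "(\<Sum>j=1..l. rphi q * of_bool ([int p = b j] (mod int q)) * of_bool ([a i = b j] (mod int q))) = rphi q * of_bool ([int p = b j] (mod int q))"
   using j by (subst sum.remove[of _ j]) auto
  have "[int p = a i] (mod int q) \<longleftrightarrow> [int p = b j] (mod int q)" using j(2) by (metis cong_sym cong_trans)
  thus ?thesis unfolding S using True by (simp add: class_weight_def)
 qed
 hence "(\<Sum>i\<in>{1..k}. class_weight q (a i) p) = (\<Sum>i\<in>{1..k}. \<Sum>j=1..l. rphi q * of_bool ([int p = b j] (mod int q)) * of_bool ([a i = b j] (mod int q)))"
  by (rule sum.cong[OF refl])
 also have "\<dots> = (\<Sum>j=1..l. \<Sum>i\<in>{1..k}. rphi q * of_bool ([int p = b j] (mod int q)) * of_bool ([a i = b j] (mod int q)))" by (rule sum.swap)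
 also have "\<dots> = (\<Sum>j=1..l. rphi q * (of_bool ([int p = b j] (mod int q)) * real (m j)))"
 proof (rule sum.cong[OF refl])
  fix j assume "j \<in> {1..l}"
  hence "m j = card {i\<in>{1..k}. [a i = b j] (mod int q)}" using pf3 by blast
  moreover have "(\<Sum>i\<in>{1..k}. of_bool ([a i = b j] (mod int q)) :: real) = (\<Sum>i\<in>{i\<in>{1..k}. [a i = b j] (mod int q)}. 1)"
   by (rule sum.mono_neutral_cong_right) auto
  ultimately show "(\<Sum>i\<in>{1..k}. rphi q * of_bool ([int p = b j] (mod int q)) * of_bool ([a i = b j] (mod int q))) = rphi q * (of_bool ([int p = b j] (mod int q)) * real (m j))"
   by (simp add: sum_distrib_left[symmetric])
 qed
 finally show ?thesis unfolding if_P[OF True] sum_distrib_left .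
qed (simp add: class_weight_def)

text \<open>At most one b j is congruent to p, so the product over j collapses to 1 plus a sum, the
  shape in which \<open>N_limit\<close> delivers the factors. Off the primes both sides are
  1.\<close>

lemma prime_factor_term_eq:
 assumes "\<forall>i\<in>{1..l}. \<forall>j\<in>{1..l}. [b i = b j] (mod int q) --> i = j"
 shows "prime_factor_term q l b e A p =
  (1 + (if prime p then rphi q * (\<Sum>j=1..l. of_bool ([int p = b j] (mod int q)) * e j) else 0) / real p) / (1 + A * all_weight q p / real p)"
proof (cases "prime p")
 case True
 have "(\<Prod>j=1..l. 1 + rphi q * e j * of_bool ([int p = b j] (mod int q)) / real p) = 1 + rphi q * (\<Sum>j=1..l. of_bool ([int p = b j] (mod int q)) * e j) / real p"
 proof (cases "\<exists>j\<in>{1..l}. [int p = b j] (mod int q)")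
  case True
  then obtain j where j: "j \<in> {1..l}" "[int p = b j] (mod int q)" by blast
  have n: "\<not> [int p = b j'] (mod int q)" if "j' \<in> {1..l} - {j}" for j'
   using assms j that by (metis DiffD1 DiffD2 cong_sym cong_trans insertI1)
  have "(\<Prod>j=1..l. 1 + rphi q * e j * of_bool ([int p = b j] (mod int q)) / real p) = 1 + rphi q * e j / real p"
   using j n by (subst prod.remove[of _ j]) auto
  moreover have "(\<Sum>j=1..l. of_bool ([int p = b j] (mod int q)) * e j) = e j" using j n by (subst sum.remove[of _ j]) auto
  ultimately show ?thesis by simp
 next
  case False
  hence "(\<Prod>j=1..l. 1 + rphi q * e j * of_bool ([int p = b j] (mod int q)) / real p) = 1" by (intro prod.neutral) auto
  moreover have "(\<Sum>j=1..l. of_bool ([int p = b j] (mod int q)) * e j) = 0" using False by (intro sum.neutral) auto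
  ultimately show ?thesis by simp
 qed
 thus ?thesis using True by (simp add: prime_factor_term_def principal_char_def all_weight_def)
qed (simp add: prime_factor_term_def all_weight_def)

theorem theorem2:
  fixes q :: nat
  assumes "q \<ge> 3"
  shows
    "(\<forall>k l. k \<ge> 2 \<longrightarrow>
        (\<exists>K x0. \<forall>a b m. residue_profile q k a l b m \<longrightarrow>
           (\<forall>x\<ge>x0.
              \<bar>M_ratio q k a l m x
                 - (1 + (real k - 1) / ln (ln x) * (1 / real k * (\<Sum>j=1..k. bias_const q (a j))))\<bar>
              \<le> K / (ln (ln x))\<^sup>2)))
     \<and>
     (\<forall>l (A::real) (b :: nat \<Rightarrow> int) (e :: nat \<Rightarrow> real)
        (k :: real \<Rightarrow> nat) (a :: real \<Rightarrow> nat \<Rightarrow> int) (m :: real \<Rightarrow> nat \<Rightarrow> nat).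
        A > 0 \<longrightarrow>
        (\<forall>\<^sub>F x in at_top. k x \<ge> 2 \<and> residue_profile q (k x) (a x) l b (m x)) \<longrightarrow>
        (\<lambda>x. real (k x)) \<sim>[at_top] (\<lambda>x. A * ln (ln x)) \<longrightarrow>
        (\<forall>j\<in>{1..l}. ((\<lambda>x. real (m x j) / ln (ln x)) \<longlongrightarrow> e j) at_top) \<longrightarrow>
        convergent_prod (prime_factor_term q l b e A) \<and>
        (\<lambda>x. M_ratio q (k x) (a x) l (m x) x)
          \<sim>[at_top] (\<lambda>_. prodinf (prime_factor_term q l b e A)))"
proof -
 define U where "U = insert (all_weight q) (class_weight q ` {c. coprime c (int q)})"
 obtain K \<beta> where pw: "prime_weights U (rphi q) K \<beta>" using PNT_weights[of q] assms unfolding U_def by auto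
 interpret prime_weights U "rphi q" K \<beta> by (rule pw)
 from mertens obtain C B where "C \<ge> 1" "\<forall>u\<in>U. \<forall>x\<ge>3. \<bar>mu u x - lnln x - B u\<bar> \<le> C * ln x powr (- \<beta>)" by blast
 hence B: "Mconst B C" by (simp add: Mconst_def)
 have wU: "all_weight q \<in> U" and cU: "\<And>c. coprime c (int q) ==> class_weight q c \<in> U" by (auto simp: U_def)
 have pU: "\<forall>i\<in>{1..k}. class_weight q (a i) \<in> U" if "residue_profile q k a l b m" for k a l b m
 proof -
  have "\<forall>i\<in>{1..k}. coprime (a i) (int q)" using that unfolding residue_profile_def by (rule conjunct1)
  thus ?thesis using cU by blast
 qed
 have L0: "\<forall>\<^sub>F x::real in at_top. lnln x > 0" by real_asymp
 show ?thesis
 proof (intro conjI allI impI)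
  fix k l :: nat assume k: "k \<ge> 2"
  have "card {1..k} = k" by simp
  from N_ratio_fixed[OF B finite_atLeastAtMost this k]
  obtain c where c: "EV x. \<forall>v w. (\<forall>i\<in>{1..k}. v i \<in> U) \<and> w \<in> U -->
   \<bar>Nsum {1..k} v x / Nsum {1..k} (\<lambda>_. w) x - (1 + (real k - 1) / real k * (\<Sum>i\<in>{1..k}. B (v i) - B w) / lnln x)\<bar> \<le> c / (lnln x)\<^sup>2" by blast
  then obtain x0 where x0: "\<And>x v w. x \<ge> x0 ==> \<forall>i\<in>{1..k}. v i \<in> U ==> w \<in> U ==>
   \<bar>Nsum {1..k} v x / Nsum {1..k} (\<lambda>_. w) x - (1 + (real k - 1) / real k * (\<Sum>i\<in>{1..k}. B (v i) - B w) / lnln x)\<bar> \<le> c / (lnln x)\<^sup>2"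
   unfolding eventually_at_top_linorder by blast
  show "\<exists>K x0. \<forall>a b m. residue_profile q k a l b m --> (\<forall>x\<ge>x0.
    \<bar>M_ratio q k a l m x - (1 + (real k - 1) / lnln x * (1 / real k * (\<Sum>j=1..k. bias_const q (a j))))\<bar> \<le> K / (lnln x)\<^sup>2)"
  proof (rule exI[of _ c], rule exI[of _ x0], intro allI impI)
   fix a b m x assume pf: "residue_profile q k a l b m" and x: "x0 \<le> x"
   have "(\<Sum>j=1..k. bias_const q (a j)) = (\<Sum>j=1..k. B (class_weight q (a j)) - B (all_weight q))"
    using pU[OF pf] wU by (intro sum.cong refl bias_const_eq[OF B]) auto
   moreover have "(real k - 1) / lnln x * (1 / real k * z) = (real k - 1) / real k * z / lnln x" for z by simp
   ultimately show "\<bar>M_ratio q k a l m x - (1 + (real k - 1) / lnln x * (1 / real k * (\<Sum>j=1..k. bias_const q (a j))))\<bar> \<le> c / (lnln x)\<^sup>2"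
    using x0[OF x pU[OF pf] wU] unfolding M_ratio_eq[OF pf] by (simp only:)
  qed
 next
  fix l and A :: real and b :: "nat => int" and e :: "nat => real" and k :: "real => nat" and a :: "real => nat => int" and m :: "real => nat => nat"
  assume A: "A > 0" and pf: "EV x. k x \<ge> 2 \<and> residue_profile q (k x) (a x) l b (m x)"
   and kA: "(\<lambda>x. real (k x)) \<sim>[at_top] (\<lambda>x. A * lnln x)"
   and e: "\<forall>j\<in>{1..l}. ((\<lambda>x. real (m x j) / lnln x) \<longlongrightarrow> e j) at_top"
  have "((\<lambda>x. real (k x) / (A * lnln x)) \<longlongrightarrow> 1) at_top"
   using kA unfolding asymp_equiv_def
  proof (rule Lim_transform_eventually)
   show "EV x. (if real (k x) = 0 \<and> A * lnln x = 0 then 1 else real (k x) / (A * lnln x)) = real (k x) / (A * lnln x)"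
    using L0 by eventually_elim (use A in auto)
  qed
  from tendsto_mult[OF tendsto_const[of A] this] A
  have kL: "((\<lambda>x. real (card {1..k x}) / lnln x) \<longlongrightarrow> A) at_top" by simp
  define v where "v x i = class_weight q (a x i)" for x i
  define s where "s p = (if prime p then rphi q * (\<Sum>j=1..l. of_bool ([int p = b j] (mod int q)) * e j) else 0)" for p
  have I: "EV x. {1..k x} \<noteq> {} \<and> finite {1..k x} \<and> real (card {1..k x}) \<le> (A + 1) * lnln x \<and> (\<forall>i\<in>{1..k x}. v x i \<in> U)"
   using pf L0 order_tendstoD(2)[OF kL less_add_one]
  proof eventually_elim
   case (elim x)
   hence "real (card {1..k x}) \<le> (A + 1) * lnln x" by (simp add: divide_less_eq less_imp_le)
   thus ?case using elim pU unfolding v_def by auto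
  qed
  have s: "((\<lambda>x. (\<Sum>i\<in>{1..k x}. v x i p) / lnln x) \<longlongrightarrow> s p) at_top" for p
  proof -
   have "((\<lambda>x. if prime p then rphi q * (\<Sum>j=1..l. of_bool ([int p = b j] (mod int q)) * (real (m x j) / lnln x)) else 0) \<longlongrightarrow> s p) at_top"
    unfolding s_def using e by (cases "prime p") (auto intro!: tendsto_intros simp del: sum_of_bool_mult_eq)
   moreover have "EV x. (if prime p then rphi q * (\<Sum>j=1..l. of_bool ([int p = b j] (mod int q)) * (real (m x j) / lnln x)) else 0) = (\<Sum>i\<in>{1..k x}. v x i p) / lnln x"
    using pf
   proof eventually_elim
    case (elim x)
    hence eq: "(\<Sum>i\<in>{1..k x}. v x i p) = (if prime p then rphi q * (\<Sum>j=1..l. of_bool ([int p = b j] (mod int q)) * real (m x j)) else 0)"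
     unfolding v_def by (intro profile_sum_class_weight) blast
    show ?case unfolding eq by (simp add: sum_divide_distrib[symmetric] del: sum_of_bool_mult_eq)
   qed
   ultimately show ?thesis by (rule Lim_transform_eventually)
  qed
  \<comment> \<open>Distinctness of the b j does not involve x, so a single x with a valid profile
    suffices.\<close>
  obtain x where "residue_profile q (k x) (a x) l b (m x)"
   using eventually_happens[OF pf] trivial_limit_at_top_linorder by blast
  hence bb: "\<forall>i\<in>{1..l}. \<forall>j\<in>{1..l}. [b i = b j] (mod int q) --> i = j" unfolding residue_profile_def by blast
  have F: "(\<lambda>p. (1 + s p / real p) / (1 + A * all_weight q p / real p)) = prime_factor_term q l b e A"
   unfolding s_def prime_factor_term_eq[OF bb, abs_def] ..
  have A1: "A + 1 \<ge> 0" using A by simp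
  note lim = N_limit[OF B A1 wU I s kL, unfolded F]
  show "convergent_prod (prime_factor_term q l b e A)" by (rule lim(1))
  have e0: "e j \<ge> 0" if "j \<in> {1..l}" for j
  proof (rule tendsto_lowerbound[OF e[rule_format, OF that]])
   show "EV x. 0 \<le> real (m x j) / lnln x" using L0 by eventually_elim simp
  qed simp
  \<comment> \<open>All factors are positive, so the infinite product is not 0; this is what turns
    convergence into asymptotic equivalence.\<close>
  have nz: "prime_factor_term q l b e A p \<noteq> 0" for p
  proof -
   have "0 \<le> s p" unfolding s_def using e0 by (auto intro!: mult_nonneg_nonneg sum_nonneg)
   hence "1 + s p / real p > 0" by (intro add_pos_nonneg) auto
   moreover have "1 + A * all_weight q p / real p > 0" using A by (intro add_pos_nonneg) (auto simp: all_weight_def)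
   ultimately show ?thesis unfolding F[symmetric] by (simp only: divide_eq_0_iff) linarith
  qed
  have P: "prodinf (prime_factor_term q l b e A) \<noteq> 0" by (rule prodinf_nonzero[OF lim(1) nz])
  have "((\<lambda>x. M_ratio q (k x) (a x) l (m x) x) \<longlongrightarrow> prodinf (prime_factor_term q l b e A)) at_top"
  proof (rule Lim_transform_eventually[OF lim(2)])
   show "EV x. Nsum {1..k x} (v x) x / Nsum {1..k x} (\<lambda>_. all_weight q) x = M_ratio q (k x) (a x) l (m x) x"
    using pf
   proof eventually_elim
    case (elim x)
    thus ?case unfolding v_def[abs_def] by (intro M_ratio_eq[symmetric]) (rule conjunct2)
   qed
  qed
  from tendsto_divide[OF this tendsto_const P] P
  show "(\<lambda>x. M_ratio q (k x) (a x) l (m x) x) \<sim>[at_top] (\<lambda>_. prodinf (prime_factor_term q l b e A))"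
   by (intro asymp_equivI') simp
 qed
qed

end
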